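(* Let $K$ be an algebraically closed field of characteristic zero, $m,r\ge1$, $V=M_m(K)^r$ with the simultaneous-conjugation action $(A_1,\ldots,A_r)\mapsto(PA_1P^{-1},\ldots,PA_rP^{-1})$ of $G=SL_m(K)$. The problem of deciding, given two rational points $A,A'\in M_m(\mathbb{Q})^r\subseteq V$, whether the closures of the $G$-orbits of $A$ and $A'$ intersect belongs to co-$RNC$.
   Context: Orbit closures are taken in the Zariski topology of $V$. The input size is measured by $m$, $r$ and the total bit-length of the entries of $A,A'$. *)

theory Defs
  imports
    "HOL-Library.Log_Nat"
    "HOL-Probability.Probability_Mass_Function"
    "Jordan_Normal_Form.Determinant"
begin

section \<open>Randomised parallel random access machines and the class RNC\<close>

text \<open>
  A PRAM consists of synchronous processors that execute one common program.  Each processor has a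
  program counter and private registers; all of them access a shared memory.  Register contents,
  addresses and memory cells are natural numbers.  The only unit-cost arithmetic is addition,
  truncated subtraction and halving, so that numbers grow by at most one bit per step; with
  unit-cost multiplication the polylogarithmic time bound would define a larger class.
\<close>

datatype instr =
    Const nat nat       \<comment> \<open>\<open>Const d c\<close>: \<open>R d := c\<close>\<close>
  | Add nat nat nat     \<comment> \<open>\<open>Add d a b\<close>: \<open>R d := R a + R b\<close>\<close>
  | Sub nat nat nat     \<comment> \<open>\<open>Sub d a b\<close>: \<open>R d := R a - R b\<close>, truncated at 0\<close>
  | Half nat nat        \<comment> \<open>\<open>Half d a\<close>: \<open>R d := R a div 2\<close>\<close>
  | Load nat nat        \<comment> \<open>\<open>Load d a\<close>: \<open>R d := M (R a)\<close>\<close>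
  | Store nat nat       \<comment> \<open>\<open>Store a b\<close>: \<open>M (R a) := R b\<close>\<close>
  | Random nat          \<comment> \<open>\<open>Random d\<close>: \<open>R d :=\<close> a fresh uniformly random bit\<close>
  | JumpZero nat nat    \<comment> \<open>\<open>JumpZero a l\<close>: continue at \<open>l\<close> if \<open>R a = 0\<close>\<close>

type_synonym memory = "nat \<Rightarrow> nat"
type_synonym processor = "nat \<times> (nat \<Rightarrow> nat)"
type_synonym pram_config = "memory \<times> (nat \<Rightarrow> processor)"

fun exec_instr :: "instr \<Rightarrow> memory \<Rightarrow> bool \<Rightarrow> processor \<Rightarrow> processor" where
  "exec_instr (Const d c) M b (pc, R) = (pc + 1, R(d := c))"
| "exec_instr (Add d a a') M b (pc, R) = (pc + 1, R(d := R a + R a'))"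
| "exec_instr (Sub d a a') M b (pc, R) = (pc + 1, R(d := R a - R a'))"
| "exec_instr (Half d a) M b (pc, R) = (pc + 1, R(d := R a div 2))"
| "exec_instr (Load d a) M b (pc, R) = (pc + 1, R(d := M (R a)))"
| "exec_instr (Store a a') M b (pc, R) = (pc + 1, R)"
| "exec_instr (Random d) M b (pc, R) = (pc + 1, R(d := of_bool b))"
| "exec_instr (JumpZero a l) M b (pc, R) = (if R a = 0 then l else pc + 1, R)"

text \<open>A processor halts by moving its program counter past the end of the program.\<close>

definition halted :: "instr list \<Rightarrow> processor \<Rightarrow> bool" where
  "halted prog s \<longleftrightarrow> length prog \<le> fst s"

definition step_processor :: "instr list \<Rightarrow> memory \<Rightarrow> bool \<Rightarrow> processor \<Rightarrow> processor" where
  "step_processor prog M b s = (if halted prog s then s else exec_instr (prog ! fst s) M b s)"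

definition write_request :: "instr list \<Rightarrow> processor \<Rightarrow> (nat \<times> nat) option" where
  "write_request prog s =
     (if halted prog s then None
      else case prog ! fst s of Store a a' \<Rightarrow> Some (snd s a, snd s a') | _ \<Rightarrow> None)"

text \<open>
  All processors read the memory as it was before the step.  Concurrent reads and writes are
  allowed; if several processors write to the same cell, the one with the smallest index wins.
\<close>

definition step_memory :: "instr list \<Rightarrow> nat \<Rightarrow> pram_config \<Rightarrow> memory" where
  "step_memory prog p c a =
     (let writers = {i. i < p \<and> (\<exists>v. write_request prog (snd c i) = Some (a, v))}
      in if writers = {} then fst c a
         else snd (the (write_request prog (snd c (LEAST i. i \<in> writers)))))"

definition pram_step :: "instr list \<Rightarrow> nat \<Rightarrow> (nat \<Rightarrow> bool) \<Rightarrow> pram_config \<Rightarrow> pram_config" where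
  "pram_step prog p b c =
     (step_memory prog p c, \<lambda>i. step_processor prog (fst c) (b i) (snd c i))"

text \<open>
  Cell 0 is reserved for the output and the input bits occupy the cells \<open>1, \<dots>, n\<close>.
  Initially, register 0 of a processor holds its index and register 1 the input length \<open>n\<close>.
\<close>

definition pram_init :: "bool list \<Rightarrow> pram_config" where
  "pram_init x =
     (\<lambda>a. if 1 \<le> a \<and> a \<le> length x then of_bool (x ! (a - 1)) else 0,
      \<lambda>i. (0, (\<lambda>_. 0)(0 := i, 1 := length x)))"

text \<open>The random bit available to processor \<open>i\<close> in step \<open>t\<close> is \<open>\<omega> (t, i)\<close>.\<close>

primrec pram_run ::
  "instr list \<Rightarrow> nat \<Rightarrow> (nat \<times> nat \<Rightarrow> bool) \<Rightarrow> bool list \<Rightarrow> nat \<Rightarrow> pram_config" where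
  "pram_run prog p \<omega> x 0 = pram_init x"
| "pram_run prog p \<omega> x (Suc t) = pram_step prog p (\<lambda>i. \<omega> (t, i)) (pram_run prog p \<omega> x t)"

definition pram_halts_within ::
  "instr list \<Rightarrow> nat \<Rightarrow> nat \<Rightarrow> (nat \<times> nat \<Rightarrow> bool) \<Rightarrow> bool list \<Rightarrow> bool" where
  "pram_halts_within prog p T \<omega> x \<longleftrightarrow> (\<forall>i<p. halted prog (snd (pram_run prog p \<omega> x T) i))"

definition pram_accepts ::
  "instr list \<Rightarrow> nat \<Rightarrow> nat \<Rightarrow> (nat \<times> nat \<Rightarrow> bool) \<Rightarrow> bool list \<Rightarrow> bool" where
  "pram_accepts prog p T \<omega> x \<longleftrightarrow> fst (pram_run prog p \<omega> x T) 0 = 1"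

definition coin_tosses :: "nat \<Rightarrow> nat \<Rightarrow> (nat \<times> nat \<Rightarrow> bool) set" where
  "coin_tosses p T = ({..<T} \<times> {..<p} \<rightarrow>\<^sub>E UNIV)"

text \<open>
  A language is in RNC if a single PRAM program decides it with one-sided error, running on
  polynomially many processors for polylogarithmic time.  On inputs of length \<open>n\<close> there are
  \<open>n ^ k + k\<close> processors and at most \<open>k * (floorlog 2 n) ^ k + k\<close> steps, for some constant \<open>k\<close>;
  \<open>floorlog 2 n\<close> is the number of binary digits of \<open>n\<close>.
\<close>

definition RNC :: "bool list set set" where
  "RNC = {L. \<exists>prog k. \<forall>x.
     let p = length x ^ k + k;
         T = k * floorlog 2 (length x) ^ k + k;
         acc = measure_pmf.prob (pmf_of_set (coin_tosses p T)) {\<omega>. pram_accepts prog p T \<omega> x}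
     in (\<forall>\<omega> \<in> coin_tosses p T. pram_halts_within prog p T \<omega> x) \<and>
        (x \<in> L \<longrightarrow> acc \<ge> 1 / 2) \<and>
        (x \<notin> L \<longrightarrow> acc = 0)}"

definition coRNC :: "bool list set set" where
  "coRNC = {L. - L \<in> RNC}"


section \<open>Simultaneous conjugation and the Zariski topology\<close>

definition mat_tuples :: "nat \<Rightarrow> nat \<Rightarrow> 'a mat list set" where
  "mat_tuples m r = {A. length A = r \<and> set A \<subseteq> carrier_mat m m}"

definition SL :: "nat \<Rightarrow> 'a::comm_ring_1 mat set" where
  "SL m = {P \<in> carrier_mat m m. det P = 1}"

text \<open>In the following definition \<open>Q\<close> is the inverse of \<open>P\<close>.\<close>

definition SL_orbit :: "nat \<Rightarrow> 'a::comm_ring_1 mat list \<Rightarrow> 'a mat list set" where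
  "SL_orbit m A = {map (\<lambda>X. P * X * Q) A | P Q.
     P \<in> SL m \<and> Q \<in> carrier_mat m m \<and> inverts_mat P Q \<and> inverts_mat Q P}"

inductive_set polynomial_functions :: "nat \<Rightarrow> nat \<Rightarrow> ('a::comm_ring_1 mat list \<Rightarrow> 'a) set"
  for m r :: nat where
  const: "(\<lambda>_. c) \<in> polynomial_functions m r"
| coord: "\<lbrakk>k < r; i < m; j < m\<rbrakk> \<Longrightarrow> (\<lambda>X. (X ! k) $$ (i, j)) \<in> polynomial_functions m r"
| add: "\<lbrakk>f \<in> polynomial_functions m r; g \<in> polynomial_functions m r\<rbrakk>
    \<Longrightarrow> (\<lambda>X. f X + g X) \<in> polynomial_functions m r"
| mult: "\<lbrakk>f \<in> polynomial_functions m r; g \<in> polynomial_functions m r\<rbrakk>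
    \<Longrightarrow> (\<lambda>X. f X * g X) \<in> polynomial_functions m r"

definition zero_locus ::
  "nat \<Rightarrow> nat \<Rightarrow> ('a::comm_ring_1 mat list \<Rightarrow> 'a) set \<Rightarrow> 'a mat list set" where
  "zero_locus m r F = {X \<in> mat_tuples m r. \<forall>f\<in>F. f X = 0}"

definition zariski_open :: "nat \<Rightarrow> nat \<Rightarrow> 'a::comm_ring_1 mat list set \<Rightarrow> bool" where
  "zariski_open m r U \<longleftrightarrow>
     (\<exists>F \<subseteq> polynomial_functions m r. U = mat_tuples m r - zero_locus m r F)"

definition zariski :: "nat \<Rightarrow> nat \<Rightarrow> 'a::comm_ring_1 mat list topology" where
  "zariski m r = topology (zariski_open m r)"

lemma istopology_zariski_open:
  "istopology (zariski_open m r :: 'a::idom mat list set \<Rightarrow> bool)"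
  unfolding istopology_def
proof (intro conjI allI impI)
  fix U U' :: "'a mat list set"
  assume "zariski_open m r U" "zariski_open m r U'"
  then obtain F G where F: "F \<subseteq> polynomial_functions m r" "U = mat_tuples m r - zero_locus m r F"
    and G: "G \<subseteq> polynomial_functions m r" "U' = mat_tuples m r - zero_locus m r G"
    unfolding zariski_open_def by blast
  let ?H = "{(\<lambda>X. f X * g X) | f g. f \<in> F \<and> g \<in> G}"
  have "?H \<subseteq> polynomial_functions m r"
    using F(1) G(1) by (auto intro: polynomial_functions.mult)
  moreover have "U \<inter> U' = mat_tuples m r - zero_locus m r ?H"
    unfolding F(2) G(2) zero_locus_def by fastforce
  ultimately show "zariski_open m r (U \<inter> U')"
    unfolding zariski_open_def by blast
next
  fix \<U> :: "'a mat list set set"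
  assume "\<forall>U\<in>\<U>. zariski_open m r U"
  then obtain F where F: "\<And>U. U \<in> \<U> \<Longrightarrow> F U \<subseteq> polynomial_functions m r"
      "\<And>U. U \<in> \<U> \<Longrightarrow> U = mat_tuples m r - zero_locus m r (F U)"
    unfolding zariski_open_def by metis
  have "X \<in> \<Union>\<U> \<longleftrightarrow> X \<in> mat_tuples m r - zero_locus m r (\<Union>(F ` \<U>))" for X
  proof -
    have "X \<in> \<Union>\<U> \<longleftrightarrow> (\<exists>U\<in>\<U>. X \<in> mat_tuples m r - zero_locus m r (F U))"
      using F(2) by blast
    then show ?thesis
      unfolding zero_locus_def by blast
  qed
  then have "\<Union>\<U> = mat_tuples m r - zero_locus m r (\<Union>(F ` \<U>))"
    by blast
  with F(1) show "zariski_open m r (\<Union>\<U>)"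
    unfolding zariski_open_def by (meson UN_least)
qed

lemma openin_zariski:
  "openin (zariski m r :: 'a::idom mat list topology) = zariski_open m r"
  unfolding zariski_def by (rule topology_inverse') (rule istopology_zariski_open)

lemma topspace_zariski:
  "topspace (zariski m r :: 'a::idom mat list topology) = mat_tuples m r"
proof (rule equalityI)
  show "topspace (zariski m r :: 'a mat list topology) \<subseteq> mat_tuples m r"
    unfolding topspace_def openin_zariski zariski_open_def by blast
  have "zero_locus m r {\<lambda>_. 1 :: 'a} = {}"
    by (simp add: zero_locus_def)
  then have "openin (zariski m r) (mat_tuples m r :: 'a mat list set)"
    unfolding openin_zariski zariski_open_def
    by (intro exI[of _ "{\<lambda>_. 1}"]) (auto intro: polynomial_functions.const)
  then show "mat_tuples m r \<subseteq> topspace (zariski m r :: 'a mat list topology)"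
    by (rule openin_subset)
qed


section \<open>Bit strings representing pairs of rational matrix tuples\<close>

text \<open>
  A bit \<open>b\<close> is written as the pair \<open>1b\<close>, and the pair \<open>00\<close> terminates a block of bits.
\<close>

definition block :: "bool list \<Rightarrow> bool list" where
  "block bs = concat (map (\<lambda>b. [True, b]) bs) @ [False, False]"

text \<open>
  A fraction is given by a sign bit (true for negative) and the binary digits, least significant
  first, of numerator and denominator.  Fractions need not be in lowest terms: reducing them, or
  checking that they are reduced, would require computing greatest common divisors, which is not
  known to be possible in (R)NC.
\<close>

type_synonym fraction = "bool \<times> bool list \<times> bool list"

definition binary :: "bool list \<Rightarrow> nat" where
  "binary bs = horner_sum of_bool 2 bs"

fun valid_fraction :: "fraction \<Rightarrow> bool" where
  "valid_fraction (s, num, den) \<longleftrightarrow> binary den \<noteq> 0"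

fun fraction_value :: "fraction \<Rightarrow> rat" where
  "fraction_value (s, num, den) = (if s then -1 else 1) * of_nat (binary num) / of_nat (binary den)"

fun fraction_code :: "fraction \<Rightarrow> bool list" where
  "fraction_code (s, num, den) = block (s # num) @ block den"

text \<open>The entries of all matrices of a tuple, each matrix being read row by row.\<close>

definition tuple_entries :: "'a mat list \<Rightarrow> 'a list" where
  "tuple_entries A = concat (map (\<lambda>X. concat (mat_to_list X)) A)"

text \<open>
  The numbers \<open>m\<close> and \<open>r\<close> are written in unary, so the length of \<open>x\<close> is linear in \<open>m + r + r m\<^sup>2\<close>
  plus the total bit-length of the entries.
\<close>

definition encodes :: "bool list \<Rightarrow> nat \<Rightarrow> nat \<Rightarrow> rat mat list \<Rightarrow> rat mat list \<Rightarrow> bool" where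
  "encodes x m r A A' \<longleftrightarrow>
     (\<exists>fs. (\<forall>f\<in>set fs. valid_fraction f) \<and>
           map fraction_value fs = tuple_entries A @ tuple_entries A' \<and>
           x = block (replicate m True) @ block (replicate r True) @
               concat (map fraction_code fs))"

text \<open>
  Strings that do not encode an instance do not belong to the language.
\<close>

definition orbit_closure_intersection :: "'k::field_char_0 itself \<Rightarrow> bool list set" where
  "orbit_closure_intersection _ = {x. \<exists>m r A A'. m \<ge> 1 \<and> r \<ge> 1 \<and>
     A \<in> mat_tuples m r \<and> A' \<in> mat_tuples m r \<and> encodes x m r A A' \<and>
     (zariski m r closure_of SL_orbit m (map (map_mat (of_rat :: rat \<Rightarrow> 'k)) A)) \<inter>
     (zariski m r closure_of SL_orbit m (map (map_mat of_rat) A')) \<noteq> {}}"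

end

theory Submission
  imports Defs "Jordan_Normal_Form.Char_Poly"
begin

text \<open>
  By block triangularisation, every orbit closure contains a direct sum of irreducible families with
  the same traces of words, since it is the limit at \<open>t = 0\<close> of a conjugation by powers of \<open>t\<close>.  Over
  an algebraically closed field of characteristic zero the irreducible constituents are determined by
  the traces of all words, and these traces are constant on orbit closures.  Hence two orbit closures
  intersect if and only if the traces of all words agree.

  For words of length \<open>l\<close> the sum of the squared differences of the traces is a linear functional of
  the \<open>l\<close>-th power of a matrix of polynomial size, so it satisfies a linear recurrence and it suffices
  to look at one polynomially large \<open>l\<close>.  After clearing denominators, the power is computed by
  repeated squaring, modulo polynomially many small numbers in parallel.  An integer that is small
  compared to the least common multiple of these numbers vanishes as soon as all its residues do.
  No random bits are needed: the algorithm accepts the complement deterministically.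
\<close>

text \<open>There are exponentially many words but only polynomially many processors. As the traces
  are rational, squared differences cannot cancel. Squaring also makes the sum bilinear: a product
  of two traces is the trace of a Kronecker product, and Kronecker products of words multiply letter
  by letter, so that the sum over all words is a matrix power. For each of the four pairs of tuples
  this matrix has m^4 entries, hence a recurrence of order at most 4 m^4.

  The constants: \<open>l = 2 ^ loglen x\<close> exceeds the input length, and the word length is
  l^2, which is at least 4 m^4. The integer to be tested has O(l^4) bits, while the moduli go up to
  \<open>radix x\<close>, which is l^8. A processor index is a vector of 16 digits below
  \<open>radix x\<close>, which serve as index variables of the nested sums and, in digit 15, as the
  modulus; this makes l^128 processors. The machine has no multiplication, so products, remainders
  and even \<open>loglen x\<close> are computed by loops of polylogarithmic length.\<close>

section \<open>Structured programs for parallel machines\<close>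

text \<open>Processors must stay synchronous although they branch on their own registers.  Hence the only
  conditional of a structured program is the conditional move \<open>Mov d a b\<close>, which copies register
  \<open>b\<close> to \<open>d\<close> if register \<open>a\<close> is nonzero and takes three steps in either case, and a loop condition
  has to be the same for all processors.  Register 2 is constantly 0 and thus provides
  unconditional jumps.\<close>

datatype cmd =
    Op instr
  | Mov nat nat nat
  | Seq cmd cmd (infixr \<open>;;\<close> 60)
  | While nat cmd

primrec code_size :: "cmd \<Rightarrow> nat" where
  "code_size (Op ins) = 1"
| "code_size (Mov d a b) = 5"
| "code_size (c ;; c') = code_size c + code_size c'"
| "code_size (While r c) = code_size c + 2"

text \<open>The address argument is absolute because jump targets are. In \<open>Mov\<close> the
  moving branch passes the offsets 0, 1, 2 and the other one the offsets 0, 3, 4; the dummy jumps at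
  3 and 4 equalize the running times.\<close>

primrec compile :: "cmd \<Rightarrow> nat \<Rightarrow> instr list" where
  "compile (Op ins) l = [ins]"
| "compile (Mov d a b) l =
     [JumpZero a (l + 3), Add d b 2, JumpZero 2 (l + 5), JumpZero 2 (l + 4), JumpZero 2 (l + 5)]"
| "compile (c ;; c') l = compile c l @ compile c' (l + code_size c)"
| "compile (While r c) l = JumpZero r (l + code_size c + 2) # compile c (l + 1) @ [JumpZero 2 l]"

lemma length_compile [simp]: "length (compile c l) = code_size c"
  by (induction c arbitrary: l) auto

type_synonym regs = "nat \<Rightarrow> nat \<Rightarrow> nat"

fun is_local :: "instr \<Rightarrow> bool" where
  "is_local (Store a b) = False"
| "is_local (Random d) = False"
| "is_local (JumpZero a l) = False"
| "is_local _ = True"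

text \<open>Big-step semantics of all processors in lock step; the number before the first memory
  counts machine steps. Counter 0 and random bit \<open>False\<close> in \<open>exec_local\<close>
  are arbitrary, since a local instruction changes the registers independently of both. The two
  extra steps of a loop round are the test and the jump back, and the latter relies on register 2
  being zero.\<close>

inductive exec :: "nat \<Rightarrow> cmd \<Rightarrow> nat \<Rightarrow> memory \<Rightarrow> regs \<Rightarrow> memory \<Rightarrow> regs \<Rightarrow> bool" for p where
  exec_local: "is_local ins \<Longrightarrow>
    exec p (Op ins) 1 M R M (\<lambda>i. snd (exec_instr ins M False (0, R i)))"
| exec_store: "exec p (Op (Store a b)) 1 M R
    (\<lambda>y. if \<exists>i<p. R i a = y then R (LEAST i. i < p \<and> R i a = y) b else M y) R"
| exec_mov: "\<forall>i<p. R i 2 = 0 \<Longrightarrow> d \<noteq> 2 \<Longrightarrow>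
    exec p (Mov d a b) 3 M R M (\<lambda>i. if R i a = 0 then R i else (R i)(d := R i b))"
| exec_seq: "exec p c t M R M' R' \<Longrightarrow> exec p c' t' M' R' M'' R'' \<Longrightarrow>
    exec p (c ;; c') (t + t') M R M'' R''"
| exec_while_end: "\<forall>i<p. R i r = 0 \<Longrightarrow> exec p (While r c) 1 M R M R"
| exec_while_step: "\<forall>i<p. R i r \<noteq> 0 \<Longrightarrow> exec p c t M R M' R' \<Longrightarrow> \<forall>i<p. R' i 2 = 0 \<Longrightarrow>
    exec p (While r c) t' M' R' M'' R'' \<Longrightarrow> exec p (While r c) (t + t' + 2) M R M'' R''"

section \<open>Simulation of structured programs by their compiled code\<close>

definition placed :: "instr list \<Rightarrow> nat \<Rightarrow> instr list \<Rightarrow> bool" where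
  "placed prog l code \<longleftrightarrow> (\<forall>j<length code. l + j < length prog \<and> prog ! (l + j) = code ! j)"

lemma placed_append:
  "placed prog l (xs @ ys) \<longleftrightarrow> placed prog l xs \<and> placed prog (l + length xs) ys"
proof
  assume *: "placed prog l (xs @ ys)"
  have "l + length xs + j < length prog \<and> prog ! (l + length xs + j) = ys ! j" if "j < length ys" for j
    using *[unfolded placed_def, rule_format, of "length xs + j"] that by (auto simp: nth_append add.assoc)
  moreover have "l + j < length prog \<and> prog ! (l + j) = xs ! j" if "j < length xs" for j
    using *[unfolded placed_def, rule_format, of j] that by (auto simp: nth_append)
  ultimately show "placed prog l xs \<and> placed prog (l + length xs) ys"
    by (auto simp: placed_def)
next
  assume *: "placed prog l xs \<and> placed prog (l + length xs) ys"
  have "l + j < length prog \<and> prog ! (l + j) = (xs @ ys) ! j" if j: "j < length (xs @ ys)" for j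
  proof (cases "j < length xs")
    case True
    then show ?thesis using * by (auto simp: placed_def nth_append)
  next
    case False
    then have "j - length xs < length ys" "l + length xs + (j - length xs) = l + j" using j by auto
    then show ?thesis using * False unfolding placed_def nth_append by metis
  qed
  then show "placed prog l (xs @ ys)" by (auto simp: placed_def)
qed

lemma placed_Cons:
  "placed prog l (a # ys) \<longleftrightarrow> l < length prog \<and> prog ! l = a \<and> placed prog (Suc l) ys"
  using placed_append[of prog l "[a]" ys] by (simp add: placed_def)

definition at_line :: "nat \<Rightarrow> pram_config \<Rightarrow> nat \<Rightarrow> memory \<Rightarrow> regs \<Rightarrow> bool" where
  "at_line p c l M R \<longleftrightarrow> fst c = M \<and> (\<forall>i<p. snd c i = (l, R i))"

lemma write_request_eq:
  assumes "l < length prog"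
  shows "write_request prog (l, r) =
    (case prog ! l of Store a a' \<Rightarrow> Some (r a, r a') | _ \<Rightarrow> None)"
  using assms by (simp add: write_request_def halted_def split: instr.split)

lemma step_memory_no_write:
  assumes "\<forall>i<p. write_request prog (snd c i) = None"
  shows "step_memory prog p c = fst c"
proof
  fix a
  have "{i. i < p \<and> (\<exists>v. write_request prog (snd c i) = Some (a, v))} = {}"
    using assms by auto
  then show "step_memory prog p c a = fst c a"
    by (simp add: step_memory_def)
qed

lemma snd_pram_step:
  assumes "snd c i = (l, r)" "l < length prog"
  shows "snd (pram_step prog p b c) i = exec_instr (prog ! l) (fst c) (b i) (l, r)"
  using assms by (simp add: pram_step_def step_processor_def halted_def)

lemma fst_pram_step_no_write:
  assumes "\<And>i. i < p \<Longrightarrow> \<exists>l r. snd c i = (l, r) \<and> l < length prog \<and> (\<forall>a a'. prog ! l \<noteq> Store a a')"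
  shows "fst (pram_step prog p b c) = fst c"
proof -
  have "write_request prog (snd c i) = None" if i: "i < p" for i
  proof -
    obtain l r where *: "snd c i = (l, r)" "l < length prog" "\<And>a a'. prog ! l \<noteq> Store a a'"
      using assms[OF i] by blast
    then show ?thesis
      by (simp add: write_request_eq split: instr.split)
  qed
  then show ?thesis by (simp add: pram_step_def step_memory_no_write)
qed

lemma at_line_local:
  assumes "at_line p c l M R" "l < length prog" "prog ! l = ins" "is_local ins"
  shows "at_line p (pram_step prog p b c) (Suc l) M (\<lambda>i. snd (exec_instr ins M False (0, R i)))"
proof -
  have c: "fst c = M" "\<And>i. i < p \<Longrightarrow> snd c i = (l, R i)" using assms(1) by (auto simp: at_line_def)
  have "fst (pram_step prog p b c) = fst c"
    by (rule fst_pram_step_no_write) (use c assms(2-) in auto)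
  moreover have "snd (pram_step prog p b c) i = (Suc l, snd (exec_instr ins M False (0, R i)))"
    if "i < p" for i
    using assms(4) by (cases ins) (simp_all add: snd_pram_step[OF c(2)[OF that] assms(2)] assms(3) c(1))
  ultimately show ?thesis using c by (simp add: at_line_def)
qed

lemma at_line_store:
  assumes "at_line p c l M R" "l < length prog" "prog ! l = Store a a'"
  shows "at_line p (pram_step prog p b c) (Suc l)
    (\<lambda>y. if \<exists>i<p. R i a = y then R (LEAST i. i < p \<and> R i a = y) a' else M y) R"
proof -
  have c: "fst c = M" "\<And>i. i < p \<Longrightarrow> snd c i = (l, R i)" using assms(1) by (auto simp: at_line_def)
  have w: "write_request prog (snd c i) = Some (R i a, R i a')" if "i < p" for i
    using c(2)[OF that] assms(2,3) by (simp add: write_request_eq)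
  have "fst (pram_step prog p b c) y =
      (if \<exists>i<p. R i a = y then R (LEAST i. i < p \<and> R i a = y) a' else M y)" for y
  proof -
    have set: "{i. i < p \<and> (\<exists>v. write_request prog (snd c i) = Some (y, v))} = {i. i < p \<and> R i a = y}"
      using w by auto
    have eq: "fst (pram_step prog p b c) y = (if {i. i < p \<and> R i a = y} = {} then M y
        else snd (the (write_request prog (snd c (LEAST i. i < p \<and> R i a = y)))))"
      unfolding pram_step_def fst_conv step_memory_def Let_def
      by (simp only: set c(1) mem_Collect_eq)
    show ?thesis
    proof (cases "\<exists>i<p. R i a = y")
      case True
      then have "(LEAST i. i < p \<and> R i a = y) < p" by (metis (mono_tags, lifting) LeastI_ex)
      then have "snd (the (write_request prog (snd c (LEAST i. i < p \<and> R i a = y)))) =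
          R (LEAST i. i < p \<and> R i a = y) a'"
        by (simp add: w)
      then show ?thesis using True unfolding eq by auto
    next
      case False
      then have "{i. i < p \<and> R i a = y} = {}" by auto
      with False show ?thesis unfolding eq by auto
    qed
  qed
  moreover have "snd (pram_step prog p b c) i = (Suc l, R i)" if "i < p" for i
    by (simp add: snd_pram_step[OF c(2)[OF that] assms(2)] assms(3))
  ultimately show ?thesis by (auto simp: at_line_def)
qed

lemma at_line_jump:
  assumes "at_line p c l M R" "l < length prog" "prog ! l = JumpZero r l'"
    and "(\<forall>i<p. R i r = 0) \<and> l'' = l' \<or> (\<forall>i<p. R i r \<noteq> 0) \<and> l'' = Suc l"
  shows "at_line p (pram_step prog p b c) l'' M R"
proof -
  have c: "fst c = M" "\<And>i. i < p \<Longrightarrow> snd c i = (l, R i)" using assms(1) by (auto simp: at_line_def)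
  have "fst (pram_step prog p b c) = fst c"
    by (rule fst_pram_step_no_write) (use c assms(2-) in auto)
  moreover have "snd (pram_step prog p b c) i = (l'', R i)" if "i < p" for i
    using assms(4) that by (auto simp: snd_pram_step[OF c(2)[OF that] assms(2)] assms(3))
  ultimately show ?thesis using c by (simp add: at_line_def)
qed

lemma at_line_mov:
  assumes at: "at_line p c l M R" and pl: "placed prog l (compile (Mov d a b) l)"
    and z: "\<forall>i<p. R i 2 = 0" and d: "d \<noteq> 2"
  shows "at_line p (pram_step prog p b3 (pram_step prog p b2 (pram_step prog p b1 c))) (l + 5) M
    (\<lambda>i. if R i a = 0 then R i else (R i)(d := R i b))"
proof -
  have c: "fst c = M" "\<And>i. i < p \<Longrightarrow> snd c i = (l, R i)" using at by (auto simp: at_line_def)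
  have pr: "l < length prog" "prog ! l = JumpZero a (l + 3)"
    "Suc l < length prog" "prog ! Suc l = Add d b 2"
    "Suc (Suc l) < length prog" "prog ! Suc (Suc l) = JumpZero 2 (l + 5)"
    "l + 3 < length prog" "prog ! (l + 3) = JumpZero 2 (l + 4)"
    "l + 4 < length prog" "prog ! (l + 4) = JumpZero 2 (l + 5)"
    using pl by (auto simp: placed_Cons eval_nat_numeral)
  define c1 where "c1 = pram_step prog p b1 c"
  define c2 where "c2 = pram_step prog p b2 c1"
  define c3 where "c3 = pram_step prog p b3 c2"
  have s1: "snd c1 i = (if R i a = 0 then (l + 3, R i) else (Suc l, R i))" if "i < p" for i
    unfolding c1_def using pr by (simp add: snd_pram_step[OF c(2)[OF that]])
  have m1: "fst c1 = M" unfolding c1_def c(1)[symmetric]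
    by (rule fst_pram_step_no_write) (use c pr in auto)
  have s2: "snd c2 i = (if R i a = 0 then (l + 4, R i) else (Suc (Suc l), (R i)(d := R i b)))"
    if i: "i < p" for i
  proof (cases "R i a = 0")
    case True
    then have "snd c1 i = (l + 3, R i)" using s1[OF i] by simp
    from snd_pram_step[OF this pr(7)] show ?thesis unfolding c2_def using True pr z i by simp
  next
    case False
    then have "snd c1 i = (Suc l, R i)" using s1[OF i] by simp
    from snd_pram_step[OF this pr(3)] show ?thesis unfolding c2_def using False pr z i by simp
  qed
  have m2: "fst c2 = M" unfolding c2_def m1[symmetric]
    by (rule fst_pram_step_no_write) (use s1 pr in \<open>auto split: if_splits\<close>)
  have s3: "snd c3 i = (l + 5, if R i a = 0 then R i else (R i)(d := R i b))"
    if i: "i < p" for i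
  proof (cases "R i a = 0")
    case True
    then have "snd c2 i = (l + 4, R i)" using s2[OF i] by simp
    from snd_pram_step[OF this pr(9)] show ?thesis unfolding c3_def using True pr z i by simp
  next
    case False
    then have "snd c2 i = (Suc (Suc l), (R i)(d := R i b))" using s2[OF i] by simp
    from snd_pram_step[OF this pr(5)] show ?thesis unfolding c3_def using False pr z i d by auto
  qed
  have m3: "fst c3 = M" unfolding c3_def m2[symmetric]
    by (rule fst_pram_step_no_write) (use s2 pr in \<open>auto split: if_splits\<close>)
  show ?thesis using s3 m3 unfolding c1_def c2_def c3_def at_line_def by blast
qed

text \<open>The coin tosses \<omega> are arbitrary because a command \<open>Op (Random d)\<close>
  has no execution at all. Start line and start time are general, as a loop returns to its first
  line at a later time.\<close>

lemma compile_correct: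
  assumes "exec p c t M R M' R'" "placed prog l (compile c l)"
    "at_line p (pram_run prog p \<omega> x t0) l M R"
  shows "at_line p (pram_run prog p \<omega> x (t0 + t)) (l + code_size c) M' R'"
  using assms
proof (induction arbitrary: l t0 rule: exec.induct)
  case (exec_local ins M R)
  then show ?case
    using at_line_local[of p _ l M R prog ins] by (auto simp: placed_Cons)
next
  case (exec_store a b M R)
  then show ?case
    using at_line_store[of p _ l M R prog a b] by (auto simp: placed_Cons)
next
  case (exec_mov R d a b M)
  then show ?case
    using at_line_mov[of p _ l M R prog d a b] by (simp add: eval_nat_numeral)
next
  case (exec_seq c t M R M' R' c' t' M'' R'')
  then show ?case
    by (simp add: placed_append add.assoc[symmetric])
next
  case (exec_while_end R r c M)
  then show ?case
    using at_line_jump[of p _ l M R prog r] by (simp add: placed_Cons)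
next
  case (exec_while_step R r c t M R' M' t' M'' R'')
  have pl: "l < length prog" "prog ! l = JumpZero r (l + code_size c + 2)"
    "placed prog (Suc l) (compile c (Suc l))"
    "Suc l + code_size c < length prog" "prog ! (Suc l + code_size c) = JumpZero 2 l"
    using exec_while_step.prems(1) by (simp_all add: placed_Cons placed_append)
  have "at_line p (pram_run prog p \<omega> x (Suc t0)) (Suc l) M R"
    using at_line_jump[OF exec_while_step.prems(2) pl(1,2), of "Suc l"] exec_while_step.hyps(1) by simp
  from exec_while_step.IH(1)[OF pl(3) this]
  have "at_line p (pram_run prog p \<omega> x (Suc t0 + t)) (Suc l + code_size c) R' M'" .
  from at_line_jump[OF this pl(4,5), of l] exec_while_step.hyps(3)
  have "at_line p (pram_run prog p \<omega> x (Suc (Suc t0 + t))) l R' M'" by simp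
  from exec_while_step.IH(2)[OF exec_while_step.prems(1) this] show ?case by (simp add: ac_simps)
qed

section \<open>Functions computable in polylogarithmic time\<close>

text \<open>The argument will always be \<open>loglen x\<close>, so that a polynomial bound here is
  polylogarithmic in the length of the input.\<close>

definition polylog :: "(nat \<Rightarrow> nat) \<Rightarrow> bool" where
  "polylog T \<longleftrightarrow> (\<exists>a e. \<forall>l. T l \<le> a * Suc l ^ e)"

lemma polylog_const [intro, simp]: "polylog (\<lambda>_. c)"
  unfolding polylog_def by (rule exI[of _ c], rule exI[of _ 0]) simp

lemma polylog_add [intro]:
  assumes "polylog S" "polylog T" shows "polylog (\<lambda>l. S l + T l)"
proof -
  from assms obtain a e b f where *: "\<And>l. S l \<le> a * Suc l ^ e" "\<And>l. T l \<le> b * Suc l ^ f"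
    unfolding polylog_def by blast
  have "S l + T l \<le> (a + b) * Suc l ^ (e + f)" for l
  proof -
    have "a * Suc l ^ e \<le> a * Suc l ^ (e + f)" "b * Suc l ^ f \<le> b * Suc l ^ (e + f)"
      by (intro mult_left_mono power_increasing; simp)+
    with *[of l] show ?thesis unfolding add_mult_distrib by linarith
  qed
  then show ?thesis unfolding polylog_def by blast
qed

text \<open>The factor \<open>c * l\<close> is the number of rounds of a loop whose body takes time
  \<open>T l\<close>.\<close>

lemma polylog_mult [intro]:
  assumes "polylog T" shows "polylog (\<lambda>l. c * l * T l)"
proof -
  from assms obtain a e where *: "\<And>l. T l \<le> a * Suc l ^ e" unfolding polylog_def by blast
  have "c * l * T l \<le> c * a * Suc l ^ Suc e" for l
  proof -
    have "c * l * T l \<le> c * Suc l * (a * Suc l ^ e)"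
      by (intro mult_mono *) auto
    also have "\<dots> = c * a * Suc l ^ Suc e" by (simp only: power_Suc mult_ac)
    finally show ?thesis .
  qed
  then show ?thesis unfolding polylog_def by blast
qed

text \<open>The successor keeps this positive for the empty input, so that powers such as
  \<open>2 ^ (8 * loglen x)\<close> are large for every input.\<close>

definition loglen :: "bool list \<Rightarrow> nat" where
  "loglen x = Suc (floorlog 2 (length x))"

text \<open>The program needs \<open>num_vecs x\<close> processors, whose indices are read as vectors of 16 digits;
  superfluous processors imitate processor 0.\<close>

definition num_vecs :: "bool list \<Rightarrow> nat" where
  "num_vecs x = 2 ^ (128 * loglen x)"

definition idx :: "bool list \<Rightarrow> nat \<Rightarrow> nat" where
  "idx x i = (if i < num_vecs x then i else 0)"

lemma num_vecs_pos [simp]: "0 < num_vecs x" by (simp add: num_vecs_def)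

lemma idx_less [simp]: "idx x i < num_vecs x" by (simp add: idx_def)

lemma idx_less_id [simp]: "i < num_vecs x \<Longrightarrow> idx x i = i" by (simp add: idx_def)

definition ready :: "bool list \<Rightarrow> nat \<Rightarrow> memory \<Rightarrow> regs \<Rightarrow> bool" where
  "ready x p M R \<longleftrightarrow> num_vecs x \<le> p \<and> M 0 = 0 \<and> (\<forall>a<length x. M (Suc a) = of_bool (x ! a)) \<and>
     (\<forall>i<p. R i 1 = length x \<and> R i 2 = 0 \<and> R i 3 = 1 \<and> R i 4 = loglen x \<and> R i 5 = idx x i)"

text \<open>Memory behind the input is scratch space through which processors exchange data; only
  the output cell, the input cells and the registers below \<open>d\<close> have to survive.\<close>

definition frame :: "bool list \<Rightarrow> nat \<Rightarrow> nat \<Rightarrow> memory \<Rightarrow> regs \<Rightarrow> memory \<Rightarrow> regs \<Rightarrow> bool" where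
  "frame x p d M R M' R' \<longleftrightarrow> (\<forall>a\<le>length x. M' a = M a) \<and> (\<forall>i<p. \<forall>r<d. R' i r = R i r)"

lemma frame_trans:
  "frame x p d M R M' R' \<Longrightarrow> frame x p d' M' R' M'' R'' \<Longrightarrow> d \<le> d' \<Longrightarrow> frame x p d M R M'' R''"
  by (simp add: frame_def)

lemma ready_frame:
  assumes "ready x p M R" "frame x p d M R M' R'" "6 \<le> d"
  shows "ready x p M' R'"
  using assms by (simp add: ready_def frame_def)

text \<open>Registers 0 to 5 are reserved.  A variable is a table with one entry per processor, kept in one
  register of all processors: variable \<open>j\<close> is held by register \<open>\<rho> j\<close> and has the entries
  \<open>E j 0, E j 1, \<dots>\<close>.  Register \<open>d\<close> is the first one that may be overwritten.\<close>

definition achieves ::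
  "nat \<Rightarrow> (nat \<Rightarrow> nat) \<Rightarrow> nat \<Rightarrow> nat \<Rightarrow> (nat \<Rightarrow> bool list \<Rightarrow> (nat \<Rightarrow> nat \<Rightarrow> nat) \<Rightarrow> nat \<Rightarrow> nat) \<Rightarrow>
    cmd \<Rightarrow> (nat \<Rightarrow> nat) \<Rightarrow> bool" where
  "achieves k \<rho> d m F c T \<longleftrightarrow> (\<forall>x p M R E. ready x p M R \<longrightarrow>
     (\<forall>j<k. \<forall>i<p. R i (\<rho> j) = E j (idx x i)) \<longrightarrow>
       (\<exists>t M' R'. exec p c t M R M' R' \<and> t \<le> T (loglen x) \<and> frame x p d M R M' R' \<and>
          (\<forall>j<m. \<forall>i<p. R' i (d + j) = F j x E (idx x i))))"

lemma achievesI: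
  assumes "\<And>x p M R E. ready x p M R \<Longrightarrow> (\<forall>j<k. \<forall>i<p. R i (\<rho> j) = E j (idx x i)) \<Longrightarrow>
    \<exists>t M' R'. exec p c t M R M' R' \<and> t \<le> T (loglen x) \<and> frame x p d M R M' R' \<and>
          (\<forall>j<m. \<forall>i<p. R' i (d + j) = F j x E (idx x i))"
  shows "achieves k \<rho> d m F c T"
  using assms unfolding achieves_def by blast

lemma achievesE:
  assumes "achieves k \<rho> d m F c T" "ready x p M R" "\<forall>j<k. \<forall>i<p. R i (\<rho> j) = E j (idx x i)"
  obtains t M' R' where "exec p c t M R M' R'" "t \<le> T (loglen x)" "frame x p d M R M' R'"
    "\<And>j i. j < m \<Longrightarrow> i < p \<Longrightarrow> R' i (d + j) = F j x E (idx x i)"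
proof -
  have "\<exists>t M' R'. exec p c t M R M' R' \<and> t \<le> T (loglen x) \<and> frame x p d M R M' R' \<and>
          (\<forall>j<m. \<forall>i<p. R' i (d + j) = F j x E (idx x i))"
    using assms unfolding achieves_def by simp
  then show thesis using that by blast
qed

text \<open>The program may depend on the registers of the variables and on the first free register,
  but not on the input. Having such a program for every register assignment is what makes these
  functions closed under composition.\<close>

definition pcomp :: "nat \<Rightarrow> (bool list \<Rightarrow> (nat \<Rightarrow> nat \<Rightarrow> nat) \<Rightarrow> nat \<Rightarrow> nat) \<Rightarrow> bool" where
  "pcomp k F \<longleftrightarrow> (\<forall>\<rho> d. 6 \<le> d \<longrightarrow> (\<forall>j<k. \<rho> j < d) \<longrightarrow>
     (\<exists>c T. polylog T \<and> achieves k \<rho> d 1 (\<lambda>_. F) c T))"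

lemma pcompE:
  assumes "pcomp k F" "6 \<le> d" "\<forall>j<k. \<rho> j < d"
  obtains c T where "polylog T" "achieves k \<rho> d 1 (\<lambda>_. F) c T"
  using assms unfolding pcomp_def by blast

lemma pcomp_cong:
  assumes "pcomp k F" "\<And>x E i. i < num_vecs x \<Longrightarrow> F x E i = G x E i"
  shows "pcomp k G"
  using assms(1) unfolding pcomp_def achieves_def by (simp add: assms(2))

lemma pcomp_weaken:
  assumes "pcomp k F" "k \<le> k'"
  shows "pcomp k' F"
  unfolding pcomp_def
proof (intro allI impI)
  fix \<rho> :: "nat \<Rightarrow> nat" and d assume *: "6 \<le> d" "\<forall>j<k'. \<rho> j < d"
  then have "\<forall>j<k. \<rho> j < d" using assms(2) by auto
  from pcompE[OF assms(1) *(1) this] obtain c T where T: "polylog T"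
    and c: "achieves k \<rho> d 1 (\<lambda>_. F) c T" .
  have "achieves k' \<rho> d 1 (\<lambda>_. F) c T"
  proof (rule achievesI)
    fix x p M R E assume r: "ready x p M R" "\<forall>j<k'. \<forall>i<p. R i (\<rho> j) = E j (idx x i)"
    then have "\<forall>j<k. \<forall>i<p. R i (\<rho> j) = E j (idx x i)" using assms(2) by simp
    from achievesE[OF c r(1) this] show "\<exists>t M' R'. exec p c t M R M' R' \<and> t \<le> T (loglen x) \<and>
        frame x p d M R M' R' \<and> (\<forall>j<1. \<forall>i<p. R' i (d + j) = F x E (idx x i))" by metis
  qed
  with T show "\<exists>c T. polylog T \<and> achieves k' \<rho> d 1 (\<lambda>_. F) c T" by blast
qed

text \<open>There is no empty command; clearing register 2, which is zero anyway, would be a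
  harmless one.\<close>

fun ops :: "instr list \<Rightarrow> cmd" where
  "ops [] = Op (Const 2 0)"
| "ops [a] = Op a"
| "ops (a # as) = Op a ;; ops as"

lemma exec_ops:
  assumes "as \<noteq> []" "list_all is_local as"
  shows "exec p (ops as) (length as) M R M
    (\<lambda>i. fold (\<lambda>a r. snd (exec_instr a M False (0, r))) as (R i))"
  using assms
proof (induction as arbitrary: R rule: ops.induct)
  case (2 a)
  then show ?case using exec_local[of a p M R] by simp
next
  case (3 a b as)
  have "exec p (Op a ;; ops (b # as)) (1 + length (b # as)) M R M
    (\<lambda>i. fold (\<lambda>a r. snd (exec_instr a M False (0, r))) (b # as)
       (snd (exec_instr a M False (0, R i))))"
    by (rule exec_seq[OF exec_local]) (use 3 in auto)
  then show ?case by simp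
qed simp

text \<open>The functions are evaluated one after the other, each with the first free register
  raised past the results obtained before.\<close>

lemma comp_all:
  assumes "\<And>j. j < m \<Longrightarrow> pcomp k (F j)" "6 \<le> d" "\<forall>j<k. \<rho> j < d"
  shows "\<exists>c T. polylog T \<and> achieves k \<rho> d m F c T"
  using assms(1)
proof (induction m)
  case 0
  have "achieves k \<rho> d 0 F (Op (Const d 0)) (\<lambda>_. 1)"
    by (rule achievesI, intro exI conjI, rule exec_local) (auto simp: frame_def)
  then show ?case by blast
next
  case (Suc m)
  then obtain c T where T: "polylog T" and c: "achieves k \<rho> d m F c T" by auto
  have "\<forall>j<k. \<rho> j < d + m" using assms(3) by auto
  with Suc.prems[of m] assms(2) obtain c' T' where T': "polylog T'"
    and c': "achieves k \<rho> (d + m) 1 (\<lambda>_. F m) c' T'"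
    by (auto elim!: pcompE[where d = "d + m" and \<rho> = \<rho>])
  have "achieves k \<rho> d (Suc m) F (c ;; c') (\<lambda>l. T l + T' l)"
  proof (rule achievesI)
    fix x p M R E assume r: "ready x p M R" and E: "\<forall>j<k. \<forall>i<p. R i (\<rho> j) = E j (idx x i)"
    obtain t1 M1 R1 where 1: "exec p c t1 M R M1 R1" "t1 \<le> T (loglen x)" "frame x p d M R M1 R1"
      "\<And>j i. j < m \<Longrightarrow> i < p \<Longrightarrow> R1 i (d + j) = F j x E (idx x i)"
      by (rule achievesE[OF c r E]) blast
    have E1: "\<forall>j<k. \<forall>i<p. R1 i (\<rho> j) = E j (idx x i)"
      using 1(3) assms(3) E by (simp add: frame_def)
    obtain t2 M2 R2 where 2: "exec p c' t2 M1 R1 M2 R2" "t2 \<le> T' (loglen x)"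
      "frame x p (d + m) M1 R1 M2 R2" "\<And>j i. j < 1 \<Longrightarrow> i < p \<Longrightarrow> R2 i (d + m + j) = F m x E (idx x i)"
      by (rule achievesE[OF c' ready_frame[OF r 1(3) assms(2)] E1]) blast
    have "R2 i (d + j) = F j x E (idx x i)" if "j < Suc m" "i < p" for i j
      using that 1(4)[of j i] 2(3) 2(4)[of 0 i] by (cases "j = m") (auto simp: frame_def)
    moreover have "frame x p d M R M2 R2" using frame_trans[OF 1(3) 2(3)] by simp
    moreover have "t1 + t2 \<le> T (loglen x) + T' (loglen x)" using 1(2) 2(2) by simp
    ultimately show "\<exists>t M' R'. exec p (c ;; c') t M R M' R' \<and> t \<le> T (loglen x) + T' (loglen x) \<and>
        frame x p d M R M' R' \<and> (\<forall>j<Suc m. \<forall>i<p. R' i (d + j) = F j x E (idx x i))"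
      using exec_seq[OF 1(1) 2(1)] by blast
  qed
  with polylog_add[OF T T'] show ?case by blast
qed

text \<open>The common pattern of all pointwise operations: the arguments are put into consecutive
  registers from \<open>d\<close> on, then a fixed piece of code combines them into register
  \<open>d\<close> in constant time.\<close>

lemma pcomp_post:
  assumes F: "\<And>j. j < m \<Longrightarrow> pcomp k (F j)"
    and post: "\<And>d. 6 \<le> d \<Longrightarrow> \<exists>c t. \<forall>x p M R E. ready x p M R \<longrightarrow>
       (\<forall>j<m. \<forall>i<p. R i (d + j) = F j x E (idx x i)) \<longrightarrow>
       (\<exists>M' R'. exec p c t M R M' R' \<and> frame x p d M R M' R' \<and>
          (\<forall>i<p. R' i d = G x E (idx x i)))"
  shows "pcomp k G"
  unfolding pcomp_def
proof (intro allI impI)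
  fix \<rho> :: "nat \<Rightarrow> nat" and d assume d: "6 \<le> d" "\<forall>j<k. \<rho> j < d"
  have "\<exists>c T. polylog T \<and> achieves k \<rho> d m F c T"
    by (rule comp_all[OF _ d]) (rule F)
  then obtain c T where T: "polylog T" and c: "achieves k \<rho> d m F c T" by blast
  from post[OF d(1)] obtain c' t' where c': "\<forall>x p M R E. ready x p M R \<longrightarrow>
       (\<forall>j<m. \<forall>i<p. R i (d + j) = F j x E (idx x i)) \<longrightarrow>
       (\<exists>M' R'. exec p c' t' M R M' R' \<and> frame x p d M R M' R' \<and>
          (\<forall>i<p. R' i d = G x E (idx x i)))" by blast
  have "achieves k \<rho> d 1 (\<lambda>_. G) (c ;; c') (\<lambda>l. T l + t')"
  proof (rule achievesI)
    fix x p M R E assume r: "ready x p M R" and E: "\<forall>j<k. \<forall>i<p. R i (\<rho> j) = E j (idx x i)"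
    obtain t1 M1 R1 where 1: "exec p c t1 M R M1 R1" "t1 \<le> T (loglen x)" "frame x p d M R M1 R1"
      "\<And>j i. j < m \<Longrightarrow> i < p \<Longrightarrow> R1 i (d + j) = F j x E (idx x i)"
      by (rule achievesE[OF c r E]) blast
    obtain M2 R2 where 2: "exec p c' t' M1 R1 M2 R2" "frame x p d M1 R1 M2 R2"
      "\<forall>i<p. R2 i d = G x E (idx x i)"
      using c'[rule_format, OF ready_frame[OF r 1(3) d(1)] 1(4)] by blast
    have "t1 + t' \<le> T (loglen x) + t'" using 1(2) by simp
    then show "\<exists>t M' R'. exec p (c ;; c') t M R M' R' \<and> t \<le> T (loglen x) + t' \<and>
        frame x p d M R M' R' \<and> (\<forall>j<1. \<forall>i<p. R' i (d + j) = G x E (idx x i))"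
      using exec_seq[OF 1(1) 2(1)] frame_trans[OF 1(3) 2(2)] 2(3)
      by (metis less_one add_0_right order_refl)
  qed
  with polylog_add[OF T polylog_const[of t']]
  show "\<exists>c T. polylog T \<and> achieves k \<rho> d 1 (\<lambda>_. G) c T" by blast
qed

lemma pcomp_post_ops:
  assumes F: "\<And>j. j < m \<Longrightarrow> pcomp k (F j)"
    and as: "\<And>d. as d \<noteq> [] \<and> list_all is_local (as d)"
    and post: "\<And>d x p M R E i. 6 \<le> d \<Longrightarrow> ready x p M R \<Longrightarrow> i < p \<Longrightarrow>
       (\<forall>j<m. R i (d + j) = F j x E (idx x i)) \<Longrightarrow>
       fold (\<lambda>a r. snd (exec_instr a M False (0, r))) (as d) (R i) d = G x E (idx x i) \<and>
       (\<forall>r<d. fold (\<lambda>a r. snd (exec_instr a M False (0, r))) (as d) (R i) r = R i r)"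
  shows "pcomp k G"
proof (rule pcomp_post[of m, OF F])
  fix d :: nat assume d: "6 \<le> d"
  show "\<exists>c t. \<forall>x p M R E. ready x p M R \<longrightarrow> (\<forall>j<m. \<forall>i<p. R i (d + j) = F j x E (idx x i)) \<longrightarrow>
       (\<exists>M' R'. exec p c t M R M' R' \<and> frame x p d M R M' R' \<and> (\<forall>i<p. R' i d = G x E (idx x i)))"
  proof (intro exI[of _ "ops (as d)"] exI[of _ "length (as d)"] allI impI)
    fix x p M R E assume *: "ready x p M R" "\<forall>j<m. \<forall>i<p. R i (d + j) = F j x E (idx x i)"
    show "\<exists>M' R'. exec p (ops (as d)) (length (as d)) M R M' R' \<and> frame x p d M R M' R' \<and>
        (\<forall>i<p. R' i d = G x E (idx x i))"
      by (rule exI, rule exI, rule conjI, rule exec_ops)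
        (use as post[OF d *(1)] * in \<open>auto simp: frame_def\<close>)
  qed
qed

section \<open>Elementary operations on tables\<close>

lemma pcomp_const [intro]: "pcomp k (\<lambda>x E i. c)"
  by (rule pcomp_post_ops[of 0 _ undefined "\<lambda>d. [Const d c]"]) auto

lemma pcomp_idx [intro]: "pcomp k (\<lambda>x E i. i)"
  by (rule pcomp_post_ops[of 0 _ undefined "\<lambda>d. [Add d 5 2]"]) (auto simp: ready_def)

lemma pcomp_length [intro]: "pcomp k (\<lambda>x E i. length x)"
  by (rule pcomp_post_ops[of 0 _ undefined "\<lambda>d. [Add d 1 2]"]) (auto simp: ready_def)

lemma pcomp_var [intro]:
  assumes "j < k" shows "pcomp k (\<lambda>x E i. E j i)"
  unfolding pcomp_def
proof (intro allI impI)
  fix \<rho> :: "nat \<Rightarrow> nat" and d assume d: "6 \<le> d" "\<forall>j<k. \<rho> j < d"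
  have "achieves k \<rho> d 1 (\<lambda>_ x E i. E j i) (Op (Add d (\<rho> j) 2)) (\<lambda>_. 1)"
    by (rule achievesI, intro exI conjI, rule exec_local)
      (use d assms in \<open>auto simp: frame_def ready_def\<close>)
  then show "\<exists>c T. polylog T \<and> achieves k \<rho> d 1 (\<lambda>_ x E i. E j i) c T" by blast
qed

lemma all_less_two: "(\<forall>j<2. P j) \<longleftrightarrow> P 0 \<and> P (1 :: nat)"
  by (auto simp: less_2_cases_iff)

lemma pcomp_add [intro]:
  assumes "pcomp k F" "pcomp k G" shows "pcomp k (\<lambda>x E i. F x E i + G x E i)"
  by (rule pcomp_post_ops[of 2 _ "\<lambda>j. if j = 0 then F else G" "\<lambda>d. [Add d d (d + 1)]"])
    (use assms in \<open>auto simp: ready_def all_less_two\<close>)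

lemma pcomp_diff [intro]:
  assumes "pcomp k F" "pcomp k G" shows "pcomp k (\<lambda>x E i. F x E i - G x E i)"
  by (rule pcomp_post_ops[of 2 _ "\<lambda>j. if j = 0 then F else G" "\<lambda>d. [Sub d d (d + 1)]"])
    (use assms in \<open>auto simp: ready_def all_less_two\<close>)

lemma pcomp_half [intro]:
  assumes "pcomp k F" shows "pcomp k (\<lambda>x E i. F x E i div 2)"
  by (rule pcomp_post_ops[of 1 _ "\<lambda>j. F" "\<lambda>d. [Half d d]"]) (use assms in auto)

text \<open>All processors compute both branches and \<open>Mov\<close> selects afterwards, so none
  of them gets out of step.\<close>

lemma pcomp_if_zero:
  assumes "pcomp k F" "pcomp k G" "pcomp k H"
  shows "pcomp k (\<lambda>x E i. if F x E i = 0 then G x E i else H x E i)"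
proof (rule pcomp_post[of 3 _ "\<lambda>j. [F, G, H] ! j"])
  fix j :: nat assume "j < 3" then show "pcomp k ([F, G, H] ! j)"
    using assms by (auto simp: numeral_3_eq_3 less_Suc_eq)
next
  fix d :: nat assume d: "6 \<le> d"
  show "\<exists>c t. \<forall>x p M R E. ready x p M R \<longrightarrow>
     (\<forall>j<3. \<forall>i<p. R i (d + j) = ([F, G, H] ! j) x E (idx x i)) \<longrightarrow>
     (\<exists>M' R'. exec p c t M R M' R' \<and> frame x p d M R M' R' \<and>
        (\<forall>i<p. R' i d = (if F x E (idx x i) = 0 then G x E (idx x i) else H x E (idx x i))))"
  proof (rule exI[of _ "Mov (d + 1) d (d + 2) ;; Op (Add d (d + 1) 2)"], rule exI[of _ "3 + 1"],
      intro allI impI)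
    fix x p M R E
    assume r: "ready x p M R" and F: "\<forall>j<3. \<forall>i<p. R i (d + j) = ([F, G, H] ! j) x E (idx x i)"
    have *: "R i d = F x E (idx x i)" "R i (d + 1) = G x E (idx x i)" "R i (d + 2) = H x E (idx x i)"
      if "i < p" for i
      using F[rule_format, of 0 i] F[rule_format, of 1 i] F[rule_format, of 2 i] that by simp_all
    define R1 where "R1 = (\<lambda>i. if R i d = 0 then R i else (R i)(d + 1 := R i (d + 2)))"
    define R2 where "R2 = (\<lambda>i. snd (exec_instr (Add d (d + 1) 2) M False (0, R1 i)))"
    have z: "R i 2 = 0" if "i < p" for i using r that by (simp add: ready_def)
    have ex: "exec p (Mov (d + 1) d (d + 2) ;; Op (Add d (d + 1) 2)) (3 + 1) M R M R2"
      unfolding R2_def R1_def by (rule exec_seq, rule exec_mov, use z d in simp, use d in simp, rule exec_local, simp)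
    have "R2 i d = (if F x E (idx x i) = 0 then G x E (idx x i) else H x E (idx x i))" if "i < p" for i
      using *[OF that] z[OF that] d by (simp add: R2_def R1_def)
    moreover have "frame x p d M R M R2"
      by (simp add: frame_def R2_def R1_def)
    ultimately show "\<exists>M' R'. exec p (Mov (d + 1) d (d + 2) ;; Op (Add d (d + 1) 2)) (3 + 1) M R M' R' \<and>
      frame x p d M R M' R' \<and>
        (\<forall>i<p. R' i d = (if F x E (idx x i) = 0 then G x E (idx x i) else H x E (idx x i)))"
      using ex by blast
  qed
qed

definition input :: "bool list \<Rightarrow> nat \<Rightarrow> nat" where
  "input x a = (if a < length x then of_bool (x ! a) else 0)"

lemma pcomp_input [intro]:
  assumes "pcomp k F" shows "pcomp k (\<lambda>x E i. input x (F x E i))"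
proof -
  \<comment> \<open>The address may lie behind the input, where the memory holds arbitrary scratch
    values. The cell is loaded in any case, and its content is replaced by 0 if the address is out
    of range.\<close>
  have "pcomp k (\<lambda>x E i. if length x - F x E i = 0 then 0 else input x (F x E i))"
  proof (rule pcomp_post[of 1 _ "\<lambda>_. F"])
    fix d :: nat assume d: "6 \<le> d"
    let ?A = "[Add (d + 1) d 3, Load (d + 1) (d + 1), Sub d 1 d, Const (d + 2) 0]"
    let ?c = "ops ?A ;; Mov (d + 2) d (d + 1) ;; Op (Add d (d + 2) 2)"
    show "\<exists>c t. \<forall>x p M R E. ready x p M R \<longrightarrow>
     (\<forall>j<1. \<forall>i<p. R i (d + j) = F x E (idx x i)) \<longrightarrow>
     (\<exists>M' R'. exec p c t M R M' R' \<and> frame x p d M R M' R' \<and>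
        (\<forall>i<p. R' i d = (if length x - F x E (idx x i) = 0 then 0 else input x (F x E (idx x i)))))"
    proof (rule exI[of _ ?c], rule exI[of _ "length ?A + (3 + 1)"], intro allI impI)
      fix x p M R E
      assume r: "ready x p M R" and F: "\<forall>j<1. \<forall>i<p. R i (d + j) = F x E (idx x i)"
      define R1 where "R1 = (\<lambda>i. fold (\<lambda>a r. snd (exec_instr a M False (0, r))) ?A (R i))"
      define R2 where "R2 = (\<lambda>i. if R1 i d = 0 then R1 i else (R1 i)(d + 2 := R1 i (d + 1)))"
      define R3 where "R3 = (\<lambda>i. snd (exec_instr (Add d (d + 2) 2) M False (0, R2 i)))"
      have R1: "R1 i d = length x - F x E (idx x i)" "R1 i (d + 1) = M (Suc (F x E (idx x i)))"
        "R1 i (d + 2) = 0" "R1 i 2 = 0" if "i < p" for i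
        using r F[rule_format, of 0 i] that d by (simp_all add: R1_def ready_def)
      have ex: "exec p ?c (length ?A + (3 + 1)) M R M R3"
      proof (intro exec_seq)
        show "exec p (ops ?A) (length ?A) M R M R1" unfolding R1_def by (rule exec_ops) auto
        show "exec p (Mov (d + 2) d (d + 1)) 3 M R1 M R2"
          unfolding R2_def by (rule exec_mov) (use R1(4) d in auto)
        have "exec p (Op (Add d (d + 2) 2)) 1 M R2 M R3"
          unfolding R3_def by (rule exec_local) simp
        then show "exec p (Op (Add d (d + 2) 2)) 1 M R2 M R3" .
      qed
      have "R3 i d = (if length x - F x E (idx x i) = 0 then 0 else input x (F x E (idx x i)))"
        if "i < p" for i
        using R1[OF that] d r by (simp add: R2_def R3_def ready_def input_def)
      moreover have "frame x p d M R M R3"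
        by (simp add: frame_def R3_def R2_def R1_def)
      ultimately show "\<exists>M' R'. exec p ?c (length ?A + (3 + 1)) M R M' R' \<and> frame x p d M R M' R' \<and>
        (\<forall>i<p. R' i d = (if length x - F x E (idx x i) = 0 then 0 else input x (F x E (idx x i))))"
        using ex by blast
    qed
  qed (use assms in auto)
  then show ?thesis by (rule pcomp_cong) (auto simp: input_def)
qed

text \<open>This is how processors communicate: the table \<open>F\<close> is written into memory
  behind the input, one cell per index, and every processor then loads the cell chosen by
  \<open>G\<close>. The values of \<open>G\<close> have to be indices, since other cells are not
  written.\<close>

lemma pcomp_gather:
  assumes "pcomp k F" "pcomp k G" and less: "\<And>x E i. i < num_vecs x \<Longrightarrow> G x E i < num_vecs x"
  shows "pcomp k (\<lambda>x E i. F x E (G x E i))"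
proof (rule pcomp_post[of 2 _ "\<lambda>j. if j = 0 then F else G"])
  fix d :: nat assume d: "6 \<le> d"
  let ?A = "[Add (d + 2) 5 1, Add (d + 2) (d + 2) 3]"
  let ?B = "[Add (d + 2) (d + 1) 1, Add (d + 2) (d + 2) 3, Load d (d + 2)]"
  show "\<exists>c t. \<forall>x p M R E. ready x p M R \<longrightarrow>
     (\<forall>j<2. \<forall>i<p. R i (d + j) = (if j = 0 then F else G) x E (idx x i)) \<longrightarrow>
     (\<exists>M' R'. exec p c t M R M' R' \<and> frame x p d M R M' R' \<and>
        (\<forall>i<p. R' i d = F x E (G x E (idx x i))))"
  proof (rule exI[of _ "ops ?A ;; Op (Store (d + 2) d) ;; ops ?B"],
      rule exI[of _ "length ?A + (1 + length ?B)"], intro allI impI)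
    fix x p M R E
    assume r: "ready x p M R" and
      F: "\<forall>j<2. \<forall>i<p. R i (d + j) = (if j = 0 then F else G) x E (idx x i)"
    define R1 where "R1 = (\<lambda>i. fold (\<lambda>a r. snd (exec_instr a M False (0, r))) ?A (R i))"
    define M2 where "M2 = (\<lambda>y. if \<exists>i<p. R1 i (d + 2) = y
      then R1 (LEAST i. i < p \<and> R1 i (d + 2) = y) d else M y)"
    define R3 where "R3 = (\<lambda>i. fold (\<lambda>a r. snd (exec_instr a M2 False (0, r))) ?B (R1 i))"
    have ex: "exec p (ops ?A ;; Op (Store (d + 2) d) ;; ops ?B) (length ?A + (1 + length ?B)) M R M2 R3"
    proof (intro exec_seq)
      show "exec p (ops ?A) (length ?A) M R M R1" unfolding R1_def by (rule exec_ops) auto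
      show "exec p (Op (Store (d + 2) d)) 1 M R1 M2 R1" unfolding M2_def by (rule exec_store)
      show "exec p (ops ?B) (length ?B) M2 R1 M2 R3" unfolding R3_def by (rule exec_ops) auto
    qed
    have p: "num_vecs x \<le> p" using r by (simp add: ready_def)
    have R1: "R1 i (d + 2) = length x + Suc (idx x i)" "R1 i d = F x E (idx x i)"
      "R1 i (d + 1) = G x E (idx x i)" if "i < p" for i
      using that r d F[rule_format, of 0 i] F[rule_format, of 1 i] by (auto simp: R1_def ready_def)
    have R1': "R1 i r = R i r" if "r < d" for i r
      using that by (auto simp: R1_def)
    have M2: "M2 (length x + Suc j) = F x E j" if j: "j < num_vecs x" for j
    proof -
      let ?P = "\<lambda>i. i < p \<and> R1 i (d + 2) = length x + Suc j"
      have "?P j" using j p R1(1)[of j] by simp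
      then have *: "?P (Least ?P)" "\<exists>i<p. R1 i (d + 2) = length x + Suc j"
        by (rule LeastI) (use \<open>?P j\<close> in blast)
      then have "idx x (Least ?P) = j" using R1(1)[of "Least ?P"] by auto
      with * show ?thesis by (simp add: M2_def R1(2))
    qed
    have M2': "M2 a = M a" if "a \<le> length x" for a
    proof -
      have "\<not> (\<exists>i<p. R1 i (d + 2) = a)" using that R1(1) by auto
      then show ?thesis by (auto simp: M2_def)
    qed
    have "R3 i d = F x E (G x E (idx x i))" if i: "i < p" for i
      using M2[OF less[OF idx_less[of x i], of E]] R1(3)[OF i] R1'[of 1 i] R1'[of 3 i] d r i
      by (simp add: R3_def ready_def add.commute)
    moreover have "R3 i r = R i r" if "r < d" for i r
      using R1'[OF that, of i] that by (simp add: R3_def)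
    ultimately have "frame x p d M R M2 R3" "\<forall>i<p. R3 i d = F x E (G x E (idx x i))"
      using M2' by (auto simp: frame_def)
    with ex show "\<exists>M' R'. exec p (ops ?A ;; Op (Store (d + 2) d) ;; ops ?B)
        (length ?A + (1 + length ?B)) M R M' R' \<and> frame x p d M R M' R' \<and>
        (\<forall>i<p. R' i d = F x E (G x E (idx x i)))"
      by blast
  qed
qed (use assms in auto)

lemma exec_while_iterate:
  assumes body: "\<And>s M R. s < n \<Longrightarrow> I s M R \<Longrightarrow> \<exists>t M' R'. exec p c t M R M' R' \<and> t \<le> T \<and> I (Suc s) M' R'"
    and cnt: "\<And>s M R i. I s M R \<Longrightarrow> i < p \<Longrightarrow> s \<le> n \<Longrightarrow> (R i r = 0 \<longleftrightarrow> s = n) \<and> R i 2 = 0"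
    and "I s M R" "s \<le> n"
  shows "\<exists>t M' R'. exec p (While r c) t M R M' R' \<and> t \<le> (n - s) * (T + 2) + 1 \<and> I n M' R'"
  using assms(3,4)
proof (induction "n - s" arbitrary: s M R)
  case 0
  then have "s = n" by simp
  with 0 have "exec p (While r c) 1 M R M R" using cnt[of s M R] by (intro exec_while_end) simp
  with 0 \<open>s = n\<close> show ?case by force
next
  case (Suc m)
  then have s: "s < n" by simp
  from body[OF this Suc.prems(1)] obtain t M' R' where 1: "exec p c t M R M' R'" "t \<le> T" "I (Suc s) M' R'"
    by blast
  have "m = n - Suc s" "Suc s \<le> n" using Suc.hyps(2) s by auto
  from Suc.hyps(1)[OF this(1) 1(3) this(2)] obtain t' M'' R'' where
    2: "exec p (While r c) t' M' R' M'' R''" "t' \<le> (n - Suc s) * (T + 2) + 1" "I n M'' R''"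
    by blast
  have "exec p (While r c) (t + t' + 2) M R M'' R''"
    using cnt[OF Suc.prems(1)] cnt[OF 1(3)] s by (intro exec_while_step[OF _ 1(1) _ 2(1)]) auto
  moreover have "t + t' + 2 \<le> (n - s) * (T + 2) + 1"
  proof -
    have "n - s = Suc (n - Suc s)" using s by simp
    then show ?thesis using 1(2) 2(2) by simp
  qed
  ultimately show ?case using 2(3) by blast
qed

section \<open>Iteration\<close>

text \<open>Register 4 holds \<open>loglen x\<close>; the number of rounds
  \<open>c * loglen x\<close> is produced by \<open>c\<close> additions.\<close>

lemma fold_replicate_add:
  assumes "4 < r"
  shows "fold (\<lambda>a s. snd (exec_instr a M False (0, s))) (replicate c (Add r r 4)) s =
    s(r := s r + c * s 4)"
  using assms by (induction c arbitrary: s) (auto simp: fun_eq_iff)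

text \<open>The two tables of the loop state live in registers \<open>d\<close> and
  \<open>d + 1\<close> and are the variables \<open>k\<close> and \<open>Suc k\<close> of the body;
  register \<open>d + 2\<close> counts down. The body computes both new tables behind them before
  either is overwritten.\<close>

lemma pcomp_iter2:
  assumes F: "pcomp k F0" "pcomp k F1" and G: "pcomp (k + 2) G0" "pcomp (k + 2) G1"
  shows "pcomp k (\<lambda>x E. fst (((\<lambda>(u, v). (G0 x (E(k := u, Suc k := v)), G1 x (E(k := u, Suc k := v))))
    ^^ (c * loglen x)) (F0 x E, F1 x E)))"
  unfolding pcomp_def
proof (intro allI impI)
  fix \<rho> :: "nat \<Rightarrow> nat" and d assume d: "6 \<le> d" "\<forall>j<k. \<rho> j < d"
  define \<rho>' where "\<rho>' = \<rho>(k := d, Suc k := d + 1)"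
  have "\<exists>c T. polylog T \<and> achieves k \<rho> d 2 (\<lambda>j. if j = 0 then F0 else F1) c T"
    by (rule comp_all[OF _ d]) (use F in auto)
  then obtain cI TI where TI: "polylog TI"
    and cI: "achieves k \<rho> d 2 (\<lambda>j. if j = 0 then F0 else F1) cI TI" by blast
  have d': "6 \<le> d + 3" "\<forall>j<k + 2. \<rho>' j < d + 3"
    using d by (auto simp: \<rho>'_def less_Suc_eq trans_less_add1)
  have "\<exists>c T. polylog T \<and> achieves (k + 2) \<rho>' (d + 3) 2 (\<lambda>j. if j = 0 then G0 else G1) c T"
    by (rule comp_all[OF _ d']) (use G in auto)
  then obtain cB TB where TB: "polylog TB"
    and cB: "achieves (k + 2) \<rho>' (d + 3) 2 (\<lambda>j. if j = 0 then G0 else G1) cB TB" by blast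
  let ?L = "Const (d + 2) 0 # replicate c (Add (d + 2) (d + 2) 4)"
  let ?B = "[Add d (d + 3) 2, Add (d + 1) (d + 4) 2, Sub (d + 2) (d + 2) 3]"
  let ?W = "While (d + 2) (cB ;; ops ?B)"
  let ?T = "\<lambda>l. TI l + (Suc c + (c * l * (TB l + 5) + 1))"
  have T: "polylog ?T"
    by (intro polylog_add TI polylog_const polylog_mult TB)
  have "achieves k \<rho> d 1 (\<lambda>_ x E. fst (((\<lambda>(u, v).
      (G0 x (E(k := u, Suc k := v)), G1 x (E(k := u, Suc k := v)))) ^^ (c * loglen x)) (F0 x E, F1 x E)))
    (cI ;; ops ?L ;; ?W) ?T"
  proof (rule achievesI)
    fix x p M R E
    assume r: "ready x p M R" and E: "\<forall>j<k. \<forall>i<p. R i (\<rho> j) = E j (idx x i)"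
    define n where "n = c * loglen x"
    define S where "S s = ((\<lambda>(u, v). (G0 x (E(k := u, Suc k := v)), G1 x (E(k := u, Suc k := v)))) ^^ s)
       (F0 x E, F1 x E)" for s
    define I where "I s M' R' \<longleftrightarrow> frame x p d M R M' R' \<and> (\<forall>i<p. R' i d = fst (S s) (idx x i) \<and>
       R' i (d + 1) = snd (S s) (idx x i) \<and> R' i (d + 2) = n - s)" for s M' R'
    obtain t1 M1 R1 where 1: "exec p cI t1 M R M1 R1" "t1 \<le> TI (loglen x)" "frame x p d M R M1 R1"
      "\<And>j i. j < 2 \<Longrightarrow> i < p \<Longrightarrow> R1 i (d + j) = (if j = 0 then F0 else F1) x E (idx x i)"
      by (rule achievesE[OF cI r E]) blast
    have 1: "exec p cI t1 M R M1 R1" "t1 \<le> TI (loglen x)" "frame x p d M R M1 R1"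
      "\<And>i. i < p \<Longrightarrow> R1 i d = F0 x E (idx x i)" "\<And>i. i < p \<Longrightarrow> R1 i (d + 1) = F1 x E (idx x i)"
      using 1(1,2,3) 1(4)[of 0] 1(4)[of 1] by auto
    have r1: "ready x p M1 R1" using ready_frame[OF r 1(3)] d by blast
    define R2 where "R2 = (\<lambda>i. fold (\<lambda>a s. snd (exec_instr a M1 False (0, s))) ?L (R1 i))"
    have ex2: "exec p (ops ?L) (length ?L) M1 R1 M1 R2"
      unfolding R2_def by (rule exec_ops) (auto simp: list_all_iff)
    have R2: "R2 i = (R1 i)(d + 2 := c * R1 i 4)" if "i < p" for i
    proof -
      have "4 < d + 2" using d by simp
      then show ?thesis
        unfolding R2_def fold.simps comp_def by (simp only: fold_replicate_add) simp
    qed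
    have "frame x p d M R M1 R2" using 1(3) R2 by (simp add: frame_def)
    moreover have "R2 i d = fst (S 0) (idx x i) \<and> R2 i (d + 1) = snd (S 0) (idx x i) \<and> R2 i (d + 2) = n"
      if "i < p" for i
      using 1(4,5)[OF that] R2[OF that] r1 that by (simp add: S_def n_def ready_def)
    ultimately have I0: "I 0 M1 R2" by (simp add: I_def)
    have body: "\<exists>t M'' R''. exec p (cB ;; ops ?B) t M' R' M'' R'' \<and> t \<le> TB (loglen x) + 3 \<and> I (Suc s) M'' R''"
      if "s < n" "I s M' R'" for s M' R'
    proof -
      have fr: "frame x p d M R M' R'" and v: "\<And>i. i < p \<Longrightarrow> R' i d = fst (S s) (idx x i)"
        "\<And>i. i < p \<Longrightarrow> R' i (Suc d) = snd (S s) (idx x i)" "\<And>i. i < p \<Longrightarrow> R' i (d + 2) = n - s"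
        using that(2) by (auto simp: I_def)
      have r': "ready x p M' R'" using ready_frame[OF r fr] d by blast
      have E': "\<forall>j<k+2. \<forall>i<p. R' i (\<rho>' j) = (E(k := fst (S s), Suc k := snd (S s))) j (idx x i)"
      proof (intro allI impI)
        fix i j assume "j < k + 2" "i < p"
        have "j < k \<Longrightarrow> R' i (\<rho> j) = E j (idx x i)"
          using fr E d \<open>i < p\<close> by (simp add: frame_def)
        then show "R' i (\<rho>' j) = (E(k := fst (S s), Suc k := snd (S s))) j (idx x i)"
          using v(1,2)[OF \<open>i < p\<close>] \<open>j < k + 2\<close> by (auto simp: \<rho>'_def)
      qed
      obtain t3 M3 R3 where 3: "exec p cB t3 M' R' M3 R3" "t3 \<le> TB (loglen x)"
        "frame x p (d + 3) M' R' M3 R3"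
        "\<And>j i. j < 2 \<Longrightarrow> i < p \<Longrightarrow> R3 i (d + 3 + j) = (if j = 0 then G0 else G1) x
           (E(k := fst (S s), Suc k := snd (S s))) (idx x i)"
        by (rule achievesE[OF cB r' E']) blast
      have R3: "R3 i (d + 3) = fst (S (Suc s)) (idx x i)" "R3 i (d + 4) = snd (S (Suc s)) (idx x i)"
        if "i < p" for i
        using 3(4)[of 0 i] 3(4)[of 1 i] that
        by (simp_all add: S_def case_prod_beta add.commute[of d])
      have r3: "ready x p M3 R3" by (rule ready_frame[OF r' 3(3)]) (use d in simp)
      define R4 where "R4 = (\<lambda>i. fold (\<lambda>a s. snd (exec_instr a M3 False (0, s))) ?B (R3 i))"
      have ex4: "exec p (ops ?B) (length ?B) M3 R3 M3 R4"
        unfolding R4_def by (rule exec_ops) auto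
      have "I (Suc s) M3 R4"
        unfolding I_def
      proof (intro conjI allI impI)
        show "frame x p d M R M3 R4"
          by (rule frame_trans[OF fr, of d]) (use 3(3) d in \<open>auto simp: frame_def R4_def\<close>)
        fix i assume i: "i < p"
        have z: "R3 i 2 = 0" "R3 i 3 = 1" using r3 i by (auto simp: ready_def)
        show "R4 i d = fst (S (Suc s)) (idx x i)" "R4 i (d + 1) = snd (S (Suc s)) (idx x i)"
          using R3[OF i] z d by (auto simp: R4_def)
        have "R3 i (d + 2) = n - s" using 3(3) v(3)[OF i] i by (simp add: frame_def)
        then show "R4 i (d + 2) = n - Suc s" using z d by (auto simp: R4_def)
      qed
      with exec_seq[OF 3(1) ex4] 3(2) show ?thesis by force
    qed
    have cnt: "(R' i (d + 2) = 0 \<longleftrightarrow> s = n) \<and> R' i 2 = 0" if "I s M' R'" "i < p" "s \<le> n" for s M' R' i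
    proof -
      have "ready x p M' R'" using ready_frame[OF r _ d(1)] that(1) by (simp add: I_def)
      then show ?thesis using that by (auto simp: I_def ready_def)
    qed
    have "\<exists>t M' R'. exec p ?W t M1 R2 M' R' \<and> t \<le> (n - 0) * (TB (loglen x) + 3 + 2) + 1 \<and> I n M' R'"
      by (rule exec_while_iterate[where I = I and s = 0], erule (1) body, erule (2) cnt, rule I0, simp)
    then obtain t5 M5 R5 where 5: "exec p ?W t5 M1 R2 M5 R5"
      "t5 \<le> n * (5 + TB (loglen x)) + 1" "I n M5 R5" by (auto simp: add.commute)
    have "exec p (cI ;; ops ?L ;; ?W) (t1 + (length ?L + t5)) M R M5 R5"
      by (rule exec_seq[OF 1(1) exec_seq[OF ex2 5(1)]])
    moreover have "t1 + (length ?L + t5) \<le> ?T (loglen x)"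
      using 1(2) 5(2) by (simp add: n_def add.commute)
    moreover have "frame x p d M R M5 R5" "\<And>i. i < p \<Longrightarrow> R5 i d = fst (S n) (idx x i)"
      using 5(3) by (auto simp: I_def)
    ultimately show "\<exists>t M' R'. exec p (cI ;; ops ?L ;; ?W) t M R M' R' \<and> t \<le> ?T (loglen x) \<and>
      frame x p d M R M' R' \<and> (\<forall>j<1. \<forall>i<p. R' i (d + j) =
        fst (((\<lambda>(u, v). (G0 x (E(k := u, Suc k := v)), G1 x (E(k := u, Suc k := v))))
         ^^ (c * loglen x)) (F0 x E, F1 x E)) (idx x i))"
      unfolding S_def n_def by (intro exI conjI) auto
  qed
  with T show "\<exists>c' T. polylog T \<and> achieves k \<rho> d 1 (\<lambda>_ x E. fst (((\<lambda>(u, v).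
      (G0 x (E(k := u, Suc k := v)), G1 x (E(k := u, Suc k := v)))) ^^ (c * loglen x)) (F0 x E, F1 x E))) c' T"
    by blast
qed

inductive_cases exec_OpE: "exec p (Op ins) t M R M' R'"
inductive_cases exec_MovE: "exec p (Mov d a b) t M R M' R'"
inductive_cases exec_SeqE: "exec p (c ;; c') t M R M' R'"
inductive_cases exec_WhileE: "exec p (While r c) t M R M' R'"

lemma exec_deterministic:
  assumes "exec p c t M R M1 R1" "exec p c t' M R M2 R2" "0 < p"
  shows "M2 = M1 \<and> R2 = R1"
  using assms
proof (induction arbitrary: t' M2 R2 rule: exec.induct)
  case (exec_local ins M R)
  from exec_local.prems(1) show ?case by (rule exec_OpE) (use exec_local.hyps in auto)
next
  case (exec_store a b M R)
  from exec_store.prems(1) show ?case by (rule exec_OpE) auto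
next
  case (exec_mov R d a b M)
  from exec_mov.prems(1) show ?case by (rule exec_MovE) auto
next
  case (exec_seq c t M R M' R' c' t'' M'' R'')
  from exec_seq.prems(1) show ?case
    by (rule exec_SeqE) (use exec_seq.IH exec_seq.prems(2) in blast)
next
  case (exec_while_end R r c M)
  from exec_while_end.prems(1) show ?case
    by (rule exec_WhileE) (use exec_while_end in auto)
next
  case (exec_while_step R r c t M M' R' t'' M'' R'')
  from exec_while_step.prems(1) show ?case
    by (rule exec_WhileE) (use exec_while_step in blast)+
qed

text \<open>Computability itself bounds what \<open>G\<close> can depend on: environments that agree
  on the variables below \<open>k\<close> and on all processor indices lead to the same initial
  configuration, and execution is deterministic.\<close>

lemma pcomp_env_cong:
  assumes G: "pcomp k G" and E: "\<And>j i. j < k \<Longrightarrow> i < num_vecs x \<Longrightarrow> E j i = E' j i" and i: "i < num_vecs x"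
  shows "G x E i = G x E' i"
proof -
  have "6 \<le> 6 + k" "\<forall>j<k. 6 + j < 6 + k" by auto
  from pcompE[OF G this] obtain c T where c: "achieves k (\<lambda>j. 6 + j) (6 + k) 1 (\<lambda>_. G) c T" .
  let ?p = "num_vecs x"
  define M where "M = (\<lambda>a. case a of 0 \<Rightarrow> 0 | Suc a \<Rightarrow> input x a)"
  define R where "R = (\<lambda>i r. if r = 1 then length x else if r = 2 then 0 else if r = 3 then 1
     else if r = 4 then loglen x else if r = 5 then idx x i else E (r - 6) (idx x i))"
  have r: "ready x ?p M R"
    by (auto simp: ready_def M_def R_def input_def)
  obtain t1 M1 R1 where 1: "exec ?p c t1 M R M1 R1"
      "\<And>j i. j < 1 \<Longrightarrow> i < ?p \<Longrightarrow> R1 i (6 + k + j) = G x E (idx x i)"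
    by (rule achievesE[OF c r, of E]) (auto simp: R_def)
  obtain t2 M2 R2 where 2: "exec ?p c t2 M R M2 R2"
      "\<And>j i. j < 1 \<Longrightarrow> i < ?p \<Longrightarrow> R2 i (6 + k + j) = G x E' (idx x i)"
    by (rule achievesE[OF c r, of E']) (auto simp: R_def E)
  have "R2 = R1" using exec_deterministic[OF 1(1) 2(1)] by simp
  then show ?thesis using 1(2)[of 0 i] 2(2)[of 0 i] i by simp
qed

text \<open>A loop on two tables, the second one being a dummy which by
  \<open>pcomp_env_cong\<close> cannot influence \<open>G\<close>.\<close>

lemma pcomp_iter:
  assumes F: "pcomp k F" and G: "pcomp (k + 1) G"
  shows "pcomp k (\<lambda>x E. ((\<lambda>v. G x (E(k := v))) ^^ (c * loglen x)) (F x E))"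
proof -
  have G': "pcomp (k + 2) G" using G by (rule pcomp_weaken) simp
  have eq: "fst (((\<lambda>(u, v). (G x (E(k := u, Suc k := v)), \<lambda>i::nat. 0::nat))
     ^^ n) (F x E, F x E)) i = ((\<lambda>v. G x (E(k := v))) ^^ n) (F x E) i"
    if "i < num_vecs x" for x E n i
  proof -
    define P :: "(nat \<Rightarrow> nat) \<times> (nat \<Rightarrow> nat) \<Rightarrow> (nat \<Rightarrow> nat) \<times> (nat \<Rightarrow> nat)"
      where "P = (\<lambda>(u, v). (G x (E(k := u, Suc k := v)), \<lambda>i. 0))"
    define Q where "Q = (\<lambda>v. G x (E(k := v)))"
    have P: "fst (P uv) = G x (E(k := fst uv, Suc k := snd uv))" for uv
      by (simp add: P_def case_prod_beta)
    have Q: "Q v = G x (E(k := v))" for v by (simp add: Q_def)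
    have "fst ((P ^^ n) (F x E, F x E)) i = (Q ^^ n) (F x E) i"
      using that
    proof (induction n arbitrary: i)
      case (Suc n)
      have "G x (E(k := fst ((P ^^ n) (F x E, F x E)), Suc k := snd ((P ^^ n) (F x E, F x E)))) i =
          G x (E(k := (Q ^^ n) (F x E))) i"
        by (rule pcomp_env_cong[OF G]) (use Suc in auto)
      then show ?case by (simp only: funpow.simps comp_def P Q[of "(Q ^^ n) (F x E)"])
    qed simp
    then show ?thesis unfolding P_def Q_def .
  qed
  show ?thesis
    by (rule pcomp_cong[OF pcomp_iter2[OF F F G' pcomp_const]]) (rule eq)
qed

section \<open>Binary arithmetic\<close>

lemma pcomp_env_upd:
  assumes "pcomp k F" "i < num_vecs x"
  shows "F x (E(k := u)) i = F x E i" "F x (E(k := u, Suc k := v)) i = F x E i"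
  by (rule pcomp_env_cong[OF assms(1) _ assms(2)]; simp)+

lemma pcomp_if_less:
  assumes "pcomp k F" "pcomp k G" "pcomp k H" "pcomp k K"
  shows "pcomp k (\<lambda>x E i. if F x E i < G x E i then H x E i else K x E i)"
  by (rule pcomp_cong[OF pcomp_if_zero[OF pcomp_diff[OF assms(2,1)] assms(4,3)]]) auto

lemma pcomp_if_le:
  assumes "pcomp k F" "pcomp k G" "pcomp k H" "pcomp k K"
  shows "pcomp k (\<lambda>x E i. if F x E i \<le> G x E i then H x E i else K x E i)"
  by (rule pcomp_cong[OF pcomp_if_zero[OF pcomp_diff[OF assms(1,2)] assms(3,4)]]) auto

lemma iterate_pointwise:
  fixes g :: "'i \<Rightarrow> 'a \<Rightarrow> 'a"
  shows "((\<lambda>v i. g i (v i)) ^^ n) f i = ((g i) ^^ n) (f i)"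
  by (induction n) auto

lemma pcomp_iter_pointwise:
  assumes F: "pcomp k F" and G: "pcomp (k + 1) (\<lambda>x E i. g x i (E k i))"
  shows "pcomp k (\<lambda>x E i. ((g x i) ^^ (c * loglen x)) (F x E i))"
proof -
  have "pcomp k (\<lambda>x E. ((\<lambda>v. (\<lambda>x E i. g x i (E k i)) x (E(k := v))) ^^ (c * loglen x)) (F x E))"
    by (rule pcomp_iter[OF F G])
  then show ?thesis
    by (rule pcomp_cong) (simp add: iterate_pointwise)
qed

lemma pcomp_shift_left:
  assumes "pcomp k F" shows "pcomp k (\<lambda>x E i. F x E i * 2 ^ (c * loglen x))"
proof -
  have "((\<lambda>a. a + a) ^^ n) a = a * 2 ^ n" for a n :: nat by (induction n) auto
  then show ?thesis
    by (intro pcomp_cong[OF pcomp_iter_pointwise[OF assms, of "\<lambda>x i a. a + a" c]] pcomp_add pcomp_var) auto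
qed

lemma pcomp_shift_right:
  assumes "pcomp k F" shows "pcomp k (\<lambda>x E i. F x E i div 2 ^ (c * loglen x))"
proof -
  have "((\<lambda>a. a div 2) ^^ n) a = a div 2 ^ n" for a n :: nat
    by (induction n) (auto simp: div_mult2_eq[symmetric] mult.commute)
  then show ?thesis
    by (intro pcomp_cong[OF pcomp_iter_pointwise[OF assms, of "\<lambda>x i a. a div 2" c]] pcomp_half pcomp_var) auto
qed

lemma pcomp_power [intro]: "pcomp k (\<lambda>x E i. 2 ^ (c * loglen x))"
  by (rule pcomp_cong[OF pcomp_shift_left[OF pcomp_const[of k 1], of c]]) simp

text \<open>The bits of the second factor are consumed from the top.\<close>

definition shift_add :: "nat \<Rightarrow> nat \<Rightarrow> nat \<Rightarrow> nat" where
  "shift_add S a b = fst (((\<lambda>(u, v). (if 2 ^ S \<le> v + v then u + u + a else u + u,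
     if 2 ^ S \<le> v + v then v + v - 2 ^ S else v + v)) ^^ S) (0, b))"

lemma shift_add:
  assumes "b < 2 ^ S" shows "shift_add S a b = a * b"
proof -
  define f where "f = (\<lambda>(u, v). (if 2 ^ S \<le> v + v then u + u + a else u + u,
     if 2 ^ S \<le> v + v then v + v - 2 ^ S else v + v :: nat))"
  define U where "U n = fst ((f ^^ n) (0, b))" for n
  define V where "V n = snd ((f ^^ n) (0, b))" for n
  have step: "U (Suc n) = (if 2 ^ S \<le> V n + V n then U n + U n + a else U n + U n)"
    "V (Suc n) = (if 2 ^ S \<le> V n + V n then V n + V n - 2 ^ S else V n + V n)" for n
    by (simp_all add: U_def V_def f_def case_prod_beta)
  \<comment> \<open>The invariant splits the product into the part accumulated in \<open>U\<close>
    and the part still encoded in \<open>V\<close>. Divisibility by \<open>2 ^ n\<close> is what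
    makes \<open>V\<close> vanish after \<open>S\<close> rounds, as it stays below
    \<open>2 ^ S\<close>.\<close>
  have "n \<le> S \<Longrightarrow> U n * 2 ^ S + a * V n = 2 ^ n * (a * b) \<and> V n < 2 ^ S \<and> 2 ^ n dvd V n" for n
  proof (induction n)
    case 0
    then show ?case using assms by (simp add: U_def V_def)
  next
    case (Suc n)
    then have IH: "U n * 2 ^ S + a * V n = 2 ^ n * (a * b)" "V n < 2 ^ S" "2 ^ n dvd V n" by auto
    have dvd: "2 ^ Suc n dvd V n + V n"
      unfolding mult_2[symmetric] power_Suc by (intro mult_dvd_mono dvd_refl IH(3))
    have "(2::nat) ^ Suc n dvd 2 ^ S" using Suc.prems by (rule le_imp_power_dvd)
    show ?case
    proof (cases "2 ^ S \<le> V n + V n")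
      case True
      then obtain w where w: "V n + V n = 2 ^ S + w" using le_Suc_ex by blast
      have "U (Suc n) * 2 ^ S + a * V (Suc n) = 2 * (U n * 2 ^ S) + a * (2 ^ S + w)"
        using True w by (simp add: step algebra_simps)
      also have "\<dots> = 2 ^ Suc n * (a * b)" using IH(1) w[symmetric] by (simp add: algebra_simps)
      finally show ?thesis
        using True IH(2) dvd \<open>2 ^ Suc n dvd 2 ^ S\<close> by (auto simp: step intro: dvd_diff_nat)
    next
      case False
      then show ?thesis using IH(1) dvd by (simp add: step algebra_simps)
    qed
  qed
  from this[of S] have "U S * 2 ^ S + a * V S = 2 ^ S * (a * b)" "V S < 2 ^ S" "2 ^ S dvd V S" by auto
  then have "V S = 0" "U S * 2 ^ S = a * b * 2 ^ S"
    using nat_dvd_not_less by (metis gr0I) (metis \<open>V S < 2 ^ S\<close> \<open>2 ^ S dvd V S\<close>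
      \<open>U S * 2 ^ S + a * V S = 2 ^ S * (a * b)\<close> add_0_right gr0I mult.commute mult_0_right nat_dvd_not_less)
  then show ?thesis by (simp add: shift_add_def U_def f_def)
qed

lemma pcomp_shift_add:
  assumes F: "pcomp k F" and G: "pcomp k G"
  shows "pcomp k (\<lambda>x E i. shift_add (c * loglen x) (F x E i) (G x E i))"
proof -
  let ?H = "\<lambda>x. 2 ^ (c * loglen x) :: nat"
  let ?G0 = "\<lambda>x E i. if ?H x \<le> E (Suc k) i + E (Suc k) i then E k i + E k i + F x E i else E k i + E k i"
  let ?G1 = "\<lambda>x (E :: nat \<Rightarrow> nat \<Rightarrow> nat) i.
    if ?H x \<le> E (Suc k) i + E (Suc k) i then E (Suc k) i + E (Suc k) i - ?H x else E (Suc k) i + E (Suc k) i"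
  have "pcomp (k + 2) F" using F by (rule pcomp_weaken) simp
  then have 0: "pcomp (k + 2) ?G0"
    by (intro pcomp_if_le pcomp_add pcomp_var pcomp_power) auto
  have 1: "pcomp (k + 2) ?G1"
    by (intro pcomp_if_le pcomp_add pcomp_var pcomp_power pcomp_diff) auto
  have *: "fst (((\<lambda>(u, v). (?G0 x (E(k := u, Suc k := v)), ?G1 x (E(k := u, Suc k := v))))
       ^^ n) (\<lambda>i. 0, G x E)) i = fst (((\<lambda>(u, v). (if ?H x \<le> v + v then u + u + F x E i else u + u,
     if ?H x \<le> v + v then v + v - ?H x else v + v)) ^^ n) (0, G x E i)) \<and>
     snd (((\<lambda>(u, v). (?G0 x (E(k := u, Suc k := v)), ?G1 x (E(k := u, Suc k := v))))
       ^^ n) (\<lambda>i. 0, G x E)) i = snd (((\<lambda>(u, v). (if ?H x \<le> v + v then u + u + F x E i else u + u,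
     if ?H x \<le> v + v then v + v - ?H x else v + v)) ^^ n) (0, G x E i))"
    if "i < num_vecs x" for x E i n
    using that by (induction n) (simp_all add: case_prod_beta pcomp_env_upd(2)[OF F])
  show ?thesis
    by (rule pcomp_cong[OF pcomp_iter2[OF pcomp_const[of k 0] G 0 1, of c]])
      (unfold shift_add_def, erule *[THEN conjunct1])
qed

lemma pcomp_mult:
  assumes "pcomp k F" "pcomp k G" "\<And>x E i. i < num_vecs x \<Longrightarrow> G x E i < 2 ^ (c * loglen x)"
  shows "pcomp k (\<lambda>x E i. F x E i * G x E i)"
  by (rule pcomp_cong[OF pcomp_shift_add[OF assms(1,2), of c]]) (simp add: shift_add assms(3))

text \<open>Schoolbook division that keeps only the remainder: the shifted divisors
  \<open>q * 2 ^ (S - 1)\<close>, ..., \<open>2 * q\<close>, \<open>q\<close> are subtracted in turn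
  whenever they fit.\<close>

definition long_mod :: "nat \<Rightarrow> nat \<Rightarrow> nat \<Rightarrow> nat" where
  "long_mod S a q = fst (((\<lambda>(u, v). (if v div 2 \<le> u then u - v div 2 else u, v div 2)) ^^ S)
     (a, q * 2 ^ S))"

lemma long_mod:
  assumes "a < q * 2 ^ S" shows "long_mod S a q = a mod q"
  using assms
proof (induction S arbitrary: a)
  case 0
  then show ?case by (simp add: long_mod_def)
next
  case (Suc S)
  let ?a = "if q * 2 ^ S \<le> a then a - q * 2 ^ S else a"
  have "long_mod (Suc S) a q = long_mod S ?a q"
    by (simp add: long_mod_def funpow_Suc_right del: funpow.simps)
  also have "\<dots> = ?a mod q"
    using Suc.prems by (intro Suc.IH) auto
  also have "\<dots> = a mod q"
    by (auto simp: le_iff_add)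
  finally show ?case .
qed

lemma pcomp_long_mod:
  assumes F: "pcomp k F" and G: "pcomp k G"
  shows "pcomp k (\<lambda>x E i. long_mod (c * loglen x) (F x E i) (G x E i))"
proof -
  let ?G0 = "\<lambda>x (E :: nat \<Rightarrow> nat \<Rightarrow> nat) i.
    if E (Suc k) i div 2 \<le> E k i then E k i - E (Suc k) i div 2 else E k i"
  let ?G1 = "\<lambda>x (E :: nat \<Rightarrow> nat \<Rightarrow> nat) i. E (Suc k) i div 2"
  have 0: "pcomp (k + 2) ?G0"
    by (intro pcomp_if_le pcomp_half pcomp_diff pcomp_var) auto
  have 1: "pcomp (k + 2) ?G1"
    by (intro pcomp_half pcomp_var) auto
  have *: "fst (((\<lambda>(u, v). (?G0 x (E(k := u, Suc k := v)), ?G1 x (E(k := u, Suc k := v))))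
       ^^ n) (U, V)) i = fst (((\<lambda>(u, v). (if v div 2 \<le> u then u - v div 2 else u, v div 2)) ^^ n)
         (U i, V i)) \<and>
     snd (((\<lambda>(u, v). (?G0 x (E(k := u, Suc k := v)), ?G1 x (E(k := u, Suc k := v))))
       ^^ n) (U, V)) i = snd (((\<lambda>(u, v). (if v div 2 \<le> u then u - v div 2 else u, v div 2)) ^^ n)
         (U i, V i))" for x E n U V i
    by (induction n) (simp_all add: case_prod_beta)
  show ?thesis
    by (rule pcomp_cong[OF pcomp_iter2[OF F pcomp_shift_left[OF G] 0 1, of c c]])
      (unfold long_mod_def, rule *[THEN conjunct1])
qed

section \<open>Processor indices as vectors of digits\<close>

definition radix :: "bool list \<Rightarrow> nat" where
  "radix x = 2 ^ (8 * loglen x)"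

lemma radix_pos [simp]: "0 < radix x" by (simp add: radix_def)

lemma num_vecs_radix: "num_vecs x = radix x ^ 16"
  by (simp add: num_vecs_def radix_def flip: power_mult)

lemma radix_power: "radix x ^ j = 2 ^ ((8 * j) * loglen x)"
  by (simp add: radix_def mult_ac flip: power_mult)

definition digit :: "bool list \<Rightarrow> nat \<Rightarrow> nat \<Rightarrow> nat" where
  "digit x i j = i div radix x ^ j mod radix x"

definition set_digit :: "bool list \<Rightarrow> nat \<Rightarrow> nat \<Rightarrow> nat \<Rightarrow> nat" where
  "set_digit x i j t = i - digit x i j * radix x ^ j + t * radix x ^ j"

lemma digit_less [simp]: "digit x i j < radix x"
  by (simp add: digit_def)

lemma digit_decomp:
  fixes i :: nat assumes "0 < B"
  obtains h l where "i = h * B ^ Suc j + (i div B ^ j mod B) * B ^ j + l" "l < B ^ j"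
proof
  show "i = (i div B ^ j div B) * B ^ Suc j + (i div B ^ j mod B) * B ^ j + i mod B ^ j"
  proof -
    have "i = i div B ^ j * B ^ j + i mod B ^ j" by (rule div_mult_mod_eq[symmetric])
    also have "i div B ^ j = i div B ^ j div B * B + i div B ^ j mod B" by simp
    finally show ?thesis by (simp only: power_Suc add_mult_distrib mult.assoc)
  qed
  show "i mod B ^ j < B ^ j" using assms by simp
qed

lemma digit_compose:
  fixes h l :: nat assumes B: "0 < B" and l: "l < B ^ j" and t: "t < B"
  shows "(h * B ^ Suc j + t * B ^ j + l) div B ^ j' mod B =
    (if j' < j then l div B ^ j' mod B else if j' = j then t else h div B ^ (j' - Suc j) mod B)"
proof -
  have low: "t * B ^ j + l < B ^ Suc j"
  proof -
    have "t * B ^ j + l < (t + 1) * B ^ j" using l by simp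
    also have "\<dots> \<le> B * B ^ j" using t by (intro mult_right_mono) auto
    finally show ?thesis by simp
  qed
  consider "j' < j" | "j' = j" | "j < j'" by linarith
  then show ?thesis
  proof cases
    case 1
    then have "B ^ j = B * B ^ (j - Suc j') * B ^ j'"
      by (simp flip: power_Suc power_add)
    then have "h * B ^ Suc j + t * B ^ j + l = (h * B + t) * B ^ (j - Suc j') * B * B ^ j' + l"
      by (simp add: algebra_simps)
    then show ?thesis using 1 B by (simp add: div_mult_self3[of "B ^ j'"] add.commute)
  next
    case 2
    have "h * B ^ Suc j + t * B ^ j + l = l + (h * B + t) * B ^ j" by (simp add: algebra_simps)
    then show ?thesis using 2 B l t by simp
  next
    case 3
    then have e: "B ^ j' = B ^ Suc j * B ^ (j' - Suc j)"
      by (metis Suc_leI le_add_diff_inverse power_add)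
    have "(h * B ^ Suc j + t * B ^ j + l) div B ^ Suc j = h"
      using low B by (simp add: add.assoc div_add1_eq[of "h * B ^ Suc j"] del: power_Suc)
    then show ?thesis using 3 unfolding e by (simp add: div_mult2_eq del: power_Suc)
  qed
qed

lemma set_digit_props:
  assumes t: "t < radix x"
  shows "digit x (set_digit x i j t) = (digit x i)(j := t)"
    "i < num_vecs x \<Longrightarrow> j < 16 \<Longrightarrow> set_digit x i j t < num_vecs x"
    "set_digit x (set_digit x i j t) j t' = set_digit x i j t'"
proof -
  let ?B = "radix x"
  obtain h l where hl: "i = h * ?B ^ Suc j + digit x i j * ?B ^ j + l" "l < ?B ^ j"
    unfolding digit_def by (rule digit_decomp[of ?B i j]) auto
  have s: "set_digit x i j t' = h * ?B ^ Suc j + t' * ?B ^ j + l" for t'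
    unfolding set_digit_def by (subst (1) hl(1)) simp
  show d: "digit x (set_digit x i j t) = (digit x i)(j := t)"
  proof
    fix j'
    have "digit x i j' = (h * ?B ^ Suc j + digit x i j * ?B ^ j + l) div ?B ^ j' mod ?B"
      by (subst hl(1)[symmetric]) (simp add: digit_def)
    also note digit_compose[OF radix_pos hl(2) digit_less[of x i j], of h j']
    finally show "digit x (set_digit x i j t) j' = ((digit x i)(j := t)) j'"
      unfolding s digit_def[of x "h * ?B ^ Suc j + t * ?B ^ j + l"]
      by (subst digit_compose[OF radix_pos hl(2) t]) simp
  qed
  show "set_digit x (set_digit x i j t) j t' = set_digit x i j t'"
    by (simp add: set_digit_def[of x "set_digit x i j t"] d) (simp add: s)
  assume i: "i < num_vecs x" and j: "j < 16"
  have "i div ?B ^ 16 = 0" using i by (simp add: num_vecs_radix)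
  have e: "?B ^ 16 = ?B ^ Suc j * ?B ^ (15 - j)" using j by (simp flip: power_add power_Suc)
  have low: "t' * ?B ^ j + l < ?B ^ Suc j" if "t' < ?B" for t'
  proof -
    have "t' * ?B ^ j + l < (t' + 1) * ?B ^ j" using hl(2) by simp
    also have "\<dots> \<le> ?B * ?B ^ j" using that by (intro mult_right_mono) auto
    finally show ?thesis by simp
  qed
  have h: "(h * ?B ^ Suc j + t' * ?B ^ j + l) div ?B ^ Suc j = h" if "t' < ?B" for t'
    using low[OF that] by (simp add: add.assoc div_add1_eq[of "h * ?B ^ Suc j"] del: power_Suc)
  have "h = i div ?B ^ Suc j" using h[OF digit_less, of i j] hl(1) by simp
  then have "set_digit x i j t div ?B ^ Suc j = i div ?B ^ Suc j" using h[OF t] s by simp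
  then have "set_digit x i j t div ?B ^ 16 = i div ?B ^ 16" unfolding e by (simp add: div_mult2_eq del: power_Suc)
  then show "set_digit x i j t < num_vecs x"
    using \<open>i div ?B ^ 16 = 0\<close> radix_pos[of x] unfolding num_vecs_radix
    by (metis div_eq_0_iff power_eq_0_iff less_irrefl)
qed

lemma pcomp_digit [intro]: "pcomp k (\<lambda>x E i. digit x i j)"
proof -
  have "pcomp k (\<lambda>x E i. i div 2 ^ ((8 * j) * loglen x) -
      i div 2 ^ ((8 * j) * loglen x) div 2 ^ (8 * loglen x) * 2 ^ (8 * loglen x))"
    by (intro pcomp_diff pcomp_shift_left pcomp_shift_right pcomp_idx)
  then show ?thesis
    by (rule pcomp_cong) (simp add: digit_def radix_power minus_div_mult_eq_mod radix_def[symmetric])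
qed

lemma pcomp_set_digit:
  assumes "pcomp k T" shows "pcomp k (\<lambda>x E i. set_digit x i j (T x E i))"
  unfolding set_digit_def radix_power
  by (intro pcomp_add pcomp_diff pcomp_shift_left pcomp_idx pcomp_digit assms)

text \<open>Reduction by a perfect shuffle: position \<open>a\<close> combines the values at 2a and
  2a + 1 modulo \<open>B\<close>, so after \<open>s\<close> rounds it covers the
  \<open>2 ^ s\<close> cyclically consecutive positions from \<open>2 ^ s * a\<close> on. If
  \<open>B = 2 ^ s\<close> these are all the positions, whatever \<open>a\<close> is, so that every
  processor obtains the full result.\<close>

primrec tree_fold :: "nat \<Rightarrow> (nat \<Rightarrow> nat \<Rightarrow> nat) \<Rightarrow> (nat \<Rightarrow> nat) \<Rightarrow> nat \<Rightarrow> nat \<Rightarrow> nat" where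
  "tree_fold B h f 0 a = f a"
| "tree_fold B h f (Suc s) a =
     h (tree_fold B h f s (2 * a mod B)) (tree_fold B h f s ((2 * a + 1) mod B))"

text \<open>The map \<phi> takes a value to the number that represents it in a register, and
  \<open>h\<close> is addition on representatives. It will be the identity for natural numbers and a
  residue map for integers.\<close>

lemma tree_fold_sum:
  fixes z :: "nat \<Rightarrow> 'z::comm_monoid_add"
  assumes "\<And>t. t < B \<Longrightarrow> f t = \<phi> (z t)" "\<And>u v. h (\<phi> u) (\<phi> v) = \<phi> (u + v)" "0 < B" "a < B"
  shows "tree_fold B h f s a = \<phi> (\<Sum>t<2 ^ s. z ((2 ^ s * a + t) mod B))"
  using assms(4)
proof (induction s arbitrary: a)
  case 0
  then show ?case using assms by simp
next
  case (Suc s)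
  have e: "(2 ^ s * (b mod B) + t) mod B = (2 ^ s * b + t) mod B" for b t
    by (metis mod_add_left_eq mod_mult_right_eq)
  have "{..<2 ^ Suc s} = {..<2 ^ s + (2::nat) ^ s}" by (simp add: mult_2)
  then have "(\<Sum>t<2 ^ Suc s. z ((2 ^ Suc s * a + t) mod B)) =
      (\<Sum>t<2 ^ s. z ((2 ^ s * (2 * a) + t) mod B)) + (\<Sum>t<2 ^ s. z ((2 ^ s * (2 * a + 1) + t) mod B))"
    by (simp add: sum.nat_group[symmetric] lessThan_atLeast0 sum.atLeastLessThan_concat[symmetric, of 0 "2^s" "2^s+2^s"]
        sum.shift_bounds_nat_ivl[of _ 0 "2^s" "2^s", simplified] algebra_simps)
  then show ?case using Suc.IH assms(2,3) by (simp add: e)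
qed

lemma tree_fold_prod:
  fixes z :: "nat \<Rightarrow> 'z::comm_monoid_mult"
  assumes "\<And>t. t < B \<Longrightarrow> f t = \<phi> (z t)" "\<And>u v. h (\<phi> u) (\<phi> v) = \<phi> (u * v)" "0 < B" "a < B"
  shows "tree_fold B h f s a = \<phi> (\<Prod>t<2 ^ s. z ((2 ^ s * a + t) mod B))"
  using assms(4)
proof (induction s arbitrary: a)
  case 0
  then show ?case using assms by simp
next
  case (Suc s)
  have e: "(2 ^ s * (b mod B) + t) mod B = (2 ^ s * b + t) mod B" for b t
    by (metis mod_add_left_eq mod_mult_right_eq)
  have "{..<2 ^ Suc s} = {..<2 ^ s + (2::nat) ^ s}" by (simp add: mult_2)
  then have "(\<Prod>t<2 ^ Suc s. z ((2 ^ Suc s * a + t) mod B)) =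
      (\<Prod>t<2 ^ s. z ((2 ^ s * (2 * a) + t) mod B)) * (\<Prod>t<2 ^ s. z ((2 ^ s * (2 * a + 1) + t) mod B))"
    by (simp add: lessThan_atLeast0 prod.atLeastLessThan_concat[symmetric, of 0 "2^s" "2^s+2^s"]
        prod.shift_bounds_nat_ivl[of _ 0 "2^s" "2^s", simplified] algebra_simps)
  then show ?case using Suc.IH assms(2,3) by (simp add: e)
qed

text \<open>The fold runs along digit \<open>j\<close> of the processor index, all other digits
  being parameters. The operation may depend on those parameters, as addition modulo a number given
  by digit 15 does.\<close>

lemma pcomp_tree_fold:
  assumes F: "pcomp k F" and j: "j < 16"
    and H: "\<And>U V. pcomp (k + 1) U \<Longrightarrow> pcomp (k + 1) V \<Longrightarrow>
      pcomp (k + 1) (\<lambda>x E i. h x i (U x E i) (V x E i))"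
    and h: "\<And>x i t. t < radix x \<Longrightarrow> h x (set_digit x i j t) = h x i"
  shows "pcomp k (\<lambda>x E i. tree_fold (radix x) (h x i) (\<lambda>t. F x E (set_digit x i j t))
    (8 * loglen x) (digit x i j))"
proof -
  let ?r = "\<lambda>x a. if radix x \<le> a then a - radix x else a"
  have r: "?r x (2 * a) = 2 * a mod radix x" "?r x (2 * a + 1) = (2 * a + 1) mod radix x"
    if "a < radix x" for x a
  proof -
    have mod: "?r x b = b mod radix x" if "b < 2 * radix x" for b
      using that by (simp add: le_mod_geq)
    show "?r x (2 * a) = 2 * a mod radix x" "?r x (2 * a + 1) = (2 * a + 1) mod radix x"
      by (rule mod, use that in linarith)+
  qed
  let ?lo = "\<lambda>x (E :: nat \<Rightarrow> nat \<Rightarrow> nat) i. set_digit x i j (?r x (digit x i j + digit x i j))"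
  let ?hi = "\<lambda>x (E :: nat \<Rightarrow> nat \<Rightarrow> nat) i. set_digit x i j (?r x (digit x i j + digit x i j + 1))"
  have lo_eq: "?lo x E i = set_digit x i j (2 * digit x i j mod radix x)"
    "?hi x E i = set_digit x i j ((2 * digit x i j + 1) mod radix x)" for x E i
    using r[OF digit_less, of x i j] by (simp_all only: mult_2)
  have [intro]: "pcomp k' (\<lambda>x E i. radix x)" for k'
    unfolding radix_def by (rule pcomp_power)
  have lo: "pcomp (k + 1) ?lo" and hi: "pcomp (k + 1) ?hi"
    by (intro pcomp_set_digit pcomp_if_le pcomp_diff pcomp_add pcomp_digit pcomp_const; blast)+
  let ?G = "\<lambda>x (E :: nat \<Rightarrow> nat \<Rightarrow> nat) i. h x i (E k (?lo x E i)) (E k (?hi x E i))"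
  have less: "?lo x E i < num_vecs x" "?hi x E i < num_vecs x" if "i < num_vecs x" for x E i
    unfolding lo_eq by (intro set_digit_props(2)[OF _ that j]; simp)+
  have "pcomp (k + 1) ?G"
    by (rule H; rule pcomp_gather[OF pcomp_var]) (use lo hi less in auto)
  from pcomp_iter[OF F this, of 8]
  have "pcomp k (\<lambda>x E. ((\<lambda>v. ?G x (E(k := v))) ^^ (8 * loglen x)) (F x E))" .
  moreover have "((\<lambda>v. ?G x (E(k := v))) ^^ n) (F x E) i =
      tree_fold (radix x) (h x i) (\<lambda>t. F x E (set_digit x i j t)) n (digit x i j)" for x E i n
  proof -
    define w where "w n = ((\<lambda>v. ?G x (E(k := v))) ^^ n) (F x E)" for n
    have w_Suc: "w (Suc n) i = h x i (w n (?lo x E i)) (w n (?hi x E i))" for n i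
      by (simp add: w_def)
    have "w n i = tree_fold (radix x) (h x i) (\<lambda>t. F x E (set_digit x i j t)) n (digit x i j)"
    proof (induction n arbitrary: i)
      case 0
      have "digit x i j * radix x ^ j \<le> i"
        unfolding digit_def by (meson div_times_less_eq_dividend mod_less_eq_dividend mult_le_mono1 order_trans)
      then have "set_digit x i j (digit x i j) = i"
        by (simp add: set_digit_def)
      then show ?case by (simp add: w_def)
    next
      case (Suc n)
      show ?case
        unfolding w_Suc lo_eq Suc.IH by (simp add: set_digit_props h)
    qed
    then show ?thesis unfolding w_def .
  qed
  ultimately show ?thesis by (rule pcomp_cong)
qed

section \<open>Arithmetic with residues\<close>

text \<open>From here on a table is a function of the digit vector of its index. Each digit holds
  one index variable, free or bound, so that nested sums and quantifiers become successive folds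
  along digits.\<close>

definition ncomp :: "(bool list \<Rightarrow> (nat \<Rightarrow> nat) \<Rightarrow> nat) \<Rightarrow> bool" where
  "ncomp F \<longleftrightarrow> pcomp 0 (\<lambda>x E i. F x (digit x i))"

definition bcomp :: "(bool list \<Rightarrow> (nat \<Rightarrow> nat) \<Rightarrow> bool) \<Rightarrow> bool" where
  "bcomp P \<longleftrightarrow> ncomp (\<lambda>x \<delta>. of_bool (P x \<delta>))"

lemma ncomp_cong:
  assumes "ncomp F" "\<And>x \<delta>. (\<And>j. \<delta> j < radix x) \<Longrightarrow> F x \<delta> = G x \<delta>"
  shows "ncomp G"
  using pcomp_cong[OF assms(1)[unfolded ncomp_def]] assms(2) unfolding ncomp_def by simp

lemma ncomp_const: "ncomp (\<lambda>x \<delta>. c)"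
  unfolding ncomp_def by (rule pcomp_const)

lemma ncomp_digit: "ncomp (\<lambda>x \<delta>. \<delta> j)"
  unfolding ncomp_def by (rule pcomp_digit)

lemma ncomp_length: "ncomp (\<lambda>x \<delta>. length x)"
  unfolding ncomp_def by (rule pcomp_length)

lemma ncomp_input: "ncomp F \<Longrightarrow> ncomp (\<lambda>x \<delta>. input x (F x \<delta>))"
  unfolding ncomp_def by (rule pcomp_input)

lemma ncomp_add: "ncomp F \<Longrightarrow> ncomp G \<Longrightarrow> ncomp (\<lambda>x \<delta>. F x \<delta> + G x \<delta>)"
  unfolding ncomp_def by (rule pcomp_add)

lemma ncomp_diff: "ncomp F \<Longrightarrow> ncomp G \<Longrightarrow> ncomp (\<lambda>x \<delta>. F x \<delta> - G x \<delta>)"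
  unfolding ncomp_def by (rule pcomp_diff)

lemma ncomp_mult:
  assumes "ncomp F" "ncomp G" "\<And>x \<delta>. G x \<delta> \<le> radix x"
  shows "ncomp (\<lambda>x \<delta>. F x \<delta> * G x \<delta>)"
proof -
  \<comment> \<open>The bound on \<open>G\<close> includes \<open>radix x\<close> itself, which has
    one bit more than \<open>8 * loglen x\<close>; another \<open>loglen x\<close> bits cover
    it.\<close>
  have "radix x < 2 ^ (9 * loglen x)" for x
    by (simp add: radix_def loglen_def)
  then have "G x \<delta> < 2 ^ (9 * loglen x)" for x \<delta>
    using assms(3)[of x \<delta>] le_less_trans by blast
  then show ?thesis
    using assms(1,2) unfolding ncomp_def by (intro pcomp_mult[where c = 9])
qed

lemma ncomp_if:
  assumes "bcomp P" "ncomp F" "ncomp G"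
  shows "ncomp (\<lambda>x \<delta>. if P x \<delta> then F x \<delta> else G x \<delta>)"
  unfolding ncomp_def
  by (rule pcomp_cong[OF pcomp_if_zero[OF assms(1)[unfolded bcomp_def ncomp_def]
      assms(3)[unfolded ncomp_def] assms(2)[unfolded ncomp_def]]]) simp

lemma bcomp_less: "ncomp F \<Longrightarrow> ncomp G \<Longrightarrow> bcomp (\<lambda>x \<delta>. F x \<delta> < G x \<delta>)"
  unfolding bcomp_def ncomp_def of_bool_def by (intro pcomp_if_less pcomp_const)

lemma bcomp_le: "ncomp F \<Longrightarrow> ncomp G \<Longrightarrow> bcomp (\<lambda>x \<delta>. F x \<delta> \<le> G x \<delta>)"
  unfolding bcomp_def ncomp_def of_bool_def by (intro pcomp_if_le pcomp_const)

lemma bcomp_not: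
  assumes "bcomp P" shows "bcomp (\<lambda>x \<delta>. \<not> P x \<delta>)"
  unfolding bcomp_def
  by (rule ncomp_cong[OF ncomp_diff[OF ncomp_const[of 1] assms[unfolded bcomp_def]]]) simp

lemma bcomp_conj:
  assumes "bcomp P" "bcomp Q" shows "bcomp (\<lambda>x \<delta>. P x \<delta> \<and> Q x \<delta>)"
  unfolding bcomp_def
  by (rule ncomp_cong[OF ncomp_if[OF assms(1) assms(2)[unfolded bcomp_def] ncomp_const[of 0]]]) simp

lemma bcomp_disj:
  assumes "bcomp P" "bcomp Q" shows "bcomp (\<lambda>x \<delta>. P x \<delta> \<or> Q x \<delta>)"
  using bcomp_not[OF bcomp_conj[OF bcomp_not[OF assms(1)] bcomp_not[OF assms(2)]]] by simp

lemma bcomp_imp: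
  assumes "bcomp P" "bcomp Q" shows "bcomp (\<lambda>x \<delta>. P x \<delta> \<longrightarrow> Q x \<delta>)"
  using bcomp_not[OF bcomp_conj[OF assms(1) bcomp_not[OF assms(2)]]] by simp

lemma bcomp_eq:
  assumes "ncomp F" "ncomp G" shows "bcomp (\<lambda>x \<delta>. F x \<delta> = G x \<delta>)"
  using bcomp_conj[OF bcomp_le[OF assms] bcomp_le[OF assms(2,1)]] by (simp add: order_eq_iff)

lemma radix_rounds: "(2 ^ (8 * loglen x) * a + t) mod radix x = t mod radix x"
  by (simp add: radix_def)

text \<open>Digit \<open>j\<close> plays the bound variable; the second hypothesis says that it does
  not occur elsewhere in the summand.\<close>

lemma ncomp_sum:
  assumes "ncomp (\<lambda>x \<delta>. F x \<delta> (\<delta> j))" "\<And>x \<delta> s t. F x (\<delta>(j := s)) t = F x \<delta> t" "j < 16"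
  shows "ncomp (\<lambda>x \<delta>. \<Sum>t<radix x. F x \<delta> t)"
  unfolding ncomp_def
proof (rule pcomp_cong[OF pcomp_tree_fold[where h = "\<lambda>x i u v. u + v" and j = j and k = 0]])
  show "pcomp 0 (\<lambda>x E i. F x (digit x i) (digit x i j))"
    using assms(1) by (simp add: ncomp_def)
  fix x :: "bool list" and E :: "nat \<Rightarrow> nat \<Rightarrow> nat" and i assume "i < num_vecs x"
  have "tree_fold (radix x) (+) (\<lambda>t. F x (digit x (set_digit x i j t)) (digit x (set_digit x i j t) j))
      (8 * loglen x) (digit x i j) = id (\<Sum>t<2 ^ (8 * loglen x). F x (digit x i)
        ((2 ^ (8 * loglen x) * digit x i j + t) mod radix x))"
    by (rule tree_fold_sum) (simp_all add: set_digit_props(1) assms(2))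
  then show "tree_fold (radix x) (+) (\<lambda>t. F x (digit x (set_digit x i j t)) (digit x (set_digit x i j t) j))
      (8 * loglen x) (digit x i j) = (\<Sum>t<radix x. F x (digit x i) t)"
    unfolding radix_rounds by (simp add: radix_def)
qed (use assms(3) in \<open>auto\<close>)

lemma bcomp_ex:
  assumes "bcomp (\<lambda>x \<delta>. P x \<delta> (\<delta> j))" "\<And>x \<delta> s t. P x (\<delta>(j := s)) t = P x \<delta> t" "j < 16"
  shows "bcomp (\<lambda>x \<delta>. \<exists>t<radix x. P x \<delta> t)"
proof -
  have "ncomp (\<lambda>x \<delta>. \<Sum>t<radix x. of_bool (P x \<delta> t))"
    by (rule ncomp_sum[OF _ _ assms(3)]) (use assms(1,2) in \<open>auto simp: bcomp_def\<close>)
  from bcomp_less[OF ncomp_const[of 0] this]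
  have "bcomp (\<lambda>x \<delta>. 0 < (\<Sum>t<radix x. of_bool (P x \<delta> t) :: nat))" .
  moreover have "0 < (\<Sum>t<radix x. of_bool (P x \<delta> t) :: nat) \<longleftrightarrow> (\<exists>t<radix x. P x \<delta> t)" for x \<delta>
    by (simp only: zero_less_iff_neq_zero sum_eq_0_iff finite_lessThan) auto
  ultimately show ?thesis by simp
qed

lemma bcomp_all:
  assumes "bcomp (\<lambda>x \<delta>. P x \<delta> (\<delta> j))" "\<And>x \<delta> s t. P x (\<delta>(j := s)) t = P x \<delta> t" "j < 16"
  shows "bcomp (\<lambda>x \<delta>. \<forall>t<radix x. P x \<delta> t)"
  using bcomp_not[OF bcomp_ex[where P = "\<lambda>x \<delta> t. \<not> P x \<delta> t", OF bcomp_not[OF assms(1)] _ assms(3)]]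
    assms(2) by simp

text \<open>The modulus is \<open>Suc q\<close>, so that a digit \<open>q < radix x\<close> names
  one of 1, ..., \<open>radix x\<close> and never the modulus 0.\<close>

definition residue :: "nat \<Rightarrow> int \<Rightarrow> nat" where
  "residue q z = nat (z mod int (Suc q))"

lemma int_residue: "int (residue q z) = z mod int (Suc q)"
  by (simp add: residue_def)

lemma residue_le: "residue q z \<le> q"
proof -
  have "z mod int (Suc q) < int (Suc q)" by simp
  then have "z mod int (Suc q) \<le> int q" by linarith
  then show ?thesis by (simp only: residue_def nat_le_iff)
qed

lemma residue_add: "(residue q a + residue q b) mod Suc q = residue q (a + b)"
proof -
  have "int ((residue q a + residue q b) mod Suc q) = int (residue q (a + b))"
    unfolding zmod_int of_nat_add int_residue by (rule mod_add_eq)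
  then show ?thesis by (simp only: of_nat_eq_iff)
qed

lemma residue_mult: "residue q a * residue q b mod Suc q = residue q (a * b)"
proof -
  have "int (residue q a * residue q b mod Suc q) = int (residue q (a * b))"
    unfolding zmod_int of_nat_mult int_residue by (rule mod_mult_eq)
  then show ?thesis by (simp only: of_nat_eq_iff)
qed

lemma residue_uminus: "(Suc q - residue q a) mod Suc q = residue q (- a)"
proof -
  have "residue q a \<le> Suc q" using residue_le[of q a] by simp
  then have "int ((Suc q - residue q a) mod Suc q) = (int (Suc q) - a mod int (Suc q)) mod int (Suc q)"
    by (simp only: zmod_int of_nat_diff int_residue)
  also have "\<dots> = int (residue q (- a))"
    unfolding int_residue by (metis diff_0 mod_diff_left_eq mod_diff_right_eq mod_self)
  finally show ?thesis by (simp only: of_nat_eq_iff)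
qed

lemma residue_of_nat: "residue q (int n) = n mod Suc q"
  unfolding residue_def by (metis nat_int zmod_int)

text \<open>Sums and products of two residues are below the square of the radix, which is
  \<open>2 ^ (16 * loglen x)\<close>; on this range \<open>16 * loglen x\<close> rounds of division
  are enough even for the modulus 1.\<close>

definition add_mod :: "bool list \<Rightarrow> nat \<Rightarrow> nat \<Rightarrow> nat \<Rightarrow> nat" where
  "add_mod x i a b = long_mod (16 * loglen x) (a + b) (digit x i 15 + 1)"

definition mult_mod :: "bool list \<Rightarrow> nat \<Rightarrow> nat \<Rightarrow> nat \<Rightarrow> nat" where
  "mult_mod x i a b = long_mod (16 * loglen x) (shift_add (8 * loglen x) a b) (digit x i 15 + 1)"

lemma radix_square: "radix x * radix x = 2 ^ (16 * loglen x)"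
  by (simp add: radix_def flip: power_add)

lemma radix_ge: "256 \<le> radix x"
proof -
  have "(2::nat) ^ 8 \<le> 2 ^ (8 * loglen x)" by (rule power_increasing) (auto simp: loglen_def)
  then show ?thesis by (simp add: radix_def)
qed

lemma long_mod_radix:
  assumes "a < radix x * radix x"
  shows "long_mod (16 * loglen x) a (q + 1) = a mod Suc q"
proof -
  have "a < (q + 1) * 2 ^ (16 * loglen x)"
    using assms unfolding radix_square by (rule order.strict_trans2) simp
  then show ?thesis by (simp add: long_mod)
qed

lemma residue_less: "residue (digit x i 15) a < radix x"
  using residue_le[of "digit x i 15" a] digit_less[of x i 15] by linarith

lemma add_mod_residue:
  "add_mod x i (residue (digit x i 15) a) (residue (digit x i 15) b) = residue (digit x i 15) (a + b)"
proof -
  have "residue (digit x i 15) a + residue (digit x i 15) b < 2 * radix x"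
    using residue_less[of x i a] residue_less[of x i b] by simp
  also have "\<dots> \<le> radix x * radix x" using radix_ge[of x] by (intro mult_right_mono) auto
  finally show ?thesis unfolding add_mod_def by (simp only: long_mod_radix residue_add)
qed

lemma mult_mod_residue:
  "mult_mod x i (residue (digit x i 15) a) (residue (digit x i 15) b) = residue (digit x i 15) (a * b)"
proof -
  have b: "residue (digit x i 15) b < 2 ^ (8 * loglen x)"
    using residue_less[of x i b] by (simp add: radix_def)
  have "residue (digit x i 15) a * residue (digit x i 15) b < radix x * radix x"
    by (intro mult_strict_mono residue_less) auto
  then show ?thesis unfolding mult_mod_def shift_add[OF b] by (simp only: long_mod_radix residue_mult)
qed

lemma pcomp_add_mod:
  "pcomp k U \<Longrightarrow> pcomp k V \<Longrightarrow> pcomp k (\<lambda>x E i. add_mod x i (U x E i) (V x E i))"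
  unfolding add_mod_def by (intro pcomp_long_mod pcomp_add pcomp_digit pcomp_const)

lemma pcomp_mult_mod:
  "pcomp k U \<Longrightarrow> pcomp k V \<Longrightarrow> pcomp k (\<lambda>x E i. mult_mod x i (U x E i) (V x E i))"
  unfolding mult_mod_def by (intro pcomp_long_mod pcomp_shift_add pcomp_add pcomp_digit pcomp_const)

lemma add_mod_set_digit:
  "j < 15 \<Longrightarrow> t < radix x \<Longrightarrow> add_mod x (set_digit x i j t) = add_mod x i"
  "j < 15 \<Longrightarrow> t < radix x \<Longrightarrow> mult_mod x (set_digit x i j t) = mult_mod x i"
  by (simp_all add: fun_eq_iff add_mod_def mult_mod_def set_digit_props(1))

text \<open>Integer tables are computed modulo all the numbers \<open>1, \<dots>, radix x\<close> in parallel; the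
  modulus is determined by digit 15.\<close>

definition zcomp :: "(bool list \<Rightarrow> (nat \<Rightarrow> nat) \<Rightarrow> int) \<Rightarrow> bool" where
  "zcomp Z \<longleftrightarrow> ncomp (\<lambda>x \<delta>. residue (\<delta> 15) (Z x \<delta>))"

lemma zcomp_add:
  assumes "zcomp Y" "zcomp Z" shows "zcomp (\<lambda>x \<delta>. Y x \<delta> + Z x \<delta>)"
  unfolding zcomp_def ncomp_def
  by (rule pcomp_cong[OF pcomp_add_mod[OF assms[unfolded zcomp_def ncomp_def]]])
    (simp add: add_mod_residue)

lemma zcomp_mult:
  assumes "zcomp Y" "zcomp Z" shows "zcomp (\<lambda>x \<delta>. Y x \<delta> * Z x \<delta>)"
  unfolding zcomp_def ncomp_def
  by (rule pcomp_cong[OF pcomp_mult_mod[OF assms[unfolded zcomp_def ncomp_def]]])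
    (simp add: mult_mod_residue)

text \<open>As the radix is at least 256, the number 65536 bounds its square from below for every
  input, and the square is the range on which the reduction modulo digit 15 is correct.\<close>

lemma zcomp_const: "c < 65536 \<Longrightarrow> zcomp (\<lambda>x \<delta>. int c)"
  unfolding zcomp_def ncomp_def
proof (rule pcomp_cong[OF pcomp_long_mod[OF pcomp_const pcomp_add[OF pcomp_digit pcomp_const]]])
  fix x E i assume "c < 65536"
  then have "c < 256 * 256" by simp
  also have "\<dots> \<le> radix x * radix x" using radix_ge by (intro mult_mono) auto
  finally show "long_mod (16 * loglen x) c (digit x i 15 + 1) = residue (digit x i 15) (int c)"
    by (simp only: long_mod_radix residue_of_nat)
qed

lemma zcomp_0: "zcomp (\<lambda>x \<delta>. 0)" and zcomp_1: "zcomp (\<lambda>x \<delta>. 1)" and zcomp_2: "zcomp (\<lambda>x \<delta>. 2)"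
  using zcomp_const[of 0] zcomp_const[of 1] zcomp_const[of 2] by simp_all

lemma zcomp_uminus:
  assumes "zcomp Z" shows "zcomp (\<lambda>x \<delta>. - Z x \<delta>)"
  unfolding zcomp_def ncomp_def
proof (rule pcomp_cong[OF pcomp_long_mod[OF pcomp_diff[OF pcomp_add[OF pcomp_digit pcomp_const]
      assms[unfolded zcomp_def ncomp_def]] pcomp_add[OF pcomp_digit pcomp_const]]])
  fix x E i
  have "digit x i 15 + 1 - residue (digit x i 15) (Z x (digit x i)) \<le> radix x"
    using digit_less[of x i 15] by linarith
  also have "\<dots> < radix x * radix x" using radix_ge[of x] by simp
  finally show "long_mod (16 * loglen x) (digit x i 15 + 1 - residue (digit x i 15) (Z x (digit x i)))
      (digit x i 15 + 1) = residue (digit x i 15) (- Z x (digit x i))"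
    by (simp only: long_mod_radix residue_uminus[symmetric] Suc_eq_plus1)
qed

lemma zcomp_if:
  assumes "bcomp P" "zcomp Y" "zcomp Z"
  shows "zcomp (\<lambda>x \<delta>. if P x \<delta> then Y x \<delta> else Z x \<delta>)"
  unfolding zcomp_def
  by (rule ncomp_cong[OF ncomp_if[OF assms(1) assms(2,3)[unfolded zcomp_def]]]) simp

lemma zcomp_of_bool: "bcomp P \<Longrightarrow> zcomp (\<lambda>x \<delta>. of_bool (P x \<delta>))"
  unfolding of_bool_def by (intro zcomp_if zcomp_0 zcomp_1)

lemma zcomp_sum:
  assumes "zcomp (\<lambda>x \<delta>. F x \<delta> (\<delta> j))" "\<And>x \<delta> s t. F x (\<delta>(j := s)) t = F x \<delta> t" "j < 15"
  shows "zcomp (\<lambda>x \<delta>. \<Sum>t<radix x. F x \<delta> t)"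
  unfolding zcomp_def ncomp_def
proof (rule pcomp_cong[OF pcomp_tree_fold[where h = add_mod and j = j and k = 0]])
  show "pcomp 0 (\<lambda>x E i. residue (digit x i 15) (F x (digit x i) (digit x i j)))"
    using assms(1) by (simp add: ncomp_def zcomp_def)
  fix x :: "bool list" and E :: "nat \<Rightarrow> nat \<Rightarrow> nat" and i assume "i < num_vecs x"
  have "tree_fold (radix x) (add_mod x i) (\<lambda>t. residue (digit x (set_digit x i j t) 15)
        (F x (digit x (set_digit x i j t)) (digit x (set_digit x i j t) j)))
      (8 * loglen x) (digit x i j) = residue (digit x i 15) (\<Sum>t<2 ^ (8 * loglen x). F x (digit x i)
        ((2 ^ (8 * loglen x) * digit x i j + t) mod radix x))"
    by (rule tree_fold_sum) (use assms(3) in \<open>simp_all add: set_digit_props(1) assms(2) add_mod_residue\<close>)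
  then show "tree_fold (radix x) (add_mod x i) (\<lambda>t. residue (digit x (set_digit x i j t) 15)
        (F x (digit x (set_digit x i j t)) (digit x (set_digit x i j t) j)))
      (8 * loglen x) (digit x i j) = residue (digit x i 15) (\<Sum>t<radix x. F x (digit x i) t)"
    unfolding radix_rounds by (simp add: radix_def)
qed (use assms(3) in \<open>auto simp: add_mod_set_digit pcomp_add_mod\<close>)

lemma zcomp_prod:
  assumes "zcomp (\<lambda>x \<delta>. F x \<delta> (\<delta> j))" "\<And>x \<delta> s t. F x (\<delta>(j := s)) t = F x \<delta> t" "j < 15"
  shows "zcomp (\<lambda>x \<delta>. \<Prod>t<radix x. F x \<delta> t)"
  unfolding zcomp_def ncomp_def
proof (rule pcomp_cong[OF pcomp_tree_fold[where h = mult_mod and j = j and k = 0]])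
  show "pcomp 0 (\<lambda>x E i. residue (digit x i 15) (F x (digit x i) (digit x i j)))"
    using assms(1) by (simp add: ncomp_def zcomp_def)
  fix x :: "bool list" and E :: "nat \<Rightarrow> nat \<Rightarrow> nat" and i assume "i < num_vecs x"
  have "tree_fold (radix x) (mult_mod x i) (\<lambda>t. residue (digit x (set_digit x i j t) 15)
        (F x (digit x (set_digit x i j t)) (digit x (set_digit x i j t) j)))
      (8 * loglen x) (digit x i j) = residue (digit x i 15) (\<Prod>t<2 ^ (8 * loglen x). F x (digit x i)
        ((2 ^ (8 * loglen x) * digit x i j + t) mod radix x))"
    by (rule tree_fold_prod) (use assms(3) in \<open>simp_all add: set_digit_props(1) assms(2) mult_mod_residue\<close>)
  then show "tree_fold (radix x) (mult_mod x i) (\<lambda>t. residue (digit x (set_digit x i j t) 15)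
        (F x (digit x (set_digit x i j t)) (digit x (set_digit x i j t) j)))
      (8 * loglen x) (digit x i j) = residue (digit x i 15) (\<Prod>t<radix x. F x (digit x i) t)"
    unfolding radix_rounds by (simp add: radix_def)
qed (use assms(3) in \<open>auto simp: add_mod_set_digit pcomp_mult_mod\<close>)

text \<open>Rows of a square matrix are indexed by digits 2 and 3, its columns by digits 4 and 5.\<close>

definition mat_square :: "nat \<Rightarrow> ((nat \<Rightarrow> nat) \<Rightarrow> int) \<Rightarrow> (nat \<Rightarrow> nat) \<Rightarrow> int" where
  "mat_square B T \<delta> = (\<Sum>s<B. \<Sum>t<B. T (\<delta>(4 := s, 5 := t)) * T (\<delta>(2 := s, 3 := t)))"

text \<open>Digits 6 and 7 are the summation indices of the matrix product. Its two factors are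
  fetched from the processors whose column digits 4, 5 or row digits 2, 3 carry the values of digits
  6 and 7; the products are then folded along digit 7 and digit 6. Squaring preserves the
  independence from these two digits, so they are free again in the next round.\<close>

lemma zcomp_mat_square:
  assumes Z: "zcomp Z" and indep: "\<And>x \<delta> s t. Z x (\<delta>(6 := s, 7 := t)) = Z x \<delta>"
  shows "zcomp (\<lambda>x. ((mat_square (radix x)) ^^ (c * loglen x)) (Z x))"
proof -
  let ?A = "\<lambda>a b x (E :: nat \<Rightarrow> nat \<Rightarrow> nat) i.
    E 0 (set_digit x (set_digit x i b (digit x i 7)) a (digit x i 6))"
  have A: "pcomp 1 (?A a b)" if "a < 6" "b < 6" for a b
  proof -
    have 1: "pcomp 1 (\<lambda>x (E :: nat \<Rightarrow> nat \<Rightarrow> nat) i. E 0 (set_digit x i a (digit x i 6)))"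
      by (rule pcomp_gather[OF pcomp_var pcomp_set_digit[OF pcomp_digit]])
        (use that set_digit_props(2) in auto)
    have "pcomp 1 (\<lambda>x (E :: nat \<Rightarrow> nat \<Rightarrow> nat) i. E 0 (set_digit x (set_digit x i b (digit x i 7)) a
        (digit x (set_digit x i b (digit x i 7)) 6)))"
      by (rule pcomp_gather[OF 1 pcomp_set_digit[OF pcomp_digit]])
        (use that set_digit_props(2) in auto)
    then show ?thesis by (rule pcomp_cong) (use that in \<open>simp add: set_digit_props(1)\<close>)
  qed
  define P where "P = (\<lambda>x E i. mult_mod x i (?A 4 5 x E i) (?A 2 3 x E i))"
  define S where "S = (\<lambda>x E i. tree_fold (radix x) (add_mod x i) (\<lambda>t. P x E (set_digit x i 7 t))
    (8 * loglen x) (digit x i 7))"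
  define G where "G = (\<lambda>x E i. tree_fold (radix x) (add_mod x i) (\<lambda>t. S x E (set_digit x i 6 t))
    (8 * loglen x) (digit x i 6))"
  have P: "pcomp 1 P" unfolding P_def by (intro pcomp_mult_mod A) auto
  have S: "pcomp 1 S" unfolding S_def
    by (rule pcomp_tree_fold[OF P]) (auto simp: add_mod_set_digit pcomp_add_mod)
  have G: "pcomp (0 + 1) G" unfolding G_def add_0
    by (rule pcomp_tree_fold[OF S]) (auto simp: add_mod_set_digit pcomp_add_mod)
  have G_eq: "G x E i = residue (digit x i 15) (mat_square (radix x) T (digit x i))"
    if i: "i < num_vecs x" and E: "\<And>i. i < num_vecs x \<Longrightarrow> E 0 i = residue (digit x i 15) (T (digit x i))"
      and T: "\<And>\<delta> s t. T (\<delta>(6 := s, 7 := t)) = T \<delta>" for x E i T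
  proof -
    have A_eq: "?A a b x E i = residue (digit x i 15) (T ((digit x i)(b := digit x i 7, a := digit x i 6)))"
      if "a < 6" "b < 6" "i < num_vecs x" for a b i
      using that by (subst E) (auto intro!: set_digit_props(2) simp: set_digit_props(1))
    have P_eq: "P x E i = residue (digit x i 15) (T ((digit x i)(5 := digit x i 7, 4 := digit x i 6)) *
        T ((digit x i)(3 := digit x i 7, 2 := digit x i 6)))" if "i < num_vecs x" for i
      using that unfolding P_def by (simp add: A_eq mult_mod_residue)
    have S_eq: "S x E i = residue (digit x i 15) (\<Sum>t<radix x.
        T ((digit x i)(7 := t, 5 := t, 4 := digit x i 6)) *
        T ((digit x i)(7 := t, 3 := t, 2 := digit x i 6)))" if i: "i < num_vecs x" for i
    proof -
      have "S x E i = residue (digit x i 15) (\<Sum>t<2 ^ (8 * loglen x). (\<lambda>t.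
        T ((digit x i)(7 := t, 5 := t, 4 := digit x i 6)) *
        T ((digit x i)(7 := t, 3 := t, 2 := digit x i 6)))
         ((2 ^ (8 * loglen x) * digit x i 7 + t) mod radix x))"
        unfolding S_def by (rule tree_fold_sum)
          (use i in \<open>simp_all add: set_digit_props P_eq add_mod_residue fun_upd_def\<close>)
      then show ?thesis unfolding radix_rounds by (simp add: radix_def)
    qed
    have "G x E i = residue (digit x i 15) (\<Sum>s<2 ^ (8 * loglen x). (\<lambda>s. \<Sum>t<radix x.
        T ((digit x i)(6 := s, 7 := t, 5 := t, 4 := s)) *
        T ((digit x i)(6 := s, 7 := t, 3 := t, 2 := s)))
         ((2 ^ (8 * loglen x) * digit x i 6 + s) mod radix x))"
      unfolding G_def by (rule tree_fold_sum)
        (use i in \<open>simp_all add: set_digit_props S_eq add_mod_residue fun_upd_def\<close>)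
    also have "\<dots> = residue (digit x i 15) (\<Sum>s<radix x. \<Sum>t<radix x.
        T ((digit x i)(6 := s, 7 := t, 5 := t, 4 := s)) *
        T ((digit x i)(6 := s, 7 := t, 3 := t, 2 := s)))"
      unfolding radix_rounds by (simp add: radix_def)
    also have "\<dots> = residue (digit x i 15) (mat_square (radix x) T (digit x i))"
    proof -
      have e: "\<delta>(6 := s, 7 := t, 5 := t, 4 := s) = \<delta>(4 := s, 5 := t, 6 := s, 7 := t)"
        "\<delta>(6 := s, 7 := t, 3 := t, 2 := s) = \<delta>(2 := s, 3 := t, 6 := s, 7 := t)"
        for s t and \<delta> :: "nat \<Rightarrow> nat"
        by (auto simp: fun_eq_iff)
      show ?thesis by (simp only: e T mat_square_def)
    qed
    finally show ?thesis .
  qed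
  have Z': "pcomp 0 (\<lambda>x E i. residue (digit x i 15) (Z x (digit x i)))"
    using Z by (simp add: zcomp_def ncomp_def)
  have ind: "((mat_square (radix x)) ^^ n) (Z x) (\<delta>(6 := s, 7 := t)) = ((mat_square (radix x)) ^^ n) (Z x) \<delta>"
    for x n \<delta> s t
  proof (induction n arbitrary: \<delta>)
    case (Suc n)
    have e: "\<delta>(6 := s, 7 := t, 4 := s', 5 := t') = \<delta>(4 := s', 5 := t', 6 := s, 7 := t)"
      "\<delta>(6 := s, 7 := t, 2 := s', 3 := t') = \<delta>(2 := s', 3 := t', 6 := s, 7 := t)" for s' t'
      by (auto simp: fun_eq_iff)
    show ?case
      by (simp only: funpow.simps comp_def mat_square_def[of _ "((mat_square (radix x)) ^^ n) (Z x)"] e Suc.IH)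
  qed (simp add: indep)
  have "((\<lambda>v. G x (E(0 := v))) ^^ n) (\<lambda>i. residue (digit x i 15) (Z x (digit x i))) i =
      residue (digit x i 15) (((mat_square (radix x)) ^^ n) (Z x) (digit x i))"
    if "i < num_vecs x" for x E n i
    using that
  proof (induction n arbitrary: i)
    case (Suc n)
    show ?case
      unfolding funpow.simps comp_def by (rule G_eq, rule Suc.prems, simp only: fun_upd_same Suc.IH, rule ind)
  qed simp
  then show ?thesis
    unfolding zcomp_def ncomp_def by (rule pcomp_cong[OF pcomp_iter[OF Z' G, of c]])
qed

section \<open>Traces of the words of an encoded instance\<close>

text \<open>The input is read as a sequence of pairs of bits; pair \<open>p\<close> occupies the positions
  \<open>2 p\<close> and \<open>2 p + 1\<close>.\<close>

definition payload :: "bool list \<Rightarrow> nat \<Rightarrow> bool" where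
  "payload x p \<longleftrightarrow> p + p + 1 < length x \<and> input x (p + p) = 1"

definition terminator :: "bool list \<Rightarrow> nat \<Rightarrow> bool" where
  "terminator x p \<longleftrightarrow> p + p + 1 < length x \<and> input x (p + p) = 0"

definition payload_bit :: "bool list \<Rightarrow> nat \<Rightarrow> bool" where
  "payload_bit x p \<longleftrightarrow> input x (p + p + 1) = 1"

text \<open>A terminator belongs to the block that it closes. Block 0 is m in unary and block 1 is
  r; fraction k occupies block 2k + 2 with its sign and numerator and block 2k + 3 with its
  denominator.\<close>

definition block_index :: "bool list \<Rightarrow> nat \<Rightarrow> nat" where
  "block_index x p = (\<Sum>t<radix x. of_bool (t < p \<and> terminator x t))"

definition num_blocks :: "bool list \<Rightarrow> nat" where
  "num_blocks x = (\<Sum>p<radix x. of_bool (terminator x p))"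

definition unary_block :: "bool list \<Rightarrow> nat \<Rightarrow> nat" where
  "unary_block x j = (\<Sum>p<radix x. of_bool (payload x p \<and> block_index x p = j))"

text \<open>A power of two whose exponent is a position in the block. It can have as many bits as
  the input, so it is written as a product of small factors, of which the residues can be
  computed.\<close>

definition weight :: "bool list \<Rightarrow> nat \<Rightarrow> int" where
  "weight x p = (\<Prod>t<radix x. if t < p \<and> block_index x t = block_index x p then 2 else 1)"

definition denominator :: "bool list \<Rightarrow> nat \<Rightarrow> int" where
  "denominator x k = 2 * (\<Sum>p<radix x.
     if payload x p \<and> payload_bit x p \<and> block_index x p = k + k + 3 then weight x p else 0)"

text \<open>The first bit of a numerator block is the sign, so the other bits have twice the weight they
  should have; doubling all the denominators makes up for that.\<close>

definition negative :: "bool list \<Rightarrow> nat \<Rightarrow> bool" where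
  "negative x k \<longleftrightarrow> (\<exists>p<radix x. payload x p \<and> payload_bit x p \<and> block_index x p = k + k + 2 \<and>
     input x (p + p - 2) = 0)"

definition numerator :: "bool list \<Rightarrow> nat \<Rightarrow> int" where
  "numerator x k = (\<Sum>p<radix x.
     if payload x p \<and> payload_bit x p \<and> block_index x p = k + k + 2 \<and> input x (p + p - 2) = 1
     then weight x p else 0)"

text \<open>All denominators of both tuples are cleared by the same factor, their product. The trace
  of a word is then scaled by a power of this factor that depends on the word but not on the
  tuple.\<close>

definition entry :: "bool list \<Rightarrow> nat \<Rightarrow> int" where
  "entry x k = (\<Prod>j<radix x. if j + j + 3 < num_blocks x then
     if j = k then if negative x j then - numerator x j else numerator x j else denominator x j
     else 1)"

abbreviation dim_m :: "bool list \<Rightarrow> nat" where "dim_m x \<equiv> unary_block x 0"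
abbreviation dim_r :: "bool list \<Rightarrow> nat" where "dim_r x \<equiv> unary_block x 1"

definition letter :: "bool list \<Rightarrow> nat \<Rightarrow> nat \<Rightarrow> nat \<Rightarrow> nat \<Rightarrow> int" where
  "letter x b i u v = (if i < dim_r x then entry x (((b * dim_r x + i) * dim_m x + u) * dim_m x + v)
     else of_bool (u = v))"

text \<open>The sum over all words of length \<open>l\<close> of the Kronecker products of the corresponding words in the
  two tuples \<open>\<delta> 0\<close> and \<open>\<delta> 1\<close> is the \<open>l\<close>-th power of the sum for \<open>l = 1\<close>, and the traces of
  its blocks add up to the sum of the squared differences of the traces.  The additional letter
  \<open>dim_r x\<close> is the identity, so that words of length \<open>l\<close> include all shorter ones.\<close>

definition kron_sum :: "bool list \<Rightarrow> (nat \<Rightarrow> nat) \<Rightarrow> int" where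
  "kron_sum x \<delta> = (if \<delta> 0 < 2 \<and> \<delta> 1 < 2 \<and> \<delta> 2 < dim_m x \<and> \<delta> 3 < dim_m x \<and> \<delta> 4 < dim_m x \<and> \<delta> 5 < dim_m x
     then \<Sum>i<radix x. if i \<le> dim_r x then letter x (\<delta> 0) i (\<delta> 2) (\<delta> 4) * letter x (\<delta> 1) i (\<delta> 3) (\<delta> 5) else 0
     else 0)"

text \<open>After \<open>2 * loglen x\<close> squarings the words have length
  \<open>2 ^ (2 * loglen x)\<close>, which on encoded instances is at least the order 4 m^4 of the
  recurrence.\<close>

definition kron_power :: "bool list \<Rightarrow> (nat \<Rightarrow> nat) \<Rightarrow> int" where
  "kron_power x = ((mat_square (radix x)) ^^ (2 * loglen x)) (kron_sum x)"

text \<open>The signs are those in the expansion of the square of a difference. Diagonal entries are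
  picked by a guard inside sums over all six digits, since the power is available as a table in
  which row and column have separate digits.\<close>

definition discrepancy :: "bool list \<Rightarrow> int" where
  "discrepancy x = (\<Sum>a<radix x. \<Sum>b<radix x. \<Sum>u<radix x. \<Sum>v<radix x. \<Sum>u'<radix x. \<Sum>v'<radix x.
     if u = u' \<and> v = v' then if a = b
       then kron_power x ((\<lambda>_. 0)(0 := a, 1 := b, 2 := u, 3 := v, 4 := u', 5 := v'))
       else - kron_power x ((\<lambda>_. 0)(0 := a, 1 := b, 2 := u, 3 := v, 4 := u', 5 := v'))
     else 0)"

text \<open>The conditions describe exactly the encodings of instances. The number of blocks is 2
  for the dimensions and 2 for each of the 2 r m^2 fractions.\<close>

definition well_formed :: "bool list \<Rightarrow> bool" where
  "well_formed x \<longleftrightarrow>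
     (\<exists>p<radix x. p + p + 2 = length x \<and> terminator x p) \<and>
     (\<forall>p<radix x. terminator x p \<longrightarrow> \<not> payload_bit x p) \<and>
     (\<forall>p<radix x. payload x p \<and> block_index x p < 2 \<longrightarrow> payload_bit x p) \<and>
     0 < dim_m x \<and> 0 < dim_r x \<and> num_blocks x = 2 + 4 * dim_r x * dim_m x * dim_m x \<and>
     (\<forall>k<radix x. k + k + 3 < num_blocks x \<longrightarrow>
        (\<exists>p<radix x. payload x p \<and> block_index x p = k + k + 2) \<and>
        (\<exists>p<radix x. payload x p \<and> payload_bit x p \<and> block_index x p = k + k + 3))"

section \<open>Computability of the rejection predicate\<close>

lemmas comp_intros = ncomp_const ncomp_digit ncomp_length ncomp_input ncomp_add ncomp_diff ncomp_if
  bcomp_less bcomp_le bcomp_eq bcomp_not bcomp_conj bcomp_disj bcomp_imp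
  zcomp_add zcomp_mult zcomp_0 zcomp_1 zcomp_2 zcomp_uminus zcomp_if

lemma comp_pairs:
  assumes "ncomp F"
  shows "bcomp (\<lambda>x \<delta>. payload x (F x \<delta>))" "bcomp (\<lambda>x \<delta>. terminator x (F x \<delta>))"
    "bcomp (\<lambda>x \<delta>. payload_bit x (F x \<delta>))"
  unfolding payload_def terminator_def payload_bit_def by (intro comp_intros assms)+

text \<open>Nested bound variables need different digits, which is the source of the side conditions
  in this part: 8 is bound in block indices, 9 in weights and counts, 10 in sums over the positions
  of a block, 11 in products over the fractions and 12 in sums over the letters. Digits 0 to 5 index
  the Kronecker matrices.\<close>

lemma ncomp_block_index: "p < 8 \<or> 8 < p \<Longrightarrow> ncomp (\<lambda>x \<delta>. block_index x (\<delta> p))"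
  unfolding block_index_def
  by (rule ncomp_sum[where j = 8], fold bcomp_def, intro comp_intros comp_pairs) auto

lemma ncomp_num_blocks: "ncomp (\<lambda>x \<delta>. num_blocks x)"
  unfolding num_blocks_def
  by (rule ncomp_sum[where j = 9], fold bcomp_def, intro comp_intros comp_pairs) auto

lemma ncomp_unary_block: "ncomp (\<lambda>x \<delta>. unary_block x j)"
  unfolding unary_block_def
  by (rule ncomp_sum[where j = 9], fold bcomp_def, intro comp_intros comp_pairs ncomp_block_index) auto

lemma zcomp_weight: "p < 8 \<or> 9 < p \<Longrightarrow> zcomp (\<lambda>x \<delta>. weight x (\<delta> p))"
  unfolding weight_def
  by (rule zcomp_prod[where j = 9], intro comp_intros comp_pairs ncomp_block_index) auto

lemma zcomp_denominator:
  assumes "k \<noteq> 8" "k \<noteq> 9" "k \<noteq> 10"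
  shows "zcomp (\<lambda>x \<delta>. denominator x (\<delta> k))"
  unfolding denominator_def
  by (intro zcomp_mult zcomp_2, rule zcomp_sum[where j = 10],
      intro comp_intros comp_pairs ncomp_block_index zcomp_weight) (use assms in simp_all)

lemma bcomp_negative:
  assumes "k \<noteq> 8" "k \<noteq> 9" "k \<noteq> 10"
  shows "bcomp (\<lambda>x \<delta>. negative x (\<delta> k))"
  unfolding negative_def
  by (rule bcomp_ex[where j = 10], intro comp_intros comp_pairs ncomp_block_index) (use assms in simp_all)

lemma zcomp_numerator:
  assumes "k \<noteq> 8" "k \<noteq> 9" "k \<noteq> 10"
  shows "zcomp (\<lambda>x \<delta>. numerator x (\<delta> k))"
  unfolding numerator_def
  by (rule zcomp_sum[where j = 10], intro comp_intros comp_pairs ncomp_block_index zcomp_weight)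
    (use assms in simp_all)

lemma zcomp_entry:
  assumes "ncomp K" "\<And>x \<delta> s. K x (\<delta>(11 := s)) = K x \<delta>"
  shows "zcomp (\<lambda>x \<delta>. entry x (K x \<delta>))"
  unfolding entry_def
  by (rule zcomp_prod[where j = 11], intro comp_intros ncomp_num_blocks assms(1) bcomp_negative
      zcomp_numerator zcomp_denominator) (auto simp: assms(2))

lemma unary_block_le: "unary_block x j \<le> radix x"
proof -
  have "unary_block x j \<le> (\<Sum>p<radix x. 1)"
    unfolding unary_block_def by (intro sum_mono) auto
  then show ?thesis by simp
qed

lemma zcomp_letter:
  assumes "b \<noteq> 11" "i \<noteq> 11" "u \<noteq> 11" "v \<noteq> 11"
  shows "zcomp (\<lambda>x \<delta>. letter x (\<delta> b) (\<delta> i) (\<delta> u) (\<delta> v))"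
  unfolding letter_def
  by (intro zcomp_if zcomp_of_bool zcomp_entry comp_intros ncomp_unary_block ncomp_mult unary_block_le)
    (use assms in auto)

lemma zcomp_kron_sum: "zcomp kron_sum"
proof -
  have "zcomp (\<lambda>x \<delta>. \<Sum>i<radix x. if i \<le> dim_r x
      then letter x (\<delta> 0) i (\<delta> 2) (\<delta> 4) * letter x (\<delta> 1) i (\<delta> 3) (\<delta> 5) else 0)"
    by (rule zcomp_sum[where j = 12], intro comp_intros ncomp_unary_block zcomp_letter)
      (simp_all cong: if_cong)
  then have "zcomp (\<lambda>x \<delta>. kron_sum x \<delta>)"
    unfolding kron_sum_def by (intro comp_intros ncomp_unary_block)
  then show ?thesis .
qed

lemma zcomp_kron_power: "zcomp kron_power"
proof -
  have "zcomp (\<lambda>x. kron_power x)"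
    unfolding kron_power_def
    by (rule zcomp_mat_square[OF zcomp_kron_sum]) (simp add: kron_sum_def cong: if_cong)
  then show ?thesis .
qed

lemma kron_power_cong:
  assumes "\<And>j. j < 6 \<Longrightarrow> \<delta> j = \<delta>' j"
  shows "((mat_square (radix x)) ^^ n) (kron_sum x) \<delta> = ((mat_square (radix x)) ^^ n) (kron_sum x) \<delta>'"
  using assms
proof (induction n arbitrary: \<delta> \<delta>')
  case 0
  then show ?case by (simp add: kron_sum_def cong: if_cong)
next
  case (Suc n)
  have "((mat_square (radix x)) ^^ n) (kron_sum x) (\<delta>(a := s, b := t)) =
      ((mat_square (radix x)) ^^ n) (kron_sum x) (\<delta>'(a := s, b := t))" for a b s t
    by (rule Suc.IH) (use Suc.prems in auto)
  then show ?case
    by (simp only: funpow.simps comp_def mat_square_def[of _ "((mat_square (radix x)) ^^ n) (kron_sum x)"])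
qed

lemma zcomp_discrepancy: "zcomp (\<lambda>x \<delta>. discrepancy x)"
proof -
  let ?K = "\<lambda>x a b u v u' v'. kron_power x ((\<lambda>_. 0)(0 := a, 1 := b, 2 := u, 3 := v, 4 := u', 5 := v'))"
  have "zcomp (\<lambda>x \<delta>. ?K x (\<delta> 0) (\<delta> 1) (\<delta> 2) (\<delta> 3) (\<delta> 4) (\<delta> 5))"
    by (rule back_subst[of zcomp, OF zcomp_kron_power], intro ext, unfold kron_power_def, rule kron_power_cong)
      (auto simp: less_Suc_eq eval_nat_numeral)
  then have K: "zcomp (\<lambda>x \<delta>. if \<delta> 2 = \<delta> 4 \<and> \<delta> 3 = \<delta> 5 then if \<delta> 0 = \<delta> 1
      then ?K x (\<delta> 0) (\<delta> 1) (\<delta> 2) (\<delta> 3) (\<delta> 4) (\<delta> 5)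
      else - ?K x (\<delta> 0) (\<delta> 1) (\<delta> 2) (\<delta> 3) (\<delta> 4) (\<delta> 5) else 0)"
    by (intro comp_intros)
  show ?thesis
    unfolding discrepancy_def
    by (rule zcomp_sum[where j = 0], rule zcomp_sum[where j = 1], rule zcomp_sum[where j = 2],
        rule zcomp_sum[where j = 3], rule zcomp_sum[where j = 4], rule zcomp_sum[where j = 5], rule K)
      (simp_all cong: if_cong)
qed

lemma bcomp_well_formed: "bcomp (\<lambda>x \<delta>. well_formed x)"
proof -
  have 1: "bcomp (\<lambda>x \<delta>. \<exists>p<radix x. p + p + 2 = length x \<and> terminator x p)"
    by (rule bcomp_ex[where j = 10], intro comp_intros comp_pairs) auto
  have 2: "bcomp (\<lambda>x \<delta>. \<forall>p<radix x. terminator x p \<longrightarrow> \<not> payload_bit x p)"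
    by (rule bcomp_all[where j = 10], intro comp_intros comp_pairs) auto
  have 3: "bcomp (\<lambda>x \<delta>. \<forall>p<radix x. payload x p \<and> block_index x p < 2 \<longrightarrow> payload_bit x p)"
    by (rule bcomp_all[where j = 10], intro comp_intros comp_pairs ncomp_block_index) auto
  have 4: "bcomp (\<lambda>x \<delta>. num_blocks x = 2 + 4 * dim_r x * dim_m x * dim_m x)"
    by (intro comp_intros ncomp_num_blocks ncomp_mult ncomp_unary_block unary_block_le)
  have 5: "bcomp (\<lambda>x \<delta>. \<exists>p<radix x. payload x p \<and> block_index x p = \<delta> 11 + \<delta> 11 + 2)"
    by (rule bcomp_ex[where j = 10], intro comp_intros comp_pairs ncomp_block_index) auto
  have 6: "bcomp (\<lambda>x \<delta>. \<exists>p<radix x. payload x p \<and> payload_bit x p \<and> block_index x p = \<delta> 11 + \<delta> 11 + 3)"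
    by (rule bcomp_ex[where j = 10], intro comp_intros comp_pairs ncomp_block_index) auto
  have 7: "bcomp (\<lambda>x \<delta>. \<forall>k<radix x. k + k + 3 < num_blocks x \<longrightarrow>
        (\<exists>p<radix x. payload x p \<and> block_index x p = k + k + 2) \<and>
        (\<exists>p<radix x. payload x p \<and> payload_bit x p \<and> block_index x p = k + k + 3))"
    by (rule bcomp_all[where j = 11], rule bcomp_imp, intro comp_intros ncomp_num_blocks,
        rule bcomp_conj, rule 5, rule 6) auto
  show ?thesis
    unfolding well_formed_def
    by (intro bcomp_conj 1 2 3 4 7 bcomp_less ncomp_const ncomp_unary_block)
qed

lemma bcomp_reject: "bcomp (\<lambda>x \<delta>. \<not> well_formed x \<or> residue (\<delta> 15) (discrepancy x) \<noteq> 0)"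
  using zcomp_discrepancy unfolding zcomp_def
  by (intro bcomp_disj bcomp_not bcomp_eq ncomp_const bcomp_well_formed)

section \<open>From computable predicates to languages in RNC\<close>

definition initial_regs :: "bool list \<Rightarrow> regs" where
  "initial_regs x i = (\<lambda>_. 0)(0 := i, 1 := length x)"

text \<open>The first loop counts how often the input length can be halved, which yields
  \<open>loglen x\<close> in register 4; the second doubles 1 until register 6 holds
  \<open>num_vecs x\<close>. The final move copies the processor index to register 5 only if it is
  below that number.\<close>

definition setup_code :: cmd where
  "setup_code =
     ops [Const 3 1, Add 6 1 2, Const 4 1] ;;
     While 6 (ops [Half 6 6, Add 4 4 3]) ;;
     ops (Const 7 0 # replicate 128 (Add 7 7 4)) ;;
     Op (Const 6 1) ;;
     While 7 (ops [Add 6 6 6, Sub 7 7 3]) ;;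
     ops [Sub 7 6 0, Const 5 0] ;;
     Mov 5 7 0"

lemma div_power_floorlog: "s \<le> floorlog 2 n \<Longrightarrow> n div 2 ^ s = 0 \<longleftrightarrow> s = floorlog 2 n"
proof (cases "n = 0")
  case True
  then show "s \<le> floorlog 2 n \<Longrightarrow> n div 2 ^ s = 0 \<longleftrightarrow> s = floorlog 2 n" by (simp add: floorlog_def)
next
  case False
  assume s: "s \<le> floorlog 2 n"
  have b: "2 ^ (floorlog 2 n - 1) \<le> n" "n < 2 ^ floorlog 2 n"
    using floorlog_bounds[of n 2] False by auto
  have pos: "floorlog 2 n > 0" using False by (simp add: floorlog_def)
  show ?thesis
  proof
    assume "n div 2 ^ s = 0"
    then have "n < 2 ^ s" by (simp add: div_eq_0_iff)
    with b(1) have "(2::nat) ^ (floorlog 2 n - 1) < 2 ^ s" by linarith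
    then have "floorlog 2 n - 1 < s" by (rule power_less_imp_less_exp[rotated]) simp
    with s pos show "s = floorlog 2 n" by linarith
  qed (use b in simp)
qed

lemma setup_exec:
  assumes p: "num_vecs x \<le> p" and M: "M 0 = 0" "\<forall>a<length x. M (Suc a) = of_bool (x ! a)"
  shows "\<exists>t R. exec p setup_code t M (initial_regs x) M R \<and> t \<le> 1000 + 1000 * loglen x \<and> ready x p M R"
proof -
  let ?n = "length x"
  define f where "f = floorlog 2 ?n"
  define R1 where "R1 = (\<lambda>i. fold (\<lambda>a r. snd (exec_instr a M False (0, r)))
      [Const 3 1, Add 6 1 2, Const 4 1] (initial_regs x i))"
  have e1: "exec p (ops [Const 3 1, Add 6 1 2, Const 4 1]) (length [Const 3 1, Add 6 1 2, Const 4 1])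
      M (initial_regs x) M R1"
    unfolding R1_def by (rule exec_ops) auto
  define good where "good R \<longleftrightarrow> (\<forall>i<p. R i 0 = i \<and> R i 1 = ?n \<and> R i 2 = 0 \<and> R i 3 = 1)" for R :: regs
  define I1 where "I1 s M' R \<longleftrightarrow> M' = M \<and> good R \<and> (\<forall>i<p. R i 6 = ?n div 2 ^ s \<and> R i 4 = Suc s)"
    for s M' R
  have I1_0: "I1 0 M R1"
    by (simp add: I1_def good_def R1_def initial_regs_def)
  have body1: "\<exists>t M'' R''. exec p (ops [Half 6 6, Add 4 4 3]) t M' R' M'' R'' \<and> t \<le> 2 \<and> I1 (Suc s) M'' R''"
    if "I1 s M' R'" for s M' R'
  proof -
    define R'' where "R'' = (\<lambda>i. fold (\<lambda>a r. snd (exec_instr a M' False (0, r))) [Half 6 6, Add 4 4 3] (R' i))"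
    have "exec p (ops [Half 6 6, Add 4 4 3]) (length [Half 6 6, Add 4 4 3]) M' R' M' R''"
      unfolding R''_def by (rule exec_ops) auto
    moreover have "I1 (Suc s) M' R''"
      using that by (auto simp: R''_def I1_def good_def div_mult2_eq[symmetric] mult.commute)
    moreover have "length [Half 6 6, Add 4 4 3] \<le> 2" by simp
    ultimately show ?thesis by blast
  qed
  have cnt1: "(R i 6 = 0 \<longleftrightarrow> s = f) \<and> R i 2 = 0" if "I1 s M' R" "i < p" "s \<le> f" for s M' R i
    using that div_power_floorlog[of s ?n] by (auto simp: I1_def good_def f_def)
  have "\<exists>t M' R'. exec p (While 6 (ops [Half 6 6, Add 4 4 3])) t M R1 M' R' \<and> t \<le> (f - 0) * (2 + 2) + 1 \<and> I1 f M' R'"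
    by (rule exec_while_iterate[where I = I1 and s = 0], erule body1, erule (2) cnt1, rule I1_0, simp)
  then obtain t2 R2 where e2: "exec p (While 6 (ops [Half 6 6, Add 4 4 3])) t2 M R1 M R2" "t2 \<le> f * 4 + 1"
    and I2: "I1 f M R2" by (auto simp: I1_def)
  define R3 where "R3 = (\<lambda>i. fold (\<lambda>a r. snd (exec_instr a M False (0, r)))
      (Const 7 0 # replicate 128 (Add 7 7 4)) (R2 i))"
  have e3: "exec p (ops (Const 7 0 # replicate 128 (Add 7 7 4)))
      (length (Const 7 0 # replicate 128 (Add 7 7 4))) M R2 M R3"
    unfolding R3_def by (rule exec_ops) (auto simp: list_all_iff)
  have R3: "R3 i = (R2 i)(7 := 128 * R2 i 4)" for i
    unfolding R3_def fold.simps comp_def by (simp only: fold_replicate_add) simp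
  define R4 where "R4 = (\<lambda>i. snd (exec_instr (Const 6 1) M False (0, R3 i)))"
  have e4: "exec p (Op (Const 6 1)) 1 M R3 M R4"
    unfolding R4_def by (rule exec_local) simp
  define m where "m = 128 * loglen x"
  define I2 where "I2 s M' R \<longleftrightarrow> M' = M \<and> good R \<and> (\<forall>i<p. R i 6 = 2 ^ s \<and> R i 7 = m - s \<and> R i 4 = loglen x)"
    for s M' R
  have I2_0: "I2 0 M R4"
    using I2 by (simp add: I2_def I1_def good_def R4_def R3 m_def loglen_def f_def)
  have body2: "\<exists>t M'' R''. exec p (ops [Add 6 6 6, Sub 7 7 3]) t M' R' M'' R'' \<and> t \<le> 2 \<and> I2 (Suc s) M'' R''"
    if "I2 s M' R'" for s M' R'
  proof -
    define R'' where "R'' = (\<lambda>i. fold (\<lambda>a r. snd (exec_instr a M' False (0, r))) [Add 6 6 6, Sub 7 7 3] (R' i))"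
    have "exec p (ops [Add 6 6 6, Sub 7 7 3]) (length [Add 6 6 6, Sub 7 7 3]) M' R' M' R''"
      unfolding R''_def by (rule exec_ops) auto
    moreover have "I2 (Suc s) M' R''"
      using that by (auto simp: R''_def I2_def good_def)
    moreover have "length [Add 6 6 6, Sub 7 7 3] \<le> 2" by simp
    ultimately show ?thesis by blast
  qed
  have cnt2: "(R i 7 = 0 \<longleftrightarrow> s = m) \<and> R i 2 = 0" if "I2 s M' R" "i < p" "s \<le> m" for s M' R i
    using that by (auto simp: I2_def good_def)
  have "\<exists>t M' R'. exec p (While 7 (ops [Add 6 6 6, Sub 7 7 3])) t M R4 M' R' \<and> t \<le> (m - 0) * (2 + 2) + 1 \<and> I2 m M' R'"
    by (rule exec_while_iterate[where I = I2 and s = 0], erule body2, erule (2) cnt2, rule I2_0, simp)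
  then obtain t5 R5 where e5: "exec p (While 7 (ops [Add 6 6 6, Sub 7 7 3])) t5 M R4 M R5" "t5 \<le> m * 4 + 1"
    and I5: "I2 m M R5" by (auto simp: I2_def)
  define R6 where "R6 = (\<lambda>i. fold (\<lambda>a r. snd (exec_instr a M False (0, r))) [Sub 7 6 0, Const 5 0] (R5 i))"
  have e6: "exec p (ops [Sub 7 6 0, Const 5 0]) (length [Sub 7 6 0, Const 5 0]) M R5 M R6"
    unfolding R6_def by (rule exec_ops) auto
  define R7 where "R7 = (\<lambda>i. if R6 i 7 = 0 then R6 i else (R6 i)(5 := R6 i 0))"
  have e7: "exec p (Mov 5 7 0) 3 M R6 M R7"
    unfolding R7_def by (rule exec_mov) (use I5 in \<open>auto simp: I2_def good_def R6_def\<close>)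
  have "ready x p M R7"
    using I5 p M unfolding ready_def
    by (auto simp: I2_def good_def R6_def R7_def m_def num_vecs_def idx_def)
  moreover note exec_seq[OF e1 exec_seq[OF e2(1) exec_seq[OF e3 exec_seq[OF e4 exec_seq[OF e5(1)
      exec_seq[OF e6 e7]]]]], folded setup_code_def]
  moreover have "length [Const 3 1, Add 6 1 2, Const 4 1] + (t2 + (length (Const 7 0 # replicate 128 (Add 7 7 4)) +
      (1 + (t5 + (length [Sub 7 6 0, Const 5 0] + 3))))) \<le> 1000 + 1000 * loglen x"
    using e2(2) e5(2) by (simp add: m_def f_def loglen_def)
  ultimately show ?thesis by blast
qed

lemma at_line_end:
  assumes "at_line p c (length prog) M R"
  shows "at_line p (pram_step prog p b c) (length prog) M R"
proof -
  have c: "fst c = M" "\<And>i. i < p \<Longrightarrow> snd c i = (length prog, R i)" using assms by (auto simp: at_line_def)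
  have "step_memory prog p c = M"
    by (subst step_memory_no_write) (use c in \<open>auto simp: write_request_def halted_def\<close>)
  then show ?thesis
    using c by (simp add: at_line_def pram_step_def step_processor_def halted_def)
qed

lemma at_line_end_run:
  assumes "at_line p (pram_run prog p \<omega> x t) (length prog) M R" "t \<le> T"
  shows "at_line p (pram_run prog p \<omega> x T) (length prog) M R"
  using assms(2)
proof (induction T rule: dec_induct)
  case base
  then show ?case by (rule assms(1))
next
  case (step n)
  then show ?case using at_line_end by simp
qed

text \<open>For n \<ge> 2 the number \<open>2 ^ loglen x\<close> is at most 4n and hence at most
  n^3, which gives n^384 processors. For n = 0 and n = 1 there are 2^128 and 2^256, which the
  additive constant absorbs.\<close>

lemma num_vecs_bound:
  assumes "2 ^ 256 \<le> k" shows "num_vecs x \<le> length x ^ k + k"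
proof -
  let ?n = "length x"
  consider "?n = 0" | "?n = 1" | "2 \<le> ?n" by linarith
  then show ?thesis
  proof cases
    case 1
    then have "num_vecs x = 2 ^ 128" by (simp add: num_vecs_def loglen_def floorlog_def)
    also have "\<dots> \<le> (2::nat) ^ 256" by simp
    finally show ?thesis using assms by linarith
  next
    case 2
    then have "num_vecs x = 2 ^ 256" by (simp add: num_vecs_def loglen_def floorlog_def)
    then show ?thesis using assms by linarith
  next
    case 3
    then have pos: "0 < floorlog 2 ?n" by (cases x) (auto simp: floorlog_def)
    have "2 ^ (floorlog 2 ?n - 1) \<le> ?n" using floorlog_bounds[of ?n 2] 3 by (cases x) auto
    have "loglen x = (floorlog 2 ?n - 1) + 2" using pos by (simp add: loglen_def)
    then have "2 ^ loglen x = 2 ^ (floorlog 2 ?n - 1) * (2::nat) ^ 2" by (simp only: power_add)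
    also have "\<dots> \<le> ?n * ?n ^ 2"
      using \<open>2 ^ (floorlog 2 ?n - 1) \<le> ?n\<close> 3 by (intro mult_mono power_mono) auto
    finally have "2 ^ loglen x \<le> ?n ^ 3" by (simp add: power2_eq_square power3_eq_cube)
    then have "(2 ^ loglen x) ^ 128 \<le> (?n ^ 3) ^ 128" by (rule power_mono) simp
    also have "\<dots> = ?n ^ 384" by (simp flip: power_mult)
    also have "\<dots> \<le> ?n ^ k"
    proof (rule power_increasing)
      have "(384::nat) \<le> 2 ^ 256" by simp
      with assms show "384 \<le> k" by linarith
    qed (use 3 in simp)
    finally show ?thesis by (simp add: num_vecs_def mult.commute flip: power_mult)
  qed
qed

lemma polylog_bound:
  assumes "polylog T"
  obtains k0 where "\<And>k (x :: bool list). k0 \<le> k \<Longrightarrow> T (loglen x) \<le> k * floorlog 2 (length x) ^ k + k"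
proof -
  from assms obtain a e where T: "\<And>l. T l \<le> a * Suc l ^ e" unfolding polylog_def by blast
  show thesis
  proof (rule that[of "a * 3 ^ e + e"])
    fix k and x :: "bool list" assume k: "a * 3 ^ e + e \<le> k"
    let ?f = "floorlog 2 (length x)"
    have "T (loglen x) \<le> a * (?f + 2) ^ e" using T[of "loglen x"] by (simp add: loglen_def)
    also have "\<dots> \<le> k * ?f ^ k + k"
    proof (cases "?f = 0")
      case True
      have "a * (?f + 2) ^ e \<le> a * 3 ^ e" using True by (intro mult_left_mono power_mono) auto
      then show ?thesis using k by linarith
    next
      case False
      then have "(?f + 2) ^ e \<le> (3 * ?f) ^ e" by (intro power_mono) auto
      then have "a * (?f + 2) ^ e \<le> a * (3 * ?f) ^ e" by (rule mult_left_mono) simp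
      also have "\<dots> = a * 3 ^ e * ?f ^ e" by (simp add: power_mult_distrib)
      also have "\<dots> \<le> k * ?f ^ k" using k False by (intro mult_mono power_increasing) auto
      finally show ?thesis by simp
    qed
    finally show "T (loglen x) \<le> k * ?f ^ k + k" .
  qed
qed

text \<open>A processor at whose index \<open>P\<close> holds stores 1 in the output cell, and any
  other one stores in the scratch cell \<open>length x + 1\<close>; a single concurrent write thus
  evaluates the existential quantifier. The result is the same for all coin tosses, so the
  acceptance probability is 0 or 1.\<close>

theorem bcomp_RNC:
  assumes "bcomp P"
  shows "{x. \<exists>i<num_vecs x. P x (digit x i)} \<in> RNC"
proof -
  have "pcomp 0 (\<lambda>x E i. of_bool (P x (digit x i)))"
    using assms by (simp add: bcomp_def ncomp_def)
  then obtain c T where T: "polylog T"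
    and c: "achieves 0 (\<lambda>_. 0) 8 1 (\<lambda>_ x E i. of_bool (P x (digit x i))) c T"
    by (rule pcompE[of 0 _ 8 "\<lambda>_. 0"]) auto
  let ?code = "setup_code ;; c ;; Op (Add 9 1 3) ;; Mov 9 8 2 ;; Op (Store 9 3)"
  define prog where "prog = compile ?code 0"
  let ?T = "\<lambda>l. 1000 + 1000 * l * 1 + (T l + 5)"
  have "polylog ?T" by (intro polylog_add polylog_const polylog_mult T)
  then obtain k0 where k0: "\<And>k x. k0 \<le> k \<Longrightarrow> ?T (loglen x) \<le> k * floorlog 2 (length x) ^ k + k"
    by (rule polylog_bound) blast
  define k where "k = k0 + 2 ^ 256"
  have "\<exists>M R. (\<forall>T' \<omega>. k * floorlog 2 (length x) ^ k + k \<le> T' \<longrightarrow>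
      at_line (length x ^ k + k) (pram_run prog (length x ^ k + k) \<omega> x T') (length prog) M R) \<and>
      (M 0 = 1 \<longleftrightarrow> (\<exists>i<num_vecs x. P x (digit x i)))" for x
  proof -
    let ?p = "length x ^ k + k"
    have p: "num_vecs x \<le> ?p" by (rule num_vecs_bound) (simp add: k_def)
    define M0 where "M0 = fst (pram_init x)"
    have M0: "M0 0 = 0" "\<forall>a<length x. M0 (Suc a) = of_bool (x ! a)"
      by (auto simp: M0_def pram_init_def)
    obtain t1 R1 where 1: "exec ?p setup_code t1 M0 (initial_regs x) M0 R1" "t1 \<le> 1000 + 1000 * loglen x"
      "ready x ?p M0 R1" using setup_exec[OF p M0] by blast
    obtain t2 M2 R2 where 2: "exec ?p c t2 M0 R1 M2 R2" "t2 \<le> T (loglen x)" "frame x ?p 8 M0 R1 M2 R2"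
      "\<And>j i. j < 1 \<Longrightarrow> i < ?p \<Longrightarrow> R2 i (8 + j) = of_bool (P x (digit x (idx x i)))"
      by (rule achievesE[OF c 1(3), of undefined]) auto
    have r2: "ready x ?p M2 R2" by (rule ready_frame[OF 1(3) 2(3)]) simp
    define R3 where "R3 = (\<lambda>i. snd (exec_instr (Add 9 1 3) M2 False (0, R2 i)))"
    define R4 where "R4 = (\<lambda>i. if R3 i 8 = 0 then R3 i else (R3 i)(9 := R3 i 2))"
    define M5 where "M5 = (\<lambda>y. if \<exists>i<?p. R4 i 9 = y then R4 (LEAST i. i < ?p \<and> R4 i 9 = y) 3 else M2 y)"
    have e3: "exec ?p (Op (Add 9 1 3)) 1 M2 R2 M2 R3" unfolding R3_def by (rule exec_local) simp
    have e4: "exec ?p (Mov 9 8 2) 3 M2 R3 M2 R4" unfolding R4_def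
      by (rule exec_mov) (use r2 in \<open>auto simp: R3_def ready_def\<close>)
    have e5: "exec ?p (Op (Store 9 3)) 1 M2 R4 M5 R4" unfolding M5_def by (rule exec_store)
    have ex: "exec ?p ?code (t1 + (t2 + (1 + (3 + 1)))) M0 (initial_regs x) M5 R4"
      by (rule exec_seq[OF 1(1) exec_seq[OF 2(1) exec_seq[OF e3 exec_seq[OF e4 e5]]]])
    have R4: "R4 i 9 = (if P x (digit x (idx x i)) then 0 else length x + 1)" "R4 i 3 = 1"
      if "i < ?p" for i
      using that r2 2(4)[of 0 i] by (auto simp: R4_def R3_def ready_def)
    have ex_iff: "(\<exists>i<?p. R4 i 9 = 0) \<longleftrightarrow> (\<exists>i<num_vecs x. P x (digit x i))"
    proof
      assume "\<exists>i<?p. R4 i 9 = 0"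
      then obtain i where "i < ?p" "P x (digit x (idx x i))" using R4(1) by (auto split: if_splits)
      then show "\<exists>i<num_vecs x. P x (digit x i)" using idx_less by blast
    next
      assume "\<exists>i<num_vecs x. P x (digit x i)"
      then show "\<exists>i<?p. R4 i 9 = 0" using R4(1) p by (metis idx_less_id order.strict_trans2)
    qed
    have out: "M5 0 = 1 \<longleftrightarrow> (\<exists>i<num_vecs x. P x (digit x i))"
    proof (cases "\<exists>i<?p. R4 i 9 = 0")
      case True
      then have "(LEAST i. i < ?p \<and> R4 i 9 = 0) < ?p" by (metis (mono_tags, lifting) LeastI_ex)
      then show ?thesis using True ex_iff R4(2) by (simp add: M5_def)
    next
      case False
      then have "M5 0 = M2 0" by (auto simp: M5_def)
      then show ?thesis using False ex_iff r2 by (simp add: ready_def)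
    qed
    have "at_line ?p (pram_run prog ?p \<omega> x T') (length prog) M5 R4"
      if T': "k * floorlog 2 (length x) ^ k + k \<le> T'" for \<omega> T'
    proof -
      have "at_line ?p (pram_run prog ?p \<omega> x 0) 0 M0 (initial_regs x)"
        by (simp add: at_line_def M0_def pram_init_def initial_regs_def)
      from compile_correct[OF ex _ this]
      have "at_line ?p (pram_run prog ?p \<omega> x (t1 + (t2 + (1 + (3 + 1))))) (length prog) M5 R4"
        by (simp add: prog_def placed_def del: compile.simps code_size.simps)
      moreover have "t1 + (t2 + (1 + (3 + 1))) \<le> T'"
        using T' k0[of k x] 1(2) 2(2) by (simp add: k_def)
      ultimately show ?thesis by (rule at_line_end_run)
    qed
    with out show ?thesis by blast
  qed
  then obtain M R where MR: "\<And>x T' \<omega>. k * floorlog 2 (length x) ^ k + k \<le> T' \<Longrightarrow>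
      at_line (length x ^ k + k) (pram_run prog (length x ^ k + k) \<omega> x T') (length prog) (M x) (R x)"
      "\<And>x. M x 0 = 1 \<longleftrightarrow> (\<exists>i<num_vecs x. P x (digit x i))"
    by metis
  show ?thesis
    unfolding RNC_def mem_Collect_eq Let_def
  proof (intro exI[of _ prog] exI[of _ k] allI conjI impI ballI)
    fix x :: "bool list"
    let ?p = "length x ^ k + k" and ?T = "k * floorlog 2 (length x) ^ k + k"
    note at = MR(1)[of x ?T, OF order_refl]
    show "pram_halts_within prog ?p ?T \<omega> x" for \<omega>
      using at[of \<omega>] by (simp add: pram_halts_within_def halted_def at_line_def)
    have acc: "{\<omega>. pram_accepts prog ?p ?T \<omega> x} = (if \<exists>i<num_vecs x. P x (digit x i) then UNIV else {})"
      using at MR(2)[of x] by (auto simp: pram_accepts_def at_line_def)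
    show "measure_pmf.prob (pmf_of_set (coin_tosses ?p ?T)) {\<omega>. pram_accepts prog ?p ?T \<omega> x} \<ge> 1 / 2"
      if "\<exists>i<num_vecs x. P x (digit x i)"
      unfolding acc using that by (simp add: measure_pmf_UNIV)
    show "measure_pmf.prob (pmf_of_set (coin_tosses ?p ?T)) {\<omega>. pram_accepts prog ?p ?T \<omega> x} = 0"
      if "\<not> (\<exists>i<num_vecs x. P x (digit x i))"
      unfolding acc using that by simp
  qed
qed

section \<open>Words in matrices\<close>

definition mtrace :: "'a::comm_ring_1 mat \<Rightarrow> 'a" where
  "mtrace A = (\<Sum>i<dim_row A. A $$ (i, i))"

lemma mtrace_add:
  assumes "A \<in> carrier_mat n n" "B \<in> carrier_mat n n"
  shows "mtrace (A + B) = mtrace A + mtrace B"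
  using assms by (simp add: mtrace_def sum.distrib)

lemma mtrace_smult:
  assumes "A \<in> carrier_mat n n" shows "mtrace (c \<cdot>\<^sub>m A) = c * mtrace A"
  using assms by (simp add: mtrace_def sum_distrib_left)

lemma mtrace_zero: "mtrace (0\<^sub>m n n) = 0"
  by (simp add: mtrace_def)

lemma mtrace_one: "mtrace (1\<^sub>m n) = of_nat n"
  by (simp add: mtrace_def)

lemma mtrace_comm:
  assumes "A \<in> carrier_mat n m" "B \<in> carrier_mat m n"
  shows "mtrace (A * B) = mtrace (B * A)"
proof -
  have "mtrace (A * B) = (\<Sum>i<n. \<Sum>j<m. A $$ (i, j) * B $$ (j, i))"
    using assms by (simp add: mtrace_def scalar_prod_def lessThan_atLeast0)
  also have "\<dots> = (\<Sum>j<m. \<Sum>i<n. B $$ (j, i) * A $$ (i, j))"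
    by (subst sum.swap) (simp add: mult.commute)
  also have "\<dots> = mtrace (B * A)"
    using assms by (simp add: mtrace_def scalar_prod_def lessThan_atLeast0)
  finally show ?thesis .
qed

lemma square_mult [simp]:
  "A \<in> carrier_mat n n \<Longrightarrow> B \<in> carrier_mat n m \<Longrightarrow> A * B \<in> carrier_mat n m"
  "B \<in> carrier_mat n m \<Longrightarrow> C \<in> carrier_mat m m \<Longrightarrow> B * C \<in> carrier_mat n m"
  by auto

lemma square_one [simp]:
  fixes A :: "'a::semiring_1 mat"
  assumes "A \<in> carrier_mat n n" shows "1\<^sub>m n * A = A" "A * 1\<^sub>m n = A"
  using assms by (rule left_mult_one_mat, rule right_mult_one_mat)

lemma one_smult [simp]: "(1 :: 'a::semiring_1) \<cdot>\<^sub>m A = A"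
  by (intro eq_matI) auto

lemma smult_smult: "(c :: 'a::semigroup_mult) \<cdot>\<^sub>m (d \<cdot>\<^sub>m A) = (c * d) \<cdot>\<^sub>m A"
  by (intro eq_matI) (auto simp: mult.assoc)

definition inverse_mats :: "nat \<Rightarrow> 'a::comm_ring_1 mat \<Rightarrow> 'a mat \<Rightarrow> bool" where
  "inverse_mats n P Q \<longleftrightarrow> P \<in> carrier_mat n n \<and> Q \<in> carrier_mat n n \<and> P * Q = 1\<^sub>m n \<and> Q * P = 1\<^sub>m n"

lemma inverse_matsD:
  assumes "inverse_mats n P Q"
  shows "P \<in> carrier_mat n n" "Q \<in> carrier_mat n n" "P * Q = 1\<^sub>m n" "Q * P = 1\<^sub>m n"
  using assms by (auto simp: inverse_mats_def)

lemma inverse_mats_sym: "inverse_mats n P Q \<Longrightarrow> inverse_mats n Q P"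
  by (auto simp: inverse_mats_def)

lemma inverse_mats_one [simp]: "inverse_mats n (1\<^sub>m n) (1\<^sub>m n)"
  by (simp add: inverse_mats_def)

lemma cancel_left:
  assumes "inverse_mats n P Q" "X \<in> carrier_mat n m" shows "P * (Q * X) = X" "Q * (P * X) = X"
proof -
  note PQ = inverse_matsD[OF assms(1)]
  have *: "P * (Q * X) = (P * Q) * X" "Q * (P * X) = (Q * P) * X"
    using PQ assms(2) assoc_mult_mat[of P n n Q n X m] assoc_mult_mat[of Q n n P n X m] by simp_all
  show "P * (Q * X) = X" "Q * (P * X) = X"
    by (simp_all only: * PQ(3,4) left_mult_one_mat[OF assms(2)])
qed

lemma inverse_mats_mult:
  assumes "inverse_mats n P Q" "inverse_mats n P' Q'"
  shows "inverse_mats n (P * P') (Q' * Q)"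
  using assms cancel_left[OF assms(1), of _ n] cancel_left[OF assms(2), of _ n]
  by (simp add: inverse_mats_def assoc_mult_mat[of _ n n _ n _ n])

lemma mtrace_conj:
  assumes "inverse_mats n P Q" "X \<in> carrier_mat n n" shows "mtrace (P * X * Q) = mtrace X"
proof -
  note PQ = inverse_matsD[OF assms(1)]
  have "mtrace (P * X * Q) = mtrace (Q * (P * X))"
    using PQ assms(2) by (intro mtrace_comm[of _ n n]) auto
  then show ?thesis using cancel_left[OF assms] by simp
qed

lemma conj_mult:
  assumes "inverse_mats n P Q" "X \<in> carrier_mat n n" "Y \<in> carrier_mat n n"
  shows "(P * X * Q) * (P * Y * Q) = P * (X * Y) * Q"
proof -
  note PQ = inverse_matsD[OF assms(1)]
  have "(P * X * Q) * (P * Y * Q) = P * (X * (Q * (P * (Y * Q))))"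
    using PQ assms by (simp add: assoc_mult_mat[of _ n n _ n _ n])
  also have "Q * (P * (Y * Q)) = Y * Q"
    using PQ assms by (intro cancel_left(2)[OF assms(1)]) auto
  finally show ?thesis using PQ assms by (simp add: assoc_mult_mat[of _ n n _ n _ n])
qed

definition family :: "nat \<Rightarrow> (nat \<Rightarrow> 'a mat) \<Rightarrow> bool" where
  "family n a \<longleftrightarrow> (\<forall>i. a i \<in> carrier_mat n n)"

primrec word_mat :: "nat \<Rightarrow> (nat \<Rightarrow> 'a::comm_ring_1 mat) \<Rightarrow> nat list \<Rightarrow> 'a mat" where
  "word_mat n a [] = 1\<^sub>m n"
| "word_mat n a (i # w) = a i * word_mat n a w"

text \<open>A noncommutative polynomial is a list of coefficients and words.\<close>

primrec nc_eval :: "nat \<Rightarrow> (nat \<Rightarrow> 'a::comm_ring_1 mat) \<Rightarrow> ('a \<times> nat list) list \<Rightarrow> 'a mat" where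
  "nc_eval n a [] = 0\<^sub>m n n"
| "nc_eval n a (cw # p) = fst cw \<cdot>\<^sub>m word_mat n a (snd cw) + nc_eval n a p"

definition nc_mult :: "('a::comm_ring_1 \<times> nat list) list \<Rightarrow> ('a \<times> nat list) list \<Rightarrow> ('a \<times> nat list) list" where
  "nc_mult p q = concat (map (\<lambda>cw. map (\<lambda>dv. (fst cw * fst dv, snd cw @ snd dv)) q) p)"

lemma word_mat_carrier [simp]: "family n a \<Longrightarrow> word_mat n a w \<in> carrier_mat n n"
  by (induction w) (auto simp: family_def)

lemma word_mat_append:
  "family n a \<Longrightarrow> word_mat n a (v @ w) = word_mat n a v * word_mat n a w"
  by (induction v) (auto simp: family_def assoc_mult_mat[of _ n n _ n _ n])

lemma nc_eval_carrier [simp]: "family n a \<Longrightarrow> nc_eval n a p \<in> carrier_mat n n"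
  by (induction p) auto

lemma nc_eval_append:
  "family n a \<Longrightarrow> nc_eval n a (p @ q) = nc_eval n a p + nc_eval n a q"
  by (induction p) (auto simp: assoc_add_mat[of _ n n])

lemma nc_eval_mult_term:
  assumes a: "family n a"
  shows "nc_eval n a (map (\<lambda>dv. (c * fst dv, w @ snd dv)) q) = (c \<cdot>\<^sub>m word_mat n a w) * nc_eval n a q"
proof (induction q)
  case (Cons dv q)
  have "(c * fst dv) \<cdot>\<^sub>m (word_mat n a w * word_mat n a (snd dv)) =
      (c \<cdot>\<^sub>m word_mat n a w) * (fst dv \<cdot>\<^sub>m word_mat n a (snd dv))"
    using a by (simp add: mult_smult_distrib[of _ n n _ n] mult_smult_assoc_mat[of _ n n _ n]
        smult_smult mult.commute)
  then show ?case
    using a Cons by (simp add: word_mat_append mult_add_distrib_mat[of _ n n _ n])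
qed (use a in \<open>simp add: right_mult_zero_mat[of _ n n]\<close>)

lemma nc_eval_mult:
  assumes a: "family n a" shows "nc_eval n a (nc_mult p q) = nc_eval n a p * nc_eval n a q"
proof (induction p)
  case (Cons cw p)
  have "nc_eval n a (nc_mult (cw # p) q) =
      (fst cw \<cdot>\<^sub>m word_mat n a (snd cw)) * nc_eval n a q + nc_eval n a (nc_mult p q)"
    using a by (simp add: nc_mult_def nc_eval_append nc_eval_mult_term)
  then show ?case
    using a Cons by (simp add: add_mult_distrib_mat[of _ n n _ _ n])
qed (use a in \<open>simp add: nc_mult_def left_mult_zero_mat[of _ n n]\<close>)

lemma nc_eval_smult:
  "family n a \<Longrightarrow> nc_eval n a (map (\<lambda>dv. (c * fst dv, snd dv)) p) = c \<cdot>\<^sub>m nc_eval n a p"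
  using nc_eval_mult_term[of n a c "[]" p]
  by (simp add: mult_smult_assoc_mat[of _ n n _ n])

lemma nc_eval_letter: "family n a \<Longrightarrow> nc_eval n a [(1, [i])] = a i"
  by (simp add: family_def right_add_zero_mat[of _ n n])

lemma nc_eval_one: "nc_eval n a [(1, [])] = 1\<^sub>m n"
  by (intro eq_matI) auto

lemma mtrace_nc_eval:
  assumes "family n a" shows "mtrace (nc_eval n a p) = (\<Sum>(c, w)\<leftarrow>p. c * mtrace (word_mat n a w))"
  by (induction p) (use assms in \<open>auto simp: mtrace_zero mtrace_add[of _ n] mtrace_smult[of _ n] case_prod_beta\<close>)

definition similar_fam :: "nat \<Rightarrow> (nat \<Rightarrow> 'a::comm_ring_1 mat) \<Rightarrow> (nat \<Rightarrow> 'a mat) \<Rightarrow> bool" where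
  "similar_fam n a b \<longleftrightarrow> (\<exists>P Q. inverse_mats n P Q \<and> (\<forall>i. b i = P * a i * Q))"

lemma similar_fam_refl: "family n a \<Longrightarrow> similar_fam n a a"
  unfolding similar_fam_def family_def
  by (intro exI[of _ "1\<^sub>m n"]) (metis inverse_mats_one left_mult_one_mat right_mult_one_mat)

lemma similar_fam_trans:
  assumes "family n a" "similar_fam n a b" "similar_fam n b c" shows "similar_fam n a c"
proof -
  obtain P Q P' Q' where PQ: "inverse_mats n P Q" "\<And>i. b i = P * a i * Q"
    "inverse_mats n P' Q'" "\<And>i. c i = P' * b i * Q'"
    using assms(2,3) by (auto simp: similar_fam_def)
  have "c i = (P' * P) * a i * (Q * Q')" for i
    using assms(1) inverse_matsD[OF PQ(1)] inverse_matsD[OF PQ(3)]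
    by (simp add: PQ(2,4) family_def assoc_mult_mat[of _ n n _ n _ n])
  with inverse_mats_mult[OF PQ(3,1)] show ?thesis by (auto simp: similar_fam_def)
qed

lemma word_mat_conj:
  assumes "family n a" "inverse_mats n P Q" "\<And>i. b i = P * a i * Q"
  shows "word_mat n b w = P * word_mat n a w * Q"
proof (induction w)
  case Nil
  then show ?case using inverse_matsD[OF assms(2)] by simp
next
  case (Cons i w)
  then show ?case
    using assms(1) conj_mult[OF assms(2), of "a i" "word_mat n a w"] by (simp add: assms(3) family_def)
qed

lemma mtrace_word_similar:
  assumes "family n a" "similar_fam n a b"
  shows "mtrace (word_mat n b w) = mtrace (word_mat n a w)"
  using assms word_mat_conj[of n a _ _ b w] mtrace_conj[of n _ _ "word_mat n a w"]
  by (auto simp: similar_fam_def)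

section \<open>Linear maps as matrices and Schur's lemma\<close>

lemma mat_eq_by_vec:
  fixes A B :: "'a::comm_ring_1 mat"
  assumes "A \<in> carrier_mat n m" "B \<in> carrier_mat n m"
    "\<And>v. v \<in> carrier_vec m \<Longrightarrow> A *\<^sub>v v = B *\<^sub>v v"
  shows "A = B"
proof (rule eq_matI)
  fix i j assume "i < dim_row B" "j < dim_col B"
  then have ij: "i < n" "j < m" using assms by auto
  have "(A *\<^sub>v unit_vec m j) $ i = (B *\<^sub>v unit_vec m j) $ i" using assms(3) by simp
  then show "A $$ (i, j) = B $$ (i, j)" using ij assms(1,2) by (simp add: scalar_prod_right_unit)
qed (use assms in auto)

definition linear_on :: "nat \<Rightarrow> nat \<Rightarrow> ('a::comm_ring_1 vec \<Rightarrow> 'a vec) \<Rightarrow> bool" where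
  "linear_on m n f \<longleftrightarrow> (\<forall>v\<in>carrier_vec m. f v \<in> carrier_vec n) \<and>
     (\<forall>v\<in>carrier_vec m. \<forall>w\<in>carrier_vec m. f (v + w) = f v + f w) \<and>
     (\<forall>v\<in>carrier_vec m. \<forall>c. f (c \<cdot>\<^sub>v v) = c \<cdot>\<^sub>v f v)"

lemma linear_on_matrix:
  fixes f :: "'a::field vec \<Rightarrow> 'a vec"
  assumes f: "linear_on m n f"
  obtains A where "A \<in> carrier_mat n m" "\<And>v. v \<in> carrier_vec m \<Longrightarrow> f v = A *\<^sub>v v"
proof -
  define A where "A = mat n m (\<lambda>(i, j). f (unit_vec m j) $ i)"
  have A: "A \<in> carrier_mat n m" by (simp add: A_def)
  have car: "f v \<in> carrier_vec n" if "v \<in> carrier_vec m" for v using f that by (simp add: linear_on_def)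
  have unit: "A *\<^sub>v unit_vec m j = f (unit_vec m j)" if "j < m" for j
    using that car[of "unit_vec m j"] by (intro eq_vecI) (auto simp: A_def scalar_prod_right_unit)
  have zero: "f (0\<^sub>v m) = 0\<^sub>v n"
  proof -
    have "f (0 \<cdot>\<^sub>v 0\<^sub>v m) = 0 \<cdot>\<^sub>v f (0\<^sub>v m)" using f by (simp add: linear_on_def)
    moreover have "0 \<cdot>\<^sub>v 0\<^sub>v m = (0\<^sub>v m :: 'a vec)" "0 \<cdot>\<^sub>v f (0\<^sub>v m) = 0\<^sub>v n"
      using car[of "0\<^sub>v m"] by (auto intro!: eq_vecI)
    ultimately show ?thesis by simp
  qed
  have "f v = A *\<^sub>v v" if "v \<in> carrier_vec m" "\<And>i. k \<le> i \<Longrightarrow> i < m \<Longrightarrow> v $ i = 0" "k \<le> m" for k v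
    using that
  proof (induction k arbitrary: v)
    case 0
    then have "v = 0\<^sub>v m" by (intro eq_vecI) auto
    moreover have "A *\<^sub>v 0\<^sub>v m = 0\<^sub>v n" using A by (intro eq_vecI) (auto simp: scalar_prod_def)
    ultimately show ?case using zero by simp
  next
    case (Suc k)
    define w where "w = vec m (\<lambda>i. if i = k then 0 else v $ i)"
    have w: "w \<in> carrier_vec m" by (simp add: w_def)
    have v: "v = w + v $ k \<cdot>\<^sub>v unit_vec m k"
      using Suc.prems by (intro eq_vecI) (auto simp: w_def unit_vec_def)
    have "f w = A *\<^sub>v w" by (rule Suc.IH) (use Suc.prems in \<open>auto simp: w_def\<close>)
    moreover have "f v = f w + v $ k \<cdot>\<^sub>v f (unit_vec m k)"
      by (subst v) (use f w in \<open>simp add: linear_on_def\<close>)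
    moreover have "A *\<^sub>v v = A *\<^sub>v w + v $ k \<cdot>\<^sub>v (A *\<^sub>v unit_vec m k)"
      by (subst v) (use A w in \<open>simp add: mult_add_distrib_mat_vec[of _ n m] mult_mat_vec[OF A]\<close>)
    ultimately show ?case using unit[of k] Suc.prems by simp
  qed
  then have "f v = A *\<^sub>v v" if "v \<in> carrier_vec m" for v
    using that by (metis le_refl not_less)
  with A show thesis by (rule that)
qed

text \<open>Every nonzero vector is cyclic for the algebra generated by the family, which amounts to
  the absence of invariant subspaces other than zero and the whole space.\<close>

definition irreducible_fam :: "nat \<Rightarrow> (nat \<Rightarrow> 'a::comm_ring_1 mat) \<Rightarrow> bool" where
  "irreducible_fam n a \<longleftrightarrow> family n a \<and> 0 < n \<and>
     (\<forall>v\<in>carrier_vec n. v \<noteq> 0\<^sub>v n \<longrightarrow> (\<forall>w\<in>carrier_vec n. \<exists>p. nc_eval n a p *\<^sub>v v = w))"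

lemma irreducible_famE:
  assumes "irreducible_fam n a" "v \<in> carrier_vec n" "v \<noteq> 0\<^sub>v n" "w \<in> carrier_vec n"
  obtains p where "nc_eval n a p *\<^sub>v v = w"
  using assms by (auto simp: irreducible_fam_def)

text \<open>Polynomials in the letters commute past \<open>F\<close>. If \<open>F\<close> killed a
  nonzero vector, cyclicity of that vector would make \<open>F\<close> zero; and cyclicity of one
  nonzero value makes \<open>F\<close> surjective.\<close>

lemma Schur_similar:
  fixes s t :: "nat \<Rightarrow> 'a::{field_char_0} mat"
  assumes s: "irreducible_fam k s" and t: "irreducible_fam l t"
    and F: "F \<in> carrier_mat k l" "F \<noteq> 0\<^sub>m k l" and comm: "\<And>i. s i * F = F * t i"
  shows "k = l \<and> similar_fam l t s"
proof -
  have fs: "family k s" and ft: "family l t" using s t by (auto simp: irreducible_fam_def)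
  then have [simp]: "s i \<in> carrier_mat k k" "t i \<in> carrier_mat l l" for i by (auto simp: family_def)
  note [simp] = F(1)
  have word: "word_mat k s w * F = F * word_mat l t w" for w
  proof (induction w)
    case (Cons i w)
    have "s i * word_mat k s w * F = s i * (F * word_mat l t w)"
      using fs Cons by (simp add: assoc_mult_mat[of _ k k _ k _ l])
    also have "\<dots> = (s i * F) * word_mat l t w"
      using ft by (simp add: assoc_mult_mat[of _ k k _ l _ l])
    finally show ?case using ft by (simp add: comm assoc_mult_mat[of _ k l _ l _ l])
  qed (simp add: left_mult_one_mat[of _ k l] right_mult_one_mat[of _ k l])
  have ev: "nc_eval k s p * F = F * nc_eval l t p" for p
    by (induction p) (use fs ft in \<open>auto simp: word add_mult_distrib_mat[of _ k k _ _ l]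
        mult_add_distrib_mat[of _ k l _ l] mult_smult_distrib[of _ k l _ l] mult_smult_assoc_mat[of _ k k _ l]
        left_mult_zero_mat[of _ k l] right_mult_zero_mat[of _ k l]\<close>)
  have ev_vec: "nc_eval k s p *\<^sub>v (F *\<^sub>v u) = F *\<^sub>v (nc_eval l t p *\<^sub>v u)" if "u \<in> carrier_vec l" for p u
    using that fs ft ev[of p]
    by (simp flip: assoc_mult_mat_vec[of _ k k _ l] assoc_mult_mat_vec[of _ k l _ l])
  have inj: "u = 0\<^sub>v l" if u: "u \<in> carrier_vec l" "F *\<^sub>v u = 0\<^sub>v k" for u
  proof (rule ccontr)
    assume "u \<noteq> 0\<^sub>v l"
    have "F *\<^sub>v w = 0\<^sub>m k l *\<^sub>v w" if w: "w \<in> carrier_vec l" for w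
    proof -
      obtain p where "nc_eval l t p *\<^sub>v u = w" using irreducible_famE[OF t u(1) \<open>u \<noteq> 0\<^sub>v l\<close> w] .
      then have "F *\<^sub>v w = nc_eval k s p *\<^sub>v 0\<^sub>v k" using ev_vec[OF u(1), of p] u(2) by simp
      then show ?thesis using fs w
        by (intro eq_vecI) (auto simp: scalar_prod_def nc_eval_carrier[THEN carrier_matD(1)] nc_eval_carrier[THEN carrier_matD(2)])
    qed
    then have "F = 0\<^sub>m k l" by (intro mat_eq_by_vec[of _ k l]) auto
    with F(2) show False by simp
  qed
  obtain u0 where u0: "u0 \<in> carrier_vec l" "F *\<^sub>v u0 \<noteq> 0\<^sub>v k"
  proof (rule ccontr)
    assume *: "\<not> thesis"
    have "F = 0\<^sub>m k l"
    proof (rule mat_eq_by_vec[of _ k l])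
      fix v :: "'a vec" assume v: "v \<in> carrier_vec l"
      then have "F *\<^sub>v v = 0\<^sub>v k" using * that by blast
      also have "\<dots> = 0\<^sub>m k l *\<^sub>v v" using v by (intro eq_vecI) (auto simp: scalar_prod_def)
      finally show "F *\<^sub>v v = 0\<^sub>m k l *\<^sub>v v" .
    qed auto
    with F(2) show False by simp
  qed
  have "\<exists>u. u \<in> carrier_vec l \<and> F *\<^sub>v u = w" if w: "w \<in> carrier_vec k" for w
  proof -
    obtain p where "nc_eval k s p *\<^sub>v (F *\<^sub>v u0) = w"
      by (rule irreducible_famE[OF s _ u0(2) w]) (use mult_mat_vec_carrier[OF F(1) u0(1)] in simp)
    then show ?thesis using ev_vec[OF u0(1), of p] ft u0(1)
      by (metis mult_mat_vec_carrier nc_eval_carrier)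
  qed
  then obtain y where y: "\<And>w. w \<in> carrier_vec k \<Longrightarrow> y w \<in> carrier_vec l \<and> F *\<^sub>v y w = w" by metis
  have y_eq: "y w = u" if "u \<in> carrier_vec l" "F *\<^sub>v u = w" "w \<in> carrier_vec k" for u w
  proof -
    have "F *\<^sub>v (y w - u) = 0\<^sub>v k"
      using y[OF that(3)] that by (simp add: mult_minus_distrib_mat_vec[of _ k l])
    then have "y w - u = 0\<^sub>v l" using inj[of "y w - u"] y[OF that(3)] that(1) by simp
    then have "(y w - u) $ i = 0" if "i < l" for i using that by simp
    then show ?thesis using y[OF that(3)] that(1) by (intro eq_vecI) auto
  qed
  have "linear_on k l y"
    unfolding linear_on_def
  proof (intro conjI ballI allI)
    fix v w :: "'a vec" and c :: 'a assume v: "v \<in> carrier_vec k" and w: "w \<in> carrier_vec k"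
    show "y v \<in> carrier_vec l" using y[OF v] by simp
    show "y (v + w) = y v + y w"
      by (rule y_eq) (use y[OF v] y[OF w] v w in \<open>auto simp: mult_add_distrib_mat_vec[of _ k l]\<close>)
    show "y (c \<cdot>\<^sub>v v) = c \<cdot>\<^sub>v y v"
      by (rule y_eq) (use y[OF v] v in \<open>auto simp: mult_mat_vec[of _ k l]\<close>)
  qed
  then obtain G where G: "G \<in> carrier_mat l k" "\<And>v. v \<in> carrier_vec k \<Longrightarrow> y v = G *\<^sub>v v"
    by (rule linear_on_matrix) blast
  note [simp] = mult_carrier_mat[OF F(1) G(1)] mult_carrier_mat[OF G(1) F(1)]
  have FG: "F * G = 1\<^sub>m k"
    by (rule mat_eq_by_vec[of _ k k]) (use G y in \<open>auto simp: assoc_mult_mat_vec[of _ k l _ k]\<close>)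
  have GF: "G * F = 1\<^sub>m l"
  proof (rule mat_eq_by_vec[of _ l l])
    fix v :: "'a vec" assume v: "v \<in> carrier_vec l"
    have Fv: "F *\<^sub>v v \<in> carrier_vec k" using v by (rule mult_mat_vec_carrier[OF F(1)])
    have "y (F *\<^sub>v v) = v" by (rule y_eq[OF v refl Fv])
    then show "G * F *\<^sub>v v = 1\<^sub>m l *\<^sub>v v"
      using v G(2)[OF Fv] G(1) by (simp add: assoc_mult_mat_vec[of _ l k _ l])
  qed auto
  \<comment> \<open>The traces of \<open>F * G\<close> and \<open>G * F\<close> agree, and in
    characteristic zero the traces of identity matrices determine their sizes.\<close>
  have "(of_nat k :: 'a) = of_nat l"
    using mtrace_comm[OF F(1) G(1)] unfolding FG GF by (simp add: mtrace_one)
  then have kl: "k = l" by simp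
  have "s i = F * t i * G" for i
  proof -
    have "F * t i * G = s i * (F * G)"
      using G(1) by (simp add: comm[symmetric] assoc_mult_mat[of _ k k _ l _ k])
    then show ?thesis unfolding FG by simp
  qed
  then show ?thesis
    using FG GF G(1) F(1) kl unfolding similar_fam_def inverse_mats_def by blast
qed

section \<open>Irreducible families\<close>

lemma nc_eval_vec:
  assumes "family n a" "u \<in> carrier_vec n"
  shows "nc_eval n a (p @ q) *\<^sub>v u = nc_eval n a p *\<^sub>v u + nc_eval n a q *\<^sub>v u"
    "nc_eval n a (nc_mult p q) *\<^sub>v u = nc_eval n a p *\<^sub>v (nc_eval n a q *\<^sub>v u)"
    "nc_eval n a p *\<^sub>v u \<in> carrier_vec n"
  using assms by (auto simp: nc_eval_append nc_eval_mult add_mult_distrib_mat_vec[of _ n n]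
    assoc_mult_mat_vec[of _ n n _ n] intro!: mult_mat_vec_carrier)

lemma smult_mat_vec:
  "A \<in> carrier_mat n m \<Longrightarrow> u \<in> carrier_vec m \<Longrightarrow> (c \<cdot>\<^sub>m A) *\<^sub>v u = c \<cdot>\<^sub>v (A *\<^sub>v u :: 'a::comm_ring_1 vec)"
  by (intro eq_vecI) (auto simp: scalar_prod_def sum_distrib_left mult.assoc)

lemma zero_mat_vec: "u \<in> carrier_vec m \<Longrightarrow> 0\<^sub>m n m *\<^sub>v u = (0\<^sub>v n :: 'a::comm_ring_1 vec)"
  by (intro eq_vecI) (auto simp: scalar_prod_def)

lemma mat_zero_vec: "A \<in> carrier_mat n m \<Longrightarrow> A *\<^sub>v 0\<^sub>v m = (0\<^sub>v n :: 'a::comm_ring_1 vec)"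
  by (intro eq_vecI) (auto simp: scalar_prod_def)

lemma vec_eq_if_diff_zero:
  fixes a b :: "'a::comm_ring_1 vec"
  assumes "a + (- 1) \<cdot>\<^sub>v b = 0\<^sub>v n" "a \<in> carrier_vec n" "b \<in> carrier_vec n"
  shows "b = a"
proof (rule eq_vecI)
  fix i assume "i < dim_vec a"
  then have "vec_index (a + (- 1) \<cdot>\<^sub>v b) i = 0" using assms by simp
  then show "vec_index b i = vec_index a i" using \<open>i < dim_vec a\<close> assms(2,3) by simp
qed (use assms in simp)

lemma nonzero_mat_vec:
  fixes A :: "'a::comm_ring_1 mat"
  assumes "A \<in> carrier_mat n m" "A \<noteq> 0\<^sub>m n m"
  obtains u where "u \<in> carrier_vec m" "A *\<^sub>v u \<noteq> 0\<^sub>v n"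
proof (rule ccontr)
  assume *: "\<not> thesis"
  have "A = 0\<^sub>m n m"
  proof (rule mat_eq_by_vec[of _ n m])
    fix v :: "'a vec" assume v: "v \<in> carrier_vec m"
    then have "A *\<^sub>v v = 0\<^sub>v n" using * that by blast
    also have "\<dots> = 0\<^sub>m n m *\<^sub>v v" using v by (intro eq_vecI) (auto simp: scalar_prod_def)
    finally show "A *\<^sub>v v = 0\<^sub>m n m *\<^sub>v v" .
  qed (use assms in auto)
  with assms(2) show False by simp
qed

lemma mat_zero_by_units:
  fixes A :: "'a::comm_ring_1 mat"
  assumes "A \<in> carrier_mat n m" "\<And>j. j < m \<Longrightarrow> A *\<^sub>v unit_vec m j = 0\<^sub>v n"
  shows "A = 0\<^sub>m n m"
proof (rule eq_matI)
  fix i j assume "i < dim_row (0\<^sub>m n m :: 'a mat)" "j < dim_col (0\<^sub>m n m :: 'a mat)"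
  then have ij: "i < n" "j < m" by auto
  have "(A *\<^sub>v unit_vec m j) $ i = 0" using assms(2)[OF ij(2)] ij by simp
  then show "A $$ (i, j) = 0\<^sub>m n m $$ (i, j)" using ij assms(1) by (simp add: scalar_prod_right_unit)
qed (use assms in auto)

text \<open>If the annihilator of \<open>t\<close> were contained in that of \<open>s\<close>, then the first unit vector on which
  the left ideals annihilating the first \<open>j\<close> unit vectors stop acting nontrivially on \<open>s\<close> would yield a
  homomorphism from \<open>t\<close> to \<open>s\<close>.\<close>

lemma annihilator_separation:
  fixes s t :: "nat \<Rightarrow> 'a::field_char_0 mat"
  assumes s: "irreducible_fam k s" and t: "irreducible_fam l t" and ns: "\<not> (k = l \<and> similar_fam l t s)"
  shows "\<exists>p. nc_eval l t p = 0\<^sub>m l l \<and> nc_eval k s p \<noteq> 0\<^sub>m k k"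
proof (rule ccontr)
  assume "\<not> ?thesis"
  then have H: "nc_eval k s p = 0\<^sub>m k k" if "nc_eval l t p = 0\<^sub>m l l" for p using that by blast
  have fs: "family k s" and ft: "family l t" and k: "0 < k" using s t by (auto simp: irreducible_fam_def)
  define v :: "'a vec" where "v = unit_vec k 0"
  have v: "v \<in> carrier_vec k" "v \<noteq> 0\<^sub>v k"
    using k by (auto simp: v_def dest!: arg_cong[of _ _ "\<lambda>v. vec_index v 0"])
  define L where "L j = {p. \<forall>i<j. nc_eval l t p *\<^sub>v unit_vec l i = 0\<^sub>v l}" for j
  define Z where "Z j \<longleftrightarrow> (\<forall>p\<in>L j. nc_eval k s p *\<^sub>v v = 0\<^sub>v k)" for j
  have Zl: "Z l"
    unfolding Z_def
  proof
    fix p assume "p \<in> L l"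
    then have "nc_eval l t p = 0\<^sub>m l l"
      using ft by (intro mat_zero_by_units) (auto simp: L_def)
    then show "nc_eval k s p *\<^sub>v v = 0\<^sub>v k" using H v by (auto intro!: eq_vecI simp: scalar_prod_def)
  qed
  have Z0: "\<not> Z 0"
    using v nc_eval_one[of k s] by (auto simp: Z_def L_def intro!: exI[of _ "[(1, [])]"] simp del: nc_eval.simps)
  have "\<exists>j<l. \<not> Z j \<and> Z (Suc j)"
  proof (rule ccontr)
    assume *: "\<not> ?thesis"
    have "j \<le> l \<Longrightarrow> \<not> Z j" for j
    proof (induction j)
      case (Suc j)
      then have "j < l" "\<not> Z j" by auto
      with * show ?case by blast
    qed (use Z0 in simp)
    with Zl show False by blast
  qed
  then obtain j where j: "j < l" "\<not> Z j" "Z (Suc j)" by blast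
  define e :: "'a vec" where "e = unit_vec l j"
  have e: "e \<in> carrier_vec l" by (simp add: e_def)
  have zero: "nc_eval k s p *\<^sub>v v = 0\<^sub>v k" if "p \<in> L j" "nc_eval l t p *\<^sub>v e = 0\<^sub>v l" for p
    using j(3) that by (auto simp: Z_def L_def e_def less_Suc_eq)
  obtain p0 where p0: "p0 \<in> L j" "nc_eval k s p0 *\<^sub>v v \<noteq> 0\<^sub>v k" using j(2) by (auto simp: Z_def)
  then have nz: "nc_eval l t p0 *\<^sub>v e \<noteq> 0\<^sub>v l" using zero by blast
  let ?scale = "\<lambda>c p. map (\<lambda>dv. (c * fst dv, snd dv)) p"
  have z: "A *\<^sub>v 0\<^sub>v l = 0\<^sub>v l" if "A \<in> carrier_mat l l" for A :: "'a mat"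
    using that by (intro eq_vecI) (auto simp: scalar_prod_def)
  have L_mult: "nc_mult q p \<in> L j" if "p \<in> L j" for p q
    using that ft by (auto simp: L_def nc_eval_vec z)
  have L_append: "p @ q \<in> L j" if "p \<in> L j" "q \<in> L j" for p q
    using that ft by (auto simp: L_def nc_eval_vec)
  have L_scale: "?scale c p \<in> L j" if "p \<in> L j" for p c
    using that ft by (auto simp: L_def nc_eval_smult smult_mat_vec[of _ l l] intro!: eq_vecI)
  have "\<exists>p. p \<in> L j \<and> nc_eval l t p *\<^sub>v e = w" if w: "w \<in> carrier_vec l" for w
  proof -
    obtain q where "nc_eval l t q *\<^sub>v (nc_eval l t p0 *\<^sub>v e) = w"
      by (rule irreducible_famE[OF t _ nz w]) (use ft e nc_eval_vec in auto)
    then have "nc_eval l t (nc_mult q p0) *\<^sub>v e = w" using ft e by (simp add: nc_eval_vec)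
    with L_mult[OF p0(1)] show ?thesis by blast
  qed
  then obtain pp where pp: "\<And>w. w \<in> carrier_vec l \<Longrightarrow> pp w \<in> L j"
    "\<And>w. w \<in> carrier_vec l \<Longrightarrow> nc_eval l t (pp w) *\<^sub>v e = w" by metis
  define f where "f w = nc_eval k s (pp w) *\<^sub>v v" for w
  \<comment> \<open>The homomorphism sends the value of a polynomial of \<open>L j\<close> at
    \<open>e\<close> to its value at \<open>v\<close>. It is well defined since a polynomial of
    \<open>L j\<close> that also kills \<open>e\<close> lies in \<open>L (Suc j)\<close> and
    therefore kills \<open>v\<close>.\<close>
  have wd: "f (nc_eval l t p *\<^sub>v e) = nc_eval k s p *\<^sub>v v" if p: "p \<in> L j" for p
  proof -
    define w where "w = nc_eval l t p *\<^sub>v e"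
    have w: "w \<in> carrier_vec l" using ft e by (simp add: w_def nc_eval_vec)
    let ?q = "p @ ?scale (- 1) (pp w)"
    have "nc_eval l t ?q *\<^sub>v e = w + (- 1) \<cdot>\<^sub>v w"
      by (simp only: nc_eval_vec(1)[OF ft e] nc_eval_smult[OF ft] smult_mat_vec[OF nc_eval_carrier[OF ft] e]
          pp(2)[OF w] w_def[symmetric])
    also have "\<dots> = 0\<^sub>v l" using w by (intro eq_vecI) auto
    finally have "nc_eval k s ?q *\<^sub>v v = 0\<^sub>v k"
      by (intro zero L_append L_scale p pp(1) w)
    then have "nc_eval k s p *\<^sub>v v + (- 1) \<cdot>\<^sub>v f w = 0\<^sub>v k"
      by (simp only: nc_eval_vec(1)[OF fs v(1)] nc_eval_smult[OF fs]
          smult_mat_vec[OF nc_eval_carrier[OF fs] v(1)] f_def)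
    moreover have "nc_eval k s p *\<^sub>v v \<in> carrier_vec k" "f w \<in> carrier_vec k"
      unfolding f_def by (rule nc_eval_vec(3)[OF fs v(1)])+
    ultimately have "f w = nc_eval k s p *\<^sub>v v" by (rule vec_eq_if_diff_zero)
    then show ?thesis by (simp add: w_def)
  qed
  have "linear_on l k f"
    unfolding linear_on_def
  proof (intro conjI ballI allI)
    fix w w' :: "'a vec" and c assume w: "w \<in> carrier_vec l" and w': "w' \<in> carrier_vec l"
    show "f w \<in> carrier_vec k" unfolding f_def by (rule nc_eval_vec(3)[OF fs v(1)])
    show "f (w + w') = f w + f w'"
      using wd[OF L_append[OF pp(1)[OF w] pp(1)[OF w']]] ft fs e v pp(2)[OF w] pp(2)[OF w']
      by (simp add: nc_eval_vec f_def)
    show "f (c \<cdot>\<^sub>v w) = c \<cdot>\<^sub>v f w"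
      using wd[OF L_scale[OF pp(1)[OF w], of c]] ft fs e v pp(2)[OF w]
      by (simp add: nc_eval_smult smult_mat_vec[of _ k k] smult_mat_vec[of _ l l] f_def)
  qed
  then obtain F where F: "F \<in> carrier_mat k l" "\<And>w. w \<in> carrier_vec l \<Longrightarrow> f w = F *\<^sub>v w"
    by (rule linear_on_matrix) blast
  have "s i * F = F * t i" for i
  proof (rule mat_eq_by_vec[of _ k l])
    have st: "s i \<in> carrier_mat k k" "t i \<in> carrier_mat l l" using fs ft by (auto simp: family_def)
    show "s i * F \<in> carrier_mat k l" "F * t i \<in> carrier_mat k l" using st F(1) by auto
    fix w :: "'a vec" assume w: "w \<in> carrier_vec l"
    have tw: "t i *\<^sub>v w \<in> carrier_vec l" using st w by auto
    have "(s i * F) *\<^sub>v w = s i *\<^sub>v f w"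
      using st F w by (simp add: assoc_mult_mat_vec[of _ k k _ l])
    also have "\<dots> = nc_eval k s (nc_mult [(1, [i])] (pp w)) *\<^sub>v v"
      using fs v by (simp add: nc_eval_vec nc_eval_letter f_def del: nc_eval.simps)
    also have "\<dots> = f (nc_eval l t (nc_mult [(1, [i])] (pp w)) *\<^sub>v e)"
      by (rule wd[symmetric], rule L_mult, rule pp(1)[OF w])
    also have "nc_eval l t (nc_mult [(1, [i])] (pp w)) *\<^sub>v e = t i *\<^sub>v w"
      using ft e pp(2)[OF w] by (simp add: nc_eval_vec nc_eval_letter del: nc_eval.simps)
    also have "f (t i *\<^sub>v w) = (F * t i) *\<^sub>v w"
      using st F w tw by (simp add: assoc_mult_mat_vec[of _ k l _ l])
    finally show "(s i * F) *\<^sub>v w = (F * t i) *\<^sub>v w" .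
  qed
  moreover have "F \<noteq> 0\<^sub>m k l"
  proof
    assume F0: "F = 0\<^sub>m k l"
    have c: "nc_eval l t p0 *\<^sub>v e \<in> carrier_vec l" using ft e by (simp add: nc_eval_vec)
    have "nc_eval k s p0 *\<^sub>v v = F *\<^sub>v (nc_eval l t p0 *\<^sub>v e)" using wd[OF p0(1)] F(2)[OF c] by simp
    also have "\<dots> = 0\<^sub>v k" unfolding F0 by (rule zero_mat_vec[OF c])
    finally show False using p0(2) by simp
  qed
  ultimately show False using Schur_similar[OF s t F(1)] ns by blast
qed

text \<open>Separating polynomials are multiplied up. A product \<open>q * p\<close> of two of them
  may vanish on \<open>s\<close>; by irreducibility a middle factor \<open>r\<close> can be inserted
  that carries a nonzero value of \<open>p\<close> to a vector not killed by
  \<open>q\<close>.\<close>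

lemma annihilator_separation_list:
  fixes s :: "nat \<Rightarrow> 'a::field_char_0 mat"
  assumes s: "irreducible_fam k s"
    and "\<And>l t. (l, t) \<in> set Ts \<Longrightarrow> irreducible_fam l t \<and> \<not> (k = l \<and> similar_fam l t s)"
  shows "\<exists>p. (\<forall>(l, t)\<in>set Ts. nc_eval l t p = 0\<^sub>m l l) \<and> nc_eval k s p \<noteq> 0\<^sub>m k k"
  using assms(2)
proof (induction Ts)
  case Nil
  have "1\<^sub>m k \<noteq> (0\<^sub>m k k :: 'a mat)"
    using s by (auto simp: irreducible_fam_def dest!: arg_cong[of _ _ "\<lambda>A. A $$ (0, 0)"])
  then show ?case using nc_eval_one[of k s] by (auto intro!: exI[of _ "[(1, [])]"] simp del: nc_eval.simps)
next
  case (Cons lt Ts)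
  obtain l t where lt: "lt = (l, t)" by (cases lt)
  obtain p where p: "\<And>l t. (l, t) \<in> set Ts \<Longrightarrow> nc_eval l t p = 0\<^sub>m l l" "nc_eval k s p \<noteq> 0\<^sub>m k k"
  proof -
    have "\<exists>p. (\<forall>(l, t)\<in>set Ts. nc_eval l t p = 0\<^sub>m l l) \<and> nc_eval k s p \<noteq> 0\<^sub>m k k"
      by (rule Cons.IH) (use Cons.prems in auto)
    then show thesis using that by blast
  qed
  have t: "irreducible_fam l t" "\<not> (k = l \<and> similar_fam l t s)" using Cons.prems[of l t] by (auto simp: lt)
  obtain q where q: "nc_eval l t q = 0\<^sub>m l l" "nc_eval k s q \<noteq> 0\<^sub>m k k"
    using annihilator_separation[OF s t] by blast
  have fs: "family k s" using s by (simp add: irreducible_fam_def)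
  obtain u where u: "u \<in> carrier_vec k" "nc_eval k s p *\<^sub>v u \<noteq> 0\<^sub>v k"
    using nonzero_mat_vec[OF nc_eval_carrier[OF fs] p(2)] .
  obtain w where w: "w \<in> carrier_vec k" "nc_eval k s q *\<^sub>v w \<noteq> 0\<^sub>v k"
    using nonzero_mat_vec[OF nc_eval_carrier[OF fs] q(2)] .
  obtain r where r: "nc_eval k s r *\<^sub>v (nc_eval k s p *\<^sub>v u) = w"
    by (rule irreducible_famE[OF s _ u(2) w(1)]) (use fs u nc_eval_vec in auto)
  let ?g = "nc_mult q (nc_mult r p)"
  have "nc_eval k s ?g *\<^sub>v u \<noteq> 0\<^sub>v k" using fs u w r by (simp add: nc_eval_vec)
  then have "nc_eval k s ?g \<noteq> 0\<^sub>m k k"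
    using u(1) by (auto intro!: eq_vecI simp: scalar_prod_def)
  moreover have "nc_eval l' t' ?g = 0\<^sub>m l' l'" if "(l', t') \<in> set (lt # Ts)" for l' t'
  proof -
    have f: "family l' t'" using Cons.prems[OF that] by (simp add: irreducible_fam_def)
    have "nc_eval l' t' q = 0\<^sub>m l' l' \<or> nc_eval l' t' p = 0\<^sub>m l' l'" using that q(1) p(1) by (auto simp: lt)
    then show ?thesis using f
      by (auto simp: nc_eval_mult left_mult_zero_mat[of _ l' l'] right_mult_zero_mat[of _ l' l'])
  qed
  ultimately show ?case by blast
qed

lemma mtrace_four_block:
  "A \<in> carrier_mat p p \<Longrightarrow> D \<in> carrier_mat q q \<Longrightarrow> mtrace (four_block_mat A B C D) = mtrace A + mtrace D"
proof -
  assume A: "A \<in> carrier_mat p p" and D: "D \<in> carrier_mat q q"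
  have "mtrace (four_block_mat A B C D) = (\<Sum>i<p + q. if i < p then A $$ (i, i) else D $$ (i - p, i - p))"
    using A D by (auto simp: mtrace_def intro!: sum.cong)
  also have "\<dots> = (\<Sum>i<p. A $$ (i, i)) + (\<Sum>i<q. D $$ (i, i))"
    by (induction q) simp_all
  finally show ?thesis using A D by (simp add: mtrace_def)
qed

lemma word_mat_four_block:
  assumes "family p a" "\<And>i. b i \<in> carrier_mat p q" "family q d"
  shows "\<exists>B \<in> carrier_mat p q. word_mat (p + q) (\<lambda>i. four_block_mat (a i) (b i) (0\<^sub>m q p) (d i)) w =
    four_block_mat (word_mat p a w) B (0\<^sub>m q p) (word_mat q d w)"
proof (induction w)
  case Nil
  have "1\<^sub>m (p + q) = four_block_mat (1\<^sub>m p) (0\<^sub>m p q) (0\<^sub>m q p) (1\<^sub>m q :: 'a mat)"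
    by (intro eq_matI) auto
  then show ?case by (auto intro: bexI[of _ "0\<^sub>m p q"])
next
  case (Cons i w)
  then obtain B where B: "B \<in> carrier_mat p q" "word_mat (p + q) (\<lambda>i. four_block_mat (a i) (b i) (0\<^sub>m q p) (d i)) w =
    four_block_mat (word_mat p a w) B (0\<^sub>m q p) (word_mat q d w)" by blast
  have c: "a i \<in> carrier_mat p p" "d i \<in> carrier_mat q q" using assms by (auto simp: family_def)
  have bz: "b i * 0\<^sub>m q p = 0\<^sub>m p p" "0\<^sub>m q p * word_mat p a w = 0\<^sub>m q p" "0\<^sub>m q p * B = 0\<^sub>m q q" "d i * 0\<^sub>m q p = 0\<^sub>m q p"
    using assms c B(1) word_mat_carrier[OF assms(1), of w]
    by (auto intro: right_mult_zero_mat left_mult_zero_mat)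
  have "four_block_mat (a i) (b i) (0\<^sub>m q p) (d i) * four_block_mat (word_mat p a w) B (0\<^sub>m q p) (word_mat q d w) =
    four_block_mat (a i * word_mat p a w) (a i * B + b i * word_mat q d w) (0\<^sub>m q p) (d i * word_mat q d w)"
    using assms c B(1) by (subst mult_four_block_mat[of _ p p _ q _ q _ _ p _ q])
      (auto simp: bz right_add_zero_mat[of _ p p] left_add_zero_mat[of _ q q])
  then show ?case using B c assms by (auto intro!: bexI[of _ "a i * B + b i * word_mat q d w"])
qed

section \<open>Trace functions of irreducible families\<close>

lemma det_inverse:
  fixes M :: "'a::field mat"
  assumes M: "M \<in> carrier_mat n n" and d: "det M \<noteq> 0"
  obtains Q where "inverse_mats n M Q"
proof
  note a = adj_mat[OF M]
  show "inverse_mats n M (inverse (det M) \<cdot>\<^sub>m adj_mat M)"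
    using a M d by (simp add: inverse_mats_def mult_smult_distrib[of _ n n _ n] mult_smult_assoc_mat[of _ n n _ n]
        smult_smult)
qed

lemma first_column:
  fixes v :: "'a::field vec"
  assumes v: "v \<in> carrier_vec n" "v \<noteq> 0\<^sub>v n"
  obtains P Q where "inverse_mats n P Q" "P *\<^sub>v unit_vec n 0 = v"
proof -
  obtain k where k: "k < n" "vec_index v k \<noteq> 0"
  proof (rule ccontr)
    assume *: "\<not> thesis"
    have "v = 0\<^sub>v n" using * that v(1) by (intro eq_vecI) auto
    with v(2) show False by simp
  qed
  \<comment> \<open>The identity matrix with \<open>v\<close> as its first column; if the nonzero
    coordinate \<open>k\<close> of \<open>v\<close> is not the first one, column \<open>k\<close>
    becomes the first unit vector, so that the columns still form a basis.\<close>
  define M where "M = mat n n (\<lambda>(i, j). if j = 0 then vec_index v i else if j = k then of_bool (i = 0) else of_bool (i = j))"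
  have M: "M \<in> carrier_mat n n" by (simp add: M_def)
  have "det M \<noteq> 0"
  proof
    assume "det M = 0"
    then obtain w where w: "w \<in> carrier_vec n" "w \<noteq> 0\<^sub>v n" "M *\<^sub>v w = 0\<^sub>v n"
      using det_0_iff_vec_prod_zero_field[OF M] by blast
    have Mw: "(\<Sum>j<n. M $$ (i, j) * vec_index w j) = 0" if "i < n" for i
    proof -
      have "vec_index (M *\<^sub>v w) i = 0" using w(3) that by simp
      then show ?thesis using that M w(1) by (simp add: scalar_prod_def lessThan_atLeast0)
    qed
    have "(\<Sum>j<n. M $$ (k, j) * vec_index w j) = (\<Sum>j<n. if j = 0 then vec_index v k * vec_index w 0 else 0)"
      using k by (intro sum.cong) (auto simp: M_def)
    then have "vec_index v k * vec_index w 0 = 0" using Mw[OF k(1)] k by (simp add: sum.delta)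
    then have w0: "vec_index w 0 = 0" using k by simp
    have w1: "vec_index w i = 0" if i: "i < n" "i \<noteq> 0" "i \<noteq> k" for i
    proof -
      have "(\<Sum>j<n. M $$ (i, j) * vec_index w j) = (\<Sum>j<n. if j = i then vec_index w i else 0)"
        using i w0 by (intro sum.cong) (auto simp: M_def)
      then show ?thesis using Mw[OF i(1)] i by (simp add: sum.delta)
    qed
    have w2: "vec_index w k = 0"
    proof (cases "k = 0")
      case False
      have "(\<Sum>j<n. M $$ (0, j) * vec_index w j) = (\<Sum>j<n. if j = k then vec_index w k else 0)"
        using k w0 w1 False by (intro sum.cong) (auto simp: M_def)
      then show ?thesis using Mw[of 0] k by (simp add: sum.delta)
    qed (use w0 in simp)
    have "w = 0\<^sub>v n"
    proof (rule eq_vecI)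
      fix i assume "i < dim_vec (0\<^sub>v n :: 'a vec)"
      then show "vec_index w i = vec_index (0\<^sub>v n) i" using w0 w1 w2 by (cases "i = 0 \<or> i = k") auto
    qed (use w in simp)
    with w(2) show False by simp
  qed
  then obtain Q where "inverse_mats n M Q" by (rule det_inverse[OF M])
  moreover have "M *\<^sub>v unit_vec n 0 = v"
    using v(1) k M by (intro eq_vecI) (auto simp: M_def scalar_prod_right_unit)
  ultimately show thesis by (rule that)
qed

text \<open>The power is written as a word in a constant family, so that the lemmas on similarity
  and on triangular blocks apply to it.\<close>

abbreviation power_trace :: "nat \<Rightarrow> 'a::comm_ring_1 mat \<Rightarrow> nat \<Rightarrow> 'a" where
  "power_trace n N k \<equiv> mtrace (word_mat n (\<lambda>_. N) (replicate k 0))"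

text \<open>Deflation: in a basis beginning with the eigenvector the matrix is block triangular,
  with the eigenvalue in the corner.\<close>

lemma power_trace_eigenvector:
  fixes N :: "'a::field mat"
  assumes N: "N \<in> carrier_mat (Suc n) (Suc n)"
    and v: "v \<in> carrier_vec (Suc n)" "v \<noteq> 0\<^sub>v (Suc n)" "N *\<^sub>v v = c \<cdot>\<^sub>v v"
  obtains N' where "N' \<in> carrier_mat n n"
    "\<And>k. power_trace (Suc n) N k = c ^ k + power_trace n N' k"
proof -
  obtain P Q where PQ: "inverse_mats (Suc n) P Q" and Pv: "P *\<^sub>v unit_vec (Suc n) 0 = v"
    using first_column[OF v(1,2)] .
  note pq = inverse_matsD[OF PQ]
  define M where "M = Q * N * P"
  have M: "M \<in> carrier_mat (Suc n) (Suc n)" using pq N by (simp add: M_def)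
  have "M *\<^sub>v unit_vec (Suc n) 0 = Q *\<^sub>v (N *\<^sub>v v)"
    using pq N by (simp add: M_def assoc_mult_mat_vec[of _ "Suc n" "Suc n" _ "Suc n"] Pv)
  also have "\<dots> = c \<cdot>\<^sub>v (Q *\<^sub>v v)" unfolding v(3) by (rule mult_mat_vec[OF pq(2) v(1)])
  also have "Q *\<^sub>v v = (Q * P) *\<^sub>v unit_vec (Suc n) 0"
    using assoc_mult_mat_vec[OF pq(2,1), of "unit_vec (Suc n) 0"] by (simp add: Pv)
  finally have e0: "M *\<^sub>v unit_vec (Suc n) 0 = c \<cdot>\<^sub>v unit_vec (Suc n) 0" by (simp add: pq(4))
  have col: "M $$ (i, 0) = (if i = 0 then c else 0)" if "i < Suc n" for i
    using arg_cong[OF e0, of "\<lambda>u. vec_index u i"] M that by (simp add: scalar_prod_right_unit)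
  define N' where "N' = mat n n (\<lambda>(i, j). M $$ (Suc i, Suc j))"
  define R where "R = mat 1 n (\<lambda>(i, j). M $$ (0, Suc j))"
  define C where "C = mat 1 1 (\<lambda>_. c)"
  have blk: "M = four_block_mat C R (0\<^sub>m n 1) N'"
    using M col by (intro eq_matI) (auto simp: N'_def R_def C_def)
  have C: "word_mat 1 (\<lambda>_. C) (replicate k 0) = mat 1 1 (\<lambda>_. c ^ k)" for k
  proof (induction k)
    case (Suc k)
    then show ?case by (intro eq_matI) (auto simp: C_def scalar_prod_def)
  qed (auto intro!: eq_matI)
  have f: "family 1 (\<lambda>_. C)" "family n (\<lambda>_. N')" "R \<in> carrier_mat 1 n" by (auto simp: family_def C_def N'_def R_def)
  have "power_trace (Suc n) N k = c ^ k + power_trace n N' k" for k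
  proof -
    obtain B where "word_mat (1 + n) (\<lambda>_. M) (replicate k 0) =
        four_block_mat (word_mat 1 (\<lambda>_. C) (replicate k 0)) B (0\<^sub>m n 1) (word_mat n (\<lambda>_. N') (replicate k 0))"
      using word_mat_four_block[of 1 "\<lambda>_. C" "\<lambda>_. R" n "\<lambda>_. N'" "replicate k 0"] f unfolding blk by blast
    then have "power_trace (Suc n) M k = mtrace (mat 1 1 (\<lambda>_. c ^ k)) + power_trace n N' k"
      unfolding plus_1_eq_Suc using mtrace_four_block[OF word_mat_carrier[OF f(1), of "replicate k 0"]
        word_mat_carrier[OF f(2), of "replicate k 0"], of B "0\<^sub>m n 1"]
      by (simp only: C)
    moreover have "power_trace (Suc n) M k = power_trace (Suc n) N k"
    proof (rule mtrace_word_similar)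
      show "family (Suc n) (\<lambda>_. N)" using N by (simp add: family_def)
      show "similar_fam (Suc n) (\<lambda>_. N) (\<lambda>_. M)"
        using inverse_mats_sym[OF PQ] by (auto simp: similar_fam_def M_def)
    qed
    ultimately show ?thesis by (simp add: mtrace_def)
  qed
  then show thesis by (rule that[of N', rotated]) (simp add: N'_def)
qed

lemma power_trace_eigenvalues:
  fixes N :: "'a::alg_closed_field mat"
  assumes "N \<in> carrier_mat n n"
  shows "\<exists>as. \<forall>k. power_trace n N k = (\<Sum>a\<leftarrow>as. a ^ k)"
  using assms
proof (induction n arbitrary: N)
  case 0
  have "power_trace 0 N k = 0" for k
  proof -
    have "word_mat 0 (\<lambda>_. N) (replicate k 0) \<in> carrier_mat 0 0"
      using 0 by (intro word_mat_carrier) (simp add: family_def)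
    then show ?thesis by (simp add: mtrace_def)
  qed
  then show ?case by (intro exI[of _ "[]"]) simp
next
  case (Suc n)
  have "degree (char_poly N) = Suc n" using degree_monic_char_poly[OF Suc.prems] by simp
  then obtain c where "poly (char_poly N) c = 0" using alg_closed_imp_poly_has_root[of "char_poly N"] by auto
  then obtain v where v: "v \<in> carrier_vec (Suc n)" "v \<noteq> 0\<^sub>v (Suc n)" "N *\<^sub>v v = c \<cdot>\<^sub>v v"
    using eigenvalue_root_char_poly[OF Suc.prems] Suc.prems by (auto simp: eigenvalue_def eigenvector_def)
  obtain N' where N': "N' \<in> carrier_mat n n" "\<And>k. power_trace (Suc n) N k = c ^ k + power_trace n N' k"
    by (rule power_trace_eigenvector[OF Suc.prems v]) blast
  obtain as where "\<And>k. power_trace n N' k = (\<Sum>a\<leftarrow>as. a ^ k)" using Suc.IH[OF N'(1)] by blast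
  then show ?case using N'(2) by (intro exI[of _ "c # as"]) simp
qed

text \<open>Sum the values of a polynomial \<open>f\<close> with zero constant term that vanishes on
  all list elements other than 1. The sum is a combination of positive power sums, hence zero; but
  it is also the multiplicity of 1 times \<open>poly f 1\<close>, which is nonzero in characteristic
  zero if 1 occurs.\<close>

lemma power_sums_zero:
  fixes as :: "'a::field_char_0 list"
  assumes "\<And>k. 0 < k \<Longrightarrow> (\<Sum>a\<leftarrow>as. a ^ k) = 0"
  shows "1 \<notin> set as"
proof
  assume 1: "1 \<in> set as"
  define f where "f = [:0, 1:] * (\<Prod>b\<in>set as - {1}. [:- b, 1:])"
  have f0: "coeff f 0 = 0" by (simp add: f_def coeff_mult)
  have fa: "poly f a = (if a = 1 then poly f 1 else 0)" if "a \<in> set as" for a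
    using that by (auto simp: f_def poly_prod prod_zero_iff)
  have f1: "poly f 1 \<noteq> 0"
    by (auto simp: f_def poly_prod prod_zero_iff)
  have "(\<Sum>a\<leftarrow>as. poly f a) = (\<Sum>a\<leftarrow>as. \<Sum>i\<le>degree f. coeff f i * a ^ i)"
    by (simp add: poly_altdef)
  also have "\<dots> = (\<Sum>i\<le>degree f. coeff f i * (\<Sum>a\<leftarrow>as. a ^ i))"
    by (induction as) (simp_all add: sum.distrib distrib_left)
  also have "\<dots> = 0"
  proof (rule sum.neutral, rule ballI)
    fix i show "coeff f i * (\<Sum>a\<leftarrow>as. a ^ i) = 0"
      using f0 assms[of i] by (cases "i = 0") auto
  qed
  finally have "(\<Sum>a\<leftarrow>as. poly f a) = 0" .
  moreover have "(\<Sum>a\<leftarrow>as. poly f a) = (\<Sum>a\<leftarrow>as. if a = 1 then poly f 1 else 0)"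
    by (intro arg_cong[of _ _ sum_list] map_cong refl fa)
  moreover have "(\<Sum>a\<leftarrow>xs. if a = 1 then poly f 1 else 0) = of_nat (count_list xs 1) * poly f 1" for xs
    by (induction xs) (auto simp: algebra_simps)
  ultimately have "of_nat (count_list as 1) * poly f 1 = 0" by metis
  then have "count_list as 1 = 0" using f1 by simp
  with 1 show False by (simp add: count_list_0_iff)
qed

lemma fixed_vector_power_trace:
  fixes N :: "'a::{alg_closed_field, field_char_0} mat"
  assumes N: "N \<in> carrier_mat n n" and u: "u \<in> carrier_vec n" "u \<noteq> 0\<^sub>v n" "N *\<^sub>v u = u"
  shows "\<exists>k. power_trace n N (Suc k) \<noteq> 0"
proof (rule ccontr)
  assume *: "\<not> ?thesis"
  have "n \<noteq> 0"
  proof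
    assume "n = 0" then have "u = 0\<^sub>v n" using u(1) by (intro eq_vecI) auto
    with u(2) show False by simp
  qed
  then obtain n' where n: "n = Suc n'" by (cases n) auto
  have "N *\<^sub>v u = 1 \<cdot>\<^sub>v u" using u(3) by simp
  then obtain N' where N': "N' \<in> carrier_mat n' n'" "\<And>k. power_trace n N k = 1 ^ k + power_trace n' N' k"
    using power_trace_eigenvector[of N n' u 1] N u unfolding n by blast
  obtain as where as: "\<And>k. power_trace n' N' k = (\<Sum>a\<leftarrow>as. a ^ k)"
    using power_trace_eigenvalues[OF N'(1)] by blast
  have "(\<Sum>a\<leftarrow>1 # as. a ^ k) = 0" if "0 < k" for k
    using * N'(2)[of k] as[of k] that by (cases k) (auto simp del: replicate.simps)
  from power_sums_zero[OF this] show False by simp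
qed

text \<open>By irreducibility some product of \<open>r\<close> and \<open>p\<close> fixes a nonzero
  vector, so it has the eigenvalue 1 and one of its powers has a nonzero trace. This power again has
  the right factor \<open>p\<close>.\<close>

lemma ideal_nonzero_trace:
  fixes s :: "nat \<Rightarrow> 'a::{alg_closed_field, field_char_0} mat"
  assumes s: "irreducible_fam k s" and p: "nc_eval k s p \<noteq> 0\<^sub>m k k"
  shows "\<exists>r. mtrace (nc_eval k s (nc_mult r p)) \<noteq> 0"
proof -
  have fs: "family k s" using s by (simp add: irreducible_fam_def)
  obtain u where u: "u \<in> carrier_vec k" "nc_eval k s p *\<^sub>v u \<noteq> 0\<^sub>v k"
    using nonzero_mat_vec[OF nc_eval_carrier[OF fs] p] .
  obtain r where r: "nc_eval k s r *\<^sub>v (nc_eval k s p *\<^sub>v u) = u"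
    by (rule irreducible_famE[OF s _ u(2) u(1)]) (use fs u nc_eval_vec in auto)
  define N where "N = nc_eval k s (nc_mult r p)"
  have N: "N \<in> carrier_mat k k" using fs by (simp add: N_def)
  have Nu: "N *\<^sub>v u = u" using fs u r by (simp add: N_def nc_eval_vec)
  have "u \<noteq> 0\<^sub>v k"
  proof
    assume "u = 0\<^sub>v k"
    then have "nc_eval k s p *\<^sub>v u = 0\<^sub>v k"
      using mat_zero_vec[OF nc_eval_carrier[OF fs, of p]] by simp
    with u(2) show False by simp
  qed
  then obtain m where m: "power_trace k N (Suc m) \<noteq> 0" using fixed_vector_power_trace[OF N u(1) _ Nu] by blast
  have "\<exists>q. word_mat k (\<lambda>_. N) (replicate (Suc m) 0) = nc_eval k s (nc_mult q p)" for m
  proof (induction m)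
    case 0
    show ?case using N by (intro exI[of _ r]) (simp add: N_def)
  next
    case (Suc m)
    then obtain q where q: "word_mat k (\<lambda>_. N) (replicate (Suc m) 0) = nc_eval k s (nc_mult q p)" by blast
    have "word_mat k (\<lambda>_. N) (replicate (Suc (Suc m)) 0) = N * nc_eval k s (nc_mult q p)"
      using q by simp
    also have "\<dots> = nc_eval k s (nc_mult (nc_mult (nc_mult r p) q) p)"
      using fs by (simp add: N_def nc_eval_mult assoc_mult_mat[of _ k k _ k _ k])
    finally show ?case by blast
  qed
  with m show ?thesis by metis
qed

definition total_trace :: "(nat \<times> (nat \<Rightarrow> 'a::comm_ring_1 mat)) list \<Rightarrow> nat list \<Rightarrow> 'a" where
  "total_trace S w = (\<Sum>x\<leftarrow>S. mtrace (word_mat (fst x) (snd x) w))"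

lemma total_trace_nc_eval:
  assumes "\<And>x. x \<in> set S \<Longrightarrow> family (fst x) (snd x)"
  shows "(\<Sum>x\<leftarrow>S. mtrace (nc_eval (fst x) (snd x) p)) = (\<Sum>(c, w)\<leftarrow>p. c * total_trace S w)"
  using assms
proof (induction S)
  case Nil
  show ?case by (induction p) (auto simp: total_trace_def)
next
  case (Cons x S)
  have "(\<Sum>(c, w)\<leftarrow>p. c * total_trace (x # S) w) =
      (\<Sum>(c, w)\<leftarrow>p. c * mtrace (word_mat (fst x) (snd x) w)) + (\<Sum>(c, w)\<leftarrow>p. c * total_trace S w)"
    by (induction p) (auto simp: total_trace_def algebra_simps)
  then show ?case using Cons by (simp add: mtrace_nc_eval)
qed

text \<open>Some \<open>p\<close> acts as zero on all the irreducible families not similar to \<open>s\<close> and has a nonzero trace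
  on \<open>s\<close>.  In characteristic zero its total traces then show the multiplicities of \<open>s\<close>.\<close>

lemma irreducible_match:
  fixes s :: "nat \<Rightarrow> 'a::{alg_closed_field, field_char_0} mat"
  assumes S: "\<And>x. x \<in> set ((k, s) # S) \<Longrightarrow> irreducible_fam (fst x) (snd x)"
    and T: "\<And>x. x \<in> set T \<Longrightarrow> irreducible_fam (fst x) (snd x)"
    and eq: "\<And>w. total_trace ((k, s) # S) w = total_trace T w"
  shows "\<exists>t. (k, t) \<in> set T \<and> similar_fam k t s"
proof (rule ccontr)
  assume *: "\<not> ?thesis"
  let ?sim = "\<lambda>x. fst x = k \<and> similar_fam k (snd x) s"
  have s: "irreducible_fam k s" using S[of "(k, s)"] by simp
  have fam: "family (fst x) (snd x)" if "x \<in> set ((k, s) # S) \<or> x \<in> set T" for x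
    using that S T by (auto simp: irreducible_fam_def)
  have "\<exists>p. (\<forall>(l, t)\<in>set (filter (\<lambda>x. \<not> ?sim x) (S @ T)). nc_eval l t p = 0\<^sub>m l l) \<and> nc_eval k s p \<noteq> 0\<^sub>m k k"
    by (rule annihilator_separation_list[OF s]) (use S T in fastforce)
  then obtain p where p: "\<And>x. x \<in> set (S @ T) \<Longrightarrow> \<not> ?sim x \<Longrightarrow> nc_eval (fst x) (snd x) p = 0\<^sub>m (fst x) (fst x)"
    "nc_eval k s p \<noteq> 0\<^sub>m k k" by fastforce
  obtain r where r: "mtrace (nc_eval k s (nc_mult r p)) \<noteq> 0" using ideal_nonzero_trace[OF s p(2)] by blast
  let ?q = "nc_mult r p"
  have val: "mtrace (nc_eval (fst x) (snd x) ?q) = (if ?sim x then mtrace (nc_eval k s ?q) else 0)"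
    if "x \<in> set ((k, s) # S) \<or> x \<in> set T" for x
  proof (cases "?sim x")
    case True
    then have "mtrace (word_mat k s w) = mtrace (word_mat (fst x) (snd x) w)" for w
      using mtrace_word_similar[of k "snd x" s w] fam[OF that] by auto
    then show ?thesis using True fam[OF that] s by (auto simp: mtrace_nc_eval irreducible_fam_def)
  next
    case False
    then have "x \<in> set (S @ T)" using that similar_fam_refl[of k s] s by (auto simp: irreducible_fam_def)
    then have "nc_eval (fst x) (snd x) ?q = 0\<^sub>m (fst x) (fst x)"
      using p(1)[OF _ False] fam[OF that] by (simp add: nc_eval_mult right_mult_zero_mat[of _ "fst x" "fst x"])
    then show ?thesis using False by (auto simp: mtrace_zero)
  qed
  have "(\<Sum>x\<leftarrow>T. mtrace (nc_eval (fst x) (snd x) ?q)) = (\<Sum>x\<leftarrow>T. 0)"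
    by (intro arg_cong[of _ _ sum_list] map_cong refl) (use val * in \<open>auto split: if_splits\<close>)
  then have "(\<Sum>x\<leftarrow>T. mtrace (nc_eval (fst x) (snd x) ?q)) = 0" by simp
  moreover have "(\<Sum>x\<leftarrow>(k, s) # S. mtrace (nc_eval (fst x) (snd x) ?q)) =
      (\<Sum>x\<leftarrow>(k, s) # S. if ?sim x then mtrace (nc_eval k s ?q) else 0)"
    by (intro arg_cong[of _ _ sum_list] map_cong refl val) auto
  moreover have "(\<Sum>x\<leftarrow>X. if ?sim x then z else 0) = of_nat (length (filter ?sim X)) * z" for X and z :: 'a
    by (induction X) (auto simp: algebra_simps)
  moreover have "(\<Sum>x\<leftarrow>(k, s) # S. mtrace (nc_eval (fst x) (snd x) ?q)) =
      (\<Sum>x\<leftarrow>T. mtrace (nc_eval (fst x) (snd x) ?q))"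
    using total_trace_nc_eval[of "(k, s) # S" ?q] total_trace_nc_eval[of T ?q] fam eq by auto
  ultimately have "of_nat (length (filter ?sim ((k, s) # S))) * mtrace (nc_eval k s ?q) = 0" by metis
  then have "filter ?sim ((k, s) # S) = []" using r by (simp del: filter.simps)
  then show False using similar_fam_refl[of k s] s by (simp add: irreducible_fam_def)
qed

section \<open>Semisimple families\<close>

definition block_sum :: "nat \<Rightarrow> (nat \<Rightarrow> 'a::zero mat) \<Rightarrow> nat \<Rightarrow> (nat \<Rightarrow> 'a mat) \<Rightarrow> nat \<Rightarrow> 'a mat" where
  "block_sum p a q b i = four_block_mat (a i) (0\<^sub>m p q) (0\<^sub>m q p) (b i)"

definition fam_dim :: "(nat \<times> (nat \<Rightarrow> 'a mat)) list \<Rightarrow> nat" where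
  "fam_dim S = sum_list (map fst S)"

primrec fam_sum :: "(nat \<times> (nat \<Rightarrow> 'a::zero mat)) list \<Rightarrow> nat \<Rightarrow> 'a mat" where
  "fam_sum [] = (\<lambda>i. 0\<^sub>m 0 0)"
| "fam_sum (x # S) = block_sum (fst x) (snd x) (fam_dim S) (fam_sum S)"

lemma fam_dim_simps [simp]: "fam_dim [] = 0" "fam_dim (x # S) = fst x + fam_dim S"
  "fam_dim (S @ T) = fam_dim S + fam_dim T"
  by (simp_all add: fam_dim_def)

lemma family_block_sum: "family p a \<Longrightarrow> family q b \<Longrightarrow> family (p + q) (block_sum p a q b)"
  by (auto simp: family_def block_sum_def)

lemma family_fam_sum: "(\<And>x. x \<in> set S \<Longrightarrow> family (fst x) (snd x)) \<Longrightarrow> family (fam_dim S) (fam_sum S)"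
proof (induction S)
  case Nil
  then show ?case by (simp add: family_def)
next
  case (Cons x S)
  then show ?case by (simp add: family_block_sum)
qed

lemma mtrace_word_fam_sum:
  "(\<And>x. x \<in> set S \<Longrightarrow> family (fst x) (snd x)) \<Longrightarrow>
    mtrace (word_mat (fam_dim S) (fam_sum S) w) = total_trace S w"
proof (induction S)
  case Nil
  have "word_mat 0 (\<lambda>i. 0\<^sub>m 0 0 :: 'a mat) w \<in> carrier_mat 0 0"
    by (intro word_mat_carrier) (simp add: family_def)
  then show ?case by (simp add: mtrace_def total_trace_def)
next
  case (Cons x S)
  have f: "family (fst x) (snd x)" "family (fam_dim S) (fam_sum S)" using Cons.prems by (auto intro: family_fam_sum)
  obtain B where "word_mat (fst x + fam_dim S) (block_sum (fst x) (snd x) (fam_dim S) (fam_sum S)) w =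
      four_block_mat (word_mat (fst x) (snd x) w) B (0\<^sub>m (fam_dim S) (fst x)) (word_mat (fam_dim S) (fam_sum S) w)"
    using word_mat_four_block[of "fst x" "snd x" "\<lambda>_. 0\<^sub>m (fst x) (fam_dim S)" "fam_dim S" "fam_sum S" w] f
    unfolding block_sum_def[abs_def] by auto
  then show ?case
    using mtrace_four_block[OF word_mat_carrier[OF f(1), of w] word_mat_carrier[OF f(2), of w]] Cons
    by (simp add: total_trace_def)
qed

lemma inverse_mats_block:
  assumes "inverse_mats p P Q" "inverse_mats q P' Q'"
  shows "inverse_mats (p + q) (four_block_mat P (0\<^sub>m p q) (0\<^sub>m q p) P') (four_block_mat Q (0\<^sub>m p q) (0\<^sub>m q p) Q')"
proof -
  note a = inverse_matsD[OF assms(1)] and b = inverse_matsD[OF assms(2)]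
  have one: "four_block_mat (1\<^sub>m p) (0\<^sub>m p q) (0\<^sub>m q p) (1\<^sub>m q) = (1\<^sub>m (p + q) :: 'a mat)"
    by (intro eq_matI) auto
  show ?thesis
    unfolding inverse_mats_def
    using a b by (auto simp: mult_four_block_mat[of _ p p _ q _ q _ _ p _ q] one
        right_mult_zero_mat[of _ p p] right_mult_zero_mat[of _ q q] left_mult_zero_mat[of _ q q] left_mult_zero_mat[of _ p p])
qed

lemma conj_four_block:
  fixes A :: "'a::comm_ring_1 mat"
  assumes "inverse_mats p P Q" "inverse_mats q P' Q'"
    and c: "A \<in> carrier_mat p p" "B \<in> carrier_mat p q" "D \<in> carrier_mat q q"
  shows "four_block_mat P (0\<^sub>m p q) (0\<^sub>m q p) P' * four_block_mat A B (0\<^sub>m q p) D *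
      four_block_mat Q (0\<^sub>m p q) (0\<^sub>m q p) Q' =
    four_block_mat (P * A * Q) (P * B * Q') (0\<^sub>m q p) (P' * D * Q')"
proof -
  note a = inverse_matsD[OF assms(1)] and b = inverse_matsD[OF assms(2)]
  have 1: "four_block_mat P (0\<^sub>m p q) (0\<^sub>m q p) P' * four_block_mat A B (0\<^sub>m q p) D =
      four_block_mat (P * A) (P * B) (0\<^sub>m q p) (P' * D)"
    using a b c by (subst mult_four_block_mat[of _ p p _ q _ q _ _ p _ q])
      (auto simp: left_mult_zero_mat[of _ q q] left_mult_zero_mat[of _ q p] left_mult_zero_mat[of _ p p]
       left_mult_zero_mat[of _ p q] right_mult_zero_mat[of _ q q] right_add_zero_mat[of _ p p] right_add_zero_mat[of _ p q]
       left_add_zero_mat[of _ q q])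
  have 2: "four_block_mat (P * A) (P * B) (0\<^sub>m q p) (P' * D) * four_block_mat Q (0\<^sub>m p q) (0\<^sub>m q p) Q' =
      four_block_mat (P * A * Q) (P * B * Q') (0\<^sub>m q p) (P' * D * Q')"
    using a b c by (subst mult_four_block_mat[of _ p p _ q _ q _ _ p _ q])
      (auto simp: left_mult_zero_mat[of _ p p] left_mult_zero_mat[of _ p q] right_mult_zero_mat[of _ p p]
       right_mult_zero_mat[of _ p q] right_mult_zero_mat[of _ q q] right_add_zero_mat[of _ p p] left_add_zero_mat[of _ p q]
       left_add_zero_mat[of _ q q])
  show ?thesis unfolding 1 2 ..
qed

lemma similar_block_sum:
  assumes "family p a" "family q b" "similar_fam p a a'" "similar_fam q b b'"
  shows "similar_fam (p + q) (block_sum p a q b) (block_sum p a' q b')"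
proof -
  obtain P Q P' Q' where PQ: "inverse_mats p P Q" "\<And>i. a' i = P * a i * Q"
    "inverse_mats q P' Q'" "\<And>i. b' i = P' * b i * Q'"
    using assms(3,4) by (auto simp: similar_fam_def)
  have "block_sum p a' q b' i = four_block_mat P (0\<^sub>m p q) (0\<^sub>m q p) P' * block_sum p a q b i *
      four_block_mat Q (0\<^sub>m p q) (0\<^sub>m q p) Q'" for i
    unfolding block_sum_def PQ(2,4) using assms(1,2) inverse_matsD[OF PQ(1)] inverse_matsD[OF PQ(3)]
    by (subst conj_four_block[OF PQ(1,3)])
      (auto simp: family_def right_mult_zero_mat[of _ p p] left_mult_zero_mat[of _ q q])
  with inverse_mats_block[OF PQ(1,3)] show ?thesis by (auto simp: similar_fam_def)
qed

lemma block_sum_assoc: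
  assumes "family p a" "family q b" "family r c"
  shows "block_sum p a (q + r) (block_sum q b r c) = block_sum (p + q) (block_sum p a q b) r c"
proof
  fix i
  have "a i \<in> carrier_mat p p" "b i \<in> carrier_mat q q" "c i \<in> carrier_mat r r"
    using assms by (auto simp: family_def)
  then show "block_sum p a (q + r) (block_sum q b r c) i = block_sum (p + q) (block_sum p a q b) r c i"
    unfolding block_sum_def by (intro eq_matI) (auto simp: not_less)
qed

lemma block_sum_swap:
  fixes a b :: "nat \<Rightarrow> 'a::comm_ring_1 mat"
  assumes "family p a" "family q b"
  shows "similar_fam (p + q) (block_sum p a q b) (block_sum q b p a)"
proof -
  let ?P = "four_block_mat (0\<^sub>m q p) (1\<^sub>m q) (1\<^sub>m p) (0\<^sub>m p q) :: 'a mat"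
  let ?Q = "four_block_mat (0\<^sub>m p q) (1\<^sub>m p) (1\<^sub>m q) (0\<^sub>m q p) :: 'a mat"
  have one: "four_block_mat (1\<^sub>m p) (0\<^sub>m p q) (0\<^sub>m q p) (1\<^sub>m q) = (1\<^sub>m (p + q) :: 'a mat)" for p q
    by (intro eq_matI) auto
  have PQ: "?P * ?Q = 1\<^sub>m (q + p)"
    by (subst mult_four_block_mat[of _ q p _ q _ p _ _ q _ p]) (auto simp: one)
  have QP: "?Q * ?P = 1\<^sub>m (p + q)"
    by (subst mult_four_block_mat[of _ p q _ p _ q _ _ p _ q]) (auto simp: one)
  have car: "?P \<in> carrier_mat (p + q) (p + q)" "?Q \<in> carrier_mat (p + q) (p + q)" by (auto simp: add.commute)
  have inv: "inverse_mats (p + q) ?P ?Q"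
    using PQ QP car by (simp add: inverse_mats_def add.commute)
  have "block_sum q b p a i = ?P * block_sum p a q b i * ?Q" for i
  proof -
    have c: "a i \<in> carrier_mat p p" "b i \<in> carrier_mat q q" using assms by (auto simp: family_def)
    have 1: "?P * block_sum p a q b i = four_block_mat (0\<^sub>m q p) (b i) (a i) (0\<^sub>m p q)"
      unfolding block_sum_def using c
      by (subst mult_four_block_mat[of _ q p _ q _ p _ _ p _ q])
        (auto simp: left_mult_zero_mat[of _ p p] left_mult_zero_mat[of _ q q] right_add_zero_mat[of _ p p] left_add_zero_mat[of _ q q])
    have 2: "four_block_mat (0\<^sub>m q p) (b i) (a i) (0\<^sub>m p q) * ?Q = block_sum q b p a i"
      unfolding block_sum_def using c
      by (subst mult_four_block_mat[of _ q p _ q _ p _ _ q _ p])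
        (auto simp: right_mult_zero_mat[of _ p p] right_mult_zero_mat[of _ q q] right_add_zero_mat[of _ p p] left_add_zero_mat[of _ q q])
    show ?thesis unfolding 1 2 ..
  qed
  with inv show ?thesis by (auto simp: similar_fam_def)
qed

lemma fam_sum_append:
  assumes "\<And>x. x \<in> set (S @ T) \<Longrightarrow> family (fst x) (snd x)"
  shows "fam_sum (S @ T) = block_sum (fam_dim S) (fam_sum S) (fam_dim T) (fam_sum T)"
  using assms
proof (induction S)
  case Nil
  have "family (fam_dim T) (fam_sum T)" using Nil by (auto intro: family_fam_sum)
  then have "block_sum 0 (\<lambda>i. 0\<^sub>m 0 0) (fam_dim T) (fam_sum T) i = fam_sum T i" for i
    unfolding block_sum_def by (intro eq_matI) (auto simp: family_def)
  then show ?case by (intro ext) simp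
next
  case (Cons x S)
  have "family (fst x) (snd x)" "family (fam_dim S) (fam_sum S)" "family (fam_dim T) (fam_sum T)"
    using Cons.prems by (auto intro!: family_fam_sum)
  then show ?case using Cons by (simp add: block_sum_assoc)
qed

lemma fam_sum_to_front:
  fixes T :: "(nat \<times> (nat \<Rightarrow> 'a::comm_ring_1 mat)) list"
  assumes "\<And>x. x \<in> set T \<Longrightarrow> family (fst x) (snd x)" "y \<in> set T"
  obtains T' where "similar_fam (fam_dim T) (fam_sum T) (fam_sum (y # T'))" "set T' \<subseteq> set T"
    "fam_dim T = fam_dim (y # T')" "\<And>w. total_trace T w = total_trace (y # T') w"
proof -
  obtain U V where T: "T = U @ y # V" using assms(2) by (auto simp: in_set_conv_decomp)
  let ?u = "fam_dim U" and ?v = "fam_dim V"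
  have f: "family (fst y) (snd y)" "family ?u (fam_sum U)" "family ?v (fam_sum V)"
    using assms(1) by (auto simp: T intro!: family_fam_sum)
  have e1: "fam_sum T = block_sum ?u (fam_sum U) (fst y + ?v) (block_sum (fst y) (snd y) ?v (fam_sum V))"
    using fam_sum_append[of U "y # V"] assms(1) by (simp add: T)
  have "\<dots> = block_sum (?u + fst y) (block_sum ?u (fam_sum U) (fst y) (snd y)) ?v (fam_sum V)"
    by (rule block_sum_assoc[OF f(2,1,3)])
  also note e1[symmetric]
  finally have e1: "fam_sum T = block_sum (?u + fst y) (block_sum ?u (fam_sum U) (fst y) (snd y)) ?v (fam_sum V)" .
  have "fam_sum (y # U @ V) = block_sum (fst y) (snd y) (?u + ?v) (block_sum ?u (fam_sum U) ?v (fam_sum V))"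
    using fam_sum_append[of U V] assms(1) by (simp add: T)
  also have "\<dots> = block_sum (fst y + ?u) (block_sum (fst y) (snd y) ?u (fam_sum U)) ?v (fam_sum V)"
    by (rule block_sum_assoc[OF f])
  finally have e2: "fam_sum (y # U @ V) = block_sum (fst y + ?u) (block_sum (fst y) (snd y) ?u (fam_sum U)) ?v (fam_sum V)" .
  have "similar_fam (?u + fst y + ?v) (fam_sum T) (block_sum (?u + fst y) (block_sum (fst y) (snd y) ?u (fam_sum U)) ?v (fam_sum V))"
    unfolding e1 using f
    by (intro similar_block_sum family_block_sum block_sum_swap similar_fam_refl)
  then have "similar_fam (fam_dim T) (fam_sum T) (fam_sum (y # U @ V))"
    unfolding e2 by (simp add: T add.commute add.left_commute)
  then show thesis
    by (rule that) (auto simp: T total_trace_def)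
qed

text \<open>The first summand of \<open>S\<close> has a similar partner in \<open>T\<close>; it is
  moved to the front, its traces are cancelled and the rest follows by induction. At the end, the
  trace of the empty word shows that \<open>T\<close> has dimension zero.\<close>

lemma fam_sum_similar:
  fixes S T :: "(nat \<times> (nat \<Rightarrow> 'a::{alg_closed_field, field_char_0} mat)) list"
  assumes "\<And>x. x \<in> set S \<Longrightarrow> irreducible_fam (fst x) (snd x)"
    "\<And>x. x \<in> set T \<Longrightarrow> irreducible_fam (fst x) (snd x)"
    "\<And>w. total_trace S w = total_trace T w"
  shows "fam_dim S = fam_dim T \<and> similar_fam (fam_dim T) (fam_sum T) (fam_sum S)"
  using assms
proof (induction S arbitrary: T)
  case Nil
  have "total_trace T [] = (of_nat (fam_dim T) :: 'a)"
    by (induction T) (auto simp: total_trace_def mtrace_one)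
  then have "fam_dim T = 0" using Nil.prems(3)[of "[]"] by (simp add: total_trace_def)
  moreover have "fst x > 0" if "x \<in> set T" for x using Nil.prems(2)[OF that] by (simp add: irreducible_fam_def)
  ultimately have "T = []"
  proof (cases T)
    case (Cons x U)
    then show ?thesis using \<open>fam_dim T = 0\<close> \<open>\<And>x. x \<in> set T \<Longrightarrow> fst x > 0\<close>[of x] by simp
  qed
  then show ?case by (simp add: similar_fam_refl family_def)
next
  case (Cons x S)
  obtain k s where x: "x = (k, s)" by (cases x)
  have fT: "family (fst x) (snd x)" if "x \<in> set T" for x
    using Cons.prems(2)[OF that] by (simp add: irreducible_fam_def)
  have "\<exists>t. (k, t) \<in> set T \<and> similar_fam k t s"
    by (rule irreducible_match[where S = S]) (use Cons.prems in \<open>auto simp: x\<close>)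
  then obtain t where t: "(k, t) \<in> set T" "similar_fam k t s" by blast
  obtain T' where T': "similar_fam (fam_dim T) (fam_sum T) (fam_sum ((k, t) # T'))" "set T' \<subseteq> set T"
    "fam_dim T = fam_dim ((k, t) # T')" "\<And>w. total_trace T w = total_trace ((k, t) # T') w"
    by (rule fam_sum_to_front[of T, OF _ t(1)]) (use fT in auto)
  have ft: "family k t" using fT[OF t(1)] by simp
  have fT': "family (fam_dim T') (fam_sum T')" using fT T'(2) by (intro family_fam_sum) auto
  have "total_trace S w = total_trace T' w" for w
    using Cons.prems(3)[of w] T'(4)[of w] mtrace_word_similar[OF ft t(2), of w] by (simp add: total_trace_def x)
  then have IH: "fam_dim S = fam_dim T' \<and> similar_fam (fam_dim T') (fam_sum T') (fam_sum S)"
    using Cons.prems(1,2) T'(2) by (intro Cons.IH) auto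
  have "similar_fam (k + fam_dim T') (fam_sum ((k, t) # T')) (fam_sum (x # S))"
    using IH similar_block_sum[OF ft fT' t(2)] by (simp add: x)
  then have "similar_fam (fam_dim T) (fam_sum T) (fam_sum (x # S))"
    using T'(1,3) family_fam_sum[of T] fT by (auto intro: similar_fam_trans)
  then show ?case using IH T'(3) by (simp add: x)
qed

lemma block_one_vCons:
  fixes A :: "'a::comm_ring_1 mat"
  assumes A: "A \<in> carrier_mat n n" and y: "y \<in> carrier_vec n"
  shows "four_block_mat (1\<^sub>m 1) (0\<^sub>m 1 n) (0\<^sub>m n 1) A *\<^sub>v vCons c y = vCons c (A *\<^sub>v y)"
proof -
  let ?c = "vec 1 (\<lambda>_. c)"
  have "vCons c y = ?c @\<^sub>v y" using y by (intro eq_vecI) (auto simp: vec_index_vCons)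
  moreover have "vCons c (A *\<^sub>v y) = ?c @\<^sub>v (A *\<^sub>v y)" using A by (intro eq_vecI) (auto simp: vec_index_vCons)
  moreover have "four_block_mat (1\<^sub>m 1) (0\<^sub>m 1 n) (0\<^sub>m n 1) A *\<^sub>v (?c @\<^sub>v y) =
      (1\<^sub>m 1 *\<^sub>v ?c + 0\<^sub>m 1 n *\<^sub>v y) @\<^sub>v (0\<^sub>m n 1 *\<^sub>v ?c + A *\<^sub>v y)"
    by (rule four_block_mat_mult_vec) (use A y in auto)
  moreover have "1\<^sub>m 1 *\<^sub>v ?c + 0\<^sub>m 1 n *\<^sub>v y = ?c" "0\<^sub>m n 1 *\<^sub>v ?c + A *\<^sub>v y = A *\<^sub>v y"
    using A y by (simp_all add: zero_mat_vec)
  ultimately show ?thesis by simp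
qed

lemma smult_vec_cancel:
  fixes a b :: "'a::comm_ring_1 vec"
  assumes "a \<in> carrier_vec n" "b \<in> carrier_vec n"
  shows "(- c) \<cdot>\<^sub>v a + (c \<cdot>\<^sub>v a + b) = b"
  using assms by (intro eq_vecI) auto

text \<open>Basis extension in matrix form: in the coordinates given by \<open>Q\<close>, the
  subspace is spanned by the first \<open>d\<close> unit vectors. A nonzero vector of
  \<open>W\<close> is moved to the first unit vector, whereupon membership depends only on the
  remaining coordinates and the induction applies to these.\<close>

lemma subspace_normal_form:
  fixes W :: "'a::field vec set"
  assumes "W \<subseteq> carrier_vec n" "0\<^sub>v n \<in> W" "\<And>v w. v \<in> W \<Longrightarrow> w \<in> W \<Longrightarrow> v + w \<in> W"
    "\<And>c v. v \<in> W \<Longrightarrow> c \<cdot>\<^sub>v v \<in> W"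
  shows "\<exists>P Q d. inverse_mats n P Q \<and> d \<le> n \<and>
    (\<forall>w\<in>carrier_vec n. w \<in> W \<longleftrightarrow> (\<forall>i. d \<le> i \<and> i < n \<longrightarrow> vec_index (Q *\<^sub>v w) i = 0))"
  using assms
proof (induction n arbitrary: W)
  case 0
  have "x = 0\<^sub>v 0" if "x \<in> W" for x
  proof -
    have "dim_vec x = 0" using 0(1) that carrier_vecD by blast
    then show ?thesis by (intro eq_vecI) (simp_all only: index_zero_vec(2) less_nat_zero_code)
  qed
  with 0(2) have "W = {0\<^sub>v 0}" by blast
  then show ?case by (intro exI[of _ "1\<^sub>m 0"] exI[of _ 0]) auto
next
  case (Suc n)
  show ?case
  proof (cases "W = {0\<^sub>v (Suc n)}")
    case True
    have "w = 0\<^sub>v (Suc n) \<longleftrightarrow> (\<forall>i<Suc n. vec_index w i = 0)" if "w \<in> carrier_vec (Suc n)" for w :: "'a vec"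
      using that by (auto intro!: eq_vecI)
    then show ?thesis using True by (intro exI[of _ "1\<^sub>m (Suc n)"] exI[of _ 0]) auto
  next
    case False
    then obtain w1 where w1: "w1 \<in> W" "w1 \<noteq> 0\<^sub>v (Suc n)" using Suc.prems(2) by blast
    then have w1c: "w1 \<in> carrier_vec (Suc n)" using Suc.prems(1) by blast
    obtain P1 Q1 where PQ1: "inverse_mats (Suc n) P1 Q1" and e0: "P1 *\<^sub>v unit_vec (Suc n) 0 = w1"
      using first_column[OF w1c w1(2)] .
    note pq1 = inverse_matsD[OF PQ1]
    define W' where "W' = {y \<in> carrier_vec n. P1 *\<^sub>v vCons 0 y \<in> W}"
    have split: "P1 *\<^sub>v vCons c y = c \<cdot>\<^sub>v w1 + P1 *\<^sub>v vCons 0 y" if y: "y \<in> carrier_vec n" for c y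
    proof -
      have "vCons c y = c \<cdot>\<^sub>v unit_vec (Suc n) 0 + vCons 0 y"
        using y by (intro eq_vecI) (auto simp: vec_index_vCons)
      then show ?thesis using pq1 y
        by (simp add: mult_add_distrib_mat_vec[of _ "Suc n" "Suc n"] mult_mat_vec[OF pq1(1)] e0)
    qed
    have mem: "P1 *\<^sub>v vCons c y \<in> W \<longleftrightarrow> y \<in> W'" if y: "y \<in> carrier_vec n" for c y
    proof
      assume *: "P1 *\<^sub>v vCons c y \<in> W"
      have z: "P1 *\<^sub>v vCons 0 y \<in> carrier_vec (Suc n)" using pq1 y by (intro mult_mat_vec_carrier) auto
      have "(- c) \<cdot>\<^sub>v w1 + (c \<cdot>\<^sub>v w1 + P1 *\<^sub>v vCons 0 y) \<in> W"
        using Suc.prems(3)[OF Suc.prems(4)[OF w1(1), of "- c"] *] split[OF y, of c] by simp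
      also have "(- c) \<cdot>\<^sub>v w1 + (c \<cdot>\<^sub>v w1 + P1 *\<^sub>v vCons 0 y) = P1 *\<^sub>v vCons 0 y"
        by (rule smult_vec_cancel[OF w1c z])
      finally show "y \<in> W'" using y by (simp add: W'_def)
    next
      assume "y \<in> W'"
      then show "P1 *\<^sub>v vCons c y \<in> W"
        unfolding split[OF y, of c] by (intro Suc.prems(3,4) w1(1)) (simp add: W'_def)
    qed
    have "\<exists>P Q d. inverse_mats n P Q \<and> d \<le> n \<and>
      (\<forall>w\<in>carrier_vec n. w \<in> W' \<longleftrightarrow> (\<forall>i. d \<le> i \<and> i < n \<longrightarrow> vec_index (Q *\<^sub>v w) i = 0))"
    proof (rule Suc.IH)
      show "W' \<subseteq> carrier_vec n" by (auto simp: W'_def)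
      have "vCons 0 (0\<^sub>v n) = (0\<^sub>v (Suc n) :: 'a vec)" by (intro eq_vecI) (auto simp: vec_index_vCons)
      then show "0\<^sub>v n \<in> W'" using Suc.prems(2) mat_zero_vec[OF pq1(1)] by (simp add: W'_def)
      fix v w c assume v: "v \<in> W'"
      then have vc: "v \<in> carrier_vec n" by (simp add: W'_def)
      have "vCons 0 (c \<cdot>\<^sub>v v) = c \<cdot>\<^sub>v vCons 0 v" using vc by (intro eq_vecI) (auto simp: vec_index_vCons)
      then show "c \<cdot>\<^sub>v v \<in> W'" using v vc Suc.prems(4) by (simp add: W'_def mult_mat_vec[OF pq1(1)])
      assume w: "w \<in> W'"
      then have wc: "w \<in> carrier_vec n" by (simp add: W'_def)
      have "vCons 0 (v + w) = vCons 0 v + vCons 0 w" using vc wc by (intro eq_vecI) (auto simp: vec_index_vCons)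
      then show "v + w \<in> W'" using v w vc wc Suc.prems(3)
        by (simp add: W'_def mult_add_distrib_mat_vec[OF pq1(1)])
    qed
    then obtain P' Q' d' where PQ': "inverse_mats n P' Q'" "d' \<le> n"
      "\<And>y. y \<in> carrier_vec n \<Longrightarrow> y \<in> W' \<longleftrightarrow> (\<forall>i. d' \<le> i \<and> i < n \<longrightarrow> vec_index (Q' *\<^sub>v y) i = 0)" by blast
    let ?R = "four_block_mat (1\<^sub>m 1) (0\<^sub>m 1 n) (0\<^sub>m n 1) P'" and ?R' = "four_block_mat (1\<^sub>m 1) (0\<^sub>m 1 n) (0\<^sub>m n 1) Q'"
    have R: "inverse_mats (Suc n) ?R ?R'" using inverse_mats_block[OF inverse_mats_one[of 1] PQ'(1)] by simp
    have "w \<in> W \<longleftrightarrow> (\<forall>i. Suc d' \<le> i \<and> i < Suc n \<longrightarrow> vec_index ((?R' * Q1) *\<^sub>v w) i = 0)"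
      if w: "w \<in> carrier_vec (Suc n)" for w
    proof -
      have "Q1 *\<^sub>v w \<in> carrier_vec (Suc n)" using pq1 w by (intro mult_mat_vec_carrier) auto
      then obtain c y where cy: "Q1 *\<^sub>v w = vCons c y" "y \<in> carrier_vec n"
        by (cases "Q1 *\<^sub>v w") auto
      have "w = P1 *\<^sub>v vCons c y"
        unfolding cy(1)[symmetric] using pq1 w by (simp flip: assoc_mult_mat_vec[of _ "Suc n" "Suc n" _ "Suc n"])
      then have "w \<in> W \<longleftrightarrow> (\<forall>i. d' \<le> i \<and> i < n \<longrightarrow> vec_index (Q' *\<^sub>v y) i = 0)"
        using mem[OF cy(2)] PQ'(3)[OF cy(2)] by simp
      also have "(?R' * Q1) *\<^sub>v w = vCons c (Q' *\<^sub>v y)"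
        using pq1 w inverse_matsD(2)[OF R] inverse_matsD(2)[OF PQ'(1)] block_one_vCons[of Q' n y c] cy
        by (simp add: assoc_mult_mat_vec[of _ "Suc n" "Suc n" _ "Suc n"])
      have "(\<forall>i. d' \<le> i \<and> i < n \<longrightarrow> vec_index (Q' *\<^sub>v y) i = 0) \<longleftrightarrow>
          (\<forall>i. Suc d' \<le> i \<and> i < Suc n \<longrightarrow> vec_index (vCons c (Q' *\<^sub>v y)) i = 0)"
      proof (intro iffI allI impI)
        fix i assume *: "\<forall>i. d' \<le> i \<and> i < n \<longrightarrow> vec_index (Q' *\<^sub>v y) i = 0" "Suc d' \<le> i \<and> i < Suc n"
        then obtain i' where "i = Suc i'" by (cases i) auto
        with * show "vec_index (vCons c (Q' *\<^sub>v y)) i = 0" by (simp only: vec_index_vCons) auto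
      next
        fix i assume *: "\<forall>i. Suc d' \<le> i \<and> i < Suc n \<longrightarrow> vec_index (vCons c (Q' *\<^sub>v y)) i = 0" "d' \<le> i \<and> i < n"
        then have "vec_index (vCons c (Q' *\<^sub>v y)) (Suc i) = 0" by (meson Suc_le_mono Suc_mono)
        then show "vec_index (Q' *\<^sub>v y) i = 0" by (simp only: vec_index_vCons) simp
      qed
      finally show ?thesis unfolding \<open>(?R' * Q1) *\<^sub>v w = vCons c (Q' *\<^sub>v y)\<close> .
    qed
    with inverse_mats_mult[OF PQ1 R] PQ'(2) show ?thesis
      by (intro exI[of _ "P1 * ?R"] exI[of _ "?R' * Q1"] exI[of _ "Suc d'"]) auto
  qed
qed

section \<open>Intersecting orbit closures\<close>

text \<open>The weights mark the diagonal blocks: the block sum has the entries of the conjugated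
  family where the weights of row and column agree, and entries with a smaller weight in the column
  vanish. The weights will be the exponents of the conjugation by powers of
  \<open>t\<close>.\<close>

definition triangular_form ::
  "nat \<Rightarrow> (nat \<Rightarrow> 'a::comm_ring_1 mat) \<Rightarrow> (nat \<times> (nat \<Rightarrow> 'a mat)) list \<Rightarrow> 'a mat \<Rightarrow> 'a mat \<Rightarrow> (nat \<Rightarrow> nat) \<Rightarrow> bool" where
  "triangular_form n a S P Q wt \<longleftrightarrow>
     (\<forall>x\<in>set S. irreducible_fam (fst x) (snd x)) \<and> fam_dim S = n \<and> inverse_mats n P Q \<and>
     (\<forall>i s u. s < n \<longrightarrow> u < n \<longrightarrow>
        fam_sum S i $$ (s, u) = (if wt s = wt u then (P * a i * Q) $$ (s, u) else 0) \<and>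
        (wt u < wt s \<longrightarrow> (P * a i * Q) $$ (s, u) = 0))"

lemma reducible_block:
  fixes a :: "nat \<Rightarrow> 'a::field mat"
  assumes a: "family n a" and n: "0 < n" and red: "\<not> irreducible_fam n a"
  obtains P Q d b c e where "inverse_mats n P Q" "0 < d" "d < n" "family d b" "family (n - d) e"
    "\<And>i. c i \<in> carrier_mat d (n - d)"
    "\<And>i. Q * a i * P = four_block_mat (b i) (c i) (0\<^sub>m (n - d) d) (e i)"
proof -
  obtain v w0 where v: "v \<in> carrier_vec n" "v \<noteq> 0\<^sub>v n" and w0: "w0 \<in> carrier_vec n"
    "\<And>p. nc_eval n a p *\<^sub>v v \<noteq> w0"
    using a n red unfolding irreducible_fam_def by blast
  \<comment> \<open>The cyclic subspace of \<open>v\<close> is invariant; it is nonzero because it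
    contains \<open>v\<close> and proper because it misses \<open>w0\<close>.\<close>
  define W where "W = {nc_eval n a p *\<^sub>v v | p. True}"
  have W: "W \<subseteq> carrier_vec n" using nc_eval_vec(3)[OF a v(1)] by (auto simp: W_def)
  have W0: "0\<^sub>v n \<in> W"
    using zero_mat_vec[OF v(1), of n] unfolding W_def by (intro CollectI exI[of _ "[]"]) simp
  have Wadd: "x + y \<in> W" if "x \<in> W" "y \<in> W" for x y
    using that nc_eval_vec(1)[OF a v(1), symmetric] by (fastforce simp: W_def)
  have Wsm: "c \<cdot>\<^sub>v x \<in> W" if "x \<in> W" for c x
    using that nc_eval_smult[OF a] smult_mat_vec[OF nc_eval_carrier[OF a] v(1), symmetric]
    unfolding W_def by clarsimp metis
  have vW: "v \<in> W"
    using v(1) nc_eval_one[of n a] unfolding W_def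
    by (intro CollectI exI[of _ "[(1, [])]"]) (simp del: nc_eval.simps)
  have Wa: "a i *\<^sub>v x \<in> W" if x: "x \<in> W" for i x
  proof -
    obtain p where p: "x = nc_eval n a p *\<^sub>v v" using x by (auto simp: W_def)
    have "a i *\<^sub>v x = nc_eval n a (nc_mult [(1, [i])] p) *\<^sub>v v"
      unfolding p nc_eval_vec(2)[OF a v(1)] nc_eval_letter[OF a] ..
    then show ?thesis by (auto simp: W_def)
  qed
  obtain P Q d where PQ: "inverse_mats n P Q" and d: "d \<le> n"
    and mem: "\<And>w. w \<in> carrier_vec n \<Longrightarrow> w \<in> W \<longleftrightarrow> (\<forall>i. d \<le> i \<and> i < n \<longrightarrow> vec_index (Q *\<^sub>v w) i = 0)"
    using subspace_normal_form[OF W W0 Wadd Wsm] by blast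
  note pq = inverse_matsD[OF PQ]
  have "d \<noteq> 0"
  proof
    assume "d = 0"
    then have "vec_index (Q *\<^sub>v v) i = 0" if "i < n" for i using mem[OF v(1)] vW that by simp
    then have "Q *\<^sub>v v = 0\<^sub>v n" using pq v by (intro eq_vecI) auto
    then have "P *\<^sub>v (Q *\<^sub>v v) = 0\<^sub>v n" using mat_zero_vec[OF pq(1)] by simp
    then have "v = 0\<^sub>v n" using pq v by (simp flip: assoc_mult_mat_vec[of _ n n _ n])
    with v(2) show False by simp
  qed
  moreover have "d \<noteq> n" using mem[OF w0(1)] w0(2) by (auto simp: W_def)
  ultimately have d': "0 < d" "d < n" using d by auto
  define M where "M i = Q * a i * P" for i
  have M: "M i \<in> carrier_mat n n" for i using a pq by (simp add: M_def family_def)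
  have low: "M i $$ (s, j) = 0" if "d \<le> s" "s < n" "j < d" for i s j
  proof -
    have j: "j < n" using that d' by simp
    let ?e = "unit_vec n j :: 'a vec"
    have Pe: "P *\<^sub>v ?e \<in> carrier_vec n" using pq by (intro mult_mat_vec_carrier) auto
    have "Q *\<^sub>v (P *\<^sub>v ?e) = ?e" using pq by (simp flip: assoc_mult_mat_vec[of _ n n _ n])
    then have "P *\<^sub>v ?e \<in> W" using mem[OF Pe] that j by auto
    then have aW: "a i *\<^sub>v (P *\<^sub>v ?e) \<in> W" by (rule Wa)
    have "vec_index (Q *\<^sub>v (a i *\<^sub>v (P *\<^sub>v ?e))) s = 0"
      using mem[of "a i *\<^sub>v (P *\<^sub>v ?e)"] aW W that by blast
    also have "Q *\<^sub>v (a i *\<^sub>v (P *\<^sub>v ?e)) = M i *\<^sub>v ?e"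
      using pq a Pe by (simp add: M_def family_def assoc_mult_mat_vec[of _ n n _ n] assoc_mult_mat[of _ n n _ n _ n])
    finally show ?thesis using M[of i] that j by (simp add: scalar_prod_right_unit)
  qed
  let ?b = "\<lambda>i. mat d d (\<lambda>(s, j). M i $$ (s, j))"
  let ?c = "\<lambda>i. mat d (n - d) (\<lambda>(s, j). M i $$ (s, j + d))"
  let ?e = "\<lambda>i. mat (n - d) (n - d) (\<lambda>(s, j). M i $$ (s + d, j + d))"
  have "M i = four_block_mat (?b i) (?c i) (0\<^sub>m (n - d) d) (?e i)" for i
    using M[of i] low[of _ _ i] d' by (intro eq_matI) auto
  then have blk: "Q * a i * P = four_block_mat (?b i) (?c i) (0\<^sub>m (n - d) d) (?e i)" for i
    by (simp only: M_def)
  have fb: "family d ?b" "family (n - d) ?e" by (simp_all add: family_def)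
  have c: "?c i \<in> carrier_mat d (n - d)" for i by simp
  show thesis by (rule that[OF PQ d' fb c blk])
qed

lemma triangular_form_exists:
  fixes a :: "nat \<Rightarrow> 'a::field mat"
  assumes "family n a"
  shows "\<exists>S P Q wt. triangular_form n a S P Q wt"
  using assms
proof (induction n arbitrary: a rule: less_induct)
  case (less n)
  consider "n = 0" | "irreducible_fam n a" | "0 < n" "\<not> irreducible_fam n a" by blast
  then show ?case
  proof cases
    case 1
    then have "triangular_form n a [] (1\<^sub>m 0) (1\<^sub>m 0) (\<lambda>_. 0)" by (simp add: triangular_form_def)
    then show ?thesis by blast
  next
    case 2
    have "block_sum n a 0 (\<lambda>i. 0\<^sub>m 0 0) i = a i" for i
      using less.prems unfolding block_sum_def family_def by (intro eq_matI) (auto dest: spec[of _ i])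
    then have "triangular_form n a [(n, a)] (1\<^sub>m n) (1\<^sub>m n) (\<lambda>_. 0)"
      using 2 less.prems by (simp add: triangular_form_def family_def)
    then show ?thesis by blast
  next
    case 3
    obtain P Q d b c e where PQ: "inverse_mats n P Q" and d: "0 < d" "d < n"
      and f: "family d b" "family (n - d) e" "\<And>i. c i \<in> carrier_mat d (n - d)"
      and M: "\<And>i. Q * a i * P = four_block_mat (b i) (c i) (0\<^sub>m (n - d) d) (e i)"
      using reducible_block[OF less.prems 3] by metis
    obtain S1 P1 Q1 w1 where 1: "triangular_form d b S1 P1 Q1 w1" using less.IH[OF d(2) f(1)] by blast
    obtain S2 P2 Q2 w2 where 2: "triangular_form (n - d) e S2 P2 Q2 w2"
      using less.IH[OF _ f(2)] d by auto
    have inv: "inverse_mats d P1 Q1" "inverse_mats (n - d) P2 Q2"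
      using 1 2 by (auto simp: triangular_form_def)
    note pq1 = inverse_matsD[OF inv(1)] and pq2 = inverse_matsD[OF inv(2)] and pq = inverse_matsD[OF PQ]
    let ?P3 = "four_block_mat P1 (0\<^sub>m d (n - d)) (0\<^sub>m (n - d) d) P2"
    let ?Q3 = "four_block_mat Q1 (0\<^sub>m d (n - d)) (0\<^sub>m (n - d) d) Q2"
    have PQ3: "inverse_mats n ?P3 ?Q3" using inverse_mats_block[OF inv] d by simp
    note pq3 = inverse_matsD[OF PQ3]
    \<comment> \<open>All weights of the second block are shifted above those of the first, so that
      entries of the upper right block get positive exponents and disappear in the limit.\<close>
    define K where "K = Suc (\<Sum>s<d. w1 s)"
    have K: "w1 s < K" if "s < d" for s
      using member_le_sum[of s "{..<d}" w1] that by (simp add: K_def)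
    define wt where "wt s = (if s < d then w1 s else K + w2 (s - d))" for s
    have conj: "?P3 * Q * a i * (P * ?Q3) = four_block_mat (P1 * b i * Q1) (P1 * c i * Q2) (0\<^sub>m (n - d) d) (P2 * e i * Q2)" for i
    proof -
      have ai: "a i \<in> carrier_mat n n" using less.prems by (simp add: family_def)
      have "?P3 * Q * a i * (P * ?Q3) = ?P3 * (Q * a i * P) * ?Q3"
        using ai pq pq3 by (simp add: assoc_mult_mat[of _ n n _ n _ n])
      also have "\<dots> = four_block_mat (P1 * b i * Q1) (P1 * c i * Q2) (0\<^sub>m (n - d) d) (P2 * e i * Q2)"
        unfolding M by (rule conj_four_block[OF inv]) (use f in \<open>auto simp: family_def\<close>)
      finally show ?thesis .
    qed
    have irr: "\<And>x. x \<in> set (S1 @ S2) \<Longrightarrow> irreducible_fam (fst x) (snd x)"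
      using 1 2 by (auto simp: triangular_form_def)
    have dims: "fam_dim S1 = d" "fam_dim S2 = n - d" using 1 2 by (auto simp: triangular_form_def)
    have fS: "family d (fam_sum S1)" "family (n - d) (fam_sum S2)"
      using family_fam_sum[of S1] family_fam_sum[of S2] irr dims by (simp_all add: irreducible_fam_def)
    have sum: "fam_sum (S1 @ S2) = block_sum d (fam_sum S1) (n - d) (fam_sum S2)"
      using fam_sum_append[of S1 S2] irr by (auto simp: dims irreducible_fam_def)
    have entries: "fam_sum (S1 @ S2) i $$ (s, u) = (if wt s = wt u then (?P3 * Q * a i * (P * ?Q3)) $$ (s, u) else 0) \<and>
        (wt u < wt s \<longrightarrow> (?P3 * Q * a i * (P * ?Q3)) $$ (s, u) = 0)" if su: "s < n" "u < n" for i s u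
    proof -
      have cars: "P1 * b i * Q1 \<in> carrier_mat d d" "P1 * c i * Q2 \<in> carrier_mat d (n - d)" "P2 * e i * Q2 \<in> carrier_mat (n - d) (n - d)"
        "fam_sum S1 i \<in> carrier_mat d d" "fam_sum S2 i \<in> carrier_mat (n - d) (n - d)"
        using f pq1 pq2 fS by (auto simp: family_def)
      note t1 = 1[unfolded triangular_form_def, THEN conjunct2, THEN conjunct2, THEN conjunct2, rule_format]
        and t2 = 2[unfolded triangular_form_def, THEN conjunct2, THEN conjunct2, THEN conjunct2, rule_format]
      obtain X1 X2 X3 where X: "X1 = P1 * b i * Q1" "X2 = P1 * c i * Q2" "X3 = P2 * e i * Q2" by simp
      note dims' = cars[folded X, THEN carrier_matD(1)] cars[folded X, THEN carrier_matD(2)]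
      have e1: "fam_sum S1 i $$ (s, u) = (if w1 s = w1 u then X1 $$ (s, u) else 0) \<and> (w1 u < w1 s \<longrightarrow> X1 $$ (s, u) = 0)"
        if "s < d" "u < d" unfolding X by (rule t1) (use that in simp_all)
      have e2: "fam_sum S2 i $$ (s - d, u - d) = (if w2 (s - d) = w2 (u - d) then X3 $$ (s - d, u - d) else 0) \<and>
          (w2 (u - d) < w2 (s - d) \<longrightarrow> X3 $$ (s - d, u - d) = 0)"
        if "\<not> s < d" "\<not> u < d" unfolding X by (rule t2) (use that su d in simp_all)
      show ?thesis
        unfolding conj sum block_sum_def X[symmetric]
        using su d e1 e2 K[of s] K[of u] by (cases "s < d"; cases "u < d") (simp_all add: dims' wt_def)
    qed
    have "inverse_mats n (?P3 * Q) (P * ?Q3)" by (rule inverse_mats_mult[OF PQ3 inverse_mats_sym[OF PQ]])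
    then have "triangular_form n a (S1 @ S2) (?P3 * Q) (P * ?Q3) wt"
      unfolding triangular_form_def using irr entries dims d by auto
    then show ?thesis by blast
  qed
qed

text \<open>Families are indexed by all natural numbers, which frees words from side conditions.
  Padding by identity matrices commutes with conjugation and adds nothing to the generated
  algebra.\<close>

definition tuple_fam :: "nat \<Rightarrow> 'a::{one,zero} mat list \<Rightarrow> nat \<Rightarrow> 'a mat" where
  "tuple_fam m A i = (if i < length A then A ! i else 1\<^sub>m m)"

lemma tuple_fam_family: "A \<in> mat_tuples m r \<Longrightarrow> family m (tuple_fam m A)"
  by (auto simp: family_def tuple_fam_def mat_tuples_def)

section \<open>Orbit closures in the Zariski topology\<close>

lemma in_closure_zariski:
  fixes Orb :: "'a::idom mat list set"
  assumes X: "X \<in> mat_tuples m r" and Orb: "Orb \<subseteq> mat_tuples m r"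
    and f: "\<And>f. f \<in> polynomial_functions m r \<Longrightarrow> (\<And>Y. Y \<in> Orb \<Longrightarrow> f Y = 0) \<Longrightarrow> f X = 0"
  shows "X \<in> zariski m r closure_of Orb"
  unfolding in_closure_of topspace_zariski openin_zariski
proof (intro conjI X allI impI)
  fix U assume "X \<in> U \<and> zariski_open m r U"
  then obtain F where F: "F \<subseteq> polynomial_functions m r" "U = mat_tuples m r - zero_locus m r F" "X \<in> U"
    by (auto simp: zariski_open_def)
  then obtain g where g: "g \<in> F" "g X \<noteq> 0" using X by (auto simp: zero_locus_def)
  then obtain Y where Y: "Y \<in> Orb" "g Y \<noteq> 0" using f[of g] F(1) by blast
  then have "Y \<in> U" using F(2) g(1) Orb by (auto simp: zero_locus_def)
  with Y(1) show "\<exists>Y. Y \<in> Orb \<and> Y \<in> U" by blast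
qed

lemma closure_zariski_vanish:
  fixes Orb :: "'a::idom mat list set"
  assumes X: "X \<in> zariski m r closure_of Orb" and f: "f \<in> polynomial_functions m r"
    and vanish: "\<And>Y. Y \<in> Orb \<Longrightarrow> f Y = 0"
  shows "f X = 0"
proof (rule ccontr)
  assume fX: "f X \<noteq> 0"
  let ?U = "mat_tuples m r - zero_locus m r {f}"
  have "X \<in> mat_tuples m r" using X by (simp add: in_closure_of topspace_zariski)
  then have "X \<in> ?U" using fX by (simp add: zero_locus_def)
  moreover have "zariski_open m r ?U" using f by (auto simp: zariski_open_def)
  ultimately obtain Y where "Y \<in> Orb" "Y \<in> ?U" using X unfolding in_closure_of openin_zariski by blast
  then show False using vanish[of Y] by (auto simp: zero_locus_def)
qed

lemma polynomial_functions_sum: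
  "finite I \<Longrightarrow> (\<And>i. i \<in> I \<Longrightarrow> f i \<in> polynomial_functions m r) \<Longrightarrow>
    (\<lambda>X. \<Sum>i\<in>I. f i X) \<in> polynomial_functions m r"
  by (induction I rule: finite_induct) (auto intro: polynomial_functions.intros)

lemma word_mat_polynomial:
  "\<exists>f. \<forall>i<m. \<forall>j<m. f i j \<in> polynomial_functions m r \<and>
     (\<forall>X\<in>mat_tuples m r. word_mat m (tuple_fam m X) w $$ (i, j) = (f i j X :: 'a::comm_ring_1))"
proof (induction w)
  case Nil
  show ?case
    by (intro exI[of _ "\<lambda>i j X. of_bool (i = j)"]) (auto intro: polynomial_functions.const)
next
  case (Cons k w)
  then obtain f where f0: "\<forall>i<m. \<forall>j<m. f i j \<in> polynomial_functions m r \<and>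
     (\<forall>X\<in>mat_tuples m r. word_mat m (tuple_fam m X) w $$ (i, j) = (f i j X :: 'a))" ..
  then have f: "\<And>i j. i < m \<Longrightarrow> j < m \<Longrightarrow> f i j \<in> polynomial_functions m r"
    "\<And>i j X. i < m \<Longrightarrow> j < m \<Longrightarrow> X \<in> mat_tuples m r \<Longrightarrow> word_mat m (tuple_fam m X) w $$ (i, j) = f i j X"
    by simp_all
  define g where "g i j X = (\<Sum>l<m. (if k < r then (X ! k) $$ (i, l) else of_bool (i = l)) * f l j X)" for i j X
  have "g i j \<in> polynomial_functions m r" if "i < m" "j < m" for i j
  proof -
    have letter: "(\<lambda>X. if k < r then (X ! k) $$ (i, l) else of_bool (i = l)) \<in> polynomial_functions m r" if "l < m" for l
      using polynomial_functions.coord[of k r i m l] polynomial_functions.const[of "of_bool (i = l)" m r] \<open>i < m\<close> that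
      by (cases "k < r") simp_all
    have "(\<lambda>X. \<Sum>l<m. (if k < r then (X ! k) $$ (i, l) else of_bool (i = l)) * f l j X) \<in> polynomial_functions m r"
      by (intro polynomial_functions_sum polynomial_functions.mult letter f(1)) (use that in simp_all)
    then show ?thesis by (simp add: g_def[abs_def])
  qed
  moreover have "word_mat m (tuple_fam m X) (k # w) $$ (i, j) = g i j X"
    if "i < m" "j < m" "X \<in> mat_tuples m r" for i j X
  proof -
    have fam: "family m (tuple_fam m X)" using that(3) by (rule tuple_fam_family)
    then have c: "tuple_fam m X k \<in> carrier_mat m m" "word_mat m (tuple_fam m X) w \<in> carrier_mat m m"
      by (auto simp: family_def)
    have "word_mat m (tuple_fam m X) (k # w) $$ (i, j) =
        (\<Sum>l<m. tuple_fam m X k $$ (i, l) * word_mat m (tuple_fam m X) w $$ (l, j))"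
      using c that by (simp add: scalar_prod_def lessThan_atLeast0)
    also have "\<dots> = g i j X"
      unfolding g_def using that f(2) by (intro sum.cong) (auto simp: tuple_fam_def mat_tuples_def)
    finally show ?thesis .
  qed
  ultimately show ?case by blast
qed

lemma SL_orbit_subset:
  assumes "A \<in> mat_tuples m r" shows "SL_orbit m A \<subseteq> mat_tuples m r"
proof
  fix Y assume "Y \<in> SL_orbit m A"
  then obtain P Q where PQ: "P \<in> carrier_mat m m" "Q \<in> carrier_mat m m" and Y: "Y = map (\<lambda>X. P * X * Q) A"
    by (auto simp: SL_orbit_def SL_def)
  have "P * X * Q \<in> carrier_mat m m" if "X \<in> set A" for X
  proof -
    have "X \<in> carrier_mat m m" using that assms by (auto simp: mat_tuples_def)
    then show ?thesis using PQ by simp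
  qed
  then show "Y \<in> mat_tuples m r" using assms by (auto simp: Y mat_tuples_def)
qed

lemma SL_orbit_trace:
  assumes A: "A \<in> mat_tuples m r" and Y: "Y \<in> SL_orbit m A"
  shows "mtrace (word_mat m (tuple_fam m Y) w) = mtrace (word_mat m (tuple_fam m A) w)"
proof -
  obtain P Q where PQ: "P \<in> SL m" "Q \<in> carrier_mat m m" "inverts_mat P Q" "inverts_mat Q P"
    and Y: "Y = map (\<lambda>X. P * X * Q) A"
    using Y by (auto simp: SL_orbit_def)
  have inv: "inverse_mats m P Q" using PQ by (auto simp: inverse_mats_def inverts_mat_def SL_def)
  have "tuple_fam m Y i = P * tuple_fam m A i * Q" for i
    using inverse_matsD[OF inv] by (auto simp: tuple_fam_def Y)
  then show ?thesis
    by (intro mtrace_word_similar tuple_fam_family[OF A]) (use inv in \<open>auto simp: similar_fam_def\<close>)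
qed

lemma closure_trace:
  fixes A :: "'a::idom mat list"
  assumes A: "A \<in> mat_tuples m r" and X: "X \<in> zariski m r closure_of SL_orbit m A"
  shows "mtrace (word_mat m (tuple_fam m X) w) = mtrace (word_mat m (tuple_fam m A) w)"
proof -
  obtain f where "\<forall>i<m. \<forall>j<m. f i j \<in> polynomial_functions m r \<and>
     (\<forall>X\<in>mat_tuples m r. word_mat m (tuple_fam m X) w $$ (i, j) = (f i j X :: 'a))"
    using word_mat_polynomial[of m r w] ..
  then have f: "\<And>i j. i < m \<Longrightarrow> j < m \<Longrightarrow> f i j \<in> polynomial_functions m r"
    "\<And>i j X. i < m \<Longrightarrow> j < m \<Longrightarrow> X \<in> mat_tuples m r \<Longrightarrow> word_mat m (tuple_fam m X) w $$ (i, j) = (f i j X :: 'a)"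
    by simp_all
  let ?c = "mtrace (word_mat m (tuple_fam m A) w)"
  let ?g = "\<lambda>X. (\<Sum>i<m. f i i X) + - ?c"
  have tr: "mtrace (word_mat m (tuple_fam m X) w) = (\<Sum>i<m. f i i X)" if "X \<in> mat_tuples m r" for X
    using word_mat_carrier[OF tuple_fam_family[OF that], of w] f(2) that by (simp add: mtrace_def)
  have "?g X = 0"
  proof (rule closure_zariski_vanish[OF X])
    show "?g \<in> polynomial_functions m r"
      by (intro polynomial_functions.add polynomial_functions_sum polynomial_functions.const) (use f in auto)
    fix Y assume Y: "Y \<in> SL_orbit m A"
    then have "Y \<in> mat_tuples m r" using SL_orbit_subset[OF A] by blast
    then show "?g Y = 0" using SL_orbit_trace[OF A Y] tr[of Y] by (metis add.right_inverse)
  qed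
  moreover have "X \<in> mat_tuples m r" using X by (simp add: in_closure_of topspace_zariski)
  ultimately show ?thesis using tr by simp
qed

text \<open>Scaling \<open>P\<close> by an m-th root of the inverse of its determinant, and
  \<open>Q\<close> by the inverse of that root, leads to determinant 1 without changing the
  conjugation. The root exists since the field is algebraically closed.\<close>

lemma GL_conj_in_SL_orbit:
  fixes A :: "'a::alg_closed_field mat list"
  assumes A: "A \<in> mat_tuples m r" and m: "1 \<le> m" and PQ: "inverse_mats m P Q"
  shows "map (\<lambda>X. P * X * Q) A \<in> SL_orbit m A"
proof -
  note pq = inverse_matsD[OF PQ]
  have "det P * det Q = 1" using det_mult[OF pq(1,2)] pq(3) by simp
  then have dP: "det P \<noteq> 0" by auto
  obtain c where c: "c ^ m = inverse (det P)" using nth_root_exists[of m "inverse (det P)"] m by auto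
  then have c0: "c \<noteq> 0" using dP m by (auto simp: power_0_left)
  let ?P = "c \<cdot>\<^sub>m P" and ?Q = "inverse c \<cdot>\<^sub>m Q"
  have PQ': "?P * ?Q = 1\<^sub>m m" "?Q * ?P = 1\<^sub>m m"
    using pq c0 by (simp_all add: mult_smult_distrib[of _ m m _ m] mult_smult_assoc_mat[of _ m m _ m] smult_smult)
  have "?P \<in> SL m" using pq c dP by (simp add: SL_def det_smult)
  have "inverts_mat ?P ?Q" "inverts_mat ?Q ?P" using PQ' pq by (auto simp: inverts_mat_def)
  have "?P * X * ?Q = P * X * Q" if "X \<in> set A" for X
  proof -
    have "X \<in> carrier_mat m m" using that A by (auto simp: mat_tuples_def)
    then show ?thesis
      using pq c0 by (simp add: mult_smult_distrib[of _ m m _ m] mult_smult_assoc_mat[of _ m m _ m] smult_smult)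
  qed
  then have "map (\<lambda>X. P * X * Q) A = map (\<lambda>X. ?P * X * ?Q) A" by simp
  moreover note \<open>?P \<in> SL m\<close> \<open>inverts_mat ?P ?Q\<close> \<open>inverts_mat ?Q ?P\<close>
  moreover have "?Q \<in> carrier_mat m m" using pq by simp
  ultimately show ?thesis unfolding SL_orbit_def by (intro CollectI exI[of _ ?P] exI[of _ ?Q] conjI)
qed

lemma curve_in_closure:
  fixes Y :: "'a::field_char_0 \<Rightarrow> 'a mat list"
  assumes Y: "\<And>t. Y t \<in> mat_tuples m r" and Orb: "Orb \<subseteq> mat_tuples m r" "\<And>t. t \<noteq> 0 \<Longrightarrow> Y t \<in> Orb"
    and poly: "\<And>k i j. k < r \<Longrightarrow> i < m \<Longrightarrow> j < m \<Longrightarrow> \<exists>p. \<forall>t. (Y t ! k) $$ (i, j) = poly p t"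
  shows "Y 0 \<in> zariski m r closure_of Orb"
proof (rule in_closure_zariski[OF Y Orb(1)])
  fix f assume f: "f \<in> polynomial_functions m r" and van: "\<And>Z. Z \<in> Orb \<Longrightarrow> f Z = 0"
  from f have "\<exists>p. \<forall>t. f (Y t) = poly p t"
  proof (induction rule: polynomial_functions.induct)
    case (const c)
    show ?case by (intro exI[of _ "[:c:]"]) simp
  next
    case (coord k i j)
    then show ?case by (rule poly)
  next
    case (add f g)
    then obtain p q where "\<forall>t. f (Y t) = poly p t" "\<forall>t. g (Y t) = poly q t" by blast
    then show ?case by (intro exI[of _ "p + q"]) simp
  next
    case (mult f g)
    then obtain p q where "\<forall>t. f (Y t) = poly p t" "\<forall>t. g (Y t) = poly q t" by blast
    then show ?case by (intro exI[of _ "p * q"]) simp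
  qed
  then obtain p where p: "\<And>t. f (Y t) = poly p t" by blast
  \<comment> \<open>The factor \<open>[:0, 1:]\<close> takes care of the exceptional point 0, so
    that the product vanishes on the whole field, which is infinite.\<close>
  have "poly ([:0, 1:] * p) t = 0" for t
    using van[OF Orb(2), of t] p[of t] by (cases "t = 0") auto
  then have "\<forall>t. poly ([:0, 1:] * p) t = 0" by blast
  then have "[:0, 1:] * p = 0" using poly_all_0_iff_0[of "[:0, 1:] * p"] by blast
  then have "p = 0" by simp
  then show "f (Y 0) = 0" by (simp add: p)
qed

text \<open>The additional conjugation by \<open>R\<close> lets the limit be any conjugate of the
  block sum. Two closures whose limits are merely similar thereby get a point in common.\<close>

lemma degeneration_in_closure:
  fixes A :: "'a::{alg_closed_field, field_char_0} mat list"
  assumes A: "A \<in> mat_tuples m r" and m: "1 \<le> m"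
    and tri: "triangular_form m (tuple_fam m A) S P Q wt" and R: "inverse_mats m R R'"
  shows "map (\<lambda>i. R * fam_sum S i * R') [0..<r] \<in> zariski m r closure_of SL_orbit m A"
proof -
  have PQ: "inverse_mats m P Q" using tri by (simp add: triangular_form_def)
  have S: "fam_sum S i $$ (s, u) = (if wt s = wt u then (P * tuple_fam m A i * Q) $$ (s, u) else 0)"
    "wt u < wt s \<Longrightarrow> (P * tuple_fam m A i * Q) $$ (s, u) = 0" if "s < m" "u < m" for i s u
    using tri that unfolding triangular_form_def by blast+
  note pq = inverse_matsD[OF PQ] and rr = inverse_matsD[OF R]
  have fS: "fam_sum S i \<in> carrier_mat m m" for i
    using family_fam_sum[of S] tri unfolding triangular_form_def family_def irreducible_fam_def by auto
  have fA: "tuple_fam m A i \<in> carrier_mat m m" for i using tuple_fam_family[OF A] by (simp add: family_def)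
  have lA: "length A = r" using A by (simp add: mat_tuples_def)
  define U where "U i = P * tuple_fam m A i * Q" for i
  have U: "U i \<in> carrier_mat m m" for i using pq fA[of i] by (simp add: U_def)
  \<comment> \<open>For nonzero \<open>t\<close> this is the conjugate of \<open>U i\<close> by the
    diagonal matrix with entries \<open>inverse t ^ wt s\<close>. Only nonnegative exponents occur,
    because entries with a smaller column weight vanish, so the curve extends to
    \<open>t = 0\<close>, where only the entries with equal weights remain.\<close>
  define D where "D t i = mat m m (\<lambda>(s, u). if wt s \<le> wt u then t ^ (wt u - wt s) * U i $$ (s, u) else 0)" for t i
  have D: "D t i \<in> carrier_mat m m" for t i by (simp add: D_def)
  define Y where "Y t = map (\<lambda>i. R * D t i * R') [0..<r]" for t
  have "Y 0 \<in> zariski m r closure_of SL_orbit m A"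
  proof (rule curve_in_closure[OF _ SL_orbit_subset[OF A]])
    show "Y t \<in> mat_tuples m r" for t using D rr by (auto simp: Y_def mat_tuples_def)
  next
    fix t :: 'a assume t: "t \<noteq> 0"
    let ?L = "mat_diag m (\<lambda>s. inverse t ^ wt s)" and ?L' = "mat_diag m (\<lambda>s. t ^ wt s)"
    have L: "inverse_mats m ?L ?L'"
      using t by (auto simp: inverse_mats_def mat_diag_diag power_mult_distrib[symmetric] mat_diag_one
          intro!: eq_matI)
    note ll = inverse_matsD[OF L]
    have LUL: "?L * U i * ?L' = D t i" for i
    proof (rule eq_matI)
      fix s u assume "s < dim_row (D t i)" "u < dim_col (D t i)"
      then have su: "s < m" "u < m" by (auto simp: D_def)
      have "(?L * U i * ?L') $$ (s, u) = inverse t ^ wt s * U i $$ (s, u) * t ^ wt u"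
        using U[of i] su by (simp add: mat_diag_mult_left[of _ m m] mat_diag_mult_right[of _ m m])
      also have "\<dots> = D t i $$ (s, u)"
      proof (cases "wt s \<le> wt u")
        case True
        have "t ^ wt u = t ^ wt s * t ^ (wt u - wt s)" using True by (simp flip: power_add)
        then have "inverse t ^ wt s * t ^ wt u = t ^ (wt u - wt s)"
          using t by (simp add: power_inverse)
        then show ?thesis using su True by (simp add: D_def mult_ac)
      next
        case False
        then show ?thesis using su S(2)[of s u i] by (simp add: D_def U_def)
      qed
      finally show "(?L * U i * ?L') $$ (s, u) = D t i $$ (s, u)" .
    qed (use U[of i] in \<open>auto simp: D_def mat_diag_def\<close>)
    have "R * D t i * R' = (R * ?L * P) * (A ! i) * (Q * ?L' * R')" if "i < r" for i
    proof -
      have Ai: "tuple_fam m A i = A ! i" "A ! i \<in> carrier_mat m m" using that lA fA[of i] by (auto simp: tuple_fam_def)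
      show ?thesis unfolding LUL[symmetric] U_def Ai(1)
        using pq rr ll Ai(2) by (simp add: assoc_mult_mat[of _ m m _ m _ m])
    qed
    then have "Y t = map (\<lambda>X. (R * ?L * P) * X * (Q * ?L' * R')) A"
      using lA by (intro nth_equalityI) (auto simp: Y_def)
    moreover have "inverse_mats m (R * ?L * P) (Q * ?L' * R')"
      using inverse_mats_mult[OF inverse_mats_mult[OF R L] PQ] pq rr ll by (simp add: assoc_mult_mat[of _ m m _ m _ m])
    ultimately show "Y t \<in> SL_orbit m A" using GL_conj_in_SL_orbit[OF A m] by simp
  next
    fix k i j assume k: "k < r" and ij: "i < m" "j < m"
    define p where "p s u = (if wt s \<le> wt u then monom (U k $$ (s, u)) (wt u - wt s) else 0)" for s u
    have "(Y t ! k) $$ (i, j) = poly (\<Sum>u<m. (\<Sum>s<m. [:R $$ (i, s):] * p s u) * [:R' $$ (u, j):]) t" for t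
    proof -
      have "(Y t ! k) $$ (i, j) = (\<Sum>u<m. (\<Sum>s<m. R $$ (i, s) * D t k $$ (s, u)) * R' $$ (u, j))"
        using k ij rr D[of t k] by (simp add: Y_def scalar_prod_def lessThan_atLeast0 sum_distrib_left sum_distrib_right mult.assoc) (rule sum.swap)
      also have "\<dots> = (\<Sum>u<m. (\<Sum>s<m. R $$ (i, s) * poly (p s u) t) * R' $$ (u, j))"
        by (intro sum.cong refl arg_cong2[of _ _ _ _ "(*)"]) (auto simp: D_def p_def poly_monom)
      finally show ?thesis by (simp add: poly_sum mult.commute)
    qed
    then show "\<exists>p. \<forall>t. (Y t ! k) $$ (i, j) = poly p t" by blast
  qed
  moreover have "D 0 i = fam_sum S i" for i
    using fS[of i] S(1)[of _ _ i] by (intro eq_matI) (auto simp: D_def U_def power_0_left)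
  ultimately show ?thesis by (simp add: Y_def)
qed

theorem orbit_closures_intersect_iff:
  fixes A A' :: "'a::{alg_closed_field, field_char_0} mat list"
  assumes A: "A \<in> mat_tuples m r" and A': "A' \<in> mat_tuples m r" and m: "1 \<le> m"
  shows "(zariski m r closure_of SL_orbit m A) \<inter> (zariski m r closure_of SL_orbit m A') \<noteq> {} \<longleftrightarrow>
    (\<forall>w. mtrace (word_mat m (tuple_fam m A) w) = mtrace (word_mat m (tuple_fam m A') w))"
proof
  assume "(zariski m r closure_of SL_orbit m A) \<inter> (zariski m r closure_of SL_orbit m A') \<noteq> {}"
  then obtain X where "X \<in> zariski m r closure_of SL_orbit m A" "X \<in> zariski m r closure_of SL_orbit m A'" by blast
  then show "\<forall>w. mtrace (word_mat m (tuple_fam m A) w) = mtrace (word_mat m (tuple_fam m A') w)"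
    using closure_trace[OF A] closure_trace[OF A'] by metis
next
  assume eq: "\<forall>w. mtrace (word_mat m (tuple_fam m A) w) = mtrace (word_mat m (tuple_fam m A') w)"
  have key: "\<exists>S. (\<forall>x\<in>set S. irreducible_fam (fst x) (snd x)) \<and> fam_dim S = m \<and>
      (\<forall>R R'. inverse_mats m R R' \<longrightarrow> map (\<lambda>i. R * fam_sum S i * R') [0..<r] \<in> zariski m r closure_of SL_orbit m B) \<and>
      (\<forall>w. total_trace S w = mtrace (word_mat m (tuple_fam m B) w))"
    if B: "B \<in> mat_tuples m r" for B :: "'a mat list"
  proof -
    obtain S P Q wt where tri: "triangular_form m (tuple_fam m B) S P Q wt"
      using triangular_form_exists[OF tuple_fam_family[OF B]] by blast
    have irr: "\<forall>x\<in>set S. irreducible_fam (fst x) (snd x)" and dim: "fam_dim S = m"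
      using tri by (auto simp: triangular_form_def)
    have fS: "family m (fam_sum S)"
      unfolding dim[symmetric] using irr by (intro family_fam_sum) (auto simp: irreducible_fam_def)
    have clo: "map (\<lambda>i. R * fam_sum S i * R') [0..<r] \<in> zariski m r closure_of SL_orbit m B"
      if "inverse_mats m R R'" for R R'
      by (rule degeneration_in_closure[OF B m tri that])
    let ?D = "map (\<lambda>i. 1\<^sub>m m * fam_sum S i * 1\<^sub>m m) [0..<r]"
    have lB: "length B = r" using B by (simp add: mat_tuples_def)
    have PQ: "inverse_mats m P Q" using tri by (simp add: triangular_form_def)
    \<comment> \<open>Behind the tuple the family consists of identity matrices. Conjugation and the
      passage to the diagonal blocks preserve these, so padding the limit tuple gives back the whole
      block sum.\<close>
    have "tuple_fam m ?D i = fam_sum S i" for i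
    proof (cases "i < r")
      case True
      then show ?thesis using fS by (simp add: tuple_fam_def family_def)
    next
      case False
      then have "P * tuple_fam m B i * Q = 1\<^sub>m m"
        using inverse_matsD[OF PQ] lB by (simp add: tuple_fam_def)
      then have "fam_sum S i $$ (s, u) = 1\<^sub>m m $$ (s, u)" if "s < m" "u < m" for s u
        using tri that unfolding triangular_form_def by (cases "s = u") auto
      then have "fam_sum S i = 1\<^sub>m m" using fS by (intro eq_matI) (auto simp: family_def)
      then show ?thesis using False by (simp add: tuple_fam_def)
    qed
    then have "tuple_fam m ?D = fam_sum S" by blast
    then have "mtrace (word_mat m (fam_sum S) w) = mtrace (word_mat m (tuple_fam m B) w)" for w
      using closure_trace[OF B clo[OF inverse_mats_one], of w] by simp
    moreover have "mtrace (word_mat m (fam_sum S) w) = total_trace S w" for w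
      using mtrace_word_fam_sum[of S w] irr by (auto simp: dim irreducible_fam_def)
    ultimately show ?thesis using irr dim clo by metis
  qed
  obtain S where S: "\<forall>x\<in>set S. irreducible_fam (fst x) (snd x)" "fam_dim S = m"
    "\<And>R R'. inverse_mats m R R' \<Longrightarrow> map (\<lambda>i. R * fam_sum S i * R') [0..<r] \<in> zariski m r closure_of SL_orbit m A"
    "\<And>w. total_trace S w = mtrace (word_mat m (tuple_fam m A) w)"
    using key[OF A] by blast
  obtain T where T: "\<forall>x\<in>set T. irreducible_fam (fst x) (snd x)" "fam_dim T = m"
    "\<And>R R'. inverse_mats m R R' \<Longrightarrow> map (\<lambda>i. R * fam_sum T i * R') [0..<r] \<in> zariski m r closure_of SL_orbit m A'"
    "\<And>w. total_trace T w = mtrace (word_mat m (tuple_fam m A') w)"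
    using key[OF A'] by blast
  have "similar_fam m (fam_sum T) (fam_sum S)"
    using fam_sum_similar[of S T] S T eq by auto
  then obtain R R' where R: "inverse_mats m R R'" "\<And>i. fam_sum S i = R * fam_sum T i * R'"
    by (auto simp: similar_fam_def)
  have "family m (fam_sum S)"
    unfolding S(2)[symmetric] using S(1) by (intro family_fam_sum) (auto simp: irreducible_fam_def)
  \<comment> \<open>The common point is the block sum of \<open>S\<close>: it is a limit of the
    first orbit as it stands, and of the second one after conjugation by \<open>R\<close>.\<close>
  then have eqm: "map (\<lambda>i. 1\<^sub>m m * fam_sum S i * 1\<^sub>m m) [0..<r] = map (\<lambda>i. R * fam_sum T i * R') [0..<r]"
    by (auto simp: family_def R(2)[symmetric])
  then show "(zariski m r closure_of SL_orbit m A) \<inter> (zariski m r closure_of SL_orbit m A') \<noteq> {}"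
    using S(3)[OF inverse_mats_one, unfolded eqm] T(3)[OF R(1)] by blast
qed

section \<open>Decoding the input\<close>

definition pairs :: "bool list list \<Rightarrow> (bool \<times> bool) list" where
  "pairs bss = concat (map (\<lambda>bs. map (Pair True) bs @ [(False, False)]) bss)"

definition flat_pairs :: "(bool \<times> bool) list \<Rightarrow> bool list" where
  "flat_pairs ps = concat (map (\<lambda>(a, b). [a, b]) ps)"

lemma pairs_simps [simp]:
  "pairs [] = []" "pairs (bs # bss) = map (Pair True) bs @ (False, False) # pairs bss"
  "pairs (bss @ bss') = pairs bss @ pairs bss'"
  by (simp_all add: pairs_def)

lemma flat_pairs_simps [simp]:
  "flat_pairs [] = []" "flat_pairs ((a, b) # ps) = a # b # flat_pairs ps"
  "flat_pairs (ps @ qs) = flat_pairs ps @ flat_pairs qs"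
  by (simp_all add: flat_pairs_def)

lemma length_flat_pairs [simp]: "length (flat_pairs ps) = 2 * length ps"
  by (induction ps) auto

lemma nth_flat_pairs:
  "p < length ps \<Longrightarrow> flat_pairs ps ! (2 * p) = fst (ps ! p) \<and> flat_pairs ps ! Suc (2 * p) = snd (ps ! p)"
proof (induction ps arbitrary: p)
  case (Cons a ps)
  then show ?case by (cases a; cases p) auto
qed simp

lemma block_flat_pairs: "block bs = flat_pairs (map (Pair True) bs @ [(False, False)])"
  by (simp add: block_def flat_pairs_def comp_def)

lemma blocks_flat_pairs: "concat (map block bss) = flat_pairs (pairs bss)"
  by (induction bss) (simp_all add: block_flat_pairs)

lemma binary_sum: "binary bs = (\<Sum>t<length bs. if bs ! t then 2 ^ t else 0)"
proof -
  have "binary bs = (\<Sum>t<length bs. of_bool (bs ! t) * 2 ^ t)"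
    unfolding binary_def by (simp add: horner_sum_eq_sum atLeast0LessThan)
  also have "\<dots> = (\<Sum>t<length bs. if bs ! t then 2 ^ t else 0)" by (intro sum.cong) auto
  finally show ?thesis .
qed

lemma binary_nonzero: "binary bs \<noteq> 0 \<longleftrightarrow> (\<exists>t<length bs. bs ! t)"
  by (auto simp: binary_sum)

text \<open>Every position of the input is a digit, so that sums and quantifiers bounded by
  \<open>radix x\<close> range over the whole input.\<close>

lemma length_le_radix: "length x < radix x"
proof -
  have "length x < 2 ^ floorlog 2 (length x)"
    using floorlog_bounds[of "length x" 2] by (cases "length x = 0") auto
  also have "\<dots> \<le> (2::nat) ^ (8 * loglen x)" by (intro power_increasing) (auto simp: loglen_def)
  finally show ?thesis by (simp add: radix_def)
qed

lemma sum_of_bool_card: "(\<Sum>t<n. of_bool (Q t)) = card {t \<in> {..<n}. Q t}" for n :: nat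
proof -
  have "(\<Sum>t<n. of_bool (Q t)) = (\<Sum>t<n. if Q t then 1 else 0 :: nat)" by (simp add: of_bool_def)
  also have "\<dots> = (\<Sum>t\<in>{t \<in> {..<n}. Q t}. 1)" by (rule sum.inter_filter[symmetric]) simp
  finally show ?thesis by simp
qed

section \<open>The input as a sequence of pairs\<close>

context
  fixes x :: "bool list" and ps :: "(bool \<times> bool) list"
  assumes x: "x = flat_pairs ps"
begin

lemma pairs_radix: "length ps < radix x"
  using length_le_radix[of x] by (simp add: x)

lemma input_pairs: "p < length ps \<Longrightarrow> input x (p + p) = of_bool (fst (ps ! p))"
  "p < length ps \<Longrightarrow> input x (Suc (p + p)) = of_bool (snd (ps ! p))"
  using nth_flat_pairs[of p ps] by (auto simp: input_def x mult_2)

lemma payload_pairs: "payload x p \<longleftrightarrow> p < length ps \<and> fst (ps ! p)"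
  using input_pairs[of p] by (cases "p < length ps") (auto simp: payload_def x)

lemma terminator_pairs: "terminator x p \<longleftrightarrow> p < length ps \<and> \<not> fst (ps ! p)"
  using input_pairs[of p] by (cases "p < length ps") (auto simp: terminator_def x)

lemma payload_bit_pairs: "p < length ps \<Longrightarrow> payload_bit x p \<longleftrightarrow> snd (ps ! p)"
  using input_pairs[of p] by (auto simp: payload_bit_def)

lemma block_index_pairs: "block_index x p = length (filter (\<lambda>a. \<not> fst a) (take p ps))"
proof -
  have "{t. t < length (take p ps) \<and> \<not> fst (take p ps ! t)} = {t \<in> {..<radix x}. t < p \<and> terminator x t}"
    using pairs_radix by (auto simp: terminator_pairs)
  then show ?thesis
    by (simp only: length_filter_conv_card block_index_def sum_of_bool_card)
qed

lemma num_blocks_pairs: "num_blocks x = length (filter (\<lambda>a. \<not> fst a) ps)"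
proof -
  have "{t. t < length ps \<and> \<not> fst (ps ! t)} = {t \<in> {..<radix x}. terminator x t}"
    using pairs_radix by (auto simp: terminator_pairs)
  then show ?thesis
    by (simp only: length_filter_conv_card num_blocks_def sum_of_bool_card)
qed

end

lemma count_terminators: "length (filter (\<lambda>a. \<not> fst a) (pairs bss)) = length bss"
  by (induction bss) (simp_all add: comp_def)

lemma take_le_filter_length: "p \<le> q \<Longrightarrow> length (filter P (take p ps)) \<le> length (filter P (take q ps))"
proof -
  assume "p \<le> q"
  then have "take q ps = take p ps @ take (q - p) (drop p ps)" by (metis le_add_diff_inverse take_add)
  then show ?thesis by simp
qed

section \<open>Position and value of a single block\<close>

context
  fixes x :: "bool list" and pre post :: "bool list list" and bs :: "bool list" and b j :: nat
  assumes x: "x = concat (map block (pre @ bs # post))"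
  defines "b \<equiv> length (pairs pre)" and "j \<equiv> length pre"
begin

private lemma xp: "x = flat_pairs (pairs (pre @ bs # post))"
  by (simp only: x blocks_flat_pairs)

lemma block_in_radix: "b + length bs < radix x"
  using pairs_radix[OF xp] by (simp add: b_def)

lemma block_index_at: "t \<le> length bs \<Longrightarrow> block_index x (b + t) = j"
  by (simp add: block_index_pairs[OF xp] b_def j_def count_terminators take_map comp_def)

lemma payload_at: "t < length bs \<Longrightarrow> payload x (b + t)"
  by (simp add: payload_pairs[OF xp] b_def nth_append)

lemma payload_bit_at: "t < length bs \<Longrightarrow> payload_bit x (b + t) \<longleftrightarrow> bs ! t"
  using payload_bit_pairs[OF xp, of "b + t"] by (simp add: b_def nth_append)

lemma terminator_at: "terminator x (b + length bs)"
  by (simp add: terminator_pairs[OF xp] b_def nth_append)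

lemma block_index_lower: "p < b \<Longrightarrow> block_index x p < j"
proof -
  assume p: "p < b"
  then have "pre \<noteq> []" by (auto simp: b_def)
  then obtain pre' bs' where pre: "pre = pre' @ [bs']" by (cases pre rule: rev_cases) auto
  \<comment> \<open>Position \<open>b - 1\<close> holds the terminator of the preceding block;
    leaving it out of the count makes the bound strict.\<close>
  have "block_index x p \<le> length (filter (\<lambda>a. \<not> fst a) (take (b - 1) (pairs (pre @ bs # post))))"
    unfolding block_index_pairs[OF xp] using p by (intro take_le_filter_length) auto
  also have "\<dots> < j" by (simp add: b_def j_def pre count_terminators comp_def)
  finally show ?thesis .
qed

lemma block_index_upper: "b + length bs < p \<Longrightarrow> j < block_index x p"
proof -
  assume p: "b + length bs < p"
  have "j < length (filter (\<lambda>a. \<not> fst a) (take (Suc (b + length bs)) (pairs (pre @ bs # post))))"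
    by (simp add: b_def j_def count_terminators comp_def take_Suc_conv_app_nth)
  also have "\<dots> \<le> block_index x p"
    unfolding block_index_pairs[OF xp] using p by (intro take_le_filter_length) auto
  finally show ?thesis .
qed

lemma payload_block_iff: "payload x p \<and> block_index x p = j \<longleftrightarrow> (\<exists>t<length bs. p = b + t)"
proof
  assume p: "payload x p \<and> block_index x p = j"
  then have "b \<le> p" "p \<le> b + length bs"
    using block_index_lower[of p] block_index_upper[of p] by (auto simp: not_less[symmetric])
  moreover have "p \<noteq> b + length bs"
    using p terminator_at by (auto simp: payload_pairs[OF xp] terminator_pairs[OF xp])
  ultimately show "\<exists>t<length bs. p = b + t" by (intro exI[of _ "p - b"]) auto
qed (auto simp: payload_at block_index_at)

lemma ex_block: "(\<exists>p<radix x. (\<exists>t<length bs. p = b + t) \<and> Q p) \<longleftrightarrow> (\<exists>t<length bs. Q (b + t))"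
proof
  assume "\<exists>t<length bs. Q (b + t)"
  then obtain t where t: "t < length bs" "Q (b + t)" by blast
  then have "b + t < radix x" using block_in_radix by linarith
  with t show "\<exists>p<radix x. (\<exists>t<length bs. p = b + t) \<and> Q p" by blast
qed blast

lemma block_sum_eq:
  "(\<Sum>p<radix x. if payload x p \<and> block_index x p = j then G p else 0) = (\<Sum>t<length bs. G (b + t))"
proof -
  have "(\<Sum>p<radix x. if payload x p \<and> block_index x p = j then G p else 0) =
      sum G {p \<in> {..<radix x}. payload x p \<and> block_index x p = j}"
    by (rule sum.inter_filter[symmetric]) simp
  also have "{p \<in> {..<radix x}. payload x p \<and> block_index x p = j} = (\<lambda>t. b + t) ` {..<length bs}"
    unfolding payload_block_iff using block_in_radix by auto
  also have "sum G \<dots> = (\<Sum>t<length bs. G (b + t))"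
    by (subst sum.reindex) (auto simp: inj_on_def)
  finally show ?thesis .
qed

lemma weight_at:
  assumes "t < length bs" shows "weight x (b + t) = 2 ^ t"
proof -
  have "weight x (b + t) = prod (\<lambda>_. 2) {s \<in> {..<radix x}. s < b + t \<and> block_index x s = j}"
    unfolding weight_def block_index_at[OF less_imp_le[OF assms]] by (rule prod.inter_filter[symmetric]) simp
  also have "{s \<in> {..<radix x}. s < b + t \<and> block_index x s = j} = {b..<b + t}"
  proof (intro equalityI subsetI)
    fix s assume "s \<in> {b..<b + t}"
    then show "s \<in> {s \<in> {..<radix x}. s < b + t \<and> block_index x s = j}"
      using block_index_at[of "s - b"] assms block_in_radix by auto
  next
    fix s assume s: "s \<in> {s \<in> {..<radix x}. s < b + t \<and> block_index x s = j}"
    then have "\<not> s < b" using block_index_lower[of s] by auto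
    with s show "s \<in> {b..<b + t}" by auto
  qed
  finally show ?thesis by simp
qed

lemma unary_block_at: "unary_block x j = length bs"
  using block_sum_eq[of "\<lambda>_. 1 :: nat"] by (simp add: unary_block_def of_bool_def)

lemma denominator_at: "j = k + k + 3 \<Longrightarrow> denominator x k = 2 * int (binary bs)"
proof -
  assume j: "j = k + k + 3"
  have "(\<Sum>p<radix x. if payload x p \<and> payload_bit x p \<and> block_index x p = k + k + 3 then weight x p else 0) =
      (\<Sum>p<radix x. if payload x p \<and> block_index x p = j then if payload_bit x p then weight x p else 0 else 0)"
    unfolding j by (intro sum.cong) auto
  also have "\<dots> = (\<Sum>t<length bs. if bs ! t then 2 ^ t else 0)"
    unfolding block_sum_eq by (intro sum.cong) (auto simp: payload_bit_at weight_at)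
  also have "\<dots> = int (binary bs)" by (simp add: binary_sum if_distrib cong: if_cong)
  finally show ?thesis by (simp add: denominator_def)
qed

text \<open>The preceding pair is a terminator exactly at the start of a block, which is how the
  sign bit is distinguished from the digits. Since some block precedes, the subtraction is not
  truncated.\<close>

lemma previous_input:
  assumes "pre \<noteq> []" "t < length bs"
  shows "input x (b + t + (b + t) - 2) = of_bool (0 < t)"
proof -
  obtain pre' bs' where pre: "pre = pre' @ [bs']" using assms by (cases pre rule: rev_cases) auto
  have b: "0 < b" by (simp add: b_def pre)
  have "b + t + (b + t) - 2 = (b + t - 1) + (b + t - 1)" using b by simp
  also have "input x \<dots> = of_bool (fst (pairs (pre @ bs # post) ! (b + t - 1)))"
    by (rule input_pairs[OF xp]) (use assms in \<open>simp add: b_def\<close>)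
  also have "fst (pairs (pre @ bs # post) ! (b + t - 1)) \<longleftrightarrow> 0 < t"
    using assms(2) by (cases t) (simp_all add: b_def pre nth_append)
  finally show ?thesis .
qed

lemma negative_at:
  assumes j: "j = k + k + 2" and "bs \<noteq> []" shows "negative x k \<longleftrightarrow> hd bs"
proof -
  have pre: "pre \<noteq> []" using j by (auto simp: j_def)
  have "negative x k \<longleftrightarrow> (\<exists>p<radix x. (payload x p \<and> block_index x p = j) \<and> payload_bit x p \<and> input x (p + p - 2) = 0)"
    by (auto simp: negative_def j)
  also have "\<dots> \<longleftrightarrow> (\<exists>t<length bs. payload_bit x (b + t) \<and> input x (b + t + (b + t) - 2) = 0)"
    unfolding payload_block_iff ex_block ..
  also have "\<dots> \<longleftrightarrow> (\<exists>t<length bs. bs ! t \<and> t = 0)"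
    by (rule ex_cong1, rule conj_cong) (auto simp: previous_input[OF pre] payload_bit_at)
  also have "\<dots> \<longleftrightarrow> hd bs" using assms by (auto simp: hd_conv_nth)
  finally show ?thesis .
qed

lemma numerator_at:
  assumes j: "j = k + k + 2" and "bs \<noteq> []" shows "numerator x k = 2 * int (binary (tl bs))"
proof -
  have pre: "pre \<noteq> []" using j by (auto simp: j_def)
  obtain c cs where bs: "bs = c # cs" using assms by (cases bs) auto
  have "numerator x k = (\<Sum>p<radix x. if payload x p \<and> block_index x p = j
      then if payload_bit x p \<and> input x (p + p - 2) = 1 then weight x p else 0 else 0)"
    unfolding numerator_def j by (intro sum.cong) auto
  also have "\<dots> = (\<Sum>t<length bs. if bs ! t \<and> 0 < t then 2 ^ t else 0)"
    unfolding block_sum_eq by (intro sum.cong) (auto simp: payload_bit_at weight_at previous_input[OF pre])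
  also have "\<dots> = (\<Sum>t<length cs. if cs ! t then 2 * 2 ^ t else 0)"
    unfolding bs length_Cons sum.lessThan_Suc_shift by (auto intro!: sum.cong)
  also have "\<dots> = 2 * int (binary cs)"
    by (simp add: binary_sum sum_distrib_left if_distrib cong: if_cong)
  finally show ?thesis by (simp add: bs)
qed

lemma nonempty_at: "(\<exists>p<radix x. payload x p \<and> block_index x p = j) \<longleftrightarrow> bs \<noteq> []"
  using ex_block[of "\<lambda>_. True"] by (simp add: payload_block_iff) (cases bs; auto)

lemma nonzero_at: "(\<exists>p<radix x. payload x p \<and> payload_bit x p \<and> block_index x p = j) \<longleftrightarrow> binary bs \<noteq> 0"
proof -
  have "(\<exists>p<radix x. payload x p \<and> payload_bit x p \<and> block_index x p = j) \<longleftrightarrow>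
      (\<exists>p<radix x. (payload x p \<and> block_index x p = j) \<and> payload_bit x p)" by blast
  also have "\<dots> \<longleftrightarrow> (\<exists>t<length bs. payload_bit x (b + t))"
    unfolding payload_block_iff ex_block ..
  also have "\<dots> \<longleftrightarrow> binary bs \<noteq> 0" unfolding binary_nonzero using payload_bit_at by blast
  finally show ?thesis .
qed

lemma all_true_at:
  "(\<forall>p<radix x. payload x p \<and> block_index x p = j \<longrightarrow> payload_bit x p) \<longleftrightarrow> bs = replicate (length bs) True"
proof -
  have "(\<forall>p<radix x. payload x p \<and> block_index x p = j \<longrightarrow> payload_bit x p) \<longleftrightarrow> (\<forall>t<length bs. payload_bit x (b + t))"
    unfolding payload_block_iff using ex_block[of "\<lambda>p. \<not> payload_bit x p"] by blast
  also have "\<dots> \<longleftrightarrow> (\<forall>t<length bs. bs ! t)" using payload_bit_at by blast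
  also have "\<dots> \<longleftrightarrow> bs = replicate (length bs) True" by (auto simp: list_eq_iff_nth_eq)
  finally show ?thesis .
qed

end

section \<open>Recognition of well-formed instances\<close>

fun fraction_blocks :: "fraction \<Rightarrow> bool list list" where
  "fraction_blocks (s, num, den) = [s # num, den]"

definition instance_blocks :: "nat \<Rightarrow> nat \<Rightarrow> fraction list \<Rightarrow> bool list list" where
  "instance_blocks m r fs = replicate m True # replicate r True # concat (map fraction_blocks fs)"

lemma concat_fraction_blocks:
  "concat (map block (concat (map fraction_blocks fs))) = concat (map fraction_code fs)"
proof (induction fs)
  case (Cons f fs)
  then show ?case by (cases f) simp
qed simp

lemma length_fraction_blocks: "length (concat (map fraction_blocks fs)) = 2 * length fs"
proof (induction fs)
  case (Cons f fs)
  then show ?case by (cases f) simp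
qed simp

lemma nth_fraction_blocks:
  "k < length fs \<Longrightarrow> concat (map fraction_blocks fs) ! (2 * k) = fst (fs ! k) # fst (snd (fs ! k)) \<and>
     concat (map fraction_blocks fs) ! Suc (2 * k) = snd (snd (fs ! k))"
proof (induction fs arbitrary: k)
  case (Cons f fs)
  then show ?case by (cases f; cases k) auto
qed simp

lemma fraction_blocks_exist:
  "length bss = 2 * L \<Longrightarrow> (\<And>k. k < L \<Longrightarrow> bss ! (2 * k) \<noteq> []) \<Longrightarrow>
     \<exists>fs. length fs = L \<and> bss = concat (map fraction_blocks fs)"
proof (induction L arbitrary: bss)
  case (Suc L)
  then obtain a b bss' where bss: "bss = a # b # bss'" by (cases bss; cases "tl bss") auto
  have "bss' ! (2 * k) \<noteq> []" if "k < L" for k using Suc.prems(2)[of "Suc k"] that by (simp add: bss)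
  then obtain fs where fs: "length fs = L" "bss' = concat (map fraction_blocks fs)"
    using Suc.IH[of bss'] Suc.prems(1) by (auto simp: bss)
  have "a \<noteq> []" using Suc.prems(2)[of 0] by (simp add: bss)
  then obtain s num where "a = s # num" by (cases a) auto
  then show ?case using fs by (intro exI[of _ "(s, num, b) # fs"]) (simp add: bss)
qed simp

lemma pairs_exist:
  "(\<forall>a\<in>set ps. \<not> fst a \<longrightarrow> \<not> snd a) \<Longrightarrow> ps = [] \<or> \<not> fst (last ps) \<Longrightarrow> \<exists>bss. ps = pairs bss"
proof (induction ps)
  case Nil
  show ?case by (rule exI[of _ "[]"]) simp
next
  case (Cons a ps)
  obtain s b where a: "a = (s, b)" by (cases a)
  have "ps = [] \<or> \<not> fst (last ps)" using Cons.prems(2) by (cases ps) auto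
  then obtain bss where bss: "ps = pairs bss" using Cons.IH Cons.prems(1) by auto
  show ?case
  proof (cases s)
    case False
    then have "a # ps = pairs ([] # bss)" using Cons.prems(1) by (simp add: a bss)
    then show ?thesis ..
  next
    case True
    then have "ps \<noteq> []" using Cons.prems(2) by (auto simp: a)
    then obtain bs bss' where "bss = bs # bss'" using bss by (cases bss) auto
    then have "a # ps = pairs ((b # bs) # bss')" using True by (simp add: a bss)
    then show ?thesis ..
  qed
qed

lemma blocks_exist:
  assumes p: "p + p + 2 = length x" "terminator x p"
    and t: "\<forall>p<radix x. terminator x p \<longrightarrow> \<not> payload_bit x p"
  shows "\<exists>bss. bss \<noteq> [] \<and> x = concat (map block bss)"
proof -
  define ps where "ps = map (\<lambda>q. (x ! (2 * q), x ! Suc (2 * q))) [0..<Suc p]"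
  have len: "length ps = Suc p" by (simp add: ps_def)
  have x: "x = flat_pairs ps"
  proof (rule nth_equalityI)
    fix i assume i: "i < length x"
    show "x ! i = flat_pairs ps ! i"
    proof (cases "even i")
      case True
      then obtain q where q: "i = 2 * q" ..
      then show ?thesis using i p(1) nth_flat_pairs[of q ps] by (simp add: len) (simp add: ps_def del: upt_Suc)
    next
      case False
      then obtain q where q: "i = Suc (2 * q)" by (auto elim: oddE)
      then show ?thesis using i p(1) nth_flat_pairs[of q ps] by (simp add: len) (simp add: ps_def del: upt_Suc)
    qed
  qed (use p in \<open>simp add: len\<close>)
  have "\<not> fst (ps ! p)" using p(2) by (simp add: terminator_pairs[OF x])
  then have 1: "ps = [] \<or> \<not> fst (last ps)" using len by (cases "ps = []") (simp_all add: last_conv_nth)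
  have 2: "\<forall>a\<in>set ps. \<not> fst a \<longrightarrow> \<not> snd a"
  proof (intro ballI impI)
    fix a assume "a \<in> set ps" "\<not> fst a"
    then obtain q where q: "q < length ps" "a = ps ! q" by (auto simp: in_set_conv_nth)
    then have "terminator x q" "q < radix x"
      using \<open>\<not> fst a\<close> pairs_radix[OF x] by (auto simp: terminator_pairs[OF x])
    then have "\<not> payload_bit x q" using t by blast
    then show "\<not> snd a" using q payload_bit_pairs[OF x] by simp
  qed
  obtain bss where bss: "ps = pairs bss" using pairs_exist[OF 2 1] by blast
  then have "bss \<noteq> []" using len by auto
  then show ?thesis using bss x by (auto simp: blocks_flat_pairs)
qed

context
  fixes x :: "bool list" and bss :: "bool list list"
  assumes x: "x = concat (map block bss)"
begin

private lemma split: "j < length bss \<Longrightarrow> x = concat (map block (take j bss @ bss ! j # drop (Suc j) bss))"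
  using id_take_nth_drop[of j bss] x by simp

lemma num_blocks_eq: "num_blocks x = length bss"
  using num_blocks_pairs[of x "pairs bss"] by (simp add: x blocks_flat_pairs count_terminators)

lemma num_blocks_radix: "length bss < radix x"
proof -
  have xp: "x = flat_pairs (pairs bss)" by (simp add: x blocks_flat_pairs)
  have "length bss \<le> length (pairs bss)"
    using length_filter_le[of "\<lambda>a. \<not> fst a" "pairs bss"] by (simp add: count_terminators)
  then show ?thesis using pairs_radix[OF xp] by simp
qed

lemma unary_block_nth: "j < length bss \<Longrightarrow> unary_block x j = length (bss ! j)"
  using unary_block_at[OF split[of j]] by simp

lemma all_true_nth: "j < length bss \<Longrightarrow>
    (\<forall>p<radix x. payload x p \<and> block_index x p = j \<longrightarrow> payload_bit x p) \<longleftrightarrow> bss ! j = replicate (length (bss ! j)) True"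
  using all_true_at[OF split[of j]] by simp

lemma nonempty_nth: "j < length bss \<Longrightarrow> (\<exists>p<radix x. payload x p \<and> block_index x p = j) \<longleftrightarrow> bss ! j \<noteq> []"
  using nonempty_at[OF split[of j]] by simp

lemma nonzero_nth: "j < length bss \<Longrightarrow>
    (\<exists>p<radix x. payload x p \<and> payload_bit x p \<and> block_index x p = j) \<longleftrightarrow> binary (bss ! j) \<noteq> 0"
  using nonzero_at[OF split[of j]] by simp

lemma denominator_nth: "k + k + 3 < length bss \<Longrightarrow> denominator x k = 2 * int (binary (bss ! (k + k + 3)))"
  by (rule denominator_at[OF split]) simp_all

lemma negative_nth: "k + k + 2 < length bss \<Longrightarrow> bss ! (k + k + 2) \<noteq> [] \<Longrightarrow> negative x k \<longleftrightarrow> hd (bss ! (k + k + 2))"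
  by (rule negative_at[OF split]) simp_all

lemma numerator_nth:
  "k + k + 2 < length bss \<Longrightarrow> bss ! (k + k + 2) \<noteq> [] \<Longrightarrow> numerator x k = 2 * int (binary (tl (bss ! (k + k + 2))))"
  by (rule numerator_at[OF split]) simp_all

lemma well_formed_blocks:
  assumes "2 \<le> length bss"
  shows "well_formed x \<longleftrightarrow>
    (\<forall>j<2. bss ! j = replicate (length (bss ! j)) True) \<and> bss ! 0 \<noteq> [] \<and> bss ! 1 \<noteq> [] \<and>
    length bss = 2 + 4 * length (bss ! 1) * length (bss ! 0) * length (bss ! 0) \<and>
    (\<forall>k. k + k + 3 < length bss \<longrightarrow> bss ! (k + k + 2) \<noteq> [] \<and> binary (bss ! (k + k + 3)) \<noteq> 0)"
proof -
  have xp: "x = flat_pairs (pairs bss)" by (simp add: x blocks_flat_pairs)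
  obtain bs bss' where bss: "bss = bss' @ [bs]" using assms by (cases bss rule: rev_cases) auto
  have 1: "\<exists>p<radix x. p + p + 2 = length x \<and> terminator x p"
  proof (intro exI conjI)
    show "length (pairs bss) - 1 < radix x" using pairs_radix[OF xp] by simp
    show "length (pairs bss) - 1 + (length (pairs bss) - 1) + 2 = length x" by (simp add: xp bss)
    show "terminator x (length (pairs bss) - 1)" by (simp add: terminator_pairs[OF xp] bss nth_append)
  qed
  have "\<forall>a\<in>set (pairs bss). \<not> fst a \<longrightarrow> \<not> snd a" by (auto simp: pairs_def)
  then have 2: "\<forall>p<radix x. terminator x p \<longrightarrow> \<not> payload_bit x p"
    using payload_bit_pairs[OF xp] by (auto simp: terminator_pairs[OF xp])
  have 3: "(\<forall>p<radix x. payload x p \<and> block_index x p < 2 \<longrightarrow> payload_bit x p) \<longleftrightarrow>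
      (\<forall>j<2. bss ! j = replicate (length (bss ! j)) True)"
  proof -
    have "(\<forall>p<radix x. payload x p \<and> block_index x p < 2 \<longrightarrow> payload_bit x p) \<longleftrightarrow>
        (\<forall>j<2. \<forall>p<radix x. payload x p \<and> block_index x p = j \<longrightarrow> payload_bit x p)" by blast
    also have "\<dots> \<longleftrightarrow> (\<forall>j<2. bss ! j = replicate (length (bss ! j)) True)"
      using all_true_nth assms by (intro all_cong) simp
    finally show ?thesis .
  qed
  have m0: "dim_m x = length (bss ! 0)" by (rule unary_block_nth) (use assms in linarith)
  have m1: "dim_r x = length (bss ! 1)" by (rule unary_block_nth) (use assms in linarith)
  have 4: "(\<forall>k<radix x. k + k + 3 < num_blocks x \<longrightarrow>
        (\<exists>p<radix x. payload x p \<and> block_index x p = k + k + 2) \<and>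
        (\<exists>p<radix x. payload x p \<and> payload_bit x p \<and> block_index x p = k + k + 3)) \<longleftrightarrow>
      (\<forall>k. k + k + 3 < length bss \<longrightarrow> bss ! (k + k + 2) \<noteq> [] \<and> binary (bss ! (k + k + 3)) \<noteq> 0)"
  proof -
    have rad: "k < radix x" if "k + k + 3 < length bss" for k using num_blocks_radix that by linarith
    have e1: "(\<exists>p<radix x. payload x p \<and> block_index x p = k + k + 2) \<longleftrightarrow> bss ! (k + k + 2) \<noteq> []"
      if "k + k + 3 < length bss" for k by (rule nonempty_nth) (use that in simp)
    have e2: "(\<exists>p<radix x. payload x p \<and> payload_bit x p \<and> block_index x p = k + k + 3) \<longleftrightarrow> binary (bss ! (k + k + 3)) \<noteq> 0"
      if "k + k + 3 < length bss" for k by (rule nonzero_nth) (use that in simp)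
    show ?thesis
      unfolding num_blocks_eq by (rule iff_allI) (simp only: e1 e2 cong: imp_cong, use rad in blast)
  qed
  show ?thesis
    unfolding well_formed_def 3 4 unfolding m0 m1 num_blocks_eq using 1 2 by auto
qed

end

lemma well_formed_instance:
  "well_formed x \<longleftrightarrow> (\<exists>m r fs. 1 \<le> m \<and> 1 \<le> r \<and> length fs = 2 * r * m * m \<and> (\<forall>f\<in>set fs. valid_fraction f) \<and>
     x = concat (map block (instance_blocks m r fs)))"
proof
  assume wf: "well_formed x"
  then obtain p where p: "p + p + 2 = length x" "terminator x p"
    and t: "\<forall>p<radix x. terminator x p \<longrightarrow> \<not> payload_bit x p" and nb: "num_blocks x = 2 + 4 * dim_r x * dim_m x * dim_m x"
    by (auto simp: well_formed_def)
  obtain bss where x: "x = concat (map block bss)" using blocks_exist[OF p t] by blast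
  have "2 \<le> length bss" using nb num_blocks_eq[OF x] by simp
  note wf' = wf[unfolded well_formed_blocks[OF x this]]
  obtain b0 b1 cs where bss: "bss = b0 # b1 # cs"
    using \<open>2 \<le> length bss\<close> by (cases bss; cases "tl bss") auto
  define m r where "m = length b0" and "r = length b1"
  have b: "b0 = replicate m True" "b1 = replicate r True" "1 \<le> m" "1 \<le> r"
    using wf' by (auto simp: bss m_def r_def less_Suc_eq eval_nat_numeral Suc_le_eq)
  have len: "length cs = 2 * (2 * r * m * m)" using wf' by (simp add: bss m_def r_def)
  have *: "cs ! (2 * k) \<noteq> [] \<and> binary (cs ! Suc (2 * k)) \<noteq> 0" if "k < 2 * r * m * m" for k
  proof -
    have "k + k + 3 < length bss" using that by (simp add: bss len)
    then have "bss ! (k + k + 2) \<noteq> [] \<and> binary (bss ! (k + k + 3)) \<noteq> 0" using wf' by blast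
    then show ?thesis by (simp add: bss mult_2 eval_nat_numeral)
  qed
  then obtain fs where fs: "length fs = 2 * r * m * m" "cs = concat (map fraction_blocks fs)"
    using fraction_blocks_exist[OF len] by blast
  have "valid_fraction f" if f: "f \<in> set fs" for f
  proof -
    obtain k where k: "k < length fs" "fs ! k = f" using f unfolding in_set_conv_nth by blast
    have "binary (cs ! Suc (2 * k)) \<noteq> 0" using *[of k] k(1) unfolding fs(1) by blast
    then have "binary (snd (snd f)) \<noteq> 0" unfolding fs(2) using nth_fraction_blocks[OF k(1)] k(2) by simp
    then show ?thesis by (cases f) simp
  qed
  then show "\<exists>m r fs. 1 \<le> m \<and> 1 \<le> r \<and> length fs = 2 * r * m * m \<and> (\<forall>f\<in>set fs. valid_fraction f) \<and>
     x = concat (map block (instance_blocks m r fs))"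
    using b fs x by (intro exI[of _ m] exI[of _ r] exI[of _ fs]) (auto simp: instance_blocks_def bss)
next
  assume "\<exists>m r fs. 1 \<le> m \<and> 1 \<le> r \<and> length fs = 2 * r * m * m \<and> (\<forall>f\<in>set fs. valid_fraction f) \<and>
     x = concat (map block (instance_blocks m r fs))"
  then obtain m r fs where mr: "1 \<le> m" "1 \<le> r" and fs: "length fs = 2 * r * m * m" "\<forall>f\<in>set fs. valid_fraction f"
    and x: "x = concat (map block (instance_blocks m r fs))" by blast
  have len: "length (instance_blocks m r fs) = 2 + 2 * length fs"
    by (simp only: instance_blocks_def list.size length_fraction_blocks)
  have *: "instance_blocks m r fs ! (k + k + 2) \<noteq> [] \<and> binary (instance_blocks m r fs ! (k + k + 3)) \<noteq> 0"
    if "k + k + 3 < length (instance_blocks m r fs)" for k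
  proof -
    have k: "k < length fs" using that len by simp
    then have "valid_fraction (fs ! k)" using fs(2) by simp
    then have "binary (snd (snd (fs ! k))) \<noteq> 0" by (cases "fs ! k") simp
    then show ?thesis
      using nth_fraction_blocks[OF k] by (simp add: instance_blocks_def mult_2 eval_nat_numeral)
  qed
  have eq: "instance_blocks m r fs ! 0 = replicate m True" "instance_blocks m r fs ! Suc 0 = replicate r True"
    by (simp_all add: instance_blocks_def)
  have len': "length (instance_blocks m r fs) = 2 + 4 * r * m * m" using len fs(1) by simp
  show "well_formed x"
    by (subst well_formed_blocks[OF x]) (use * mr in \<open>auto simp: less_2_cases_iff eq len'\<close>)
qed

lemma instance_dims:
  assumes x: "x = concat (map block (instance_blocks m r fs))"
  shows "dim_m x = m" "dim_r x = r" "length fs < radix x"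
proof -
  show "dim_m x = m" using unary_block_nth[OF x, of 0] by (simp add: instance_blocks_def)
  show "dim_r x = r" using unary_block_nth[OF x, of 1] by (simp add: instance_blocks_def)
  have "length (instance_blocks m r fs) = 2 + 2 * length fs"
    by (simp only: instance_blocks_def list.size length_fraction_blocks)
  then show "length fs < radix x" using num_blocks_radix[OF x] by simp
qed

text \<open>The factor \<open>D\<close> is the product of all the doubled denominators. In the k-th
  entry the factor \<open>denominator x k\<close> is replaced by the signed doubled numerator, which
  is its product with the value of the fraction, so the doubling cancels.\<close>

lemma instance_entry:
  assumes x: "x = concat (map block (instance_blocks m r fs))" and valid: "\<forall>f\<in>set fs. valid_fraction f"
  shows "\<exists>D. D \<noteq> 0 \<and> (\<forall>k<length fs. of_int (entry x k) = of_int D * fraction_value (fs ! k))"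
proof -
  have len: "length (instance_blocks m r fs) = 2 + 2 * length fs"
    by (simp only: instance_blocks_def list.size length_fraction_blocks)
  have nb: "num_blocks x = 2 + 2 * length fs" using num_blocks_eq[OF x] len by simp
  have blocks: "instance_blocks m r fs ! (k + k + 2) = fst (fs ! k) # fst (snd (fs ! k))"
    "instance_blocks m r fs ! (k + k + 3) = snd (snd (fs ! k))" if "k < length fs" for k
    using nth_fraction_blocks[OF that] by (simp_all add: instance_blocks_def mult_2 eval_nat_numeral)
  have den: "denominator x k = 2 * int (binary (snd (snd (fs ! k))))" if "k < length fs" for k
    using denominator_nth[OF x, of k] blocks[OF that] that len by simp
  have den0: "denominator x k \<noteq> 0" if "k < length fs" for k
  proof -
    have "valid_fraction (fs ! k)" using valid that by simp
    then show ?thesis using den[OF that] by (cases "fs ! k") simp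
  qed
  define N where "N k = (if negative x k then - numerator x k else numerator x k)" for k
  have N: "rat_of_int (N k) = fraction_value (fs ! k) * of_int (denominator x k)" if "k < length fs" for k
  proof -
    have "N k = (if fst (fs ! k) then - 1 else 1) * (2 * int (binary (fst (snd (fs ! k)))))"
      using negative_nth[OF x, of k] numerator_nth[OF x, of k] blocks[OF that] that len by (simp add: N_def)
    then show ?thesis using den[OF that] den0[OF that] by (cases "fs ! k") (simp add: field_simps)
  qed
  define D where "D = (\<Prod>j<length fs. denominator x j)"
  have "of_int (entry x k) = of_int D * fraction_value (fs ! k)" if k: "k < length fs" for k
  proof -
    have "entry x k = (\<Prod>j\<in>{..<radix x}. if j < length fs then if j = k then N j else denominator x j else 1)"
      unfolding entry_def nb N_def by (intro prod.cong) auto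
    also have "\<dots> = (\<Prod>j\<in>{j \<in> {..<radix x}. j < length fs}. if j = k then N j else denominator x j)"
      by (rule prod.inter_filter[symmetric]) simp
    also have "{j \<in> {..<radix x}. j < length fs} = {..<length fs}" using instance_dims(3)[OF x] by auto
    also have "(\<Prod>j<length fs. if j = k then N j else denominator x j) = N k * (\<Prod>j\<in>{..<length fs} - {k}. denominator x j)"
      using k by (subst prod.remove[of _ k]) (auto intro!: prod.cong)
    finally have "rat_of_int (entry x k) = fraction_value (fs ! k) * of_int (denominator x k * (\<Prod>j\<in>{..<length fs} - {k}. denominator x j))"
      using N[OF k] by simp
    also have "denominator x k * (\<Prod>j\<in>{..<length fs} - {k}. denominator x j) = D"
      using k by (simp add: D_def prod.remove[of _ k])
    finally show ?thesis by simp
  qed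
  moreover have "D \<noteq> 0" using den0 by (simp add: D_def)
  ultimately show ?thesis by blast
qed

section \<open>Matrix entries and their positions in the list of fractions\<close>

lemma nth_concat_uniform:
  "(\<And>ys. ys \<in> set xss \<Longrightarrow> length ys = n) \<Longrightarrow> i < length xss \<Longrightarrow> j < n \<Longrightarrow> concat xss ! (i * n + j) = xss ! i ! j"
proof (induction xss arbitrary: i)
  case (Cons xs xss)
  then show ?case by (cases i) (auto simp: nth_append add_ac)
qed simp

lemma length_concat_uniform:
  "(\<And>ys. ys \<in> set xss \<Longrightarrow> length ys = n) \<Longrightarrow> length (concat xss) = length xss * n"
  by (induction xss) auto

lemma length_concat_mat: "X \<in> carrier_mat m m \<Longrightarrow> length (concat (mat_to_list X)) = m * m"
  by (subst length_concat_uniform[where n = m]) (auto simp: mat_to_list_def)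

lemma length_tuple_entries: "A \<in> mat_tuples m r \<Longrightarrow> length (tuple_entries A) = r * (m * m)"
  unfolding tuple_entries_def mat_tuples_def
  by (subst length_concat_uniform[where n = "m * m"]) (auto intro!: length_concat_mat)

lemma nth_tuple_entries:
  assumes A: "A \<in> mat_tuples m r" and i: "i < r" "u < m" "v < m"
  shows "tuple_entries A ! ((i * m + u) * m + v) = A ! i $$ (u, v)"
proof -
  have len: "length ys = m * m" if "ys \<in> set (map (\<lambda>X. concat (mat_to_list X)) A)" for ys
    using A that by (auto simp: mat_tuples_def intro!: length_concat_mat)
  have Ai: "A ! i \<in> carrier_mat m m" using A i by (auto simp: mat_tuples_def)
  have uv: "u * m + v < m * m"
  proof -
    have "u * m + v < Suc u * m" using i by simp
    also have "\<dots> \<le> m * m" using i by (intro mult_right_mono) auto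
    finally show ?thesis .
  qed
  have "tuple_entries A ! (i * (m * m) + (u * m + v)) = concat (mat_to_list (A ! i)) ! (u * m + v)"
    unfolding tuple_entries_def using nth_concat_uniform[where xss = "map (\<lambda>X. concat (mat_to_list X)) A" and i = i and j = "u * m + v", OF len] A i uv by (simp add: mat_tuples_def)
  also have "\<dots> = mat_to_list (A ! i) ! u ! v"
    by (rule nth_concat_uniform) (use Ai i in \<open>auto simp: mat_to_list_def\<close>)
  also have "\<dots> = A ! i $$ (u, v)" using Ai i by (simp add: mat_to_list_def)
  finally show ?thesis by (simp add: algebra_simps)
qed

lemma tuple_entries_exist:
  assumes "length vs = r * (m * m)"
  shows "\<exists>A\<in>mat_tuples m r. tuple_entries A = vs"
proof -
  define A where "A = map (\<lambda>i. mat m m (\<lambda>(u, v). vs ! ((i * m + u) * m + v))) [0..<r]"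
  have A: "A \<in> mat_tuples m r" by (auto simp: A_def mat_tuples_def)
  have "tuple_entries A = vs"
  proof (rule nth_equalityI)
    fix p assume "p < length (tuple_entries A)"
    then have p: "p < r * (m * m)" using length_tuple_entries[OF A] by simp
    then have m: "0 < m" by (cases m) auto
    define i u v where "i = p div m div m" and "u = p div m mod m" and "v = p mod m"
    have "i < r" using p by (simp add: i_def less_mult_imp_div_less mult.assoc[symmetric])
    moreover have "u < m" "v < m" using m by (simp_all add: u_def v_def)
    moreover have "p = (i * m + u) * m + v" by (simp add: i_def u_def v_def)
    ultimately show "tuple_entries A ! p = vs ! p" using nth_tuple_entries[OF A] by (simp add: A_def)
  qed (simp add: length_tuple_entries[OF A] assms)
  with A show ?thesis by blast
qed

definition encoded :: "bool list \<Rightarrow> nat \<Rightarrow> nat \<Rightarrow> rat mat list \<Rightarrow> rat mat list \<Rightarrow> bool" where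
  "encoded x m r A A' \<longleftrightarrow> 1 \<le> m \<and> 1 \<le> r \<and> A \<in> mat_tuples m r \<and> A' \<in> mat_tuples m r \<and> encodes x m r A A'"

lemma encoded_instance:
  assumes "encoded x m r A A'"
  obtains fs where "length fs = 2 * r * m * m" "\<forall>f\<in>set fs. valid_fraction f"
    "x = concat (map block (instance_blocks m r fs))" "map fraction_value fs = tuple_entries A @ tuple_entries A'"
proof -
  from assms obtain fs where fs: "\<forall>f\<in>set fs. valid_fraction f" "map fraction_value fs = tuple_entries A @ tuple_entries A'"
    "x = block (replicate m True) @ block (replicate r True) @ concat (map fraction_code fs)"
    by (auto simp: encoded_def encodes_def)
  have "length fs = length (map fraction_value fs)" by simp
  also have "\<dots> = 2 * r * m * m"
    unfolding fs(2) using assms length_tuple_entries[of A m r] length_tuple_entries[of A' m r]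
    by (simp add: encoded_def)
  finally show ?thesis
    using that[of fs] fs by (simp add: instance_blocks_def concat_fraction_blocks)
qed

lemma well_formed_encoded: "well_formed x \<longleftrightarrow> (\<exists>m r A A'. encoded x m r A A')"
proof
  assume "well_formed x"
  then obtain m r fs where mr: "1 \<le> m" "1 \<le> r" and fs: "length fs = 2 * r * m * m" "\<forall>f\<in>set fs. valid_fraction f"
    and x: "x = concat (map block (instance_blocks m r fs))"
    unfolding well_formed_instance by blast
  let ?vs = "map fraction_value fs" and ?N = "r * (m * m)"
  obtain A where A: "A \<in> mat_tuples m r" "tuple_entries A = take ?N ?vs"
    using tuple_entries_exist[of "take ?N ?vs" r m] fs by auto
  obtain A' where A': "A' \<in> mat_tuples m r" "tuple_entries A' = drop ?N ?vs"
    using tuple_entries_exist[of "drop ?N ?vs" r m] fs by auto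
  have "?vs = tuple_entries A @ tuple_entries A'" by (simp only: A(2) A'(2) append_take_drop_id)
  then have "encodes x m r A A'"
    unfolding encodes_def using fs(2) x
    by (intro exI[of _ fs]) (simp add: instance_blocks_def concat_fraction_blocks)
  then show "\<exists>m r A A'. encoded x m r A A'" using mr A A' unfolding encoded_def by blast
next
  assume "\<exists>m r A A'. encoded x m r A A'"
  then obtain m r A A' where e: "encoded x m r A A'" by blast
  show "well_formed x"
    using e by (rule encoded_instance) (use e in \<open>auto simp: well_formed_instance encoded_def\<close>)
qed

lemma encoded_letter:
  assumes e: "encoded x m r A A'"
  shows "dim_m x = m" "dim_r x = r"
    "\<exists>D. D \<noteq> 0 \<and> (\<forall>i<r. \<forall>u<m. \<forall>v<m. of_int (letter x 0 i u v) = of_int D * A ! i $$ (u, v) \<and>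
       of_int (letter x 1 i u v) = of_int D * A' ! i $$ (u, v))"
proof -
  obtain fs where len: "length fs = 2 * r * m * m" and valid: "\<forall>f\<in>set fs. valid_fraction f"
    and x: "x = concat (map block (instance_blocks m r fs))"
    and vs: "map fraction_value fs = tuple_entries A @ tuple_entries A'"
    using e by (rule encoded_instance)
  show d: "dim_m x = m" "dim_r x = r" using instance_dims[OF x] by auto
  obtain D where D: "D \<noteq> 0" "\<And>k. k < length fs \<Longrightarrow> of_int (entry x k) = of_int D * fraction_value (fs ! k)"
    using instance_entry[OF x valid] by blast
  have A: "A \<in> mat_tuples m r" "A' \<in> mat_tuples m r" using e by (auto simp: encoded_def)
  have "of_int (letter x 0 i u v) = of_int D * A ! i $$ (u, v) \<and>
       of_int (letter x 1 i u v) = of_int D * A' ! i $$ (u, v)" if iuv: "i < r" "u < m" "v < m" for i u v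
  proof -
    let ?k = "(i * m + u) * m + v"
    have k: "?k < r * (m * m)"
    proof -
      have "?k < Suc (i * m + u) * m" using iuv by simp
      also have "\<dots> \<le> (Suc i * m) * m" using iuv by (intro mult_right_mono) auto
      also have "\<dots> \<le> (r * m) * m" using iuv by (intro mult_right_mono) auto
      finally show ?thesis by (simp add: mult.assoc)
    qed
    have len2: "length fs = r * (m * m) + r * (m * m)" by (simp add: len)
    have "fraction_value (fs ! ?k) = (map fraction_value fs) ! ?k" using k len by simp
    also have "\<dots> = A ! i $$ (u, v)"
      unfolding vs using nth_tuple_entries[OF A(1) iuv] k by (simp add: nth_append length_tuple_entries[OF A(1)])
    finally have 0: "fraction_value (fs ! ?k) = A ! i $$ (u, v)" .
    have "fraction_value (fs ! (r * (m * m) + ?k)) = (map fraction_value fs) ! (r * (m * m) + ?k)"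
      by (rule nth_map[symmetric]) (use k len2 in linarith)
    also have "\<dots> = A' ! i $$ (u, v)"
      unfolding vs using nth_tuple_entries[OF A(2) iuv] by (simp add: nth_append length_tuple_entries[OF A(1)])
    finally have 1: "fraction_value (fs ! (r * (m * m) + ?k)) = A' ! i $$ (u, v)" .
    have "((1 * r + i) * m + u) * m + v = r * (m * m) + ?k" by (simp add: algebra_simps)
    then have "letter x 0 i u v = entry x ?k" "letter x 1 i u v = entry x (r * (m * m) + ?k)"
      using iuv d by (simp_all add: letter_def add.assoc)
    then show ?thesis using D(2)[of ?k] D(2)[of "r * (m * m) + ?k"] 0 1 k len2 by simp
  qed
  with D(1) show "\<exists>D. D \<noteq> 0 \<and> (\<forall>i<r. \<forall>u<m. \<forall>v<m. of_int (letter x 0 i u v) = of_int D * A ! i $$ (u, v) \<and>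
       of_int (letter x 1 i u v) = of_int D * A' ! i $$ (u, v))" by blast
qed

text \<open>Each fraction has two blocks, every block has at least a terminator, and a pair takes
  two bits. This bounds the order of the recurrence and the number of letters in terms of the input
  length.\<close>

lemma encoded_length:
  assumes e: "encoded x m r A A'" shows "4 * (r * (m * m)) + m + r < length x"
proof -
  obtain fs where len: "length fs = 2 * r * m * m" and x: "x = concat (map block (instance_blocks m r fs))"
    using e by (rule encoded_instance)
  have *: "length bss \<le> length (pairs bss)" for bss
    using length_filter_le[of "\<lambda>a. \<not> fst a" "pairs bss"] by (simp add: count_terminators)
  have "2 * length fs + m + r < length (pairs (instance_blocks m r fs))"
    using *[of "concat (map fraction_blocks fs)"] unfolding length_fraction_blocks by (simp add: instance_blocks_def)
  then show ?thesis using len by (simp add: x blocks_flat_pairs)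
qed

section \<open>Correlation of words\<close>

text \<open>The alphabet contains \<open>r\<close> itself, the letter reserved for the identity
  matrix.\<close>

definition words :: "nat \<Rightarrow> nat \<Rightarrow> nat list set" where
  "words r l = {w. set w \<subseteq> {..r} \<and> length w = l}"

lemma finite_words [simp]: "finite (words r l)"
  unfolding words_def by (rule finite_lists_length_eq) simp

lemma card_words: "card (words r l) = Suc r ^ l"
  unfolding words_def by (simp add: card_lists_length_eq)

lemma sum_words_append:
  "(\<Sum>w\<in>words r (k + l). g w) = (\<Sum>v\<in>words r k. \<Sum>w\<in>words r l. g (v @ w))"
proof -
  have "(\<Sum>v\<in>words r k. \<Sum>w\<in>words r l. g (v @ w)) = (\<Sum>(v, w)\<in>words r k \<times> words r l. g (v @ w))"
    by (rule sum.cartesian_product)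
  also have "\<dots> = (\<Sum>w\<in>words r (k + l). g w)"
  proof (rule sum.reindex_bij_witness[where j = "\<lambda>(v, w). v @ w" and i = "\<lambda>w. (take k w, drop k w)"])
    fix w assume "w \<in> words r (k + l)"
    then show "(take k w, drop k w) \<in> words r k \<times> words r l"
      by (auto simp: words_def dest: in_set_takeD in_set_dropD)
  qed (auto simp: words_def)
  finally show ?thesis ..
qed

lemma words_1: "words r (Suc 0) = (\<lambda>i. [i]) ` {..r}"
  by (auto simp: words_def length_Suc_conv)

text \<open>The entry in row \<open>(u, v)\<close> and column \<open>(u', v')\<close> of the
  \<open>l\<close>-th power of the sum, over all letters, of the Kronecker products of the matrices
  in the families \<open>a b\<close> and \<open>a b'\<close>.\<close>

definition corr :: "nat \<Rightarrow> nat \<Rightarrow> (nat \<Rightarrow> nat \<Rightarrow> int mat) \<Rightarrow> nat \<Rightarrow> nat \<Rightarrow> nat \<Rightarrow> nat \<Rightarrow> nat \<Rightarrow> nat \<Rightarrow> nat \<Rightarrow> int" where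
  "corr m r a l b b' u v u' v' =
     (\<Sum>w\<in>words r l. word_mat m (a b) w $$ (u, u') * word_mat m (a b') w $$ (v, v'))"

lemma corr_1:
  assumes "\<And>b. family m (a b)" "u < m" "u' < m" "v < m" "v' < m"
  shows "corr m r a 1 b b' u v u' v' = (\<Sum>i\<le>r. a b i $$ (u, u') * a b' i $$ (v, v'))"
proof -
  have "a b i * 1\<^sub>m m = a b i" for b i using assms(1)[of b] by (simp add: family_def)
  then show ?thesis
    unfolding corr_def One_nat_def words_1 by (subst sum.reindex) (auto simp: inj_on_def)
qed

text \<open>Cutting each word into a prefix of length \<open>k\<close> and a suffix of length
  \<open>l\<close> turns the sum into a product of two matrix powers.\<close>

lemma corr_add:
  assumes a: "\<And>b. family m (a b)" and uv: "u < m" "u' < m" "v < m" "v' < m"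
  shows "corr m r a (k + l) b b' u v u' v' =
    (\<Sum>s<m. \<Sum>t<m. corr m r a k b b' u v s t * corr m r a l b b' s t u' v')"
proof -
  let ?W = "\<lambda>b w. word_mat m (a b) w"
  have app: "?W b (v @ w) $$ (u, u') = (\<Sum>s<m. ?W b v $$ (u, s) * ?W b w $$ (s, u'))"
    if "u < m" "u' < m" for b v w u u'
    using word_mat_carrier[OF a, of b v] word_mat_carrier[OF a, of b w] that
    by (simp add: word_mat_append[OF a] scalar_prod_def lessThan_atLeast0)
  have "corr m r a (k + l) b b' u v u' v' = (\<Sum>x\<in>words r k. \<Sum>y\<in>words r l.
      (\<Sum>s<m. ?W b x $$ (u, s) * ?W b y $$ (s, u')) * (\<Sum>t<m. ?W b' x $$ (v, t) * ?W b' y $$ (t, v')))"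
    unfolding corr_def sum_words_append using app uv by simp
  also have "\<dots> = (\<Sum>x\<in>words r k. \<Sum>y\<in>words r l. \<Sum>s<m. \<Sum>t<m.
      (?W b x $$ (u, s) * ?W b' x $$ (v, t)) * (?W b y $$ (s, u') * ?W b' y $$ (t, v')))"
    by (simp add: sum_product mult_ac)
  also have "\<dots> = (\<Sum>s<m. \<Sum>t<m. \<Sum>x\<in>words r k. \<Sum>y\<in>words r l.
      (?W b x $$ (u, s) * ?W b' x $$ (v, t)) * (?W b y $$ (s, u') * ?W b' y $$ (t, v')))"
    by (simp only: sum.swap[where A = "words r l" and B = "{..<m}"] sum.swap[where A = "words r k" and B = "{..<m}"])
  also have "\<dots> = (\<Sum>s<m. \<Sum>t<m. corr m r a k b b' u v s t * corr m r a l b b' s t u' v')"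
    by (simp add: corr_def sum_product)
  finally show ?thesis .
qed

text \<open>Squares of integers cannot cancel, so one number tells whether the traces of all the
  words of length \<open>l\<close> agree; expanded, it is a combination of correlations.\<close>

definition energy :: "nat \<Rightarrow> nat \<Rightarrow> (nat \<Rightarrow> nat \<Rightarrow> int mat) \<Rightarrow> nat \<Rightarrow> int" where
  "energy m r a l = (\<Sum>w\<in>words r l. (mtrace (word_mat m (a 0) w) - mtrace (word_mat m (a 1) w))\<^sup>2)"

lemma energy_corr:
  assumes a: "\<And>b. family m (a b)"
  shows "energy m r a l = (\<Sum>b<2. \<Sum>b'<2. \<Sum>u<m. \<Sum>v<m.
    (if b = b' then 1 else - 1) * corr m r a l b b' u v u v)"
proof -
  let ?W = "\<lambda>b w. word_mat m (a b) w"
  have tr: "mtrace (?W b w) = (\<Sum>u<m. ?W b w $$ (u, u))" for b w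
    using word_mat_carrier[OF a, of b w] by (simp add: mtrace_def)
  have tt: "mtrace (?W b w) * mtrace (?W b' w) = (\<Sum>u<m. \<Sum>v<m. ?W b w $$ (u, u) * ?W b' w $$ (v, v))" for b b' w
    by (simp only: tr sum_product)
  have "(mtrace (?W 0 w) - mtrace (?W 1 w))\<^sup>2 =
      (\<Sum>b<2. \<Sum>b'<2. (if b = b' then 1 else - 1) * (mtrace (?W b w) * mtrace (?W b' w)))" for w
    by (simp add: eval_nat_numeral power2_eq_square algebra_simps)
  then have "energy m r a l = (\<Sum>w\<in>words r l. \<Sum>b<2. \<Sum>b'<2. \<Sum>u<m. \<Sum>v<m.
      (if b = b' then 1 else - 1) * (?W b w $$ (u, u) * ?W b' w $$ (v, v)))"
    unfolding energy_def by (simp only: tt sum_distrib_left)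
  also have "\<dots> = (\<Sum>b<2. \<Sum>b'<2. \<Sum>u<m. \<Sum>v<m. \<Sum>w\<in>words r l.
      (if b = b' then 1 else - 1) * (?W b w $$ (u, u) * ?W b' w $$ (v, v)))"
    by (simp only: sum.swap[where A = "words r l" and B = "{..<m}"] sum.swap[where A = "words r l" and B = "{..<2}"])
  finally show ?thesis by (simp only: corr_def sum_distrib_left)
qed

lemma energy_eq_0_iff:
  "energy m r a l = 0 \<longleftrightarrow> (\<forall>w\<in>words r l. mtrace (word_mat m (a 0) w) = mtrace (word_mat m (a 1) w))"
  unfolding energy_def by (subst sum_nonneg_eq_0_iff) auto

text \<open>A system with one more unknown than equations has a nonzero solution; a zero row makes
  the matrix square, so that a vanishing determinant supplies it over the integers. Choosing
  \<open>t\<close> as the last index with a nonzero coefficient makes the relation usable as a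
  recurrence.\<close>

lemma dependency:
  fixes z :: "nat \<Rightarrow> 'a \<Rightarrow> int"
  assumes "finite I"
  shows "\<exists>c t. t \<le> card I \<and> c t \<noteq> 0 \<and> (\<forall>p\<in>I. (\<Sum>l\<le>t. c l * z l p) = 0)"
proof -
  define d where "d = card I"
  obtain e where e: "bij_betw e {0..<d} I" using ex_bij_betw_nat_finite[OF assms] unfolding d_def by blast
  define A where "A = mat (Suc d) (Suc d) (\<lambda>(p, l). if p < d then z l (e p) else 0)"
  have A: "A \<in> carrier_mat (Suc d) (Suc d)" by (simp add: A_def)
  have "det A = (\<Sum>l<Suc d. A $$ (d, l) * cofactor A d l)" by (rule laplace_expansion_row[OF A]) simp
  also have "\<dots> = 0" by (rule sum.neutral) (simp add: A_def)
  finally have "det A = 0" .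
  then obtain v where v: "v \<in> carrier_vec (Suc d)" "v \<noteq> 0\<^sub>v (Suc d)" "A *\<^sub>v v = 0\<^sub>v (Suc d)"
    using det_0_iff_vec_prod_zero[OF A] by blast
  define T where "T = {l. l < Suc d \<and> vec_index v l \<noteq> 0}"
  have T: "finite T" "T \<noteq> {}"
  proof -
    show "T \<noteq> {}"
    proof
      assume "T = {}"
      then have "v = 0\<^sub>v (Suc d)" using v(1) by (intro eq_vecI) (auto simp: T_def)
      with v(2) show False ..
    qed
  qed (simp add: T_def)
  define t where "t = Max T"
  have t: "t \<le> d" "vec_index v t \<noteq> 0" using Max_in[OF T] by (auto simp: t_def T_def)
  have "(\<Sum>l\<le>t. vec_index v l * z l p) = 0" if p: "p \<in> I" for p
  proof -
    obtain q where q: "q < d" "p = e q" using e p by (auto simp: bij_betw_def)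
    have "0 = vec_index (A *\<^sub>v v) q" using v(3) q by simp
    also have "\<dots> = (\<Sum>l<Suc d. A $$ (q, l) * vec_index v l)"
      using A v(1) q by (simp add: scalar_prod_def lessThan_atLeast0 del: sum.lessThan_Suc)
    also have "\<dots> = (\<Sum>l<Suc d. vec_index v l * z l p)" using q by (intro sum.cong) (auto simp: A_def)
    also have "\<dots> = (\<Sum>l\<le>t. vec_index v l * z l p)"
    proof (rule sum.mono_neutral_right)
      show "\<forall>l\<in>{..<Suc d} - {..t}. vec_index v l * z l p = 0"
      proof
        fix l assume l: "l \<in> {..<Suc d} - {..t}"
        then have "l \<notin> T" using Max_ge[OF T(1), of l] by (auto simp: t_def)
        then show "vec_index v l * z l p = 0" using l by (auto simp: T_def)
      qed
    qed (use t in auto)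
    finally show ?thesis ..
  qed
  then show ?thesis using t unfolding d_def by blast
qed

text \<open>The correlations for all index tuples form 4 m^4 sequences in \<open>l\<close>, so a
  single linear relation of order \<open>t \<le> 4 * m ^ 4\<close> holds for all of them at the
  initial lengths. Multiplying by a further power of the Kronecker sum shifts it to later lengths.
  The nonzero leading coefficient then propagates the vanishing from lengths up to \<open>N\<close>
  to all lengths.\<close>

lemma energy_recurrence:
  assumes a: "\<And>b. family m (a b)" and N: "4 * m ^ 4 \<le> N" and E: "\<And>l. l \<le> N \<Longrightarrow> energy m r a l = 0"
  shows "energy m r a l = 0"
proof -
  define I where "I = {..<2::nat} \<times> {..<2::nat} \<times> {..<m} \<times> {..<m} \<times> {..<m} \<times> {..<m}"
  have I: "finite I" "card I = 4 * m ^ 4"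
    by (auto simp: I_def card_cartesian_product eval_nat_numeral)
  obtain c t where t: "t \<le> card I" "c t \<noteq> 0"
    and c: "\<forall>p\<in>I. (\<Sum>l\<le>t. c l * (case p of (b, b', u, v, s, t) \<Rightarrow> corr m r a l b b' u v s t)) = 0"
    using dependency[OF I(1), of "\<lambda>l p. case p of (b, b', u, v, s, t) \<Rightarrow> corr m r a l b b' u v s t"] by blast
  have c: "(\<Sum>l\<le>t. c l * corr m r a l b b' u v s s') = 0"
    if "b < 2" "b' < 2" "u < m" "v < m" "s < m" "s' < m" for b b' u v s s'
    using bspec[OF c, of "(b, b', u, v, s, s')"] that by (simp add: I_def)
  have shift: "(\<Sum>l\<le>t. c l * corr m r a (l + k) b b' u v u v) = 0"
    if "b < 2" "b' < 2" "u < m" "v < m" for b b' u v k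
  proof -
    have "(\<Sum>l\<le>t. c l * corr m r a (l + k) b b' u v u v) =
        (\<Sum>l\<le>t. \<Sum>s<m. \<Sum>s'<m. (c l * corr m r a l b b' u v s s') * corr m r a k b b' s s' u v)"
      using corr_add[where a = a, OF a that(3) that(3) that(4) that(4), of r _ k b b'] by (simp add: sum_distrib_left mult.assoc)
    also have "\<dots> = (\<Sum>s<m. \<Sum>s'<m. \<Sum>l\<le>t. (c l * corr m r a l b b' u v s s') * corr m r a k b b' s s' u v)"
      by (simp only: sum.swap[where A = "{..t}" and B = "{..<m}"])
    also have "\<dots> = 0" using c that by (simp flip: sum_distrib_right)
    finally show ?thesis .
  qed
  have rec: "(\<Sum>l\<le>t. c l * energy m r a (l + k)) = 0" for k
  proof -
    have "(\<Sum>l\<le>t. c l * energy m r a (l + k)) = (\<Sum>l\<le>t. \<Sum>b<2. \<Sum>b'<2. \<Sum>u<m. \<Sum>v<m.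
        (if b = b' then 1 else - 1) * (c l * corr m r a (l + k) b b' u v u v))"
      unfolding energy_corr[where a = a, OF a] by (simp only: sum_distrib_left mult.left_commute)
    also have "\<dots> = (\<Sum>b<2. \<Sum>b'<2. \<Sum>u<m. \<Sum>v<m. \<Sum>l\<le>t.
        (if b = b' then 1 else - 1) * (c l * corr m r a (l + k) b b' u v u v))"
      by (simp only: sum.swap[where A = "{..t}" and B = "{..<m}"] sum.swap[where A = "{..t}" and B = "{..<2}"])
    also have "\<dots> = 0"
      by (rule sum.neutral, rule ballI, rule sum.neutral, rule ballI, rule sum.neutral, rule ballI,
          rule sum.neutral, rule ballI, fold sum_distrib_left) (simp add: shift)
    finally show ?thesis .
  qed
  show ?thesis
  proof (induction l rule: less_induct)
    case (less l)
    show ?case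
    proof (cases "l \<le> N")
      case False
      then have l: "t \<le> l" using t(1) I(2) N by linarith
      have "0 = (\<Sum>i\<le>t. c i * energy m r a (i + (l - t)))" using rec by simp
      also have "\<dots> = c t * energy m r a (t + (l - t)) + (\<Sum>i<t. c i * energy m r a (i + (l - t)))"
        by (simp flip: lessThan_Suc_atMost)
      also have "(\<Sum>i<t. c i * energy m r a (i + (l - t))) = 0"
        using less l by (intro sum.neutral) auto
      finally show ?thesis using t(2) l by simp
    qed (rule E)
  qed
qed

lemma word_mat_ones: "family m a \<Longrightarrow> a r = 1\<^sub>m m \<Longrightarrow> word_mat m a (replicate k r) = 1\<^sub>m m"
  by (induction k) auto

theorem energy_eq_0:
  assumes a: "\<And>b. family m (a b)" and N: "4 * m ^ 4 \<le> N" and one: "\<And>b. a b r = 1\<^sub>m m"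
  shows "energy m r a N = 0 \<longleftrightarrow>
    (\<forall>w. set w \<subseteq> {..r} \<longrightarrow> mtrace (word_mat m (a 0) w) = mtrace (word_mat m (a 1) w))"
proof
  assume E: "energy m r a N = 0"
  have "energy m r a l = 0" if l: "l \<le> N" for l
  proof (unfold energy_eq_0_iff, rule ballI)
    fix w assume w: "w \<in> words r l"
    then have "w @ replicate (N - l) r \<in> words r N" using l by (auto simp: words_def)
    moreover have "word_mat m (a b) (w @ replicate (N - l) r) = word_mat m (a b) w" for b
      using word_mat_carrier[OF a, of b w] by (simp add: word_mat_append[OF a] word_mat_ones[OF a one])
    ultimately show "mtrace (word_mat m (a 0) w) = mtrace (word_mat m (a 1) w)"
      using E unfolding energy_eq_0_iff by metis
  qed
  then have "energy m r a l = 0" for l using energy_recurrence[where a = a, OF a N] by blast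
  then show "\<forall>w. set w \<subseteq> {..r} \<longrightarrow> mtrace (word_mat m (a 0) w) = mtrace (word_mat m (a 1) w)"
    unfolding energy_eq_0_iff by (auto simp: words_def)
next
  assume "\<forall>w. set w \<subseteq> {..r} \<longrightarrow> mtrace (word_mat m (a 0) w) = mtrace (word_mat m (a 1) w)"
  then show "energy m r a N = 0" unfolding energy_eq_0_iff by (auto simp: words_def)
qed

section \<open>Size of the integer to be tested, and its vanishing from its residues\<close>

lemma word_mat_bound:
  fixes M :: int
  assumes a: "family m a" and M: "1 \<le> M" "\<And>i u v. i \<le> r \<Longrightarrow> u < m \<Longrightarrow> v < m \<Longrightarrow> \<bar>a i $$ (u, v)\<bar> \<le> M"
  shows "w \<in> words r l \<Longrightarrow> u < m \<Longrightarrow> v < m \<Longrightarrow> \<bar>word_mat m a w $$ (u, v)\<bar> \<le> (int m * M) ^ l"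
proof (induction w arbitrary: l u)
  case Nil
  then show ?case by (auto simp: words_def)
next
  case (Cons i w)
  then obtain l' where l: "l = Suc l'" "w \<in> words r l'" "i \<le> r" by (auto simp: words_def)
  have "word_mat m a (i # w) $$ (u, v) = (\<Sum>s<m. a i $$ (u, s) * word_mat m a w $$ (s, v))"
    using a[unfolded family_def, rule_format, of i] word_mat_carrier[OF a, of w] Cons.prems
    by (simp add: scalar_prod_def lessThan_atLeast0)
  also have "\<bar>\<dots>\<bar> \<le> (\<Sum>s<m. M * (int m * M) ^ l')"
    unfolding abs_mult
    by (rule order_trans[OF sum_abs], rule sum_mono, unfold abs_mult, rule mult_mono)
      (use Cons M l in auto)
  also have "\<dots> = (int m * M) ^ l" by (simp add: l)
  finally show ?case .
qed

lemma energy_bound: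
  fixes M :: int
  assumes a: "\<And>b. family m (a b)"
    and M: "1 \<le> M" "\<And>b i u v. b < 2 \<Longrightarrow> i \<le> r \<Longrightarrow> u < m \<Longrightarrow> v < m \<Longrightarrow> \<bar>a b i $$ (u, v)\<bar> \<le> M"
  shows "\<bar>energy m r a l\<bar> \<le> int (Suc r) ^ l * (2 * (int m * (int m * M) ^ l))\<^sup>2"
proof -
  have tr: "\<bar>mtrace (word_mat m (a b) w)\<bar> \<le> int m * (int m * M) ^ l" if w: "w \<in> words r l" and b: "b < 2" for b w
  proof -
    have "\<bar>mtrace (word_mat m (a b) w)\<bar> \<le> (\<Sum>u<m. \<bar>word_mat m (a b) w $$ (u, u)\<bar>)"
      using word_mat_carrier[OF a, of b w] by (simp add: mtrace_def)
    also have "\<dots> \<le> (\<Sum>u<m. (int m * M) ^ l)"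
      by (intro sum_mono word_mat_bound[OF a M(1)]) (use M b w in auto)
    finally show ?thesis by simp
  qed
  have "\<bar>energy m r a l\<bar> = energy m r a l" by (simp add: energy_def sum_nonneg)
  also have "\<dots> \<le> (\<Sum>w\<in>words r l. (2 * (int m * (int m * M) ^ l))\<^sup>2)"
    unfolding energy_def
  proof (intro sum_mono)
    fix w assume w: "w \<in> words r l"
    have "\<bar>mtrace (word_mat m (a 0) w) - mtrace (word_mat m (a 1) w)\<bar> \<le> 2 * (int m * (int m * M) ^ l)"
      using tr[OF w, of 0] tr[OF w, of 1] by simp
    then show "(mtrace (word_mat m (a 0) w) - mtrace (word_mat m (a 1) w))\<^sup>2 \<le> (2 * (int m * (int m * M) ^ l))\<^sup>2"
      using abs_le_square_iff by fastforce
  qed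
  also have "\<dots> = int (Suc r) ^ l * (2 * (int m * (int m * M) ^ l))\<^sup>2" by (simp add: card_words)
  finally show ?thesis .
qed

text \<open>Partial fractions: k + 1 is the difference of a + k + 1 and a, so the quotient for a
  window of k + 2 consecutive divisors is the difference of the quotients for the two overlapping
  windows of k + 1 divisors. For positive a this says that a times the binomial coefficient of a + k
  over k divides \<open>z\<close>.\<close>

lemma pochhammer_dvd:
  fixes z :: int and a :: nat
  assumes "\<And>q. a \<le> q \<Longrightarrow> q \<le> a + k \<Longrightarrow> int q dvd z"
  shows "pochhammer (int a) (Suc k) dvd z * fact k"
  using assms
proof (induction k arbitrary: a)
  case 0
  then show ?case by (simp add: pochhammer_1)
next
  case (Suc k)
  obtain u where u: "z * fact k = pochhammer (int a) (Suc k) * u" using Suc.IH[of a] Suc.prems by (auto simp: dvd_def)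
  obtain w where w: "z * fact k = pochhammer (int (Suc a)) (Suc k) * w" using Suc.IH[of "Suc a"] Suc.prems by (auto simp: dvd_def)
  have 1: "pochhammer (int a) (Suc (Suc k)) = pochhammer (int a) (Suc k) * (int a + int (Suc k))" by (rule pochhammer_Suc)
  have 2: "pochhammer (int a) (Suc (Suc k)) = int a * pochhammer (int (Suc a)) (Suc k)"
    by (simp only: pochhammer_rec[of _ "Suc k"] of_nat_Suc add.commute)
  have "pochhammer (int a) (Suc (Suc k)) * (u - w) =
      (pochhammer (int a) (Suc k) * u) * (int a + int (Suc k)) - int a * (pochhammer (int (Suc a)) (Suc k) * w)"
    unfolding right_diff_distrib by (subst 1, subst 2) (simp only: mult_ac)
  also have "\<dots> = z * fact (Suc k)" unfolding u[symmetric] w[symmetric] by (simp add: algebra_simps)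
  finally show ?case by (metis dvd_triv_left)
qed

text \<open>For i < k the factor k + 1 + (i + 1) is at least 2 (i + 1), and the remaining factor k +
  1 is at least 1. A nonzero common multiple of k + 1, ..., 2k + 1 therefore has absolute value at
  least 2^k.\<close>

lemma pochhammer_ge: "2 ^ k * fact k \<le> pochhammer (int (Suc k)) (Suc k)"
proof -
  have "(2 :: int) ^ k * fact k = (\<Prod>i<k. 2 * (int i + 1))"
    unfolding prod.distrib by (simp add: fact_prod_Suc atLeast0LessThan add.commute)
  also have "\<dots> \<le> (\<Prod>i<k. int (Suc k) + int (Suc i))" by (intro prod_mono) auto
  also have "\<dots> \<le> int (Suc k) * (\<Prod>i<k. int (Suc k) + int (Suc i))"
    using mult_right_mono[of 1 "int (Suc k)", OF _ prod_nonneg[of "{..<k}" "\<lambda>i. int (Suc k) + int (Suc i)"]] by simp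
  also have "\<dots> = pochhammer (int (Suc k)) (Suc k)"
    unfolding pochhammer_prod atLeast0_lessThan_Suc lessThan_atLeast0[symmetric]
    by (simp add: lessThan_Suc[symmetric] prod.lessThan_Suc_shift del: prod.lessThan_Suc lessThan_Suc)
  finally show ?thesis .
qed

text \<open>This replaces the Chinese remainder theorem together with a lower bound for the least common
  multiple of an initial segment of the natural numbers.\<close>

lemma zero_of_all_divisors:
  fixes z :: int
  assumes div: "\<And>q. 1 \<le> q \<Longrightarrow> q \<le> 2 * k + 1 \<Longrightarrow> int q dvd z" and small: "\<bar>z\<bar> < 2 ^ k"
  shows "z = 0"
proof (rule ccontr)
  assume z: "z \<noteq> 0"
  have "pochhammer (int (Suc k)) (Suc k) dvd z * fact k" by (rule pochhammer_dvd) (use div in auto)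
  then have le: "\<bar>pochhammer (int (Suc k)) (Suc k)\<bar> \<le> \<bar>z * fact k\<bar>" using z by (intro dvd_imp_le_int) auto
  have "2 ^ k * fact k \<le> \<bar>z\<bar> * fact k"
    using order_trans[OF order_trans[OF pochhammer_ge abs_ge_self] le] by (simp add: abs_mult)
  then show False using small by simp
qed

section \<open>The decision procedure\<close>

definition letter_mat :: "bool list \<Rightarrow> nat \<Rightarrow> nat \<Rightarrow> int mat" where
  "letter_mat x b i = mat (dim_m x) (dim_m x) (\<lambda>(u, v). letter x b i u v)"

lemma letter_mat_family: "family (dim_m x) (letter_mat x b)"
  by (simp add: family_def letter_mat_def)

lemma letter_mat_one: "dim_r x \<le> i \<Longrightarrow> letter_mat x b i = 1\<^sub>m (dim_m x)"
  by (intro eq_matI) (auto simp: letter_mat_def letter_def)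

lemma sum_cut:
  fixes h :: "nat \<Rightarrow> 'a::comm_monoid_add"
  assumes "m \<le> R" "\<And>s. m \<le> s \<Longrightarrow> h s = 0" shows "(\<Sum>s<R. h s) = (\<Sum>s<m. h s)"
  by (rule sum.mono_neutral_right) (use assms in auto)

lemma kron_power_corr:
  fixes \<delta> :: "nat \<Rightarrow> nat"
  assumes r: "dim_r x < radix x"
  shows "((mat_square (radix x)) ^^ n) (kron_sum x) \<delta> =
    (if \<delta> 0 < 2 \<and> \<delta> 1 < 2 \<and> \<delta> 2 < dim_m x \<and> \<delta> 3 < dim_m x \<and> \<delta> 4 < dim_m x \<and> \<delta> 5 < dim_m x
     then corr (dim_m x) (dim_r x) (letter_mat x) (2 ^ n) (\<delta> 0) (\<delta> 1) (\<delta> 2) (\<delta> 3) (\<delta> 4) (\<delta> 5) else 0)"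
proof (induction n arbitrary: \<delta>)
  case 0
  have "(\<Sum>i<radix x. if i \<le> dim_r x then g i else 0) = (\<Sum>i\<le>dim_r x. g i)" for g :: "nat \<Rightarrow> int"
    unfolding lessThan_Suc_atMost[symmetric]
    by (subst sum_cut[of "Suc (dim_r x)"]) (use r in auto)
  moreover have "letter_mat x b i $$ (u, v) = letter x b i u v" if "u < dim_m x" "v < dim_m x" for b i u v
    using that by (simp add: letter_mat_def)
  ultimately show ?case
    using corr_1[where a = "letter_mat x" and m = "dim_m x" and u = "\<delta> 2" and u' = "\<delta> 4" and v = "\<delta> 3" and v' = "\<delta> 5" and
        r = "dim_r x" and b = "\<delta> 0" and b' = "\<delta> 1", OF letter_mat_family]
    by (auto simp: kron_sum_def)
next
  case (Suc n)
  let ?C = "corr (dim_m x) (dim_r x) (letter_mat x) (2 ^ n)"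
  let ?T = "((mat_square (radix x)) ^^ n) (kron_sum x)"
  have T: "?T (\<delta>(4 := s, 5 := t)) * ?T (\<delta>(2 := s, 3 := t)) =
      (if \<delta> 0 < 2 \<and> \<delta> 1 < 2 \<and> \<delta> 2 < dim_m x \<and> \<delta> 3 < dim_m x \<and> \<delta> 4 < dim_m x \<and> \<delta> 5 < dim_m x \<and> s < dim_m x \<and> t < dim_m x
       then ?C (\<delta> 0) (\<delta> 1) (\<delta> 2) (\<delta> 3) s t * ?C (\<delta> 0) (\<delta> 1) s t (\<delta> 4) (\<delta> 5) else 0)" for s t
    by (simp add: Suc.IH cong: if_cong)
  have m: "dim_m x \<le> radix x" by (rule unary_block_le)
  have eq: "((mat_square (radix x)) ^^ Suc n) (kron_sum x) \<delta> =
      (\<Sum>s<radix x. \<Sum>t<radix x. ?T (\<delta>(4 := s, 5 := t)) * ?T (\<delta>(2 := s, 3 := t)))"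
    by (simp only: funpow.simps comp_def mat_square_def[of _ ?T])
  show ?case
  proof (cases "\<delta> 0 < 2 \<and> \<delta> 1 < 2 \<and> \<delta> 2 < dim_m x \<and> \<delta> 3 < dim_m x \<and> \<delta> 4 < dim_m x \<and> \<delta> 5 < dim_m x")
    case False
    then show ?thesis unfolding eq T by auto
  next
    case True
    have "(\<Sum>s<radix x. \<Sum>t<radix x. ?T (\<delta>(4 := s, 5 := t)) * ?T (\<delta>(2 := s, 3 := t))) =
        (\<Sum>s<dim_m x. \<Sum>t<radix x. ?T (\<delta>(4 := s, 5 := t)) * ?T (\<delta>(2 := s, 3 := t)))"
      unfolding T by (rule sum_cut[OF m]) auto
    also have "\<dots> = (\<Sum>s<dim_m x. \<Sum>t<dim_m x. ?T (\<delta>(4 := s, 5 := t)) * ?T (\<delta>(2 := s, 3 := t)))"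
      unfolding T by (rule sum.cong[OF refl], rule sum_cut[OF m]) auto
    also have "\<dots> = (\<Sum>s<dim_m x. \<Sum>t<dim_m x. ?C (\<delta> 0) (\<delta> 1) (\<delta> 2) (\<delta> 3) s t * ?C (\<delta> 0) (\<delta> 1) s t (\<delta> 4) (\<delta> 5))"
      unfolding T using True by (intro sum.cong) auto
    also have "\<dots> = corr (dim_m x) (dim_r x) (letter_mat x) (2 ^ n + 2 ^ n) (\<delta> 0) (\<delta> 1) (\<delta> 2) (\<delta> 3) (\<delta> 4) (\<delta> 5)"
      by (rule corr_add[where a = "letter_mat x", OF letter_mat_family, symmetric]) (use True in auto)
    finally show ?thesis unfolding eq using True by (simp add: mult_2)
  qed
qed

lemma sum_diagonal:
  fixes g :: "nat \<Rightarrow> nat \<Rightarrow> 'a::comm_monoid_add"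
  assumes "u < R" "v < R"
  shows "(\<Sum>u'<R. \<Sum>v'<R. if u = u' \<and> v = v' then g u' v' else 0) = g u v"
proof -
  have "(\<Sum>v'<R. if u = u' \<and> v = v' then g u' v' else 0) = (if u = u' then g u' v else 0)" for u'
    using assms(2) by simp
  then show ?thesis using assms(1) by simp
qed

lemma discrepancy_energy:
  assumes r: "dim_r x < radix x"
  shows "discrepancy x = energy (dim_m x) (dim_r x) (letter_mat x) (2 ^ (2 * loglen x))"
proof -
  let ?R = "radix x" and ?m = "dim_m x"
  define K where "K a b u v u' v' = kron_power x ((\<lambda>_. 0)(0 := a, 1 := b, 2 := u, 3 := v, 4 := u', 5 := v'))" for a b u v u' v'
  have K: "K a b u v u' v' = (if a < 2 \<and> b < 2 \<and> u < ?m \<and> v < ?m \<and> u' < ?m \<and> v' < ?m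
      then corr ?m (dim_r x) (letter_mat x) (2 ^ (2 * loglen x)) a b u v u' v' else 0)" for a b u v u' v'
    unfolding K_def kron_power_def kron_power_corr[OF r] by (simp cong: if_cong)
  have m: "?m \<le> ?R" by (rule unary_block_le)
  have two: "2 \<le> ?R" using power_increasing[of 1 "8 * loglen x" "2 :: nat"] by (simp add: radix_def loglen_def)
  define G where "G a b u v = (if a = b then 1 else - 1) * K a b u v u v" for a b u v
  have "discrepancy x = (\<Sum>a<?R. \<Sum>b<?R. \<Sum>u<?R. \<Sum>v<?R. \<Sum>u'<?R. \<Sum>v'<?R.
      if u = u' \<and> v = v' then (if a = b then 1 else - 1) * K a b u v u' v' else 0)"
    unfolding discrepancy_def K_def by (intro sum.cong refl) auto
  also have "\<dots> = (\<Sum>a<?R. \<Sum>b<?R. \<Sum>u<?R. \<Sum>v<?R. G a b u v)"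
    unfolding G_def by (intro sum.cong refl sum_diagonal) auto
  also have "\<dots> = (\<Sum>a<2. \<Sum>b<?R. \<Sum>u<?R. \<Sum>v<?R. G a b u v)"
    by (rule sum_cut[OF two]) (simp add: G_def K)
  also have "\<dots> = (\<Sum>a<2. \<Sum>b<2. \<Sum>u<?R. \<Sum>v<?R. G a b u v)"
    by (rule sum.cong[OF refl], rule sum_cut[OF two]) (simp add: G_def K)
  also have "\<dots> = (\<Sum>a<2. \<Sum>b<2. \<Sum>u<?m. \<Sum>v<?R. G a b u v)"
    by (rule sum.cong[OF refl], rule sum.cong[OF refl], rule sum_cut[OF m]) (simp add: G_def K)
  also have "\<dots> = (\<Sum>a<2. \<Sum>b<2. \<Sum>u<?m. \<Sum>v<?m. G a b u v)"
    by (rule sum.cong[OF refl], rule sum.cong[OF refl], rule sum.cong[OF refl], rule sum_cut[OF m]) (simp add: G_def K)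
  also have "\<dots> = energy ?m (dim_r x) (letter_mat x) (2 ^ (2 * loglen x))"
    unfolding energy_corr[where a = "letter_mat x", OF letter_mat_family] G_def K by (intro sum.cong refl) auto
  finally show ?thesis .
qed

lemma length_block: "length (block bs) = 2 * length bs + 2"
  by (simp add: block_flat_pairs)

lemma double_binary_le:
  assumes x: "x = concat (map block bss)" and bs: "bs \<in> set bss"
  shows "2 * int (binary bs) \<le> 2 ^ length x"
proof -
  have "length (block bs) \<le> sum_list (map length (map block bss))"
    using bs by (intro member_le_sum_list) auto
  then have "Suc (length bs) \<le> length x" by (simp add: x length_block length_concat)
  have "binary bs < 2 ^ length bs" unfolding binary_def by (rule horner_sum_of_bool_2_less)
  then have "2 * binary bs \<le> 2 ^ Suc (length bs)" by simp
  also have "\<dots> \<le> 2 ^ length x" using \<open>Suc (length bs) \<le> length x\<close> by (intro power_increasing) auto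
  finally show ?thesis by (metis of_nat_le_iff of_nat_mult of_nat_numeral of_nat_power)
qed

text \<open>There are fewer than \<open>length x\<close> nontrivial factors, and each is a doubled
  number whose digits are part of the input.\<close>

lemma entry_bound:
  assumes e: "encoded x m r A A'" shows "\<bar>entry x k\<bar> \<le> 2 ^ (length x * length x)"
proof -
  obtain fs where len: "length fs = 2 * r * m * m" and x: "x = concat (map block (instance_blocks m r fs))"
    using e by (rule encoded_instance)
  let ?bss = "instance_blocks m r fs"
  have lb: "length ?bss = 2 + 2 * length fs"
    by (simp only: instance_blocks_def list.size length_fraction_blocks)
  have nb: "num_blocks x = 2 + 2 * length fs" using num_blocks_eq[OF x] lb by simp
  have L: "length fs < length x" using encoded_length[OF e] len by simp
  define F where "F j = (if j = k then if negative x j then - numerator x j else numerator x j else denominator x j)" for j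
  have F: "\<bar>F j\<bar> \<le> 2 ^ length x" if j: "j < length fs" for j
  proof -
    have l: "j + j + 2 < length ?bss" "j + j + 3 < length ?bss" using j lb by auto
    have ne: "?bss ! (j + j + 2) = fst (fs ! j) # fst (snd (fs ! j))"
      using nth_fraction_blocks[OF j] by (simp add: instance_blocks_def mult_2 eval_nat_numeral)
    have "binary (fst (snd (fs ! j))) \<le> binary (?bss ! (j + j + 2))"
      unfolding ne binary_def by simp
    then have "2 * int (binary (fst (snd (fs ! j)))) \<le> 2 * int (binary (?bss ! (j + j + 2)))" by simp
    also have "\<dots> \<le> 2 ^ length x" by (rule double_binary_le[OF x nth_mem[OF l(1)]])
    finally have "\<bar>numerator x j\<bar> \<le> 2 ^ length x" using numerator_nth[OF x l(1)] ne by simp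
    moreover have "\<bar>denominator x j\<bar> \<le> 2 ^ length x"
      using double_binary_le[OF x nth_mem[OF l(2)]] denominator_nth[OF x l(2)] by simp
    ultimately show ?thesis by (auto simp: F_def)
  qed
  have "\<bar>entry x k\<bar> = (\<Prod>j<radix x. \<bar>if j < length fs then F j else 1\<bar>)"
    unfolding entry_def nb F_def abs_prod by (intro prod.cong) auto
  also have "\<dots> \<le> (\<Prod>j<radix x. if j < length fs then 2 ^ length x else 1)"
    using F by (intro prod_mono) auto
  also have "\<dots> = (\<Prod>j\<in>{j \<in> {..<radix x}. j < length fs}. 2 ^ length x)"
    by (rule prod.inter_filter[symmetric]) simp
  also have "\<dots> = 2 ^ (length x * card {j \<in> {..<radix x}. j < length fs})" by (simp add: power_mult)
  also have "\<dots> \<le> 2 ^ (length x * length x)"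
  proof -
    have "card {j \<in> {..<radix x}. j < length fs} \<le> card {..<length fs}" by (intro card_mono) auto
    then show ?thesis using L by (intro power_increasing mult_left_mono) auto
  qed
  finally show ?thesis .
qed

lemma length_less_loglen: "length x < 2 ^ loglen x"
proof -
  have "length x < 2 ^ floorlog 2 (length x)"
    using floorlog_bounds[of "length x" 2] by (cases "length x = 0") auto
  then show ?thesis by (simp add: loglen_def)
qed

text \<open>With \<open>l = 2 ^ loglen x\<close> the letters have entries of at most l^2 bits and
  the words have length l^2, so the exponent is of the order l^4, far below half the radix l^8. The
  form \<open>radix x div 2 - 1\<close> comes from \<open>zero_of_all_divisors\<close>, where an
  exponent \<open>k\<close> requires the divisors up to \<open>2 * k + 1\<close>.\<close>

lemma discrepancy_bound:
  assumes e: "encoded x m r A A'" shows "\<bar>discrepancy x\<bar> < 2 ^ (radix x div 2 - 1)"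
proof -
  define l where "l = (2 :: nat) ^ loglen x"
  have n: "length x < l" unfolding l_def by (rule length_less_loglen)
  have mr: "1 \<le> m" "m < l" "Suc r < l" "r < radix x"
    using encoded_length[OF e] e n length_le_radix[of x] by (auto simp: encoded_def)
  have "length x \<noteq> 0" using encoded_length[OF e] by linarith
  then have "2 \<le> loglen x" by (simp add: loglen_def floorlog_def)
  then have l4: "4 \<le> l" using power_increasing[of 2 "loglen x" "2 :: nat"] by (simp add: l_def)
  have N: "2 ^ (2 * loglen x) = l\<^sup>2" by (simp add: l_def mult.commute flip: power_mult)
  have R: "radix x = l ^ 8" by (simp add: radix_def l_def mult.commute flip: power_mult)
  define M where "M = (2 :: int) ^ (l * l)"
  have "\<bar>letter_mat x b i $$ (u, v)\<bar> \<le> M" if "u < dim_m x" "v < dim_m x" for b i u v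
  proof -
    have "\<bar>letter x b i u v\<bar> \<le> 2 ^ (length x * length x)"
      using entry_bound[OF e] by (simp add: letter_def)
    also have "\<dots> \<le> M" unfolding M_def using n by (intro power_increasing mult_mono) auto
    finally show ?thesis using that by (simp add: letter_mat_def)
  qed
  then have "\<bar>energy m r (letter_mat x) (l\<^sup>2)\<bar> \<le> int (Suc r) ^ (l\<^sup>2) * (2 * (int m * (int m * M) ^ (l\<^sup>2)))\<^sup>2"
    using letter_mat_family[of x] encoded_letter(1)[OF e]
    by (intro energy_bound) (auto simp: M_def)
  \<comment> \<open>The crude bounds \<open>m \<le> 2 ^ l\<close> and
    \<open>Suc r \<le> 2 ^ l\<close> turn everything into a single power of two.\<close>
  also have "\<dots> \<le> (2 ^ l) ^ (l\<^sup>2) * (2 * (2 ^ l * (2 ^ l * 2 ^ (l * l)) ^ (l\<^sup>2)))\<^sup>2"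
  proof -
    have "l \<le> 2 ^ l" by (simp add: less_imp_le)
    then have "m \<le> 2 ^ l" "Suc r \<le> 2 ^ l" using mr by linarith+
    then have b: "int m \<le> 2 ^ l" "int (Suc r) \<le> 2 ^ l" by (metis of_nat_le_iff of_nat_numeral of_nat_power)+
    show ?thesis
      unfolding M_def by (intro mult_mono power_mono b) (auto intro!: mult_nonneg_nonneg zero_le_power)
  qed
  also have "\<dots> = 2 ^ (l * l\<^sup>2 + (1 + (l + (l + l * l) * l\<^sup>2)) * 2)"
    by (simp only: power_add power_mult power_one_right power_mult_distrib)
  also have "\<dots> < 2 ^ (radix x div 2 - 1)"
  proof (intro power_strict_increasing)
    have p: "l ^ 3 \<le> l ^ 4" "l \<le> l ^ 4" "1 \<le> l ^ 4"
      using l4 power_increasing[of 3 4 l] power_increasing[of 1 4 l] by auto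
    have e1: "l * l\<^sup>2 + (1 + (l + (l + l * l) * l\<^sup>2)) * 2 = 3 * l ^ 3 + 2 + 2 * l + 2 * l ^ 4"
      by (simp add: eval_nat_numeral algebra_simps)
    have "256 \<le> l ^ 4" using power_mono[of 4 l 4] l4 by simp
    then have "256 * l ^ 4 \<le> l ^ 4 * l ^ 4" by (rule mult_right_mono) simp
    also have "\<dots> = l ^ 8" by (simp flip: power_add)
    finally have q: "256 * l ^ 4 \<le> radix x" by (simp only: R)
    show "l * l\<^sup>2 + (1 + (l + (l + l * l) * l\<^sup>2)) * 2 < radix x div 2 - 1"
      unfolding e1 using p q by linarith
  qed simp
  finally show ?thesis
    using discrepancy_energy[of x] mr(4) encoded_letter(1,2)[OF e] by (simp add: N)
qed

lemma discrepancy_zero_iff: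
  assumes e: "encoded x m r A A'"
  shows "discrepancy x = 0 \<longleftrightarrow> (\<forall>i<num_vecs x. residue (digit x i 15) (discrepancy x) = 0)"
proof
  assume "discrepancy x = 0"
  then show "\<forall>i<num_vecs x. residue (digit x i 15) (discrepancy x) = 0" by (simp add: residue_def)
next
  assume all: "\<forall>i<num_vecs x. residue (digit x i 15) (discrepancy x) = 0"
  have even: "2 * (radix x div 2 - 1) + 1 \<le> radix x" using radix_pos[of x] by linarith
  show "discrepancy x = 0"
  proof (rule zero_of_all_divisors[OF _ discrepancy_bound[OF e]])
    fix q assume q: "1 \<le> q" "q \<le> 2 * (radix x div 2 - 1) + 1"
    then obtain q' where q': "q = Suc q'" "q' < radix x" using even by (cases q) auto
    \<comment> \<open>A processor that works modulo \<open>q\<close>: digit 15 is the predecessor of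
      its modulus.\<close>
    let ?i = "set_digit x 0 15 q'"
    have "?i < num_vecs x" by (rule set_digit_props(2)[OF q'(2)]) (auto simp: num_vecs_def)
    moreover have "digit x ?i 15 = q'" by (simp add: set_digit_props(1)[OF q'(2)])
    ultimately have "residue q' (discrepancy x) = 0" using all by metis
    then have "discrepancy x mod int (Suc q') = 0" using int_residue[of q' "discrepancy x"] by simp
    then show "int q dvd discrepancy x" by (simp add: q' mod_eq_0_iff_dvd)
  qed
qed

text \<open>Each letter of the tuple contributes one factor \<open>D\<close>, and the identity
  letters contribute none. As the exponent is the same for both tuples, a nonzero \<open>D\<close>
  cancels when traces are compared.\<close>

lemma scaled_word_mat:
  fixes L :: "nat \<Rightarrow> int mat" and B :: "rat mat list"
  assumes L: "family m L" and B: "B \<in> mat_tuples m r"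
    and D: "\<And>i u v. i < r \<Longrightarrow> u < m \<Longrightarrow> v < m \<Longrightarrow> of_int (L i $$ (u, v)) = of_int D * B ! i $$ (u, v)"
    and one: "\<And>i. r \<le> i \<Longrightarrow> L i = 1\<^sub>m m"
  defines "C \<equiv> tuple_fam m (map (map_mat (of_rat :: rat \<Rightarrow> 'k::field_char_0)) B)"
  shows "u < m \<Longrightarrow> v < m \<Longrightarrow> of_int (word_mat m L w $$ (u, v)) =
    of_int D ^ length (filter (\<lambda>i. i < r) w) * word_mat m C w $$ (u, v)"
proof (induction w arbitrary: u)
  case Nil
  then show ?case by simp
next
  case (Cons i w)
  have B': "map (map_mat (of_rat :: rat \<Rightarrow> 'k)) B \<in> mat_tuples m r" using B by (auto simp: mat_tuples_def)
  have C: "family m C" unfolding C_def by (rule tuple_fam_family[OF B'])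
  note c = L[unfolded family_def, rule_format, of i] C[unfolded family_def, rule_format, of i]
    word_mat_carrier[OF L, of w] word_mat_carrier[OF C, of w]
  have letter: "of_int (L i $$ (u, s)) = (if i < r then of_int D else 1) * C i $$ (u, s)" if "s < m" for s
  proof (cases "i < r")
    case True
    then have "B ! i \<in> carrier_mat m m" using B by (auto simp: mat_tuples_def)
    then have "C i $$ (u, s) = of_rat (B ! i $$ (u, s))"
      using True B Cons.prems that by (simp add: C_def tuple_fam_def mat_tuples_def)
    moreover have "(of_int (L i $$ (u, s)) :: 'k) = of_rat (of_int D * B ! i $$ (u, s))"
      using D[OF True Cons.prems(1) that] by (metis of_rat_of_int_eq)
    ultimately show ?thesis using True by (simp add: of_rat_mult)
  next
    case False
    then show ?thesis using B' one[of i] Cons.prems that by (simp add: C_def tuple_fam_def mat_tuples_def)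
  qed
  have "of_int (word_mat m L (i # w) $$ (u, v)) =
      (\<Sum>s<m. (of_int (L i $$ (u, s)) * of_int (word_mat m L w $$ (s, v)) :: 'k))"
    using c Cons.prems by (simp add: scalar_prod_def lessThan_atLeast0)
  also have "\<dots> = (\<Sum>s<m. of_int D ^ length (filter (\<lambda>i. i < r) (i # w)) * (C i $$ (u, s) * word_mat m C w $$ (s, v)))"
    using Cons.IH Cons.prems letter by (intro sum.cong) auto
  also have "\<dots> = of_int D ^ length (filter (\<lambda>i. i < r) (i # w)) * word_mat m C (i # w) $$ (u, v)"
    using c Cons.prems by (simp add: scalar_prod_def lessThan_atLeast0 sum_distrib_left)
  finally show ?case .
qed

lemma word_mat_min:
  assumes "\<And>i. r \<le> i \<Longrightarrow> a i = a r" shows "word_mat m a (map (min r) w) = word_mat m a w"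
  by (induction w) (simp_all add: min_def, metis assms nat_le_linear)

lemma discrepancy_intersect_iff:
  assumes e: "encoded x m r A A'"
  shows "discrepancy x = 0 \<longleftrightarrow>
    (zariski m r closure_of SL_orbit m (map (map_mat (of_rat :: rat \<Rightarrow> 'k::{alg_closed_field, field_char_0})) A)) \<inter>
    (zariski m r closure_of SL_orbit m (map (map_mat of_rat) A')) \<noteq> {}"
proof -
  have A: "A \<in> mat_tuples m r" "A' \<in> mat_tuples m r" and m: "1 \<le> m" using e by (auto simp: encoded_def)
  let ?B = "map (map_mat (of_rat :: rat \<Rightarrow> 'k)) A" and ?B' = "map (map_mat (of_rat :: rat \<Rightarrow> 'k)) A'"
  have B: "?B \<in> mat_tuples m r" "?B' \<in> mat_tuples m r" using A by (auto simp: mat_tuples_def)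
  note dims = encoded_letter(1,2)[OF e]
  obtain D where D: "D \<noteq> 0" "\<And>i u v. i < r \<Longrightarrow> u < m \<Longrightarrow> v < m \<Longrightarrow> of_int (letter x 0 i u v) = of_int D * A ! i $$ (u, v)"
    "\<And>i u v. i < r \<Longrightarrow> u < m \<Longrightarrow> v < m \<Longrightarrow> of_int (letter x 1 i u v) = of_int D * A' ! i $$ (u, v)"
    using encoded_letter(3)[OF e] by blast
  have fam: "family m (letter_mat x b)" for b using letter_mat_family[of x b] dims by simp
  have one: "letter_mat x b i = 1\<^sub>m m" if "r \<le> i" for b i using letter_mat_one[of x i b] dims that by simp
  have tr: "of_int (mtrace (word_mat m (letter_mat x b) w)) = of_int D ^ length (filter (\<lambda>i. i < r) w) *
      mtrace (word_mat m (tuple_fam m (map (map_mat (of_rat :: rat \<Rightarrow> 'k)) Z)) w)"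
    if Z: "Z \<in> mat_tuples m r" "\<And>i u v. i < r \<Longrightarrow> u < m \<Longrightarrow> v < m \<Longrightarrow> of_int (letter x b i u v) = of_int D * Z ! i $$ (u, v)"
    for b Z w
  proof -
    have "map (map_mat (of_rat :: rat \<Rightarrow> 'k)) Z \<in> mat_tuples m r" using Z by (auto simp: mat_tuples_def)
    note c = word_mat_carrier[OF tuple_fam_family[OF this], of w] word_mat_carrier[OF fam, of b w]
    have *: "of_int (word_mat m (letter_mat x b) w $$ (u, v)) = of_int D ^ length (filter (\<lambda>i. i < r) w) *
        word_mat m (tuple_fam m (map (map_mat (of_rat :: rat \<Rightarrow> 'k)) Z)) w $$ (u, v)" if "u < m" "v < m" for u v
      by (rule scaled_word_mat[OF fam Z(1)]) (use that Z(2) one dims in \<open>auto simp: letter_mat_def\<close>)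
    show ?thesis using c * by (simp add: mtrace_def sum_distrib_left)
  qed
  have t0: "of_int (mtrace (word_mat m (letter_mat x 0) w)) = of_int D ^ length (filter (\<lambda>i. i < r) w) *
      mtrace (word_mat m (tuple_fam m ?B) w)" for w by (rule tr[OF A(1)], rule D(2))
  have t1: "of_int (mtrace (word_mat m (letter_mat x 1) w)) = of_int D ^ length (filter (\<lambda>i. i < r) w) *
      mtrace (word_mat m (tuple_fam m ?B') w)" for w by (rule tr[OF A(2)], rule D(3))
  have "discrepancy x = energy m r (letter_mat x) (2 ^ (2 * loglen x))"
    using discrepancy_energy[of x] encoded_length[OF e] length_le_radix[of x] dims by simp
  also have "\<dots> = 0 \<longleftrightarrow> (\<forall>w. set w \<subseteq> {..r} \<longrightarrow>
      mtrace (word_mat m (letter_mat x 0) w) = mtrace (word_mat m (letter_mat x 1) w))"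
  proof (rule energy_eq_0[OF fam _ one])
    \<comment> \<open>Since \<open>r \<ge> 1\<close>, the encoding is longer than 4 m^2, so
      \<open>2 ^ loglen x\<close> is at least 2 m^2, and its square, the word length, is at least 4
      m^4.\<close>
    have "4 * (1 * (m * m)) \<le> 4 * (r * (m * m))" using e by (intro mult_left_mono mult_right_mono) (auto simp: encoded_def)
    then have "2 * (m * m) \<le> 2 ^ loglen x" using encoded_length[OF e] length_less_loglen[of x] by linarith
    then have "(2 * (m * m)) ^ 2 \<le> (2 ^ loglen x) ^ 2" by (rule power_mono) simp
    then show "4 * m ^ 4 \<le> 2 ^ (2 * loglen x)"
      by (simp add: power_mult_distrib mult.commute[of 2] power_mult flip: power2_eq_square power_mult)
  qed simp
  also have "\<dots> \<longleftrightarrow> (\<forall>w. set w \<subseteq> {..r} \<longrightarrow> mtrace (word_mat m (tuple_fam m ?B) w) = mtrace (word_mat m (tuple_fam m ?B') w))"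
  proof (intro iff_allI imp_cong refl)
    fix w
    have "mtrace (word_mat m (letter_mat x 0) w) = mtrace (word_mat m (letter_mat x 1) w) \<longleftrightarrow>
        (of_int (mtrace (word_mat m (letter_mat x 0) w)) :: 'k) = of_int (mtrace (word_mat m (letter_mat x 1) w))" by simp
    also have "\<dots> \<longleftrightarrow> mtrace (word_mat m (tuple_fam m ?B) w) = mtrace (word_mat m (tuple_fam m ?B') w)"
      unfolding t0 t1 using D(1) by simp
    finally show "mtrace (word_mat m (letter_mat x 0) w) = mtrace (word_mat m (letter_mat x 1) w) \<longleftrightarrow>
        mtrace (word_mat m (tuple_fam m ?B) w) = mtrace (word_mat m (tuple_fam m ?B') w)" .
  qed
  also have "\<dots> \<longleftrightarrow> (\<forall>w. mtrace (word_mat m (tuple_fam m ?B) w) = mtrace (word_mat m (tuple_fam m ?B') w))"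
  proof (intro iffI allI impI)
    fix w assume *: "\<forall>w. set w \<subseteq> {..r} \<longrightarrow> mtrace (word_mat m (tuple_fam m ?B) w) = mtrace (word_mat m (tuple_fam m ?B') w)"
    have le: "set (map (min r) w) \<subseteq> {..r}" by auto
    have "word_mat m (tuple_fam m Z) (map (min r) w) = word_mat m (tuple_fam m Z) w" if "Z \<in> mat_tuples m r" for Z :: "'k mat list"
      by (rule word_mat_min) (use that in \<open>auto simp: tuple_fam_def mat_tuples_def\<close>)
    then show "mtrace (word_mat m (tuple_fam m ?B) w) = mtrace (word_mat m (tuple_fam m ?B') w)"
      using *[rule_format, OF le] B by simp
  qed blast
  also have "\<dots> \<longleftrightarrow> (zariski m r closure_of SL_orbit m ?B) \<inter> (zariski m r closure_of SL_orbit m ?B') \<noteq> {}"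
    by (rule orbit_closures_intersect_iff[OF B m, symmetric])
  finally show ?thesis .
qed

theorem theorem3p6:
  shows "orbit_closure_intersection TYPE('k::{alg_closed_field, field_char_0}) \<in> coRNC"
proof -
  have mem: "x \<in> orbit_closure_intersection TYPE('k) \<longleftrightarrow> (\<exists>m r A A'. encoded x m r A A' \<and> discrepancy x = 0)" for x
    unfolding orbit_closure_intersection_def mem_Collect_eq
    by (intro iff_exI) (auto simp: encoded_def discrepancy_intersect_iff[where 'k = 'k])
  \<comment> \<open>A single processor that finds the input malformed or a nonzero residue is enough
    to put it into the complement; this is the existential form that concurrent writing
    decides.\<close>
  have "- orbit_closure_intersection TYPE('k) =
      {x. \<exists>i<num_vecs x. \<not> well_formed x \<or> residue (digit x i 15) (discrepancy x) \<noteq> 0}"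
  proof (rule Set.set_eqI)
    fix x
    show "x \<in> - orbit_closure_intersection TYPE('k) \<longleftrightarrow>
        x \<in> {x. \<exists>i<num_vecs x. \<not> well_formed x \<or> residue (digit x i 15) (discrepancy x) \<noteq> 0}"
    proof (cases "well_formed x")
      case True
      then obtain m r A A' where e: "encoded x m r A A'" unfolding well_formed_encoded by blast
      show ?thesis using True e discrepancy_zero_iff[OF e] by (auto simp: mem)
    next
      case False
      moreover have "0 < num_vecs x" by (simp add: num_vecs_def)
      ultimately show ?thesis unfolding Compl_iff mem well_formed_encoded by blast
    qed
  qed
  also have "\<dots> \<in> RNC" by (rule bcomp_RNC[OF bcomp_reject])
  finally show ?thesis by (simp add: coRNC_def)
qed

end
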